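(* Let $1<\alpha<2$, $1-\frac{\alpha}{2}<s<1$, $u_0\in V_{1/2}$ and $u_1\in L^2(\Omega)$. Let $f\in C^1(\mathbb R)$ and assume that there exist $C_f>0$ and $r>1$ such that $$f(0)=0\quad\text{and}\quad |f'(\sigma)|\le C_f|\sigma|^{r-1}\quad\text{for all }\sigma\in\mathbb R,$$ and that $V_{1/2}\hookrightarrow L^{2r}(\Omega)$ (continuous embedding). Then there is $T_{\max}\in(0,\infty]$ such that the problem $$\mathbb D_t^\alpha u+Au=f(u),\qquad u(\cdot,0)=u_0,\quad\partial_tu(\cdot,0)=u_1,$$ has a unique weak energy solution in $X_{s,T}$ for all $0<T<T_{\max}$, where either $T_{\max}=\infty$, or $T_{\max}<\infty$ and in that case $$\lim_{t\to T_{\max}}\left(\|u(t)\|_{V_{1/2}}^2+t^{2s}\|\partial_tu(t)\|_{L^2(\Omega)}^2+\big(g_{2-\alpha}*\|\partial_tu\|_{L^2(\Omega)}^2\big)(t)\right)=\infty.$$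
   Context: Operator setting. $A$ is a positive (nonnegative and injective) self-adjoint operator with $0\in\rho(A)$ on a separable Hilbert space; by the spectral theorem it is identified with a multiplication operator: $(\Omega,\Sigma,\mu)$ is a finite measure space, $L^2(\Omega)=L^2(\Omega,\Sigma,\mu)$ (real-valued functions here), $m:\Omega\to\mathbb R$ is $\Sigma$-measurable with $m\ge m_0$ $\mu$-a.e. for some constant $m_0>0$, and $Ag=mg$ for $g\in D(A)=\{g\in L^2(\Omega): mg\in L^2(\Omega)\}$. No compactness of the resolvent is assumed. For $\gamma\ge0$, $V_\gamma:=D(A^\gamma)=\{g\in L^2(\Omega): m^\gamma g\in L^2(\Omega)\}$ with norm $\|g\|_{V_\gamma}=\|m^\gamma g\|_{L^2(\Omega)}$, and $V_{-\gamma}:=(V_\gamma)^*$ with norm $\|h\|_{V_{-\gamma}}=\|m^{-\gamma}h\|_{L^2(\Omega)}$. Fractional derivative. For $\gamma>0$ put $g_\gamma(t)=t^{\gamma-1}/\Gamma(\gamma)$ for $t>0$ and $g_\gamma(t)=0$ for $t\le0$; $(g_\gamma*h)(t)=\int_0^tg_\gamma(t-\tau)h(\tau)\,d\tau$. The Caputo derivative of order $\alpha$ is $\mathbb D_t^\alpha u(t)=\int_0^tg_{2-\alpha}(t-s)\partial_s^2u(s)\,ds$, or, in its equivalent weaker form, $\mathbb D_t^\alpha u(t)=\partial_t^2\int_0^tg_{2-\alpha}(t-s)[u(s)-u(0)-s\,\partial_su(0)]\,ds$. Mittag-Leffler functions: $E_{\alpha,\beta}(z)=\sum_{n=0}^\infty\frac{z^n}{\Gamma(\alpha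 n+\beta)}$. Solution space. For $T>0$, $$X_{s,T}=\{u\in C([0,T];V_{1/2})\cap C^1((0,T];L^2(\Omega)):\ \|u\|_{s,T}<\infty\},$$ $$\|u\|_{s,T}^2=\sup_{t\in(0,T]}\left(\|u(\cdot,t)\|_{V_{1/2}}^2+t^{2s}\|\partial_tu(\cdot,t)\|_{L^2(\Omega)}^2+\big(g_{2-\alpha}*\|\partial_tu\|_{L^2(\Omega)}^2\big)(t)\right).$$ Weak energy solution. For $v\in X_{s,T}$ with $v(0)=u_0$, $\partial_tv(0)=u_1$, set $$\Phi(v)(t)=E_{\alpha,1}(-m(\cdot)t^\alpha)u_0(\cdot)+tE_{\alpha,2}(-m(\cdot)t^\alpha)u_1(\cdot)+\int_0^tf(v(\cdot,\tau))(t-\tau)^{\alpha-1}E_{\alpha,\alpha}(-m(\cdot)(t-\tau)^\alpha)\,d\tau .$$ A weak energy solution in $X_{s,T}$ is such a $u\in X_{s,T}$ with $\Phi(u)(t)=u(t)$ for all $t\in[0,T]$. Here the condition $\partial_tv(0)=u_1$ is understood as $\lim_{t\to0^+}\|\partial_tv(t)-u_1\|_{V_{-\beta}}=0$ for some $\beta>\alpha^{-1}-\frac12$. *)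

theory Defs
  imports "HOL-Analysis.Analysis"
begin

text \<open>
  Elements of \<open>L\<^sup>p\<close>-spaces are represented by functions \<open>'a \<Rightarrow> real\<close> that are identified when
  they agree almost everywhere, and time-dependent functions with values in such a space are
  represented by curves \<open>real \<Rightarrow> 'a \<Rightarrow> real\<close>. Limits, derivatives and integrals of such curves are
  taken with respect to the (semi-)norm of the space, never pointwise in \<open>x\<close>.
\<close>

definition Lp :: "'a measure \<Rightarrow> real \<Rightarrow> ('a \<Rightarrow> real) set" where
  "Lp M p = {g \<in> borel_measurable M. integrable M (\<lambda>x. \<bar>g x\<bar> powr p)}"

definition Lp_norm :: "'a measure \<Rightarrow> real \<Rightarrow> ('a \<Rightarrow> real) \<Rightarrow> real" where
  "Lp_norm M p g = (\<integral>x. \<bar>g x\<bar> powr p \<partial>M) powr (1 / p)"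

abbreviation L2 :: "'a measure \<Rightarrow> ('a \<Rightarrow> real) set" where
  "L2 M \<equiv> Lp M 2"

abbreviation L2_norm :: "'a measure \<Rightarrow> ('a \<Rightarrow> real) \<Rightarrow> real" where
  "L2_norm M \<equiv> Lp_norm M 2"

definition separable_L2 :: "'a measure \<Rightarrow> bool" where
  "separable_L2 M \<longleftrightarrow> (\<exists>D \<subseteq> L2 M. countable D \<and>
     (\<forall>g \<in> L2 M. \<forall>\<epsilon>>0. \<exists>d \<in> D. L2_norm M (\<lambda>x. g x - d x) < \<epsilon>))"

text \<open>
  The space \<open>V\<^sub>\<gamma> = D(A\<^sup>\<gamma>)\<close> for \<open>\<gamma> \<ge> 0\<close>, where \<open>A\<close> is multiplication by \<open>m\<close>. The norm is also used
  with negative exponents, where it is the norm of \<open>V\<^sub>-\<^sub>\<gamma> = (V\<^sub>\<gamma>)\<^sup>*\<close>; it is only applied to elements of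
  \<open>L2 M\<close> in that case.
\<close>

definition V :: "'a measure \<Rightarrow> ('a \<Rightarrow> real) \<Rightarrow> real \<Rightarrow> ('a \<Rightarrow> real) set" where
  "V M m \<gamma> = {g \<in> L2 M. (\<lambda>x. m x powr \<gamma> * g x) \<in> L2 M}"

definition V_norm :: "'a measure \<Rightarrow> ('a \<Rightarrow> real) \<Rightarrow> real \<Rightarrow> ('a \<Rightarrow> real) \<Rightarrow> real" where
  "V_norm M m \<gamma> g = L2_norm M (\<lambda>x. m x powr \<gamma> * g x)"

definition V_embeds_Lp :: "'a measure \<Rightarrow> ('a \<Rightarrow> real) \<Rightarrow> real \<Rightarrow> real \<Rightarrow> bool" where
  "V_embeds_Lp M m \<gamma> p \<longleftrightarrow> V M m \<gamma> \<subseteq> Lp M p \<and>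
     (\<exists>C. \<forall>g \<in> V M m \<gamma>. Lp_norm M p g \<le> C * V_norm M m \<gamma> g)"

definition mittag_leffler :: "real \<Rightarrow> real \<Rightarrow> real \<Rightarrow> real" where
  "mittag_leffler \<alpha> \<beta> z = (\<Sum>n. z ^ n / Gamma (\<alpha> * real n + \<beta>))"

definition g_kernel :: "real \<Rightarrow> real \<Rightarrow> real" where
  "g_kernel \<gamma> t = (if t > 0 then t powr (\<gamma> - 1) / Gamma \<gamma> else 0)"

text \<open>\<open>(g\<^sub>\<gamma> * h)(t)\<close> for nonnegative \<open>h\<close>, possibly infinite.\<close>

definition g_conv :: "real \<Rightarrow> (real \<Rightarrow> real) \<Rightarrow> real \<Rightarrow> ennreal" where
  "g_conv \<gamma> h t = (\<integral>\<^sup>+ \<tau> \<in> {0<..<t}. ennreal (g_kernel \<gamma> (t - \<tau>) * h \<tau>) \<partial>lborel)"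

definition has_L2_derivative ::
    "'a measure \<Rightarrow> (real \<Rightarrow> 'a \<Rightarrow> real) \<Rightarrow> ('a \<Rightarrow> real) \<Rightarrow> real \<Rightarrow> real set \<Rightarrow> bool" where
  "has_L2_derivative M u d t S \<longleftrightarrow> d \<in> L2 M \<and>
     ((\<lambda>\<tau>. L2_norm M (\<lambda>x. (u \<tau> x - u t x) / (\<tau> - t) - d x)) \<longlongrightarrow> 0) (at t within S)"

text \<open>
  The time derivative \<open>\<partial>\<^sub>tu(t)\<close> relative to the interval \<open>S\<close> (one-sided at an end point that belongs
  to \<open>S\<close>). It is determined up to equality almost everywhere.
\<close>

definition L2_deriv :: "'a measure \<Rightarrow> real set \<Rightarrow> (real \<Rightarrow> 'a \<Rightarrow> real) \<Rightarrow> real \<Rightarrow> 'a \<Rightarrow> real" where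
  "L2_deriv M S u t = (SOME d. has_L2_derivative M u d t S)"

definition continuous_V ::
    "'a measure \<Rightarrow> ('a \<Rightarrow> real) \<Rightarrow> real \<Rightarrow> real set \<Rightarrow> (real \<Rightarrow> 'a \<Rightarrow> real) \<Rightarrow> bool" where
  "continuous_V M m \<gamma> S u \<longleftrightarrow> (\<forall>t \<in> S. u t \<in> V M m \<gamma> \<and>
     ((\<lambda>\<tau>. V_norm M m \<gamma> (\<lambda>x. u \<tau> x - u t x)) \<longlongrightarrow> 0) (at t within S))"

definition C1_L2 :: "'a measure \<Rightarrow> real set \<Rightarrow> (real \<Rightarrow> 'a \<Rightarrow> real) \<Rightarrow> bool" where
  "C1_L2 M S u \<longleftrightarrow> (\<forall>t \<in> S. u t \<in> L2 M \<and>
     has_L2_derivative M u (L2_deriv M S u t) t S \<and>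
     ((\<lambda>\<tau>. L2_norm M (\<lambda>x. L2_deriv M S u \<tau> x - L2_deriv M S u t x)) \<longlongrightarrow> 0) (at t within S))"

definition energy ::
    "'a measure \<Rightarrow> ('a \<Rightarrow> real) \<Rightarrow> real \<Rightarrow> real \<Rightarrow> real set \<Rightarrow> (real \<Rightarrow> 'a \<Rightarrow> real) \<Rightarrow> real \<Rightarrow> ennreal" where
  "energy M m \<alpha> s S u t =
     ennreal ((V_norm M m (1/2) (u t))\<^sup>2 + t powr (2 * s) * (L2_norm M (L2_deriv M S u t))\<^sup>2)
     + g_conv (2 - \<alpha>) (\<lambda>\<tau>. (L2_norm M (L2_deriv M S u \<tau>))\<^sup>2) t"

definition X_space ::
    "'a measure \<Rightarrow> ('a \<Rightarrow> real) \<Rightarrow> real \<Rightarrow> real \<Rightarrow> real \<Rightarrow> (real \<Rightarrow> 'a \<Rightarrow> real) set" where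
  "X_space M m \<alpha> s T = {u. continuous_V M m (1/2) {0..T} u \<and> C1_L2 M {0<..T} u \<and>
     (SUP t \<in> {0<..T}. energy M m \<alpha> s {0<..T} u t) < \<infinity>}"

text \<open>
  The Bochner integral of an \<open>L2 M\<close>-valued function \<open>F\<close> over a measure space \<open>N\<close>. The library's
  integral is not applicable because \<open>L2 M\<close> is not a type. A list \<open>[(A\<^sub>1, c\<^sub>1), \<dots>, (A\<^sub>k, c\<^sub>k)]\<close>
  represents the simple function that is the sum of the \<open>indicator A\<^sub>i \<cdot> c\<^sub>i\<close>.
\<close>

definition L2_simple :: "'b measure \<Rightarrow> 'a measure \<Rightarrow> ('b set \<times> ('a \<Rightarrow> real)) list \<Rightarrow> bool" where
  "L2_simple N M P \<longleftrightarrow> (\<forall>(A, c) \<in> set P. A \<in> sets N \<and> emeasure N A < \<infinity> \<and> c \<in> L2 M)"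

definition simple_value :: "('b set \<times> ('a \<Rightarrow> real)) list \<Rightarrow> 'b \<Rightarrow> 'a \<Rightarrow> real" where
  "simple_value P \<tau> x = (\<Sum>(A, c) \<leftarrow> P. indicator A \<tau> * c x)"

definition simple_integral :: "'b measure \<Rightarrow> ('b set \<times> ('a \<Rightarrow> real)) list \<Rightarrow> 'a \<Rightarrow> real" where
  "simple_integral N P x = (\<Sum>(A, c) \<leftarrow> P. measure N A * c x)"

definition has_L2_integral ::
    "'b measure \<Rightarrow> 'a measure \<Rightarrow> ('b \<Rightarrow> 'a \<Rightarrow> real) \<Rightarrow> ('a \<Rightarrow> real) \<Rightarrow> bool" where
  "has_L2_integral N M F w \<longleftrightarrow> (\<forall>\<tau> \<in> space N. F \<tau> \<in> L2 M) \<and> w \<in> L2 M \<and>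
     (\<exists>P :: nat \<Rightarrow> ('b set \<times> ('a \<Rightarrow> real)) list. (\<forall>n. L2_simple N M (P n)) \<and>
        (AE \<tau> in N. (\<lambda>n. L2_norm M (\<lambda>x. F \<tau> x - simple_value (P n) \<tau> x)) \<longlonglongrightarrow> 0) \<and>
        (\<lambda>n. \<integral>\<^sup>+ \<tau>. ennreal (L2_norm M (\<lambda>x. F \<tau> x - simple_value (P n) \<tau> x)) \<partial>N) \<longlonglongrightarrow> 0 \<and>
        (\<lambda>n. L2_norm M (\<lambda>x. simple_integral N (P n) x - w x)) \<longlonglongrightarrow> 0)"

definition L2_integrable :: "'b measure \<Rightarrow> 'a measure \<Rightarrow> ('b \<Rightarrow> 'a \<Rightarrow> real) \<Rightarrow> bool" where
  "L2_integrable N M F \<longleftrightarrow> (\<exists>w. has_L2_integral N M F w)"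

definition L2_integral :: "'b measure \<Rightarrow> 'a measure \<Rightarrow> ('b \<Rightarrow> 'a \<Rightarrow> real) \<Rightarrow> 'a \<Rightarrow> real" where
  "L2_integral N M F = (SOME w. has_L2_integral N M F w)"

definition Duhamel_integrand ::
    "('a \<Rightarrow> real) \<Rightarrow> (real \<Rightarrow> real) \<Rightarrow> real \<Rightarrow> (real \<Rightarrow> 'a \<Rightarrow> real) \<Rightarrow> real \<Rightarrow> real \<Rightarrow> 'a \<Rightarrow> real" where
  "Duhamel_integrand m f \<alpha> v t \<tau> x =
     f (v \<tau> x) * (t - \<tau>) powr (\<alpha> - 1) * mittag_leffler \<alpha> \<alpha> (- m x * (t - \<tau>) powr \<alpha>)"

definition Phi ::
    "'a measure \<Rightarrow> ('a \<Rightarrow> real) \<Rightarrow> (real \<Rightarrow> real) \<Rightarrow> real \<Rightarrow> ('a \<Rightarrow> real) \<Rightarrow> ('a \<Rightarrow> real) \<Rightarrow>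
     (real \<Rightarrow> 'a \<Rightarrow> real) \<Rightarrow> real \<Rightarrow> 'a \<Rightarrow> real" where
  "Phi M m f \<alpha> u0 u1 v t x =
     mittag_leffler \<alpha> 1 (- m x * t powr \<alpha>) * u0 x
     + t * mittag_leffler \<alpha> 2 (- m x * t powr \<alpha>) * u1 x
     + L2_integral (restrict_space lborel {0..t}) M (Duhamel_integrand m f \<alpha> v t) x"

definition weak_energy_solution ::
    "'a measure \<Rightarrow> ('a \<Rightarrow> real) \<Rightarrow> (real \<Rightarrow> real) \<Rightarrow> real \<Rightarrow> real \<Rightarrow> ('a \<Rightarrow> real) \<Rightarrow> ('a \<Rightarrow> real) \<Rightarrow>
     real \<Rightarrow> (real \<Rightarrow> 'a \<Rightarrow> real) \<Rightarrow> bool" where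
  "weak_energy_solution M m f \<alpha> s u0 u1 T u \<longleftrightarrow>
     u \<in> X_space M m \<alpha> s T \<and>
     (AE x in M. u 0 x = u0 x) \<and>
     (\<exists>\<beta> > 1 / \<alpha> - 1 / 2.
        ((\<lambda>t. V_norm M m (- \<beta>) (\<lambda>x. L2_deriv M {0<..T} u t x - u1 x)) \<longlongrightarrow> 0) (at_right 0)) \<and>
     (\<forall>t \<in> {0..T}.
        L2_integrable (restrict_space lborel {0..t}) M (Duhamel_integrand m f \<alpha> u t) \<and>
        (AE x in M. Phi M m f \<alpha> u0 u1 u t x = u t x))"

end

theory Submission
 imports Defs "HOL-Probability.Characteristic_Functions"
begin

text \<open>
The function \<open>m\<close> may be replaced by \<open>max m m0\<close>, which changes nothing up to null sets, and the equation
then decouples into one scalar fractional oscillator per point \<open>x\<close>. Everything linear is obtained by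
estimating the scalar solution kernels with constants that do not depend on \<open>m x\<close>, and then integrating
over \<open>x\<close> with Minkowski's inequality.

Kernels. For \<open>1 < \<alpha> < 2\<close> the Mittag-Leffler functions satisfy bounds such as
\<open>\<bar>E\<^sub>\<alpha>\<^sub>,\<^sub>1(-x)\<bar> \<le> C\<close>, \<open>\<surd>x \<bar>E\<^sub>\<alpha>\<^sub>,\<^sub>\<alpha>(-x)\<bar> \<le> C\<close> for \<open>x \<ge> 0\<close> (\<open>mittag_leffler_bounds\<close>). They follow from the
boundedness of the functions \<open>moment al j\<close>, the images of \<open>t E\<^sub>\<alpha>\<^sub>,\<^sub>2(-t\<^sup>\<alpha>)\<close> under powers of the operator
\<open>t d/dt\<close>. Their Laplace transforms are integrable on the lines \<open>Re p = c\<close> uniformly in \<open>c > 0\<close>, because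
\<open>\<bar>1 + p powr (-\<alpha>)\<bar>\<close> is bounded below on the right half plane; a Fourier inversion inequality turns
this into a bound. That the Laplace transform converges on the whole half plane is known only after
an energy estimate (\<open>volterra_bound\<close>), which rests on the positivity of convolution with the fractional
kernel and gives polynomial growth.

Linear problem. For a continuous curve \<open>\<phi>\<close> in \<open>L\<^sup>2\<close> put \<open>U \<phi> = E\<^sub>\<alpha>\<^sub>,\<^sub>1 u\<^sub>0 + t E\<^sub>\<alpha>\<^sub>,\<^sub>2 u\<^sub>1 + k * \<phi>\<close>. The kernel
\<open>\<surd>m k\<close> is bounded by \<open>C t powr (\<alpha>/2 - 1)\<close>, which is integrable at \<open>0\<close>, so \<open>U \<phi>\<close> is a continuous curve in
\<open>V\<^sub>1\<^sub>/\<^sub>2\<close>; its time derivative \<open>w \<phi>\<close> is given by a formula of the same type and is \<open>O(t powr (\<alpha>/2 - 1))\<close>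
near \<open>0\<close>, which is what the energy space asks for (\<open>U_in_X\<close>).

Nonlinear problem. The embedding makes \<open>v \<mapsto> f(v)\<close> Lipschitz from balls of \<open>V\<^sub>1\<^sub>/\<^sub>2\<close> to \<open>L\<^sup>2\<close>. After
composing with the radial retraction onto the ball of radius \<open>R\<close> it is globally Lipschitz, and a fixed
point iteration in an exponentially weighted norm gives one global curve \<open>uR R\<close> for every \<open>R\<close>. As long as
\<open>\<parallel>uR R\<parallel> \<le> R\<close> this curve solves the original problem, and each solution that is bounded by \<open>R\<close> agrees with it
(\<open>solution_unique\<close>). The maximal solution is glued from the \<open>uR R\<close>, and \<open>Tmax\<close> is the supremum of the times
up to which some \<open>R\<close> works.

Blow-up. The equation has memory, so a bound for the solution at a single time does not allow a
restart. The energy contains the convolution of \<open>g\<^sub>2\<^sub>-\<^sub>\<alpha>\<close> with \<open>\<parallel>w\<parallel>\<^sup>2\<close>, and this is exactly what controls the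
influence of the past: if the energy is at most \<open>K\<close> at one time \<open>t\<^sub>1\<close>, then \<open>memory_bound\<close> bounds the solution
in \<open>V\<^sub>1\<^sub>/\<^sub>2\<close> on an interval after \<open>t\<^sub>1\<close> whose length depends only on \<open>K\<close> and on a positive lower bound for
\<open>t\<^sub>1\<close> (\<open>good_extends\<close>). If the energy
did not tend to infinity at a finite \<open>Tmax\<close>, such \<open>t\<^sub>1\<close> would exist arbitrarily close to \<open>Tmax\<close>, and the
solution could be continued beyond \<open>Tmax\<close>.

Throughout, \<open>NN s. f s\<close> and \<open>LL s. f s\<close> are integrals with respect to Lebesgue measure, of extended
nonnegative and of vector valued functions; \<open>al\<close> is the order \<open>\<alpha>\<close>, and \<open>ph\<close>, \<open>psi\<close> denote
source terms.
\<close>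

abbreviation nn_leb :: "('a::euclidean_space => ennreal) => ennreal" (binder "NN " 10) where
 "nn_leb f \<equiv> nn_integral lborel f"

abbreviation int_leb :: "('a::euclidean_space => 'b::{banach, second_countable_topology}) => 'b" (binder "LL " 10) where
 "int_leb f \<equiv> lebesgue_integral lborel f"

abbreviation jmeas :: "'a measure => (real \<times> 'a => real) set" where
 "jmeas M \<equiv> borel_measurable (lborel \<Otimes>\<^sub>M M)"

abbreviation gk :: "real => real => real" where
 "gk \<equiv> g_kernel"

abbreviation "ind \<equiv> indicator"
abbreviation "sval \<equiv> simple_value"
abbreviation "sint \<equiv> simple_integral"
abbreviation "nrm \<equiv> L2_norm"

abbreviation bor :: "('a::topological_space => 'b::topological_space) set" where
 "bor \<equiv> borel_measurable borel"

abbreviation cr :: "real => complex" where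
 "cr \<equiv> complex_of_real"

section \<open>Convolution on the line\<close>

definition conv :: "(real => real) => (real => real) => real => real" where
 "conv a b t = (LL s. a (t - s) * b s)"

text \<open>The value of \<open>conv\<close> is meaningless where the integral diverges; finiteness of \<open>aconv\<close> certifies that it
does not, and is the hypothesis under which convolutions may be reassociated.\<close>

definition aconv :: "(real => real) => (real => real) => real => ennreal" where
 "aconv a b t = (NN s. ennreal \<bar>a (t - s) * b s\<bar>)"

lemma conv_measurable [measurable]:
 assumes [measurable]: "a \<in> bor" "b \<in> bor"
 shows "conv a b \<in> bor"
 unfolding conv_def[abs_def] by measurable

lemma aconv_measurable [measurable]:
 assumes [measurable]: "a \<in> bor" "b \<in> bor"
 shows "aconv a b \<in> bor"
 unfolding aconv_def[abs_def] by measurable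

lemma aconv_integrable:
 assumes [measurable]: "a \<in> bor" "b \<in> bor"
  and "aconv a b t < \<infinity>"
 shows "integrable lborel (%s. a (t - s) * b s)"
 using assms(3) by (intro integrableI_bounded) (auto simp: aconv_def)

lemma abs_conv_le_aconv:
 assumes [measurable]: "a \<in> bor" "b \<in> bor"
 shows "ennreal \<bar>conv a b t\<bar> <= aconv a b t"
 unfolding conv_def aconv_def
 using integral_norm_bound_ennreal[of lborel "%s. a (t - s) * b s"]
 by (cases "integrable lborel (%s. a (t - s) * b s)") (auto simp: not_integrable_integral_eq)

lemma nn_integral_lborel_shift:
 fixes c :: real
 assumes [measurable]: "f \<in> bor"
 shows "(NN s. f (s - c)) = (NN s. f s)"
 using nn_integral_real_affine[of f 1 "-c"] by (simp add: add.commute)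

lemma nn_integral_lborel_reflect:
 fixes c :: real
 assumes [measurable]: "f \<in> bor"
 shows "(NN s. f (c - s)) = (NN s. f s)"
 using nn_integral_real_affine[of f "-1" c] by simp

lemma integral_lborel_shift:
 fixes f :: "real => 'b::{banach, second_countable_topology}" and c :: real
 shows "(LL s. f (s - c)) = (LL s. f s)"
 using lborel_integral_real_affine[of 1 f "-c"] by (simp add: add.commute)

lemma integral_lborel_reflect:
 fixes f :: "real => 'b::{banach, second_countable_topology}" and c :: real
 shows "(LL s. f (c - s)) = (LL s. f s)"
 using lborel_integral_real_affine[of "-1" f c] by simp

lemma conv_commute: "conv a b t = conv b a t"
 unfolding conv_def using integral_lborel_reflect[of "%s. a (t - s) * b s" t]
 by (simp add: mult.commute)

lemma aconv_commute:
 assumes [measurable]: "a \<in> bor" "b \<in> bor"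
 shows "aconv a b t = aconv b a t"
 unfolding aconv_def using nn_integral_lborel_reflect[of "%s. ennreal \<bar>a (t - s) * b s\<bar>" t]
 by (simp add: mult.commute)

lemma conv_assoc:
 assumes [measurable]: "a \<in> bor" "b \<in> bor"
  "c \<in> bor"
  and fin: "(NN ta. aconv a b (t - ta) * ennreal \<bar>c ta\<bar>) < \<infinity>"
 shows "conv a (conv b c) t = conv (conv a b) c t"
proof -
 have shift: "(NN s. ennreal \<bar>a (t - s) * b (s - ta)\<bar>) = aconv a b (t - ta)" for ta
  unfolding aconv_def
  using nn_integral_lborel_shift[of "%s. ennreal \<bar>a (t - ta - s) * b s\<bar>" ta] by simp
 have int: "integrable (lborel \<Otimes>\<^sub>M lborel) (%(ta, s). a (t - s) * b (s - ta) * c ta)"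
 proof (rule integrableI_bounded)
  have "(\<integral>\<^sup>+x. ennreal (norm ((%(ta, s). a (t - s) * b (s - ta) * c ta) x)) \<partial>(lborel \<Otimes>\<^sub>M lborel))
   = (NN ta. \<integral>\<^sup>+s. ennreal \<bar>a (t - s) * b (s - ta)\<bar> * ennreal \<bar>c ta\<bar> \<partial>lborel)"
   by (subst lborel.nn_integral_fst[symmetric]) (auto simp: abs_mult ennreal_mult)
  also have "... = (NN ta. aconv a b (t - ta) * ennreal \<bar>c ta\<bar>)"
   by (subst nn_integral_multc) (auto simp: shift)
  finally show "(\<integral>\<^sup>+x. ennreal (norm ((%(ta, s). a (t - s) * b (s - ta) * c ta) x)) \<partial>(lborel \<Otimes>\<^sub>M lborel)) < \<infinity>"
   using fin by simp
 qed auto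
 have "conv a (conv b c) t = (LL s. \<integral>ta. a (t - s) * b (s - ta) * c ta \<partial>lborel)"
  unfolding conv_def by (simp add: mult.assoc)
 also have "... = (LL ta. \<integral>s. a (t - s) * b (s - ta) * c ta \<partial>lborel)"
  using lborel_pair.Fubini_integral[OF int] by simp
 also have "... = (LL ta. (LL s. a (t - ta - s) * b s) * c ta)"
 proof (rule Bochner_Integration.integral_cong[OF refl])
  fix ta
  show "(LL s. a (t - s) * b (s - ta) * c ta) = (LL s. a (t - ta - s) * b s) * c ta"
   using integral_lborel_shift[of "%s. a (t - ta - s) * b s" ta] by simp
 qed
 finally show ?thesis unfolding conv_def .
qed

lemma g_kernel_measurable [measurable]: "gk a \<in> bor"
 unfolding g_kernel_def[abs_def] by measurable

lemma g_kernel_nonneg: "a > 0 ==> gk a t >= 0"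
 by (auto simp: g_kernel_def Gamma_real_pos intro!: divide_nonneg_pos)

text \<open>The semigroup property \<open>g\<^sub>a * g\<^sub>b = g\<^sub>a\<^sub>+\<^sub>b\<close>: after scaling to \<open>t = 1\<close> the integral is Euler's Beta function.\<close>

lemma aconv_g_kernel:
 assumes a: "a > 0" and b: "b > 0"
 shows "aconv (gk a) (gk b) t = ennreal (gk (a + b) t)"
proof (cases "t > 0")
 case False
 then have "gk a (t - s) * gk b s = 0" for s by (auto simp: g_kernel_def)
 then have "aconv (gk a) (gk b) t = 0" by (simp only: aconv_def) simp
 then show ?thesis using False by (simp add: g_kernel_def)
next
 case t: True
 let ?f = "%v::real. v powr (b - 1) * (1 - v) powr (a - 1)"
 have hi: "(?f has_integral Beta b a) {0..1}" using has_integral_Beta_real[OF b a] .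
 have beta: "(NN v. ennreal (ind {0..1} v * ?f v)) = ennreal (Beta b a)"
  using nn_integral_has_integral_lebesgue[OF _ hi] by simp
 have "aconv (gk a) (gk b) t =
  ennreal t * (NN v. ennreal (gk a (t - t * v) * gk b (t * v)))"
  unfolding aconv_def using t a b
  by (subst nn_integral_real_affine[where c = t and t = 0])
   (auto simp: abs_mult g_kernel_nonneg)
 also have "(NN v. ennreal (gk a (t - t * v) * gk b (t * v))) =
  (NN v. ennreal (t powr (a + b - 2) / (Gamma a * Gamma b)) * ennreal (ind {0..1} v * ?f v))"
 proof (intro nn_integral_cong)
  fix v :: real
  have pos: "Gamma a > 0" "Gamma b > 0" using a b by (auto intro: Gamma_real_pos)
  consider "v <= 0" | "v >= 1" | "0 < v" "v < 1" by linarith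
  then show "ennreal (gk a (t - t * v) * gk b (t * v)) =
   ennreal (t powr (a + b - 2) / (Gamma a * Gamma b)) * ennreal (ind {0..1} v * ?f v)"
  proof cases
   case 1
   then have "t * v <= 0" using t by (simp add: mult_nonneg_nonpos)
   then show ?thesis using 1 by (auto simp: g_kernel_def indicator_def)
  next
   case 2
   then have "t - t * v <= 0" using t by (simp add: algebra_simps)
   then show ?thesis using 2 by (auto simp: g_kernel_def indicator_def)
  next
   case 3
   then have "t * v < t" using t by simp
   moreover have "t - t * v = t * (1 - v)" by (simp add: algebra_simps)
   moreover have "t powr (a - 1) * t powr (b - 1) = t powr (a + b - 2)"
    by (simp add: powr_add[symmetric] algebra_simps)
   ultimately have "gk a (t - t * v) * gk b (t * v) =
    t powr (a + b - 2) / (Gamma a * Gamma b) * ?f v"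
    using 3 t by (simp add: g_kernel_def powr_mult)
   then show ?thesis using 3 pos by (simp add: ennreal_mult[symmetric] t)
  qed
 qed
 also have "... = ennreal (t powr (a + b - 2) / (Gamma a * Gamma b)) * ennreal (Beta b a)"
  by (subst nn_integral_cmult) (auto simp: beta)
 also have "ennreal t * ... = ennreal (gk (a + b) t)"
 proof -
  have pos: "Gamma a > 0" "Gamma b > 0" "Gamma (a + b) > 0" using a b by (auto intro: Gamma_real_pos)
  have "t * t powr (a + b - 2) = t powr (a + b - 1)"
   using t powr_add[of t 1 "a + b - 2"] by simp
  then have "t * (t powr (a + b - 2) / (Gamma a * Gamma b) * Beta b a) = gk (a + b) t"
   using t pos by (simp add: g_kernel_def Beta_def add.commute)
  moreover have "Beta b a >= 0" using pos by (simp add: Beta_def add.commute)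
  ultimately show ?thesis using t pos by (simp add: ennreal_mult[symmetric])
 qed
 finally show ?thesis .
qed

lemma conv_g_kernel:
 assumes a: "a > 0" and b: "b > 0"
 shows "conv (gk a) (gk b) t = gk (a + b) t"
proof -
 have nn: "(NN s. ennreal (gk a (t - s) * gk b s)) = ennreal (gk (a + b) t)"
  using aconv_g_kernel[OF a b, of t] a b by (simp add: aconv_def abs_mult g_kernel_nonneg)
 show ?thesis unfolding conv_def
  using nn_integral_eq_integrable[of "%s. gk a (t - s) * gk b s" lborel "gk (a + b) t"] nn a b
  by (auto simp: g_kernel_nonneg)
qed

text \<open>Restricting Euler's integral to \<open>{A..}\<close>, where the power is at least \<open>A powr (s - 1)\<close>. With large \<open>A\<close> this
is the superexponential growth of \<open>Gamma\<close> in a form that handles noninteger steps.\<close>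

lemma Gamma_real_ge:
 assumes s: "s >= (1::real)" and A: "A >= 0"
 shows "A powr (s - 1) * exp (- A) <= Gamma s"
proof -
 have hi: "((%t. A powr (s - 1) * exp (- 1 * t)) has_integral A powr (s - 1) * (exp (- 1 * A) / 1)) {A..}"
  by (intro has_integral_mult_right has_integral_exp_minus_to_infinity) auto
 have "ennreal (A powr (s - 1) * exp (- A)) =
   (NN t. ennreal (ind {A..} t * (A powr (s - 1) * exp (- 1 * t))))"
  using nn_integral_has_integral_lebesgue[OF _ hi] by simp
 also have "... <= (NN t. ennreal (ind {0..} t * t powr (s - 1) / exp t))"
  using s A by (intro nn_integral_mono ennreal_leI)
   (auto simp: indicator_def exp_minus field_simps powr_mono2)
 also have "... = ennreal (Gamma s)" using s by (subst Gamma_conv_nn_integral_real) auto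
 finally show ?thesis using s by (simp add: Gamma_real_pos less_imp_le)
qed

section \<open>Series of fractional kernels\<close>

definition geo_bounded :: "(nat => real) => bool" where
 "geo_bounded c \<longleftrightarrow> (\<exists>K B. \<forall>n. \<bar>c n\<bar> <= K * B ^ n)"

lemma geo_bounded_abs: "geo_bounded c ==> geo_bounded (%n. \<bar>c n\<bar>)"
 by (simp add: geo_bounded_def)

lemma geo_bounded_power: "geo_bounded (%n. z ^ n)"
 unfolding geo_bounded_def by (rule exI[of _ 1], rule exI[of _ "\<bar>z\<bar>"]) (simp add: power_abs)

lemma power_le_fact_exp: "0 <= x ==> x ^ j <= fact j * exp (x::real)"
proof -
 assume x: "0 <= x"
 have "(\<Sum>n\<in>{j}. x ^ n /\<^sub>R fact n) <= exp x"
  unfolding exp_def using x summable_exp_generic[of x] by (intro sum_le_suminf) auto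
 then show ?thesis by (simp add: field_simps)
qed

lemma geo_bounded_poly:
 assumes "al > 0"
 shows "geo_bounded (%n. (-1) ^ n * (al * real n + 1) ^ j)"
 unfolding geo_bounded_def
proof (intro exI allI)
 fix n
 have "\<bar>(-1) ^ n * (al * real n + 1) ^ j\<bar> = (al * real n + 1) ^ j"
  using assms by (simp add: abs_mult power_abs)
 also have "... <= fact j * exp (al * real n + 1)"
  using assms by (intro power_le_fact_exp) simp
 also have "... = (fact j * exp 1) * exp al ^ n"
  by (simp add: exp_add exp_of_nat2_mult)
 finally show "\<bar>(-1) ^ n * (al * real n + 1) ^ j\<bar> <= (fact j * exp 1) * exp al ^ n" .
qed

text \<open>\<open>Gamma_real_ge\<close> with \<open>A\<close> so large that \<open>A powr a\<close> exceeds twice the geometric rate of the numerator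
leaves a geometric series of ratio at most \<open>1/2\<close>.\<close>

lemma summable_Gamma_series:
 assumes a: "a > 0" and c: "geo_bounded c"
 shows "summable (%n. \<bar>c n / Gamma (a * real n + b) * x ^ n\<bar>)"
proof -
 obtain K B0 where KB0: "\<And>n. \<bar>c n\<bar> <= K * B0 ^ n" using c by (auto simp: geo_bounded_def)
 define B where "B = \<bar>B0\<bar>"
 have B: "B >= 0" and KB: "\<bar>c n\<bar> <= \<bar>K\<bar> * B ^ n" for n
 proof -
  show "B >= 0" by (simp add: B_def)
  have "K * B0 ^ n <= \<bar>K * B0 ^ n\<bar>" by simp
  also have "... = \<bar>K\<bar> * B ^ n" by (simp add: abs_mult power_abs B_def)
  finally show "\<bar>c n\<bar> <= \<bar>K\<bar> * B ^ n" using KB0[of n] by linarith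
 qed
 (* the summand 1 keeps A positive when x = 0 *)
 define A where "A = (2 * B * \<bar>x\<bar> + 1) powr (1 / a)"
 have "2 * B * \<bar>x\<bar> + 1 > 0" using B by (simp add: add_nonneg_pos)
 then have Aa: "A powr a = 2 * B * \<bar>x\<bar> + 1" and A: "A > 0" using a
  by (auto simp: A_def powr_powr)
 define N where "N = nat \<lceil>(1 + \<bar>b\<bar>) / a\<rceil>"
 have big: "a * real n + b >= 1" if "n >= N" for n
 proof -
  have "(1 + \<bar>b\<bar>) / a <= real n" using that unfolding N_def by linarith
  then have "1 + \<bar>b\<bar> <= a * real n" using a by (simp add: field_simps)
  then show ?thesis by linarith
 qed
 have bound: "\<bar>c n / Gamma (a * real n + b) * x ^ n\<bar> <= \<bar>K\<bar> * exp A * A powr (1 - b) * (1/2) ^ n" if "n >= N" for n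
 proof -
  have G: "A powr (a * real n + b - 1) * exp (- A) <= Gamma (a * real n + b)"
   using big[OF that] A by (intro Gamma_real_ge) auto
  have lhs: "A powr (a * real n + b - 1) * exp (- A) > 0" using A by simp
  have "\<bar>c n / Gamma (a * real n + b) * x ^ n\<bar> = \<bar>c n\<bar> * \<bar>x\<bar> ^ n / Gamma (a * real n + b)"
   using G lhs by (simp add: abs_mult power_abs)
  also have "... <= (\<bar>K\<bar> * B ^ n) * \<bar>x\<bar> ^ n / (A powr (a * real n + b - 1) * exp (- A))"
   using G lhs KB[of n] B by (intro frac_le mult_right_mono mult_nonneg_nonneg) auto
  also have "A powr (a * real n + b - 1) = (A powr a) ^ n / A powr (1 - b)"
   using A powr_diff[of A "a * real n" "1 - b"]
   by (simp add: powr_powr[symmetric] powr_realpow algebra_simps)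
  also have "(\<bar>K\<bar> * B ^ n) * \<bar>x\<bar> ^ n / ((A powr a) ^ n / A powr (1 - b) * exp (- A))
   = \<bar>K\<bar> * exp A * A powr (1 - b) * (B * \<bar>x\<bar> / (2 * B * \<bar>x\<bar> + 1)) ^ n"
   using A by (simp add: Aa exp_minus field_simps power_mult_distrib power_divide)
  also have "... <= \<bar>K\<bar> * exp A * A powr (1 - b) * (1/2) ^ n"
   using B by (intro mult_left_mono power_mono) (auto simp: divide_simps add_nonneg_pos)
  finally show ?thesis .
 qed
 show ?thesis
  by (rule summable_comparison_test'[of "%n. \<bar>K\<bar> * exp A * A powr (1 - b) * (1/2) ^ n" N])
   (use bound in \<open>auto intro!: summable_mult summable_geometric\<close>)
qed

text \<open>All scalar kernels of the problem are series of this form. Each term is a fractional kernel, so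
convolution with \<open>g\<^sub>d\<close> is a shift of the last index but one (\<open>conv_g_ser\<close>).\<close>

definition ser :: "(nat => real) => real => real => real => real" where
 "ser c a b t = (\<Sum>n. c n * gk (a * real n + b) t)"

lemma ser_measurable [measurable]: "ser c a b \<in> bor"
 unfolding ser_def[abs_def] by measurable

lemma ser_nonpos [simp]: "t <= 0 ==> ser c a b t = 0"
 by (simp add: ser_def g_kernel_def)

lemma g_kernel_series_term:
 assumes "t > 0"
 shows "gk (a * real n + b) t = t powr (b - 1) * ((t powr a) ^ n / Gamma (a * real n + b))"
proof -
 have "t powr (a * real n + b - 1) = t powr (b - 1) * (t powr a) ^ n"
  using assms powr_add[of t "b - 1" "a * real n"]
  by (simp add: powr_powr[symmetric] powr_realpow algebra_simps)
 then show ?thesis using assms by (simp add: g_kernel_def)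
qed

lemma ser_summable:
 assumes a: "a > 0" and c: "geo_bounded c"
 shows "summable (%n. \<bar>c n * gk (a * real n + b) t\<bar>)"
proof (cases "t > 0")
 case True
 have "summable (%n. t powr (b - 1) * \<bar>c n / Gamma (a * real n + b) * (t powr a) ^ n\<bar>)"
  by (intro summable_mult summable_Gamma_series a c)
 then show ?thesis using True by (simp add: g_kernel_series_term abs_mult mult_ac)
qed (simp add: g_kernel_def)

lemma ser_eq:
 assumes "t > 0" "a > 0" "geo_bounded c"
 shows "ser c a b t = t powr (b - 1) * (\<Sum>n. c n / Gamma (a * real n + b) * (t powr a) ^ n)"
 unfolding ser_def using assms summable_rabs_cancel[OF summable_Gamma_series[of a c b "t powr a"]]
 by (subst suminf_mult[symmetric]) (auto simp: g_kernel_series_term mult_ac)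

lemma ser_shift:
 assumes a: "a > 0" and c: "geo_bounded c"
 shows "ser c a b t = c 0 * gk b t + ser (%n. c (Suc n)) a (b + a) t"
proof -
 have s: "summable (%n. c n * gk (a * real n + b) t)"
  using ser_summable[OF a c] by (rule summable_rabs_cancel)
 have "(\<Sum>n. c (Suc n) * gk (a * real (Suc n) + b) t) = ser c a b t - c 0 * gk b t"
  using suminf_split_head[OF s] by (simp add: ser_def)
 moreover have "a * real (Suc n) + b = a * real n + (b + a)" for n by (simp add: algebra_simps)
 ultimately show ?thesis unfolding ser_def by (simp only:)
qed

lemma
 assumes a: "a > 0" and b: "b > 0" and d: "d > 0" and c: "geo_bounded c"
 shows aconv_g_ser: "aconv (gk d) (ser c a b) t <= ennreal (ser (%n. \<bar>c n\<bar>) a (b + d) t)"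
  and conv_g_ser: "conv (gk d) (ser c a b) t = ser c a (b + d) t"
proof -
 let ?f = "%n s. gk d (t - s) * (c n * gk (a * real n + b) s)"
 have pos: "a * real n + b > 0" for n using a b by (simp add: add_nonneg_pos)
 have sumc: "summable (%n. c n * gk (a * real n + b) s)" for s
  using ser_summable[OF a c] by (rule summable_rabs_cancel)
 have eq: "gk d (t - s) * ser c a b s = (\<Sum>n. ?f n s)" for s
  unfolding ser_def by (rule suminf_mult[symmetric, OF sumc])
 have sum: "summable (%n. \<bar>?f n s\<bar>)" for s
  using summable_mult[OF ser_summable[OF a c], of "\<bar>gk d (t - s)\<bar>" b s]
  by (simp add: abs_mult)
 have nnf: "(NN s. ennreal \<bar>?f n s\<bar>) = ennreal (\<bar>c n\<bar> * gk (a * real n + (b + d)) t)" for n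
 proof -
  have "(NN s. ennreal \<bar>?f n s\<bar>) = ennreal \<bar>c n\<bar> * aconv (gk d) (gk (a * real n + b)) t"
   unfolding aconv_def by (subst nn_integral_cmult[symmetric])
   (auto intro!: nn_integral_cong simp: abs_mult ennreal_mult[symmetric] mult_ac)
  also have "... = ennreal \<bar>c n\<bar> * ennreal (gk (d + (a * real n + b)) t)"
   using aconv_g_kernel[OF d pos, of n t] by simp
  finally show ?thesis using d pos[of n]
   by (simp add: ennreal_mult[symmetric] g_kernel_nonneg add_ac)
 qed
 have sum2: "summable (%n. \<bar>c n\<bar> * gk (a * real n + (b + d)) t)"
 proof -
  have "\<bar>c n * gk (a * real n + (b + d)) t\<bar> = \<bar>c n\<bar> * gk (a * real n + (b + d)) t" for n
   using g_kernel_nonneg[of "a * real n + (b + d)" t] pos[of n] d by (simp add: abs_mult add.assoc[symmetric])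
  then show ?thesis using ser_summable[OF a c, of "b + d" t] by simp
 qed
 have "aconv (gk d) (ser c a b) t <= (NN s. (\<Sum>n. ennreal \<bar>?f n s\<bar>))"
  unfolding aconv_def eq
  by (intro nn_integral_mono) (auto simp: suminf_ennreal2 sum intro!: ennreal_leI summable_rabs)
 also have "... = (\<Sum>n. NN s. ennreal \<bar>?f n s\<bar>)" by (rule nn_integral_suminf) auto
 also have "... = ennreal (ser (%n. \<bar>c n\<bar>) a (b + d) t)"
  unfolding nnf ser_def using sum2 pos d
  by (intro suminf_ennreal2) (auto intro!: mult_nonneg_nonneg g_kernel_nonneg simp: add.assoc[symmetric] add_pos_pos)
 finally show "aconv (gk d) (ser c a b) t <= ennreal (ser (%n. \<bar>c n\<bar>) a (b + d) t)" .
 have int: "integrable lborel (?f n)" for n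
  by (rule integrableI_bounded) (use nnf[of n] in auto)
 have intn: "(LL s. norm (?f n s)) = \<bar>c n\<bar> * gk (a * real n + (b + d)) t" for n
  using nnf[of n] pos[of n] d
  by (intro integral_eq_nn_integral[THEN trans]) (auto simp: g_kernel_nonneg add.assoc[symmetric])
 have "conv (gk d) (ser c a b) t = (\<Sum>n. LL s. ?f n s)"
  unfolding conv_def eq
  by (rule integral_suminf[OF int]) (use sum sum2 intn in auto)
 also have "... = ser c a (b + d) t"
 proof -
  have "(LL s. ?f n s) = c n * gk (a * real n + (b + d)) t" for n
  proof -
   have "(LL s. ?f n s) = c n * conv (gk d) (gk (a * real n + b)) t"
    unfolding conv_def by (subst integral_mult_right_zero[symmetric]) (simp add: mult_ac)
   then show ?thesis using conv_g_kernel[OF d pos, of n t] by (simp add: add_ac)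
  qed
  then show ?thesis by (simp add: ser_def)
 qed
 finally show "conv (gk d) (ser c a b) t = ser c a (b + d) t" .
qed

lemma isCont_Gamma_series:
 assumes "a > 0" "geo_bounded c"
 shows "isCont (%x. \<Sum>n. c n / Gamma (a * real n + b) * x ^ n) x"
 by (rule isCont_powser_converges_everywhere)
  (rule summable_rabs_cancel[OF summable_Gamma_series[OF assms]])

lemma mittag_leffler_eq:
 "mittag_leffler a b z = (\<Sum>n. 1 / Gamma (a * real n + b) * z ^ n)"
 by (simp add: mittag_leffler_def)

lemma isCont_mittag_leffler: "a > 0 ==> isCont (mittag_leffler a b) z"
 unfolding mittag_leffler_eq[abs_def]
 using isCont_Gamma_series[where a = a and c = "%n. 1 ^ n" and b = b and x = z] geo_bounded_power[of 1] by simp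

lemma mittag_leffler_measurable:
 assumes "a > 0" shows "mittag_leffler a b \<in> bor"
 using isCont_mittag_leffler[OF assms]
 by (intro borel_measurable_continuous_onI) (simp add: continuous_on_eq_continuous_at)

lemma ser_bounded:
 assumes a: "a > 0" and c: "geo_bounded c" and b: "b >= 1"
 shows "\<exists>C. \<forall>t\<le>T. \<bar>ser c a b t\<bar> <= C"
proof -
 define P where "P x = (\<Sum>n. c n / Gamma (a * real n + b) * x ^ n)" for x
 have cont: "continuous_on {0..\<bar>T\<bar> powr a} P"
  unfolding P_def using isCont_Gamma_series[OF a c] by (intro continuous_at_imp_continuous_on ballI)
 then obtain C where C: "\<And>x. x \<in> {0..\<bar>T\<bar> powr a} ==> norm (P x) <= C"
  using compact_continuous_image[OF cont compact_Icc] compact_imp_bounded[of "P ` {0..\<bar>T\<bar> powr a}"]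
  by (metis bounded_iff imageI)
 have C0: "C >= 0" using C[of 0] by (auto intro: order_trans[OF norm_ge_zero])
 show ?thesis
 proof (intro exI allI impI)
  fix t assume t: "t <= T"
  show "\<bar>ser c a b t\<bar> <= \<bar>T\<bar> powr (b - 1) * C"
  proof (cases "t > 0")
   case True
   have "t powr (b - 1) <= \<bar>T\<bar> powr (b - 1)" "t powr a <= \<bar>T\<bar> powr a"
    using True t a b by (auto intro!: powr_mono2)
   moreover have "\<bar>ser c a b t\<bar> = t powr (b - 1) * \<bar>P (t powr a)\<bar>"
    using True a c by (simp add: ser_eq P_def abs_mult)
   ultimately show ?thesis using C[of "t powr a"] C0 by (auto intro!: mult_mono)
  qed (use C0 in simp)
 qed
qed

lemma continuous_on_ser:
 assumes a: "a > 0" and c: "geo_bounded c"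
 shows "continuous_on {0<..} (ser c a b)"
proof -
 define P where "P x = (\<Sum>n. c n / Gamma (a * real n + b) * x ^ n)" for x
 have P: "continuous_on UNIV P"
  unfolding P_def using isCont_Gamma_series[OF a c] by (intro continuous_at_imp_continuous_on ballI)
 have "continuous_on {0<..} (%t. t powr (b - 1) * P (t powr a))"
  by (intro continuous_intros continuous_on_compose2[OF P]) auto
 then show ?thesis
  by (rule continuous_on_eq) (use a c in \<open>auto simp: ser_eq P_def\<close>)
qed

section \<open>Positivity of the fractional kernel\<close>

lemma nn_integral_powr_from_0:
 assumes "p > -1" "c >= 0"
 shows "(NN x. ennreal (ind {0..c} x * x powr p)) = ennreal (c powr (p + 1) / (p + 1))"
 using nn_integral_has_integral_lebesgue[OF _ has_integral_powr_from_0[of p c]] assms by simp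

lemma nn_integral_powr_to_inf:
 assumes "p < -1" "c > 0"
 shows "(NN x. ennreal (ind {c..} x * x powr p)) = ennreal (- (c powr (p + 1)) / (p + 1))"
 using nn_integral_has_integral_lebesgue[OF _ has_integral_powr_to_inf[of p c]] assms by simp

lemma g_kernel_1: "gk 1 t = (if t > 0 then 1 else 0)"
 by (simp add: g_kernel_def)

lemma nn_integral_g_kernel:
 assumes "ga > 0" "T >= 0"
 shows "(NN u. ennreal (ind {0..T} u * gk ga u)) = ennreal (T powr ga / (ga * Gamma ga))"
proof -
 have "(NN u. ennreal (ind {0..T} u * gk ga u))
  = (NN u. ennreal (1 / Gamma ga) * ennreal (ind {0..T} u * u powr (ga - 1)))"
  using assms by (intro nn_integral_cong)
   (auto simp: g_kernel_def indicator_def Gamma_real_pos less_imp_le ennreal_mult[symmetric])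
 also have "... = ennreal (1 / Gamma ga) * ennreal (T powr ga / ga)"
  using assms nn_integral_powr_from_0[of "ga - 1" T] by (subst nn_integral_cmult) auto
 finally show ?thesis using assms by (simp add: ennreal_mult[symmetric] Gamma_real_pos less_imp_le mult.commute)
qed

text \<open>The kernel \<open>\<bar>t - s\<bar> powr (ga - 1)\<close> is a square: with \<open>h = g\<^sub>g\<^sub>a\<^sub>/\<^sub>2\<close>, translating and scaling
\<open>\<integral> h(t - \<xi>) h(s - \<xi>) d\<xi>\<close> by \<open>\<bar>t - s\<bar>\<close> leaves a constant.\<close>

lemma riesz_composition:
 assumes ga: "0 < ga" "ga < (1::real)"
 shows "\<exists>K>0. \<forall>t s. t \<noteq> s \<longrightarrow>
  (NN \<xi>. ennreal (gk (ga/2) (t - \<xi>) * gk (ga/2) (s - \<xi>))) =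
   ennreal (K * \<bar>t - s\<bar> powr (ga - 1))"
proof -
 let ?h = "gk (ga/2)"
 have G: "Gamma (ga/2) > 0" using ga by (simp add: Gamma_real_pos)
 define I where "I = (NN v. ennreal (?h v * ?h (1 + v)))"
 have hn: "?h v >= 0" for v using ga by (simp add: g_kernel_nonneg)
 have "I <= (NN v. ennreal (1 / (Gamma (ga/2))\<^sup>2) * (ennreal (ind {0..1} v * v powr (ga/2 - 1)) +
   ennreal (ind {1..} v * v powr (ga - 2))))"
  unfolding I_def
 proof (intro nn_integral_mono)
  fix v :: real
  have 1: "(1 + v) powr (ga/2 - 1) <= 1" if "v > 0"
   using that ga powr_mono2'[of "ga/2 - 1" 1 "1 + v"] by simp
  have 2: "v powr (ga/2 - 1) * (1 + v) powr (ga/2 - 1) <= v powr (ga - 2)" if "v > 0"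
  proof -
   have "v powr (ga/2 - 1) * (1 + v) powr (ga/2 - 1) <= v powr (ga/2 - 1) * v powr (ga/2 - 1)"
    using that ga by (intro mult_left_mono powr_mono2') auto
   also have "... = v powr (ga - 2)" by (simp add: powr_add[symmetric])
   finally show ?thesis .
  qed
  have "?h v * ?h (1 + v) <= 1 / (Gamma (ga/2))\<^sup>2 *
   (ind {0..1} v * v powr (ga/2 - 1) + ind {1..} v * v powr (ga - 2))"
  proof (cases "v > 0")
   case True
   have "v powr (ga/2 - 1) * (1 + v) powr (ga/2 - 1) \<le>
    ind {0..1} v * v powr (ga/2 - 1) + ind {1..} v * v powr (ga - 2)"
    using True 1 2 mult_left_mono[OF 1, of "v powr (ga/2 - 1)"] by (auto simp: indicator_def)
   then show ?thesis using True G
    by (simp add: g_kernel_def power2_eq_square divide_right_mono)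
  next
   case False
   then have "?h v = 0" by (simp add: g_kernel_def)
   then show ?thesis by simp
  qed
  then show "ennreal (?h v * ?h (1 + v)) <= ennreal (1 / (Gamma (ga/2))\<^sup>2) * (ennreal (ind {0..1} v * v powr (ga/2 - 1)) +
   ennreal (ind {1..} v * v powr (ga - 2)))"
   by (simp add: ennreal_mult[symmetric] ennreal_plus[symmetric] del: ennreal_plus)
 qed
 also have "... < \<infinity>"
  using ga nn_integral_powr_from_0[of "ga/2 - 1" 1] nn_integral_powr_to_inf[of "ga - 2" 1]
  by (subst nn_integral_cmult, simp, subst nn_integral_add) (auto simp: ennreal_mult_less_top)
 finally have fin: "I < \<infinity>" .
 have "0 < ennreal (2 powr (ga/2 - 1) / (Gamma (ga/2))\<^sup>2)" using G by simp
 also have "... = (\<integral>\<^sup>+v. ennreal (2 powr (ga/2 - 1) / (Gamma (ga/2))\<^sup>2) * ind {0<..<1} v \<partial>(lborel :: real measure))"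
  by (simp add: nn_integral_cmult_indicator)
 also have "... <= I" unfolding I_def
 proof (intro nn_integral_mono)
  fix v :: real
  show "ennreal (2 powr (ga/2 - 1) / (Gamma (ga/2))\<^sup>2) * ind {0<..<1} v <= ennreal (?h v * ?h (1 + v))"
  proof (cases "v \<in> {0<..<1}")
   case True
   have "1 * 2 powr (ga/2 - 1) <= v powr (ga/2 - 1) * (1 + v) powr (ga/2 - 1)"
    using True ga powr_mono2'[of "ga/2 - 1" v 1] by (intro mult_mono powr_mono2') auto
   then show ?thesis using True G by (auto simp: g_kernel_def power2_eq_square intro!: ennreal_leI divide_right_mono)
  qed simp
 qed
 finally have pos: "I > 0" .
 define K where "K = enn2real I"
 have IK: "I = ennreal K" and K: "K > 0" using fin pos by (auto simp: K_def enn2real_positive_iff)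
 have "(NN \<xi>. ennreal (?h (t - \<xi>) * ?h (s - \<xi>))) = ennreal (K * \<bar>t - s\<bar> powr (ga - 1))" if "s < t" for s t
 proof -
  define u where "u = t - s"
  have u: "u > 0" using that by (simp add: u_def)
  have "(NN \<xi>. ennreal (?h (t - \<xi>) * ?h (s - \<xi>))) =
   ennreal u * (NN v. ennreal (?h (t - (s - u * v)) * ?h (s - (s - u * v))))"
   using u by (subst nn_integral_real_affine[where c = "-u" and t = s]) auto
  also have "(NN v. ennreal (?h (t - (s - u * v)) * ?h (s - (s - u * v)))) =
   (NN v. ennreal (u powr (ga - 2)) * ennreal (?h v * ?h (1 + v)))"
  proof (intro nn_integral_cong)
   fix v :: real
   have "t - (s - u * v) = u * (1 + v)" by (simp add: u_def algebra_simps)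
   moreover have "?h (u * w) = u powr (ga/2 - 1) * ?h w" for w
    using u by (auto simp: g_kernel_def powr_mult zero_less_mult_iff)
   ultimately have "?h (t - (s - u * v)) * ?h (s - (s - u * v)) = (u powr (ga/2 - 1) * u powr (ga/2 - 1)) * (?h v * ?h (1 + v))"
    by simp
   also have "u powr (ga/2 - 1) * u powr (ga/2 - 1) = u powr (ga - 2)" by (simp add: powr_add[symmetric])
   finally show "ennreal (?h (t - (s - u * v)) * ?h (s - (s - u * v))) = ennreal (u powr (ga - 2)) * ennreal (?h v * ?h (1 + v))"
    using hn by (simp add: ennreal_mult[symmetric])
  qed
  also have "... = ennreal (u powr (ga - 2)) * ennreal K"
   by (subst nn_integral_cmult) (auto simp: I_def[symmetric] IK)
  also have "ennreal u * ... = ennreal (K * \<bar>t - s\<bar> powr (ga - 1))"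
  proof -
   have "u * u powr (ga - 2) = u powr (ga - 1)" using u powr_add[of u 1 "ga - 2"] by simp
   then have "u * (u powr (ga - 2) * K) = K * u powr (ga - 1)" by (simp add: mult_ac)
   then show ?thesis using u K by (simp add: ennreal_mult[symmetric] u_def[symmetric])
  qed
  finally show ?thesis .
 qed note less = this
 show ?thesis
 proof (intro exI conjI allI impI)
  show "K > 0" by fact
  fix t s :: real assume "t \<noteq> s"
  then consider "s < t" | "t < s" by linarith
  then show "(NN \<xi>. ennreal (?h (t - \<xi>) * ?h (s - \<xi>))) = ennreal (K * \<bar>t - s\<bar> powr (ga - 1))"
  proof cases
   case 2 then show ?thesis using less[of t s] by (simp add: mult.commute abs_minus_commute)
  qed (use less in simp)
 qed
qed

text \<open>Symmetrizing the double integral replaces the one-sided kernel by half of \<open>g\<^sub>g\<^sub>a(\<bar>t - s\<bar>)\<close>, and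
\<open>riesz_composition\<close> turns the form into an integral of the squares \<open>(\<integral> h(t - \<xi>) Y(t) dt)\<^sup>2\<close>.\<close>

lemma fractional_kernel_positive:
 assumes ga: "0 < ga" "ga < (1::real)" and [measurable]: "Y \<in> bor"
  and B: "\<And>t. \<bar>Y t\<bar> <= B * ind {0..T} t" and T: "T >= 0"
 shows "0 <= (LL t. Y t * conv (gk ga) Y t)"
proof -
 let ?h = "gk (ga/2)" and ?g = "gk ga"
 obtain K where K: "K > 0" and R: "\<And>t s. t \<noteq> s ==> (NN \<xi>. ennreal (?h (t - \<xi>) * ?h (s - \<xi>))) =
   ennreal (K * \<bar>t - s\<bar> powr (ga - 1))" using riesz_composition[OF ga] by auto
 have hn: "?h v >= 0" "?g v >= 0" for v using ga by (simp_all add: g_kernel_nonneg)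
 have B0: "B >= 0" using B[of 0] T by simp
 have G: "Gamma ga > 0" using ga by (simp add: Gamma_real_pos)
 have sym: "\<bar>t - s\<bar> powr (ga - 1) = Gamma ga * (?g (t - s) + ?g (s - t))" for t s
  using G by (auto simp: g_kernel_def abs_if)
 have RI: "(LL \<xi>. ?h (t - \<xi>) * ?h (s - \<xi>)) = K * \<bar>t - s\<bar> powr (ga - 1)" if "t \<noteq> s" for t s
  using R[OF that] nn_integral_eq_integrable[of "%\<xi>. ?h (t - \<xi>) * ?h (s - \<xi>)" lborel "K * \<bar>t - s\<bar> powr (ga - 1)"] hn K
  by auto
 define G1 where "G1 = T powr ga / (ga * Gamma ga)"
 have G1: "(NN s. ennreal (ind {0..T} s * ?g (t - s))) <= ennreal G1"
  "(NN s. ennreal (ind {0..T} s * ?g (s - t))) <= ennreal G1" if "t \<in> {0..T}" for t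
 proof -
  have "(NN s. ennreal (ind {0..T} s * ?g (t - s))) \<le>
   (NN s. ennreal (ind {0..T} (t - s) * ?g (t - s)))"
   using that G by (intro nn_integral_mono ennreal_leI) (auto simp: indicator_def g_kernel_def less_imp_le)
  also have "... = ennreal G1"
   using nn_integral_lborel_reflect[of "%s. ennreal (ind {0..T} s * ?g s)" t] nn_integral_g_kernel[OF ga(1) T]
   by (simp add: G1_def)
  finally show "(NN s. ennreal (ind {0..T} s * ?g (t - s))) <= ennreal G1" .
  have "(NN s. ennreal (ind {0..T} s * ?g (s - t))) \<le>
   (NN s. ennreal (ind {0..T} (s - t) * ?g (s - t)))"
   using that G by (intro nn_integral_mono ennreal_leI) (auto simp: indicator_def g_kernel_def less_imp_le)
  also have "... = ennreal G1"
   using nn_integral_lborel_shift[of "%s. ennreal (ind {0..T} s * ?g s)" t] nn_integral_g_kernel[OF ga(1) T]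
   by (simp add: G1_def)
  finally show "(NN s. ennreal (ind {0..T} s * ?g (s - t))) <= ennreal G1" .
 qed
 have ae: "AE s in lborel. s \<noteq> (t::real)" for t by (simp add: AE_lborel_singleton)
 have fin0: "(NN t. \<integral>\<^sup>+s. ennreal \<bar>Y t * Y s * (?g (t - s) + ?g (s - t))\<bar> \<partial>lborel) < \<infinity>"
 proof -
  have "(NN t. \<integral>\<^sup>+s. ennreal \<bar>Y t * Y s * (?g (t - s) + ?g (s - t))\<bar> \<partial>lborel) \<le>
   (NN t. ennreal (B\<^sup>2 * (G1 + G1)) * ind {0..T} t)"
  proof (intro nn_integral_mono)
   fix t
   show "(NN s. ennreal \<bar>Y t * Y s * (?g (t - s) + ?g (s - t))\<bar>) <= ennreal (B\<^sup>2 * (G1 + G1)) * ind {0..T} t"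
   proof (cases "t \<in> {0..T}")
    case True
    have "(NN s. ennreal \<bar>Y t * Y s * (?g (t - s) + ?g (s - t))\<bar>) \<le>
     (NN s. ennreal (B\<^sup>2) * (ennreal (ind {0..T} s * ?g (t - s)) + ennreal (ind {0..T} s * ?g (s - t))))"
    proof (intro nn_integral_mono)
     fix s
     have "\<bar>Y t * Y s * (?g (t - s) + ?g (s - t))\<bar> = \<bar>Y t\<bar> * \<bar>Y s\<bar> * (?g (t - s) + ?g (s - t))"
      using hn by (simp add: abs_mult)
     also have "... <= B * (B * ind {0..T} s) * (?g (t - s) + ?g (s - t))"
      using B[of t] B[of s] True B0 hn(2)[of "t - s"] hn(2)[of "s - t"] by (intro mult_right_mono mult_mono) auto
     also have "... = B\<^sup>2 * (ind {0..T} s * ?g (t - s) + ind {0..T} s * ?g (s - t))"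
      by (simp add: power2_eq_square algebra_simps)
     finally show "ennreal \<bar>Y t * Y s * (?g (t - s) + ?g (s - t))\<bar> <= ennreal (B\<^sup>2) * (ennreal (ind {0..T} s * ?g (t - s)) + ennreal (ind {0..T} s * ?g (s - t)))"
      using hn by (simp add: ennreal_mult[symmetric] ennreal_plus[symmetric] ennreal_leI del: ennreal_plus)
    qed
    also have "... <= ennreal (B\<^sup>2) * (ennreal G1 + ennreal G1)"
     using G1[OF True] by (subst nn_integral_cmult, simp, subst nn_integral_add) (auto intro!: mult_left_mono add_mono)
    also have "... = ennreal (B\<^sup>2 * (G1 + G1))"
     using ga T G by (simp add: ennreal_mult[symmetric] ennreal_plus[symmetric] G1_def del: ennreal_plus)
    finally show ?thesis using True by simp
   next
    case False
    then have "Y t = 0" using B[of t] by simp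
    then show ?thesis by simp
   qed
  qed
  also have "... < \<infinity>" using T by (subst nn_integral_cmult_indicator) (auto simp: ennreal_mult_less_top emeasure_lborel_Icc)
  finally show ?thesis .
 qed
 have int2: "integrable (lborel \<Otimes>\<^sub>M lborel) (%(t,s). Y t * Y s * (?g (t - s) + ?g (s - t)))"
  using fin0 by (intro integrableI_bounded) (auto simp: lborel.nn_integral_fst[symmetric])
 define \<Phi> where "\<Phi> = (%(x :: real \<times> real, \<xi>). Y (fst x) * Y (snd x) * (?h (fst x - \<xi>) * ?h (snd x - \<xi>)))"
 have [measurable]: "fst \<in> borel_measurable (lborel :: (real \<times> real) measure)"
  "snd \<in> borel_measurable (lborel :: (real \<times> real) measure)"
  by (auto intro!: borel_measurable_continuous_onI continuous_intros)
 have [measurable]: "\<Phi> \<in> borel_measurable (lborel \<Otimes>\<^sub>M lborel)" unfolding \<Phi>_def split_beta' by measurable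
 have int3: "integrable (lborel \<Otimes>\<^sub>M lborel) \<Phi>"
 proof (rule integrableI_bounded)
  have "(\<integral>\<^sup>+x. ennreal (norm (\<Phi> x)) \<partial>(lborel \<Otimes>\<^sub>M lborel)) = (\<integral>\<^sup>+x. \<integral>\<^sup>+\<xi>. ennreal (norm (\<Phi> (x, \<xi>))) \<partial>lborel \<partial>(lborel :: (real \<times> real) measure))"
   by (subst lborel.nn_integral_fst[symmetric]) auto
  also have "... = (NN t. \<integral>\<^sup>+s. \<integral>\<^sup>+\<xi>. ennreal (norm (\<Phi> ((t, s), \<xi>))) \<partial>lborel \<partial>lborel)"
   unfolding lborel_prod[symmetric] by (subst lborel.nn_integral_fst[symmetric]) (auto simp: lborel_prod)
  also have "... = (NN t. \<integral>\<^sup>+s. ennreal (K * Gamma ga) * ennreal \<bar>Y t * Y s * (?g (t - s) + ?g (s - t))\<bar> \<partial>lborel)"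
  proof (intro nn_integral_cong nn_integral_cong_AE, rule AE_mp[OF ae], intro AE_I2 impI)
   fix t s :: real assume "s \<noteq> t"
   have "(NN \<xi>. ennreal (norm (\<Phi> ((t, s), \<xi>)))) = (NN \<xi>. ennreal \<bar>Y t * Y s\<bar> * ennreal (?h (t - \<xi>) * ?h (s - \<xi>)))"
    using hn by (intro nn_integral_cong) (simp add: \<Phi>_def abs_mult ennreal_mult[symmetric])
   also have "... = ennreal \<bar>Y t * Y s\<bar> * ennreal (K * \<bar>t - s\<bar> powr (ga - 1))"
    using \<open>s \<noteq> t\<close> by (subst nn_integral_cmult) (auto simp: R)
   also have "... = ennreal (K * Gamma ga) * ennreal \<bar>Y t * Y s * (?g (t - s) + ?g (s - t))\<bar>"
    using K G hn by (simp add: ennreal_mult[symmetric] sym abs_mult mult_ac)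
   finally show "(NN \<xi>. ennreal (norm (\<Phi> ((t, s), \<xi>)))) = ennreal (K * Gamma ga) * ennreal \<bar>Y t * Y s * (?g (t - s) + ?g (s - t))\<bar>" .
  qed
  also have "... = ennreal (K * Gamma ga) * (NN t. \<integral>\<^sup>+s. ennreal \<bar>Y t * Y s * (?g (t - s) + ?g (s - t))\<bar> \<partial>lborel)"
   by (subst nn_integral_cmult[symmetric]) (auto simp: nn_integral_cmult)
  also have "... < \<infinity>" using fin0 by (auto simp: ennreal_mult_less_top)
  finally show "(\<integral>\<^sup>+x. ennreal (norm (\<Phi> x)) \<partial>(lborel \<Otimes>\<^sub>M lborel)) < \<infinity>" .
 qed auto
 have "0 <= (LL \<xi>. (LL x. \<Phi> (x, \<xi>)))"
 proof (rule integral_nonneg_AE)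
  have "AE \<xi> in lborel. integrable lborel (%x. \<Phi> (x, \<xi>))"
   using lborel_pair.AE_integrable_snd[of "%x \<xi>. \<Phi> (x, \<xi>)"] int3 by (simp add: split_beta')
  then show "AE \<xi> in lborel. 0 <= (LL x. \<Phi> (x, \<xi>))"
  proof eventually_elim
   fix \<xi> assume i: "integrable lborel (%x. \<Phi> (x, \<xi>))"
   have "(LL x. \<Phi> (x, \<xi>)) = (LL t. \<integral>s. \<Phi> ((t, s), \<xi>) \<partial>lborel)"
    using lborel_pair.integral_fst'[of "%x. \<Phi> (x, \<xi>)"] i by (simp add: lborel_prod)
   also have "... = (LL t. (Y t * ?h (t - \<xi>)) * (LL s. Y s * ?h (s - \<xi>)))"
    unfolding \<Phi>_def by (subst integral_mult_right_zero[symmetric]) (simp add: mult_ac)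
   also have "... = (LL s. Y s * ?h (s - \<xi>))\<^sup>2"
    by (simp add: power2_eq_square)
   finally show "0 <= (LL x. \<Phi> (x, \<xi>))" by simp
  qed
 qed
 also have "... = (\<integral>x. (LL \<xi>. \<Phi> (x, \<xi>)) \<partial>(lborel :: (real \<times> real) measure))"
  using lborel_pair.Fubini_integral[of "%x \<xi>. \<Phi> (x, \<xi>)"] int3 by (simp add: split_beta')
 also have "... = (LL t. \<integral>s. (LL \<xi>. \<Phi> ((t, s), \<xi>)) \<partial>lborel)"
  using lborel_pair.integral_fst'[of "%x. \<integral>\<xi>. \<Phi> (x, \<xi>) \<partial>lborel"] lborel_pair.integrable_fst'[OF int3]
  by (simp add: lborel_prod)
 also have "... = (LL t. \<integral>s. K * Gamma ga * (Y t * Y s * (?g (t - s) + ?g (s - t))) \<partial>lborel)"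
 proof (rule Bochner_Integration.integral_cong[OF refl], rule integral_cong_AE)
  fix t
  show "(%s. LL \<xi>. \<Phi> ((t, s), \<xi>)) \<in> borel_measurable lborel"
   unfolding \<Phi>_def by simp
  show "(%s. K * Gamma ga * (Y t * Y s * (?g (t - s) + ?g (s - t)))) \<in> borel_measurable lborel"
   by simp
  show "AE s in lborel. (LL \<xi>. \<Phi> ((t, s), \<xi>)) = K * Gamma ga * (Y t * Y s * (?g (t - s) + ?g (s - t)))"
   using ae[of t]
  proof eventually_elim
   fix s assume "s \<noteq> t"
   then show "(LL \<xi>. \<Phi> ((t, s), \<xi>)) = K * Gamma ga * (Y t * Y s * (?g (t - s) + ?g (s - t)))"
    unfolding \<Phi>_def by (simp add: RI sym)
  qed
 qed
 also have "... = K * Gamma ga * (LL t. \<integral>s. Y t * Y s * (?g (t - s) + ?g (s - t)) \<partial>lborel)"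
  by simp
 finally have "0 <= (LL t. \<integral>s. Y t * Y s * (?g (t - s) + ?g (s - t)) \<partial>lborel)"
  using mult_le_cancel_left_pos[OF mult_pos_pos[OF K G], of 0] by simp
 also have "... = (\<integral>z. (%(t,s). Y t * Y s * (?g (t - s) + ?g (s - t))) z \<partial>(lborel \<Otimes>\<^sub>M lborel))"
  using lborel_pair.integral_fst'[OF int2] by simp
 also have "... = (\<integral>z. (%(t,s). Y t * Y s * ?g (t - s)) z \<partial>(lborel \<Otimes>\<^sub>M lborel)) + (\<integral>z. (%(t,s). Y t * Y s * ?g (s - t)) z \<partial>(lborel \<Otimes>\<^sub>M lborel))"
 proof -
  have i1: "integrable (lborel \<Otimes>\<^sub>M lborel) (%(t,s). Y t * Y s * ?g (t - s))"
   by (rule Bochner_Integration.integrable_bound[OF int2]) (use hn in \<open>auto simp: abs_mult intro!: mult_left_mono AE_I2\<close>)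
  have i2: "integrable (lborel \<Otimes>\<^sub>M lborel) (%(t,s). Y t * Y s * ?g (s - t))"
   by (rule Bochner_Integration.integrable_bound[OF int2]) (use hn in \<open>auto simp: abs_mult intro!: mult_left_mono AE_I2\<close>)
  show ?thesis by (subst Bochner_Integration.integral_add[OF i1 i2, symmetric]) (auto intro!: Bochner_Integration.integral_cong simp: algebra_simps)
 qed
 also have "... = 2 * (LL t. Y t * conv ?g Y t)"
 proof -
  have i1: "integrable (lborel \<Otimes>\<^sub>M lborel) (%(t,s). Y t * Y s * ?g (t - s))"
   by (rule Bochner_Integration.integrable_bound[OF int2]) (use hn in \<open>auto simp: abs_mult intro!: mult_left_mono AE_I2\<close>)
  have i2: "integrable (lborel \<Otimes>\<^sub>M lborel) (%(t,s). Y t * Y s * ?g (s - t))"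
   by (rule Bochner_Integration.integrable_bound[OF int2]) (use hn in \<open>auto simp: abs_mult intro!: mult_left_mono AE_I2\<close>)
  have "(\<integral>z. (%(t,s). Y t * Y s * ?g (t - s)) z \<partial>(lborel \<Otimes>\<^sub>M lborel)) = (LL t. \<integral>s. Y t * Y s * ?g (t - s) \<partial>lborel)"
   using lborel_pair.integral_fst'[OF i1] by simp
  moreover have "(\<integral>z. (%(t,s). Y t * Y s * ?g (s - t)) z \<partial>(lborel \<Otimes>\<^sub>M lborel)) = (LL s. \<integral>t. Y t * Y s * ?g (s - t) \<partial>lborel)"
   using lborel_pair.integral_snd[of "%t s. Y t * Y s * ?g (s - t)"] i2 by simp
  moreover have "(LL t. Y t * conv ?g Y t) = (LL t. \<integral>s. Y t * Y s * ?g (t - s) \<partial>lborel)"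
   unfolding conv_def by (subst integral_mult_right_zero[symmetric]) (simp add: mult_ac)
  ultimately show ?thesis by (simp add: mult.commute)
 qed
 finally show ?thesis by simp
qed

section \<open>An energy estimate for a Volterra equation\<close>

lemma conv_causal_cong:
 assumes "\<And>s. s <= 0 ==> a s = 0" "\<And>s. s < t ==> b s = b' s"
 shows "conv a b t = conv a b' t"
 unfolding conv_def
proof (rule Bochner_Integration.integral_cong[OF refl])
 fix s show "a (t - s) * b s = a (t - s) * b' s"
  using assms(1)[of "t - s"] assms(2)[of s] by (cases "s < t") auto
qed

lemma abs_conv_g_le:
 assumes a: "a > 0" and b: "b > 0" and [measurable]: "f \<in> bor"
  and f: "\<And>s. s < t ==> \<bar>f s\<bar> <= K * gk b s" and K: "K >= 0"
 shows "\<bar>conv (gk a) f t\<bar> <= K * gk (a + b) t"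
proof -
 have "ennreal \<bar>conv (gk a) f t\<bar> <= aconv (gk a) f t"
  by (rule abs_conv_le_aconv) auto
 also have "... <= (NN s. ennreal K * ennreal \<bar>gk a (t - s) * gk b s\<bar>)"
  unfolding aconv_def
 proof (intro nn_integral_mono)
  fix s
  show "ennreal \<bar>gk a (t - s) * f s\<bar> <= ennreal K * ennreal \<bar>gk a (t - s) * gk b s\<bar>"
  proof (cases "s < t")
   case True
   have "\<bar>gk a (t - s) * f s\<bar> <= gk a (t - s) * (K * gk b s)"
    using f[OF True] a by (simp add: abs_mult g_kernel_nonneg mult_left_mono)
   then show ?thesis using a b K
    by (simp add: ennreal_mult[symmetric] abs_mult g_kernel_nonneg mult_ac ennreal_leI)
  qed (simp add: g_kernel_def)
 qed
 also have "... = ennreal K * aconv (gk a) (gk b) t"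
  unfolding aconv_def by (rule nn_integral_cmult) simp
 also have "... = ennreal (K * gk (a + b) t)"
  using a b K by (simp add: aconv_g_kernel ennreal_mult[symmetric] g_kernel_nonneg)
 finally show ?thesis using a b K by (simp add: g_kernel_nonneg)
qed

text \<open>The square over \<open>s, t\<close> consists of two triangles with equal contributions. This replaces
\<open>y y' = (y\<^sup>2)'/2\<close> for a primitive \<open>y\<close> of a function that is merely integrable.\<close>

lemma double_integral_triangle:
 assumes [measurable]: "Z \<in> bor" and int: "integrable lborel Z"
 shows "(LL t. Z t)\<^sup>2 = 2 * (LL t. Z t * conv (gk 1) Z t)"
proof -
 have ip: "integrable (lborel \<Otimes>\<^sub>M lborel) (%(t,s). Z t * Z s)"
 proof (rule lborel_pair.Fubini_integrable)
  show "integrable lborel (%x. LBINT y. norm ((%(t,s). Z t * Z s) (x, y)))"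
   using int by (simp add: abs_mult)
  show "AE x in lborel. integrable lborel (%y. (%(t,s). Z t * Z s) (x, y))" using int by simp
 qed auto
 have i1: "integrable (lborel \<Otimes>\<^sub>M lborel) (%(t,s). Z t * Z s * gk 1 (t - s))"
  by (rule Bochner_Integration.integrable_bound[OF ip]) (auto simp: g_kernel_1)
 have i2: "integrable (lborel \<Otimes>\<^sub>M lborel) (%(t,s). Z t * Z s * gk 1 (s - t))"
  by (rule Bochner_Integration.integrable_bound[OF ip]) (auto simp: g_kernel_1)
 have a1: "(LL t. \<integral>s. Z t * Z s * gk 1 (t - s) \<partial>lborel) = (LL t. Z t * conv (gk 1) Z t)"
  unfolding conv_def by (subst integral_mult_right_zero[symmetric]) (simp add: mult_ac)
 have a2: "(LL t. \<integral>s. Z t * Z s * gk 1 (s - t) \<partial>lborel) = (LL t. Z t * conv (gk 1) Z t)"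
  using lborel_pair.Fubini_integral[of "%t s. Z t * Z s * gk 1 (s - t)"] i2 a1
  by (simp add: mult_ac)
 have "(LL t. Z t)\<^sup>2 = (LL t. \<integral>s. Z t * Z s \<partial>lborel)"
  by (simp add: power2_eq_square)
 also have "... = (LL t. \<integral>s. Z t * Z s * gk 1 (t - s) + Z t * Z s * gk 1 (s - t) \<partial>lborel)"
 proof (rule Bochner_Integration.integral_cong[OF refl], rule integral_cong_AE)
  fix t
  have "AE s in lborel. s \<noteq> (t::real)" by (simp add: AE_lborel_singleton)
  then show "AE s in lborel. Z t * Z s = Z t * Z s * gk 1 (t - s) + Z t * Z s * gk 1 (s - t)"
   by eventually_elim (auto simp: g_kernel_1)
 qed auto
 also have "... = (\<integral>z. (%(t,s). Z t * Z s * gk 1 (t - s) + Z t * Z s * gk 1 (s - t)) z \<partial>(lborel \<Otimes>\<^sub>M lborel))"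
  using lborel_pair.integral_fst'[of "%(t,s). Z t * Z s * gk 1 (t - s) + Z t * Z s * gk 1 (s - t)"]
   Bochner_Integration.integrable_add[OF i1 i2] by (simp add: split_beta')
 also have "... = (\<integral>z. (%(t,s). Z t * Z s * gk 1 (t - s)) z \<partial>(lborel \<Otimes>\<^sub>M lborel)) + (\<integral>z. (%(t,s). Z t * Z s * gk 1 (s - t)) z \<partial>(lborel \<Otimes>\<^sub>M lborel))"
  using Bochner_Integration.integral_add[OF i1 i2] by (simp add: split_beta')
 also have "... = 2 * (LL t. Z t * conv (gk 1) Z t)"
  using lborel_pair.integral_fst'[OF i1] lborel_pair.integral_fst'[OF i2] a1 a2 by simp
 finally show ?thesis .
qed

text \<open>Here \<open>z = y'\<close>. Multiplying \<open>y' = F - g\<^sub>g\<^sub>a * y\<close> by \<open>y\<close> and integrating, the memory term has a sign, so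
\<open>y(t)\<^sup>2/2 \<le> \<integral> F y \<le> T D S\<close> with \<open>S\<close> the supremum of \<open>\<bar>y\<bar>\<close>; hence \<open>S\<^sup>2 \<le> 2 T D S\<close>.\<close>

lemma volterra_bound:
 assumes ga: "0 < ga" "ga < (1::real)" and T: "T > 0"
  and [measurable]: "z \<in> bor" "F \<in> bor"
  and z0: "\<And>t. t <= 0 ==> z t = 0" and zB: "\<And>t. t <= T ==> \<bar>z t\<bar> <= B"
  and FD: "\<And>t. 0 < t ==> t <= T ==> \<bar>F t\<bar> <= D"
  and y: "\<And>t. y t = conv (gk 1) z t"
  and eq: "\<And>t. 0 < t ==> t <= T ==> z t = F t - conv (gk ga) y t"
 shows "\<bar>y T\<bar> <= 2 * T * D"
proof -
 have yd: "y = conv (gk 1) z" using y by auto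
 have [measurable]: "y \<in> bor" unfolding yd by measurable
 have B0: "B >= 0" using zB[of 0] T z0[of 0] by simp
 have D0: "D >= 0" using FD[of T] T by (auto intro: order_trans[OF abs_ge_zero])
 have y0: "y t = 0" if "t <= 0" for t
 proof -
  have "gk 1 (t - s) * z s = 0" for s using that z0[of s] by (cases "s <= 0") (auto simp: g_kernel_1)
  then show ?thesis unfolding y conv_def by (simp only:) simp
 qed
 have yB: "\<bar>y t\<bar> <= B * T" if "t <= T" for t
 proof (cases "t > 0")
  case True
  have "\<bar>conv (gk 1) z t\<bar> <= B * gk (1 + 1) t"
   using zB z0 that B0 by (intro abs_conv_g_le) (auto simp: g_kernel_1)
  also have "gk (1 + 1) t = t" using True by (simp add: g_kernel_def Gamma_numeral)
  finally show ?thesis using that B0 mult_left_mono[OF that B0] by (simp add: y)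
 qed (use y0 B0 T in simp)
 define S where "S = (SUP t\<in>{..T}. \<bar>y t\<bar>)"
 have bdd: "bdd_above ((%t. \<bar>y t\<bar>) ` {..T})" using yB by (auto intro!: bdd_aboveI[of _ "B * T"])
 have yS: "\<bar>y t\<bar> <= S" if "t <= T" for t unfolding S_def using that bdd by (auto intro!: cSUP_upper)
 have S0: "S >= 0" using yS[of 0] T by (auto intro: order_trans[OF abs_ge_zero])
 have main: "(y T')\<^sup>2 <= 2 * (T * D * S)" if T': "T' <= T" "T' > 0" for T'
 proof -
  define I :: "real => real" where "I = ind {0<..<T'}"
  have [measurable]: "I \<in> bor" by (simp add: I_def)
  define Z where "Z t = I t * z t" for t
  define Y where "Y t = I t * y t" for t
  have [measurable]: "Z \<in> bor" "Y \<in> bor"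
   unfolding Z_def[abs_def] Y_def[abs_def] by measurable
  have Iint: "integrable lborel I" unfolding I_def using T' by simp
  have Zint: "integrable lborel Z"
   by (rule Bochner_Integration.integrable_bound[OF integrable_mult_right[OF Iint, of B]])
    (use T' zB B0 in \<open>auto simp: Z_def I_def indicator_def\<close>)
  have yT: "y T' = (LL t. Z t)"
   unfolding y conv_def Z_def I_def
   by (intro Bochner_Integration.integral_cong refl) (auto simp: g_kernel_1 indicator_def z0 not_less)
  have eqY: "conv (gk 1) Z t = y t" if "t \<in> {0<..<T'}" for t
   unfolding y using that z0 by (intro conv_causal_cong) (auto simp: g_kernel_1 Z_def I_def indicator_def not_less)
  have eqg: "conv (gk ga) y t = conv (gk ga) Y t" if "t \<in> {0<..<T'}" for t
   using that y0 by (intro conv_causal_cong) (auto simp: g_kernel_def Y_def I_def indicator_def not_less)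
  have pos: "0 <= (LL t. Y t * conv (gk ga) Y t)"
   by (rule fractional_kernel_positive[OF ga, where B = "B * T" and T = T'])
    (use yB T' T B0 in \<open>auto simp: Y_def I_def indicator_def\<close>)
  have iF: "integrable lborel (%t. Y t * F t)"
   by (rule Bochner_Integration.integrable_bound[OF integrable_mult_right[OF Iint, of "S * D"]])
    (use T' yS FD S0 D0 in \<open>auto simp: Y_def I_def indicator_def abs_mult intro!: mult_mono AE_I2\<close>)
  have iz: "integrable lborel (%t. Y t * z t)"
   by (rule Bochner_Integration.integrable_bound[OF integrable_mult_right[OF Iint, of "S * B"]])
    (use T' yS zB S0 B0 in \<open>auto simp: Y_def I_def indicator_def abs_mult intro!: mult_mono AE_I2\<close>)
  have pt: "Z t * conv (gk 1) Z t = Y t * z t" for t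
   using eqY[of t] by (cases "t \<in> {0<..<T'}") (auto simp: Z_def Y_def I_def)
  have pt2: "Y t * conv (gk ga) Y t = Y t * F t - Y t * z t" for t
  proof (cases "t \<in> {0<..<T'}")
   case True
   then have "conv (gk ga) Y t = F t - z t" using eqg[OF True] eq[of t] T' by simp
   then show ?thesis by (simp add: right_diff_distrib)
  qed (simp add: Y_def I_def)
  have "(y T')\<^sup>2 = 2 * (LL t. Y t * z t)"
   unfolding yT using double_integral_triangle[OF _ Zint] by (simp add: pt)
  also have "... <= 2 * (LL t. Y t * F t)"
   using pos iF iz by (simp add: pt2)
  also have "(LL t. Y t * F t) <= (LL t. (S * D) * I t)"
  proof (rule integral_mono[OF iF])
   show "integrable lborel (%t. (S * D) * I t)" using Iint by simp
   fix t
   have "\<bar>Y t * F t\<bar> <= S * D * I t"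
    using T' yS[of t] FD[of t] S0 D0 by (auto simp: Y_def I_def indicator_def abs_mult intro!: mult_mono)
   then show "Y t * F t <= S * D * I t" by linarith
  qed
  also have "... = S * D * T'" using T' by (simp add: I_def)
  also have "2 * (S * D * T') <= 2 * (T * D * S)"
   using T' S0 D0 mult_left_mono[of T' T "S * D"] by (simp add: mult_ac)
  finally show ?thesis by simp
 qed
 have "S <= sqrt (2 * (T * D * S))" unfolding S_def
 proof (rule cSUP_least)
  fix t assume t: "t \<in> {..T}"
  show "\<bar>y t\<bar> <= sqrt (2 * (T * D * (SUP t\<in>{..T}. \<bar>y t\<bar>)))"
  proof (cases "t > 0")
   case True
   then show ?thesis using real_sqrt_le_mono[OF main[of t]] t by (simp add: S_def)
  qed (use y0[of t] T D0 S0 in \<open>auto simp: S_def\<close>)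
 qed simp
 then have "S\<^sup>2 <= (sqrt (2 * (T * D * S)))\<^sup>2" using S0 by (intro power_mono)
 then have "S * S <= (2 * T * D) * S" using T D0 S0 by (simp add: power2_eq_square mult_ac)
 then have "S <= 2 * T * D" using S0 T D0 by (cases "S = 0") auto
 then show ?thesis using yS[of T] by simp
qed

section \<open>Laplace transforms\<close>

lemma nn_integral_g_kernel_exp:
 assumes a: "a > 0" and c: "c > (0::real)"
 shows "(NN t. ennreal (gk a t * exp (- (c * t)))) = ennreal (c powr (- a))"
proof -
 have G: "Gamma a > 0" using a by (simp add: Gamma_real_pos)
 have "(NN t. ennreal (gk a t * exp (- (c * t)))) =
  ennreal (1 / c) * (NN u. ennreal (gk a (u / c) * exp (- u)))"
  using c by (subst nn_integral_real_affine[where c = "1 / c" and t = 0]) auto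
 also have "(NN u. ennreal (gk a (u / c) * exp (- u))) =
  (NN u. ennreal (c powr (1 - a) / Gamma a) * ennreal (ind {0..} u * u powr (a - 1) / exp u))"
 proof (intro nn_integral_cong)
  fix u :: real
  have "gk a (u / c) * exp (- u) = c powr (1 - a) / Gamma a * (ind {0..} u * u powr (a - 1) / exp u)"
  proof (cases "u > 0")
   case True
   have "c powr (a - 1) * c powr (1 - a) = 1" using c by (simp add: powr_add[symmetric])
   then have "(u / c) powr (a - 1) = u powr (a - 1) * c powr (1 - a)"
    using True c by (simp add: powr_divide field_simps)
   then show ?thesis using True c by (simp add: g_kernel_def exp_minus field_simps)
  qed (use c in \<open>auto simp: g_kernel_def zero_less_divide_iff indicator_def\<close>)
  then show "ennreal (gk a (u / c) * exp (- u)) = ennreal (c powr (1 - a) / Gamma a) * ennreal (ind {0..} u * u powr (a - 1) / exp u)"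
   using G by (simp add: ennreal_mult[symmetric])
 qed
 also have "... = ennreal (c powr (1 - a) / Gamma a) * ennreal (Gamma a)"
  using a by (subst nn_integral_cmult) (auto simp: Gamma_conv_nn_integral_real)
 also have "ennreal (1 / c) * ... = ennreal (c powr (- a))"
  using G c powr_add[of c "-1" "1 - a"] by (simp add: ennreal_mult[symmetric] powr_minus_divide)
 finally show ?thesis .
qed

lemma integrable_g_kernel_exp:
 assumes a: "a > 0" and c: "c > (0::real)"
 shows "integrable lborel (%t. gk a t * exp (- (c * t)))"
 by (rule integrableI_bounded) (use nn_integral_g_kernel_exp[OF assms] a in \<open>auto simp: g_kernel_nonneg\<close>)

definition laplace :: "(real => real) => complex => complex" where
 "laplace f p = (LL t. cr (f t) * exp (- (p * cr t)))"

lemma laplace_integrable: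
 assumes [measurable]: "f \<in> bor" and i: "integrable lborel (%t. f t * exp (- (Re p * t)))"
 shows "integrable lborel (%t. cr (f t) * exp (- (p * cr t)))"
 by (rule Bochner_Integration.integrable_bound[OF integrable_norm[OF i]]) (auto simp: norm_mult)

text \<open>For real \<open>p\<close> this is Euler's integral. For complex \<open>p\<close> the exponential is expanded around a real point \<open>c\<close>
with \<open>\<bar>p - c\<bar> < c\<close>, which exists for each \<open>p\<close> in the right half plane, and both sides become the same
binomial series.\<close>

lemma laplace_g_kernel:
 assumes a: "a > 0" and p: "Re p > 0"
 shows "laplace (gk a) p = p powr (- of_real a)"
proof -
 \<comment> \<open>the disc of radius \<open>c\<close> around \<open>c\<close> contains \<open>p\<close> iff \<open>2 c Re p > (norm p)\<^sup>2\<close>\<close>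
 define c where "c = (norm p)\<^sup>2 / (2 * Re p) + Re p"
 define q where "q = cr c - p"
 have c0: "c > 0" using p by (simp add: c_def add_nonneg_pos)
 have p0: "p \<noteq> 0" using p by auto
 have "(norm q)\<^sup>2 = (norm p)\<^sup>2 - 2 * c * Re p + c\<^sup>2"
  unfolding cmod_power2 q_def by (simp add: power2_eq_square algebra_simps)
 also have "2 * c * Re p = (norm p)\<^sup>2 + 2 * (Re p)\<^sup>2" using p by (simp add: c_def field_simps power2_eq_square)
 also have "(norm p)\<^sup>2 - ((norm p)\<^sup>2 + 2 * (Re p)\<^sup>2) + c\<^sup>2 < c\<^sup>2" using p by simp
 finally have qc: "norm q < c" using c0 by (simp add: power_less_imp_less_base)
 let ?f = "%n t. cr (gk a t * exp (- (c * t))) * ((q * cr t) ^ n / fact n)"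
 have expq: "(%n. (q * cr t) ^ n / fact n) sums exp (q * cr t)" for t
  using exp_converges[of "q * cr t"] by (simp add: scaleR_conv_of_real field_simps)
 have sumf: "(\<Sum>n. ?f n t) = cr (gk a t) * exp (- (p * cr t))" for t
 proof -
  have "(\<Sum>n. ?f n t) = cr (gk a t * exp (- (c * t))) * exp (q * cr t)"
   using sums_mult[OF expq] by (rule sums_unique[symmetric])
  also have "... = cr (gk a t) * (exp (cr (- (c * t))) * exp (q * cr t))"
   by (simp add: exp_of_real[symmetric] mult_ac)
  also have "exp (cr (- (c * t))) * exp (q * cr t) = exp (- (p * cr t))"
   by (simp add: q_def exp_add[symmetric] algebra_simps)
  finally show ?thesis .
 qed
 have nt: "norm (?f n t) = gk a t * exp (- (c * t)) * ((norm q * t) ^ n / fact n)" for n t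
  using a g_kernel_nonneg[OF a, of t]
  by (cases "t > 0") (auto simp: norm_mult norm_divide norm_power g_kernel_def power_mult_distrib)
 have trm: "gk a t * exp (- (c * t)) * t ^ n = Gamma (a + n) / Gamma a * (gk (a + real n) t * exp (- (c * t)))" for n t
 proof (cases "t > 0")
  case True
  have "Gamma (a + real n) > 0" using a by (simp add: Gamma_real_pos)
  then show ?thesis using True powr_add[of t "a - 1" "real n"]
   by (simp add: g_kernel_def powr_realpow algebra_simps)
 qed (simp add: g_kernel_def)
 define K where "K n = cr (Gamma (a + real n) / Gamma a) * (q ^ n / fact n)" for n
 have fK: "?f n t = K n * cr (gk (a + real n) t * exp (- (c * t)))" for n t
 proof -
  have "?f n t = cr (gk a t * exp (- (c * t)) * t ^ n) * (q ^ n / fact n)"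
   by (simp add: power_mult_distrib)
  also have "... = K n * cr (gk (a + real n) t * exp (- (c * t)))"
   unfolding trm K_def by (simp only: of_real_mult) (simp only: mult_ac)
  finally show ?thesis .
 qed
 have intg: "integrable lborel (%t. gk (a + real n) t * exp (- (c * t)))" for n
  using integrable_g_kernel_exp[of "a + real n" c] a c0 by simp
 have int: "integrable lborel (?f n)" for n
  unfolding fK by (intro integrable_mult_right integrable_of_real intg)
 have intval: "(LL t. ?f n t) = cr (c powr (- a)) * ((- of_real a gchoose n) * (- q / of_real c) ^ n)" for n
 proof -
  have "(LL t. gk (a + real n) t * exp (- (c * t))) = c powr (- (a + real n))"
   using nn_integral_eq_integrable[of "%t. gk (a + real n) t * exp (- (c * t))" lborel "c powr (- (a + real n))"]
    nn_integral_g_kernel_exp[of "a + real n" c] a c0 by (auto simp: g_kernel_nonneg)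
  then have "(LL t. ?f n t) = K n * cr (c powr (- (a + real n)))"
   unfolding fK by (simp only: integral_mult_right_zero integral_complex_of_real)
  also have "c powr (- (a + real n)) = c powr (- a) / c ^ n"
   using c0 powr_diff[of c "- a" "real n"] by (simp add: powr_realpow)
  also have "K n = (- of_real a gchoose n) * (- q) ^ n"
  proof -
   have "Gamma (a + real n) / Gamma a = pochhammer a n"
    using pochhammer_Gamma[of a n] a nonpos_Ints_nonpos[of a] by fastforce
   moreover have "(-1) ^ n * ((-1) ^ n * x) = (x :: complex)" for x
    by (metis (no_types) left_minus_one_mult_self mult.left_commute mult.commute)
   ultimately show ?thesis
    by (simp add: K_def gbinomial_pochhammer pochhammer_of_real power_minus[of q n])
  qed
  also have "(- of_real a gchoose n) * (- q) ^ n * cr (c powr (- a) / c ^ n) =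
   cr (c powr (- a)) * ((- of_real a gchoose n) * (- q / of_real c) ^ n)"
   unfolding power_divide by simp
  finally show ?thesis .
 qed
 have "laplace (gk a) p = (LL t. (\<Sum>n. ?f n t))" unfolding laplace_def sumf ..
 also have "... = (\<Sum>n. LL t. ?f n t)"
 proof (rule integral_suminf[OF int])
  show "AE t in lborel. summable (%n. norm (?f n t))"
  proof (rule AE_I2)
   fix t
   have "summable (%n. gk a t * exp (- (c * t)) * ((norm q * t) ^ n / fact n))"
    using summable_exp_generic[of "norm q * t"] by (intro summable_mult) (simp add: field_simps)
   then show "summable (%n. norm (?f n t))" by (simp only: nt)
  qed
  have "(\<Sum>n. ennreal (LL t. norm (?f n t))) = (\<Sum>n. NN t. ennreal (norm (?f n t)))"
   by (intro suminf_cong nn_integral_eq_integral[symmetric] integrable_norm int) auto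
  also have "... = (NN t. (\<Sum>n. ennreal (norm (?f n t))))"
   by (rule nn_integral_suminf[symmetric]) auto
  also have "... <= (NN t. ennreal (gk a t * exp (- ((c - norm q) * t))))"
  proof (intro nn_integral_mono)
   fix t :: real
   have "(%n. gk a t * exp (- (c * t)) * ((norm q * t) ^ n / fact n)) sums (gk a t * exp (- (c * t)) * exp (norm q * t))"
    using exp_converges[of "norm q * t"] by (intro sums_mult) (simp add: field_simps)
   then have "(%n. norm (?f n t)) sums (gk a t * exp (- (c * t)) * exp (norm q * t))" by (simp only: nt)
   then have "(\<Sum>n. ennreal (norm (?f n t))) = ennreal (gk a t * exp (- (c * t)) * exp (norm q * t))"
    by (subst suminf_ennreal2) (auto simp: sums_iff)
   also have "gk a t * exp (- (c * t)) * exp (norm q * t) = gk a t * exp (- ((c - norm q) * t))"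
    by (simp add: mult.assoc exp_add[symmetric] algebra_simps)
   finally show "(\<Sum>n. ennreal (norm (?f n t))) <= ennreal (gk a t * exp (- ((c - norm q) * t)))" by simp
  qed
  also have "... < \<infinity>" using nn_integral_g_kernel_exp[of a "c - norm q"] a qc by simp
  finally show "summable (%n. LL t. norm (?f n t))"
   by (intro summable_suminf_not_top) (auto simp: integral_nonneg_AE)
 qed
 also have "... = cr (c powr (- a)) * (1 + (- q / of_real c)) powr (- of_real a)"
 proof -
  have "norm (- q / cr c) < 1" using qc c0 by (simp add: norm_divide)
  from sums_mult[OF gen_binomial_complex[OF this, of "- of_real a"], of "cr (c powr (- a))"]
  show ?thesis unfolding intval by (rule sums_unique[symmetric])
 qed
 also have "1 + (- q / of_real c) = p / of_real c" using c0 by (simp add: q_def field_simps)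
 also have "cr (c powr (- a)) * (p / of_real c) powr (- of_real a) = p powr (- of_real a)"
 proof -
  have pc: "p / of_real c \<noteq> 0" using p0 c0 by simp
  have "Ln p = Ln (cr c * (p / of_real c))" using c0 by simp
  also have "... = of_real (ln c) + Ln (p / of_real c)" using Ln_times_of_real[OF c0 pc] c0 by (simp add: Ln_of_real)
  finally have "p powr (- of_real a) = exp (of_real (- a * ln c)) * exp (- of_real a * Ln (p / of_real c))"
   using p0 by (simp add: powr_def exp_add[symmetric] algebra_simps)
  then show ?thesis using p0 c0 by (simp add: powr_def exp_of_real[symmetric])
 qed
 finally show ?thesis .
qed

lemma laplace_conv_g_kernel:
 assumes a: "a > 0" and p: "Re p > 0" and [measurable]: "f \<in> bor"
  and i: "integrable lborel (%t. f t * exp (- (Re p * t)))"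
 shows "laplace (conv (gk a) f) p = p powr (- of_real a) * laplace f p"
  and "integrable lborel (%t. conv (gk a) f t * exp (- (Re p * t)))"
proof -
 let ?E = "%t. exp (- (p * cr t))"
 let ?F = "%s t. cr (gk a (t - s)) * ?E (t - s) * (cr (f s) * ?E s)"
 have Eadd: "?E (t - s) * ?E s = ?E t" for s t by (simp add: exp_add[symmetric] algebra_simps)
 have ig: "integrable lborel (%t. cr (gk a t) * ?E t)"
  using integrable_g_kernel_exp[OF a p] by (intro laplace_integrable) auto
 have if': "integrable lborel (%t. cr (f t) * ?E t)"
  using i by (intro laplace_integrable) auto
 have igs: "integrable lborel (%t. cr (gk a (t - s)) * ?E (t - s))" for s
  using lborel_integrable_real_affine[OF ig, of 1 "-s"] by (simp add: add.commute)
 have int: "integrable (lborel \<Otimes>\<^sub>M lborel) (%(s, t). ?F s t)"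
 proof (rule lborel_pair.Fubini_integrable)
  have "(LBINT t. norm (?F s t)) = (LBINT t. norm (cr (gk a t) * ?E t)) * norm (cr (f s) * ?E s)" for s
   using integral_lborel_shift[of "%t. norm (cr (gk a t) * ?E t)" s] by (simp add: norm_mult)
  then show "integrable lborel (%x. LBINT y. norm ((%(s, t). ?F s t) (x, y)))"
   using if' by simp
  show "AE x in lborel. integrable lborel (%y. (%(s, t). ?F s t) (x, y))"
   using integrable_mult_left[OF igs] by (intro AE_I2) (simp only: prod.case)
 qed (simp add: split_beta')
 have inner: "(LL s. ?F s t) = cr (conv (gk a) f t) * ?E t" for t
 proof -
  have "(LL s. ?F s t) = (LL s. cr (gk a (t - s) * f s) * ?E t)"
  proof (rule Bochner_Integration.integral_cong[OF refl])
   fix s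
   have "?F s t = cr (gk a (t - s) * f s) * (?E (t - s) * ?E s)" by (simp only: of_real_mult mult_ac)
   then show "?F s t = cr (gk a (t - s) * f s) * ?E t" by (simp only: Eadd)
  qed
  then show ?thesis unfolding conv_def by (simp only: integral_mult_left_zero integral_complex_of_real)
 qed
 have inner2: "(LL t. ?F s t) = laplace (gk a) p * (cr (f s) * ?E s)" for s
  using integral_lborel_shift[of "%t. cr (gk a t) * ?E t" s]
  unfolding laplace_def by (simp only: integral_mult_left_zero)
 have "laplace (conv (gk a) f) p = (LL t. \<integral>s. ?F s t \<partial>lborel)"
  unfolding laplace_def inner ..
 also have "... = (LL s. \<integral>t. ?F s t \<partial>lborel)"
  by (rule lborel_pair.Fubini_integral[OF int])
 also have "... = laplace (gk a) p * laplace f p"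
  unfolding inner2 by (simp only: integral_mult_right_zero laplace_def[of f])
 finally show "laplace (conv (gk a) f) p = p powr (- of_real a) * laplace f p"
  by (simp add: laplace_g_kernel[OF a p])
 have "integrable lborel (%t. cr (conv (gk a) f t) * ?E t)"
  using lborel_pair.integrable_snd[OF int] by (simp only: inner)
 from integrable_norm[OF this] show "integrable lborel (%t. conv (gk a) f t * exp (- (Re p * t)))"
  by (rule Bochner_Integration.integrable_bound) (auto simp: norm_mult abs_mult)
qed

section \<open>A symbol estimate and Fourier inversion\<close>

text \<open>For \<open>Re p > 0\<close> the argument of \<open>p powr (-al)\<close> stays within \<open>\<plusminus> pi al / 2\<close>, away from \<open>\<plusminus> pi\<close> since \<open>al < 2\<close>.
Thus \<open>p powr (-al)\<close> cannot cancel \<open>1\<close>.\<close>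

lemma sector_lower_bound:
 assumes al: "0 < al" "al < 2"
 shows "\<exists>ka>0. \<forall>p. Re p > 0 --> ka * (1 + norm p powr (- al)) <= norm (1 + p powr (- cr al))"
proof -
 define C where "C = cos (pi * al / 2)"
 have C: "-1 < C"
 proof -
  have "cos pi < cos (pi * al / 2)" using al by (intro cos_monotone_0_pi) (auto simp: field_simps)
  then show ?thesis by (simp add: C_def)
 qed
 define ka where "ka = sqrt ((1 + C) / 2)"
 have C1: "C <= 1" by (simp add: C_def)
 have "ka * (1 + norm p powr (- al)) <= norm (1 + p powr (- cr al))" if p: "Re p > 0" for p
 proof -
  define r where "r = norm p powr (- al)"
  define psi where "psi = al * Im (Ln p)"
  have p0: "p \<noteq> 0" using p by auto
  have "\<bar>Im (Ln p)\<bar> < pi / 2" using Re_Ln_pos_lt[OF p0] p by simp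
  then have psi: "\<bar>psi\<bar> <= pi * al / 2" using al mult_left_mono[of "\<bar>Im (Ln p)\<bar>" "pi/2" al] by (simp add: psi_def abs_mult mult_ac)
  have r: "r > 0" using p0 by (simp add: r_def)
  have Lnp: "Ln p = cr (ln (norm p)) + \<i> * cr (Im (Ln p))"
   using p0 complex_eq[of "Ln p"] by simp
  have "p powr (- cr al) = exp (- cr al * Ln p)"
   using p0 by (simp add: powr_def)
  also have "- cr al * Ln p = cr (- al * ln (norm p)) + \<i> * cr (- psi)"
   by (subst Lnp) (simp add: psi_def algebra_simps)
  also have "exp ... = cr (exp (- al * ln (norm p))) * cis (- psi)"
   by (simp only: exp_add cis_conv_exp exp_of_real)
  also have "exp (- al * ln (norm p)) = r" using p0 by (simp add: r_def powr_def)
  finally have pw: "p powr (- cr al) = cr r * cis (- psi)" .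
  have "cos (pi * al / 2) <= cos \<bar>psi\<bar>" using psi al by (intro cos_monotone_0_pi_le) (auto simp: field_simps)
  then have cpsi: "C <= cos psi" by (simp add: C_def)
  have "(norm (1 + p powr (- cr al)))\<^sup>2 = (1 + r * cos psi)\<^sup>2 + (r * sin psi)\<^sup>2"
   unfolding cmod_power2 pw by simp
  also have "... = 1 + 2 * r * cos psi + r\<^sup>2 * ((sin psi)\<^sup>2 + (cos psi)\<^sup>2)"
   by algebra
  also have "... = 1 + 2 * r * cos psi + r\<^sup>2" by simp
  also have "... >= 1 + 2 * r * C + r\<^sup>2" using cpsi r by (simp add: mult_left_mono)
  also have "1 + 2 * r * C + r\<^sup>2 = (1 + C) / 2 * (1 + r)\<^sup>2 + (1 - C) / 2 * (1 - r)\<^sup>2"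
   by (simp add: power2_eq_square field_simps)
  also have "... >= (1 + C) / 2 * (1 + r)\<^sup>2" using C1 by simp
  also have "(1 + C) / 2 * (1 + r)\<^sup>2 = (ka * (1 + r))\<^sup>2" using C by (simp add: ka_def power_mult_distrib)
  finally show ?thesis unfolding r_def[symmetric] by (rule power2_le_imp_le) simp
 qed
 moreover have "ka > 0" using C by (simp add: ka_def)
 ultimately show ?thesis by blast
qed

text \<open>An inequality in place of the inversion formula: the convolution of \<open>h\<close> with a narrow Gaussian
is the Fourier integral of the transform of \<open>h\<close> times a Gaussian, hence at most \<open>\<integral> H\<close>, and it tends to \<open>h t\<close> by
continuity.\<close>

lemma fourier_sup_bound:
 fixes h :: "real => real" and H :: "real => real"
 assumes [measurable]: "h \<in> bor" and ih: "integrable lborel h"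
  and B: "\<And>s. \<bar>h s\<bar> <= B" and cont: "isCont h t" and iH: "integrable lborel H"
  and hH: "\<And>y. y \<noteq> 0 ==> norm (LL s. cr (h s) * exp (- (\<i> * cr y * cr s))) <= H y"
 shows "\<bar>h t\<bar> <= (LL y. H y)"
proof -
 let ?n = std_normal_density
 have n_int: "integrable lborel ?n" and n1: "(LL x. ?n x) = 1"
  using integrable_normal_density[of 1 0] integral_normal_density[of 1 0] by auto
 define ka where "ka = 1 / sqrt (2 * pi)"
 have ka: "0 < ka" "ka <= 1" using pi_ge_two by (auto simp: ka_def real_le_rsqrt)
 have n_le: "?n x <= 1" "?n x >= 0" for x
 proof -
  have "?n x = ka * exp (- x\<^sup>2 / 2)" by (simp add: std_normal_density_def ka_def)
  also have "... <= 1 * 1" using ka by (intro mult_mono) auto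
  finally show "?n x <= 1" by simp
 qed simp
 have n_char: "cr (?n sg) = cr ka * (LL y. cr (?n y) * exp (\<i> * cr (sg * y)))" for sg
 proof -
  have "cr (exp (- (sg\<^sup>2) / 2)) = char std_normal_distribution sg" by (simp add: char_std_normal_distribution)
  also have "... = (LL y. ?n y *\<^sub>R exp (\<i> * cr (sg * y)))"
   unfolding char_def by (subst integral_density) auto
  finally have "cr (exp (- (sg\<^sup>2) / 2)) = (LL y. cr (?n y) * exp (\<i> * cr (sg * y)))"
   by (simp add: scaleR_conv_of_real)
  moreover have "?n sg = ka * exp (- sg\<^sup>2 / 2)" by (simp add: std_normal_density_def ka_def)
  ultimately show ?thesis by (simp only: of_real_mult)
 qed
 define J where "J ep = (LL sg. h (t - ep * sg) * ?n sg)" for ep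
 have J_le: "\<bar>J ep\<bar> <= (LL y. H y)" if ep: "ep > 0" for ep
 proof -
  have ihe: "integrable lborel (%sg. h (t - ep * sg))"
   using lborel_integrable_real_affine[OF ih, of "-ep" t] ep by simp
  let ?F = "%y sg. cr (?n y) * (cr (h (t - ep * sg)) * exp (\<i> * cr (sg * y)))"
  have iF: "integrable (lborel \<Otimes>\<^sub>M lborel) (%(y, sg). ?F y sg)"
  proof (rule lborel_pair.Fubini_integrable)
   have "(LBINT sg. norm (?F y sg)) = ?n y * (LBINT sg. \<bar>h (t - ep * sg)\<bar>)" for y
    by (simp add: norm_mult)
   then show "integrable lborel (%x. LBINT y. norm ((%(y, sg). ?F y sg) (x, y)))"
    using n_int by simp
   have "integrable lborel (%sg. ?F y sg)" for y
    by (rule Bochner_Integration.integrable_bound[OF integrable_mult_right[OF ihe, of "?n y"]]) (auto simp: norm_mult abs_mult)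
   then show "AE x in lborel. integrable lborel (%y. (%(y, sg). ?F y sg) (x, y))" by simp
  qed (simp add: split_beta')
  have "cr (J ep) = (LL sg. cr (h (t - ep * sg)) * cr (?n sg))"
   unfolding J_def of_real_mult[symmetric] by (simp only: integral_complex_of_real)
  also have "... = (LL sg. \<integral>y. cr ka * ?F y sg \<partial>lborel)"
  proof (rule Bochner_Integration.integral_cong[OF refl])
   fix sg
   have "(LL y. cr ka * ?F y sg) = (LL y. cr ka * cr (h (t - ep * sg)) *
     (cr (?n y) * exp (\<i> * cr (sg * y))))"
    by (simp only: mult_ac)
   also have "... = cr ka * cr (h (t - ep * sg)) *
     (LL y. cr (?n y) * exp (\<i> * cr (sg * y)))"
    by (rule integral_mult_right_zero)
   also have "... = cr (h (t - ep * sg)) * (cr ka *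
     (LL y. cr (?n y) * exp (\<i> * cr (sg * y))))"
    by (simp only: mult_ac)
   also have "... = cr (h (t - ep * sg)) * cr (?n sg)"
    by (simp only: n_char[of sg])
   finally show "cr (h (t - ep * sg)) * cr (?n sg) = (LL y. cr ka * ?F y sg)" ..
  qed
  also have "... = cr ka * (LL sg. \<integral>y. ?F y sg \<partial>lborel)"
   by (simp only: integral_mult_right_zero)
  also have "(LL sg. \<integral>y. ?F y sg \<partial>lborel) = (LL y. \<integral>sg. ?F y sg \<partial>lborel)"
   by (rule lborel_pair.Fubini_integral[OF iF])
  finally have "\<bar>J ep\<bar> = ka * norm (LL y. \<integral>sg. ?F y sg \<partial>lborel)"
  proof -
   assume "cr (J ep) = cr ka * (LL y. \<integral>sg. ?F y sg \<partial>lborel)"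
   then have "norm (cr (J ep)) = norm (cr ka) * norm (LL y. \<integral>sg. ?F y sg \<partial>lborel)"
    by (simp only: norm_mult)
   then show ?thesis using ka by (simp only: norm_of_real abs_of_pos)
  qed
  also have "... <= 1 * norm (LL y. \<integral>sg. ?F y sg \<partial>lborel)" using ka by (intro mult_right_mono) auto
  also have "... <= (LL y. H (y / ep) / ep)"
  proof -
   have iHe: "integrable lborel (%y. H (y / ep) / ep)"
    using lborel_integrable_real_affine[OF iH, of "1/ep" 0] ep by simp
   have nb: "norm (LL sg. ?F y sg) <= H (y / ep) / ep" if y: "y \<noteq> 0" for y
   proof -
    have "(LL sg. cr (h (t - ep * sg)) * exp (\<i> * cr (sg * y)))
     = (1 / ep) *\<^sub>R (LL s. cr (h s) * exp (\<i> * cr ((t - s) / ep * y)))"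
    proof -
     have "(LL s. cr (h s) * exp (\<i> * cr ((t - s) / ep * y))) =
      \<bar>- ep\<bar> *\<^sub>R (LL sg. cr (h (t + (- ep) * sg)) * exp (\<i> * cr ((t - (t + (- ep) * sg)) / ep * y)))"
      using ep by (intro lborel_integral_real_affine) auto
     then show ?thesis using ep by simp
    qed
    also have "(LL s. cr (h s) * exp (\<i> * cr ((t - s) / ep * y))) =
     exp (\<i> * cr (t * y / ep)) * (LL s. cr (h s) * exp (- (\<i> * cr (y / ep) * cr s)))"
    proof -
     have "cr (h s) * exp (\<i> * cr ((t - s) / ep * y)) =
      exp (\<i> * cr (t * y / ep)) * (cr (h s) * exp (- (\<i> * cr (y / ep) * cr s)))" for s
     proof -
      have "\<i> * cr ((t - s) / ep * y) = \<i> * cr (t * y / ep) + (- (\<i> * cr (y / ep) * cr s))"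
       using ep by (simp add: field_simps)
      then show ?thesis by (simp only: exp_add mult_ac)
     qed
     then show ?thesis by (simp only: integral_mult_right_zero)
    qed
    finally have "norm (LL sg. cr (h (t - ep * sg)) * exp (\<i> * cr (sg * y))) <= H (y / ep) / ep"
     using hH[of "y / ep"] ep y by (simp add: norm_mult divide_right_mono)
    moreover have "norm (LL sg. ?F y sg) = ?n y * norm (LL sg. cr (h (t - ep * sg)) * exp (\<i> * cr (sg * y)))"
     unfolding integral_mult_right_zero norm_mult by simp
    ultimately show ?thesis using mult_left_le_one_le[OF norm_ge_zero[of "\<integral>sg. cr (h (t - ep * sg)) * exp (\<i> * cr (sg * y)) \<partial>lborel"] n_le(2)[of y] n_le(1)[of y]] by linarith
   qed
   have "norm (LL y. \<integral>sg. ?F y sg \<partial>lborel) <= (LL y. norm (LL sg. ?F y sg))"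
    by (rule integral_norm_bound)
   also have "... <= (LL y. H (y / ep) / ep)"
   proof (rule integral_mono_AE)
    show "AE y in lborel. norm (LL sg. ?F y sg) <= H (y / ep) / ep"
     using AE_lborel_singleton[of 0] by eventually_elim (rule nb)
    show "integrable lborel (%y. norm (LL sg. ?F y sg))"
     using lborel_pair.integrable_fst'[OF iF] by (intro integrable_norm) simp
   qed (rule iHe)
   finally show ?thesis by simp
  qed
  also have "(LL y. H (y / ep) / ep) = (LL y. H y)"
   using lborel_integral_real_affine[of "1/ep" H 0] ep by simp
  finally show ?thesis .
 qed
 have "(%k. J (1 / real (Suc k))) \<longlonglongrightarrow> (LL sg. h t * ?n sg)"
  unfolding J_def
 proof (rule integral_dominated_convergence[where w = "%sg. B * ?n sg"])
  show "integrable lborel (%sg. B * ?n sg)" using n_int by simp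
  show "AE sg in lborel. (%k. h (t - 1 / real (Suc k) * sg) * ?n sg) \<longlonglongrightarrow> h t * ?n sg"
  proof (rule AE_I2)
   fix sg :: real
   have "(%k. t - 1 / real (Suc k) * sg) \<longlonglongrightarrow> t - 0 * sg"
    by (intro tendsto_intros LIMSEQ_Suc lim_inverse_n')
   then have "(%k. h (t - 1 / real (Suc k) * sg)) \<longlonglongrightarrow> h t"
    by (intro isCont_tendsto_compose[OF cont]) simp
   then show "(%k. h (t - 1 / real (Suc k) * sg) * ?n sg) \<longlonglongrightarrow> h t * ?n sg" by (rule tendsto_mult_right)
  qed
  show "AE sg in lborel. norm (h (t - 1 / real (Suc k) * sg) * ?n sg) <= B * ?n sg" for k
   using B n_le by (intro AE_I2) (simp add: abs_mult mult_right_mono)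
 qed auto
 then have "(%k. J (1 / real (Suc k))) \<longlonglongrightarrow> h t" using n1 by simp
 then have "(%k. \<bar>J (1 / real (Suc k))\<bar>) \<longlonglongrightarrow> \<bar>h t\<bar>" by (rule tendsto_rabs)
 then show ?thesis by (rule LIMSEQ_le_const2) (use J_le in auto)
qed

section \<open>Bounds for Mittag-Leffler functions\<close>

text \<open>On \<open>{0<..}\<close> this is \<open>(t d/dt)\<^sup>j (t E\<^sub>\<alpha>\<^sub>,\<^sub>2(-t\<^sup>\<alpha>))\<close>. All of these functions turn out to be bounded, and
combinations of the first four are \<open>t\<close> or \<open>t powr (1 + al)\<close> times the Mittag-Leffler functions that occur
below, which therefore decay.\<close>

definition moment :: "real => nat => real => real" where
 "moment al j = ser (%n. (-1) ^ n * (al * real n + 1) ^ j) al 2"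

lemma ser_sum:
 assumes a: "a > 0" and c: "\<And>i. i \<in> I ==> geo_bounded (c i)" and I: "finite I"
 shows "ser (%n. \<Sum>i\<in>I. K i * c i n) a b t = (\<Sum>i\<in>I. K i * ser (c i) a b t)"
proof -
 have s: "summable (%n. c i n * gk (a * real n + b) t)" if "i \<in> I" for i
  using ser_summable[OF a c[OF that]] by (rule summable_rabs_cancel)
 have "(\<Sum>i\<in>I. K i * ser (c i) a b t) = (\<Sum>i\<in>I. \<Sum>n. K i * (c i n * gk (a * real n + b) t))"
  unfolding ser_def by (intro sum.cong refl suminf_mult[symmetric] s)
 also have "... = (\<Sum>n. \<Sum>i\<in>I. K i * (c i n * gk (a * real n + b) t))"
  by (rule suminf_sum[symmetric]) (intro summable_mult s)
 finally show ?thesis by (simp add: ser_def sum_distrib_right mult.assoc)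
qed

text \<open>The factor \<open>al n + 1\<close> becomes \<open>(al n + 1) + al\<close> under the index shift; the binomial theorem then expresses
the shifted series by moments of order at most \<open>j\<close>, with coefficient \<open>1\<close> in front of the highest one.\<close>

lemma moment_series_rec:
 assumes al: "al > 0"
 shows "ser (%n. (-1) ^ n * (al * real n + 1) ^ j) al b t =
  gk b t - (\<Sum>i\<le>j. real (j choose i) * al ^ (j - i) * ser (%n. (-1) ^ n * (al * real n + 1) ^ i) al (b + al) t)"
proof -
 have "(-1) ^ Suc n * (al * real (Suc n) + 1) ^ j =
  (\<Sum>i\<le>j. - (real (j choose i) * al ^ (j - i)) * ((-1) ^ n * (al * real n + 1) ^ i))" for n
 proof -
  have "(al * real (Suc n) + 1) ^ j = ((al * real n + 1) + al) ^ j" by (simp add: algebra_simps)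
  also have "... = (\<Sum>i\<le>j. real (j choose i) * (al * real n + 1) ^ i * al ^ (j - i))" by (rule binomial_ring)
  finally show ?thesis by (simp add: sum_distrib_left sum_negf mult_ac)
 qed
 then show ?thesis
  using ser_shift[OF al geo_bounded_poly[OF al], of j b t]
   ser_sum[OF al geo_bounded_poly[OF al], of "{..j}" "%i. - (real (j choose i) * al ^ (j - i))" "%i. i" "b + al" t]
  by (simp add: sum_negf)
qed

lemma aconv_finite_if_bounded:
 assumes "a > 0" "b > 0" and [measurable]: "f \<in> bor" and "\<And>s. \<bar>f s\<bar> <= K * gk b s"
 shows "aconv (gk a) f t < \<infinity>"
proof -
 have "aconv (gk a) f t <= (NN s. ennreal \<bar>K\<bar> * ennreal \<bar>gk a (t - s) * gk b s\<bar>)"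
  unfolding aconv_def
 proof (intro nn_integral_mono)
  fix s
  have "\<bar>f s\<bar> <= \<bar>K\<bar> * \<bar>gk b s\<bar>"
   using assms(4)[of s] abs_ge_self[of "K * gk b s"] unfolding abs_mult by linarith
  then show "ennreal \<bar>gk a (t - s) * f s\<bar> <= ennreal \<bar>K\<bar> * ennreal \<bar>gk a (t - s) * gk b s\<bar>"
   using mult_left_mono[of "\<bar>f s\<bar>" "\<bar>K\<bar> * \<bar>gk b s\<bar>" "\<bar>gk a (t - s)\<bar>"]
   by (simp add: ennreal_mult[symmetric] abs_mult mult_ac)
 qed
 also have "... = ennreal \<bar>K\<bar> * aconv (gk a) (gk b) t"
  unfolding aconv_def by (rule nn_integral_cmult) simp
 also have "... < \<infinity>" using assms(1,2) by (simp add: aconv_g_kernel ennreal_mult_less_top)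
 finally show ?thesis .
qed

lemma volterra_kernel_integrable:
 assumes "1 < al" "al < 2"
 shows "integrable lborel (%y::real. 1 / (\<bar>y\<bar>\<^sup>2 + \<bar>y\<bar> powr (2 - al)))"
proof (rule integrableI_bounded)
 let ?f = "%y::real. ind {0..1} y * y powr (al - 2)"
 let ?g = "%y::real. ind {1..} y * y powr (- 2)"
 have "(NN y. ennreal (norm (1 / (\<bar>y\<bar>\<^sup>2 + \<bar>y\<bar> powr (2 - al))))) \<le>
  (NN y. (ennreal (?f y) + ennreal (?g y)) + (ennreal (?f (0 - y)) + ennreal (?g (0 - y))))"
 proof (intro nn_integral_mono)
  fix y :: real
  have key: "1 / (z\<^sup>2 + z powr (2 - al)) <= ?f z + ?g z" if "z > 0" for z
  proof (cases "z <= 1")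
   case True
   have "1 / (z\<^sup>2 + z powr (2 - al)) <= 1 / z powr (2 - al)" using that by (intro divide_left_mono) (auto simp: add_pos_pos)
   also have "... = z powr (al - 2)" using that powr_minus_divide[of z "2 - al"] by simp
   finally show ?thesis using True that by (auto simp: indicator_def add_increasing2)
  next
   case False
   have "1 / (z\<^sup>2 + z powr (2 - al)) <= 1 / z\<^sup>2" using that by (intro divide_left_mono) (auto simp: add_pos_pos)
   also have "... = z powr (- 2)" using that by (simp add: powr_minus_divide powr_numeral)
   finally show ?thesis using False that by (auto simp: indicator_def add_increasing)
  qed
  have nn: "?f z >= 0" "?g z >= 0" for z by (auto simp: indicator_def)
  have "norm (1 / (\<bar>y\<bar>\<^sup>2 + \<bar>y\<bar> powr (2 - al))) <= (?f y + ?g y) + (?f (0 - y) + ?g (0 - y))"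
  proof (cases "y = 0")
   case True then show ?thesis by (auto simp: indicator_def)
  next
   case False
   have "1 / (\<bar>y\<bar>\<^sup>2 + \<bar>y\<bar> powr (2 - al)) >= 0" by simp
   then have "norm (1 / (\<bar>y\<bar>\<^sup>2 + \<bar>y\<bar> powr (2 - al))) = 1 / (\<bar>y\<bar>\<^sup>2 + \<bar>y\<bar> powr (2 - al))"
    by (simp only: real_norm_def abs_of_nonneg)
   also have "... <= (?f y + ?g y) + (?f (0 - y) + ?g (0 - y))" using key[of "\<bar>y\<bar>"] nn[of y] nn[of "0 - y"] False by (cases "y > 0") (auto simp: abs_if)
   finally show ?thesis .
  qed
  then show "ennreal (norm (1 / (\<bar>y\<bar>\<^sup>2 + \<bar>y\<bar> powr (2 - al)))) <= (ennreal (?f y) + ennreal (?g y)) + (ennreal (?f (0 - y)) + ennreal (?g (0 - y)))"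
   using nn[of y] nn[of "0 - y"] by (simp only: ennreal_plus[symmetric] add_nonneg_nonneg) (rule ennreal_leI)
 qed
 also have "... = ((NN y. ennreal (?f y)) + (NN y. ennreal (?g y))) + ((NN y. ennreal (?f (0 - y))) + (NN y. ennreal (?g (0 - y))))"
  by (simp add: nn_integral_add)
 also have "... < \<infinity>"
  using assms nn_integral_lborel_reflect[of "%y. ennreal (?f y)" 0] nn_integral_lborel_reflect[of "%y. ennreal (?g y)" 0]
   nn_integral_powr_from_0[of "al - 2" 1] nn_integral_powr_to_inf[of "-2" 1] by simp
 finally show "(NN y. ennreal (norm (1 / (\<bar>y\<bar>\<^sup>2 + \<bar>y\<bar> powr (2 - al))))) < \<infinity>" .
qed auto

text \<open>By induction on \<open>j\<close>. The recursion is a Volterra equation for the highest moment with lower moments as data,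
so \<open>volterra_bound\<close> gives polynomial growth and the Laplace transform exists for \<open>Re p > 0\<close>. There the
recursion becomes algebraic, and \<open>sector_lower_bound\<close> bounds the transform by a multiple of
\<open>1 / (\<bar>p\<bar>\<^sup>2 + \<bar>p\<bar> powr (2 - al))\<close>, which is integrable on vertical lines uniformly in \<open>Re p\<close>.\<close>

lemma moment_bounded:
 assumes al: "1 < al" "al < 2"
 shows "\<exists>K\<ge>0. \<forall>t. \<bar>moment al j t\<bar> <= K * gk 1 t"
proof -
 define Hc where "Hc x = 1 / (x\<^sup>2 + x powr (2 - al))" for x :: real
 have a0: "al > 0" "al - 1 > 0" "al - 1 < 1" using al by auto
 obtain ka where ka: "ka > 0" and sect: "\<And>p. Re p > 0 ==> ka * (1 + norm p powr (- al)) <= norm (1 + p powr (- cr al))"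
  using sector_lower_bound[of al] al by auto
 have Gp: "Gamma (al + 1) = al * Gamma al" and G: "Gamma al > 0"
  using Gamma_plus1[of al] nonpos_Ints_nonpos[of al] a0 Gamma_real_pos[of al] by fastforce+
 have Gn: "Gamma al \<noteq> 0" using G by linarith
 let ?W = "moment al"
 let ?c = "%i n. (-1) ^ n * (al * real n + 1) ^ i"
 define K where "K j i = real (j choose i) * al ^ (j - i)" for j i
 have K0: "K j i >= 0" for j i using a0 by (simp add: K_def)
 have Kjj: "K j j = 1" for j by (simp add: K_def)
 have [measurable]: "?W i \<in> bor" for i unfolding moment_def by measurable
 have geo: "geo_bounded (?c i)" for i by (rule geo_bounded_poly[OF a0(1)])
 have cW: "conv (gk d) (?W i) t = ser (?c i) al (2 + d) t" if "d > 0" for d i t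
  unfolding moment_def by (rule conv_g_ser) (use that a0 geo in auto)
 have W_rec: "?W j t = gk 2 t - (\<Sum>i\<le>j. K j i * conv (gk al) (?W i) t)" for j t
  using moment_series_rec[OF a0(1), of j 2 t] a0 by (simp add: cW K_def) (simp add: moment_def)
 define Z where "Z j = ser (?c j) al 1" for j
 have Z_rec: "Z j t = gk 1 t - (\<Sum>i\<le>j. K j i * conv (gk (al - 1)) (?W i) t)" for j t
  using moment_series_rec[OF a0(1), of j 1 t] a0 by (simp add: cW K_def Z_def add.commute)
 have WZ: "?W j t = conv (gk 1) (Z j) t" for j t
  using conv_g_ser[OF a0(1), of 1 1 "?c j" t] geo by (simp add: Z_def moment_def)
 have "(\<exists>B\<ge>0. \<forall>t. \<bar>?W j t\<bar> <= B * gk 1 t) \<and>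
  (\<exists>C\<ge>0. \<forall>p. Re p > 0 --> norm (laplace (?W j) p) <= C * Hc (norm p))" for j
 proof (induction j rule: less_induct)
  case (less j)
  have "\<exists>B. \<forall>i<j. B i >= 0 \<and> (\<forall>t. \<bar>?W i t\<bar> <= B i * gk 1 t)" using less.IH by metis
  then obtain B where B: "\<And>i. i < j ==> B i >= 0" "\<And>i t. i < j ==> \<bar>?W i t\<bar> <= B i * gk 1 t" by blast
  have "\<exists>C. \<forall>i<j. C i >= 0 \<and> (\<forall>p. Re p > 0 --> norm (laplace (?W i) p) <= C i * Hc (norm p))" using less.IH by metis
  then obtain C where C: "\<And>i. i < j ==> C i >= 0" "\<And>i p. i < j ==> Re p > 0 ==> norm (laplace (?W i) p) <= C i * Hc (norm p)" by blast
  \<comment> \<open>a bound that grows polynomially in \<open>t\<close>, enough for the Laplace integral to converge\<close>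
  define D where "D = (\<Sum>i<j. K j i * B i)"
  have D0: "D >= 0" unfolding D_def using K0 B by (intro sum_nonneg mult_nonneg_nonneg) auto
  have split: "(\<Sum>i\<le>j. K j i * x i) = (\<Sum>i<j. K j i * x i) + x j" for x :: "nat => real"
   by (simp add: lessThan_Suc_atMost[symmetric] Kjj)
  have growth: "\<bar>?W j t\<bar> <= 2 * t * (1 + D * gk al t)" if t: "t > 0" for t
  proof -
   define F where "F s = gk 1 s - (\<Sum>i<j. K j i * conv (gk (al - 1)) (?W i) s)" for s
   have [measurable]: "F \<in> bor" unfolding F_def[abs_def] by measurable
   obtain BZ where BZ: "\<And>s. s <= t ==> \<bar>Z j s\<bar> <= BZ" using ser_bounded[OF a0(1) geo, of 1 t j] unfolding Z_def by auto
   have FD: "\<bar>F s\<bar> <= 1 + D * gk al t" if s: "0 < s" "s <= t" for s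
   proof -
    have "\<bar>\<Sum>i<j. K j i * conv (gk (al - 1)) (?W i) s\<bar> <= (\<Sum>i<j. \<bar>K j i * conv (gk (al - 1)) (?W i) s\<bar>)"
     by (rule sum_abs)
    also have "... <= (\<Sum>i<j. K j i * (B i * gk al s))"
    proof (intro sum_mono)
     fix i assume "i \<in> {..<j}"
     then have "\<bar>conv (gk (al - 1)) (?W i) s\<bar> <= B i * gk al s"
      using abs_conv_g_le[of "al - 1" 1 "?W i" s "B i"] B a0 by simp
     then show "\<bar>K j i * conv (gk (al - 1)) (?W i) s\<bar> <= K j i * (B i * gk al s)"
      using K0[of j i] by (simp add: abs_mult mult_left_mono)
    qed
    also have "... = D * gk al s" by (simp add: D_def sum_distrib_right mult.assoc)
    also have "... <= D * gk al t"
     using s a0 D0 Gamma_real_pos[of al] powr_mono2[of "al - 1" s t]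
     by (intro mult_left_mono) (auto simp: g_kernel_def divide_right_mono)
    finally show ?thesis using s unfolding F_def by (simp add: g_kernel_1)
   qed
   have "\<bar>?W j t\<bar> <= 2 * t * (1 + D * gk al t)"
   proof (rule volterra_bound[where ga = "al - 1" and z = "Z j" and F = F and y = "?W j" and B = BZ])
    show "Z j s = 0" if "s <= 0" for s using that by (simp add: Z_def)
    show "Z j s = F s - conv (gk (al - 1)) (?W j) s" for s
     unfolding Z_rec split F_def by simp
    show "Z j \<in> bor" unfolding Z_def by measurable
   qed (use a0 t BZ FD WZ in auto)
   then show ?thesis .
  qed
  have W0: "?W j t = 0" if "t <= 0" for t j using that by (simp add: moment_def)
  define A where "A = 2 * (1 + D / Gamma al)"
  have A0: "A >= 0" using D0 a0 by (simp add: A_def Gamma_real_pos less_imp_le)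
  have poly: "\<bar>?W j t\<bar> <= A * (gk 2 t + gk (al + 1) t * al * Gamma al)" for t
  proof (cases "t > 0")
   case True
   have "gk (al + 1) t * al * Gamma al = t powr al"
    using True a0 G by (simp add: g_kernel_def Gp Gn)
   moreover have "gk 2 t = t" using True by (simp add: g_kernel_def Gamma_numeral)
   moreover have "2 * t * (1 + D * gk al t) = 2 * t + 2 * (D / Gamma al) * t powr al"
    using True powr_add[of t 1 "al - 1"] by (simp add: g_kernel_def algebra_simps)
   moreover have "... <= A * (t + t powr al)"
   proof -
    have "D / Gamma al * t >= 0" "t powr al >= 0" using True D0 G by auto
    then show ?thesis unfolding A_def distrib_left distrib_right by simp
   qed
   ultimately show ?thesis using growth[OF True] by simp
  qed (simp add: W0 g_kernel_def)
  have Wint: "integrable lborel (%t. ?W j t * exp (- (c * t)))" if c: "c > 0" for c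
  proof (rule Bochner_Integration.integrable_bound)
   show "integrable lborel (%t. A * (gk 2 t * exp (- (c * t)) + (gk (al + 1) t * exp (- (c * t))) * (al * Gamma al)))"
    using a0 c by (intro integrable_mult_right Bochner_Integration.integrable_add integrable_mult_left integrable_g_kernel_exp) auto
   show "AE t in lborel. norm (?W j t * exp (- (c * t))) <= norm (A * (gk 2 t * exp (- (c * t)) + (gk (al + 1) t * exp (- (c * t))) * (al * Gamma al)))"
   proof (rule AE_I2)
    fix t
    have "norm (?W j t * exp (- (c * t))) <= (A * (gk 2 t + gk (al + 1) t * al * Gamma al)) * exp (- (c * t))"
     using poly[of t] by (simp add: abs_mult mult_right_mono)
    also have "... = A * (gk 2 t * exp (- (c * t)) + (gk (al + 1) t * exp (- (c * t))) * (al * Gamma al))"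
     by (simp add: algebra_simps)
    finally show "norm (?W j t * exp (- (c * t))) <= norm (A * (gk 2 t * exp (- (c * t)) + (gk (al + 1) t * exp (- (c * t))) * (al * Gamma al)))"
     by (simp only: real_norm_def)
   qed
  qed auto
  have Wint_i: "integrable lborel (%t. ?W i t * exp (- (c * t)))" if c: "c > 0" and i: "i < j" for c i
  proof (rule Bochner_Integration.integrable_bound[OF integrable_mult_right[OF integrable_g_kernel_exp[of 1 c], of "B i"]])
   show "AE t in lborel. norm (?W i t * exp (- (c * t))) <= norm (B i * (gk 1 t * exp (- (c * t))))"
   proof (rule AE_I2)
    fix t
    show "norm (?W i t * exp (- (c * t))) <= norm (B i * (gk 1 t * exp (- (c * t))))"
     using mult_right_mono[OF B(2)[OF i, of t], of "exp (- (c * t))"] B(1)[OF i] g_kernel_nonneg[of 1 t]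
     by (simp add: abs_mult mult_ac)
   qed
  qed (use c in auto)
  have Wint_le: "integrable lborel (%t. ?W i t * exp (- (c * t)))" if "c > 0" "i <= j" for c i
   using that Wint Wint_i by (cases "i = j") auto
  \<comment> \<open>convolutions become products, and the equation can be solved for the highest transform\<close>
  have lapW: "laplace (?W j) p = p powr (- 2) - (\<Sum>i\<le>j. of_real (K j i) * (p powr (- of_real al) * laplace (?W i) p))" if p: "Re p > 0" for p
  proof -
   let ?E = "%t. exp (- (p * cr t))"
   have i2: "integrable lborel (%t. cr (gk 2 t) * ?E t)"
    using integrable_g_kernel_exp[of 2] p by (intro laplace_integrable) auto
   have ic: "integrable lborel (%t. cr (conv (gk al) (?W i) t) * ?E t)" if "i <= j" for i
    using laplace_conv_g_kernel(2)[OF a0(1) p _ Wint_le[OF p that]] by (intro laplace_integrable) auto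
   have "laplace (?W j) p = (LL t. cr (gk 2 t) * ?E t - (\<Sum>i\<le>j. of_real (K j i) * (cr (conv (gk al) (?W i) t) * ?E t)))"
    unfolding laplace_def W_rec[of j] by (simp add: left_diff_distrib sum_distrib_right mult.assoc)
   also have "... = laplace (gk 2) p - (\<Sum>i\<le>j. of_real (K j i) * laplace (conv (gk al) (?W i)) p)"
    unfolding laplace_def using i2 ic by (subst Bochner_Integration.integral_diff) auto
   also have "laplace (gk 2) p = p powr (- 2)" using laplace_g_kernel[of 2 p] p by simp
   also have "(\<Sum>i\<le>j. of_real (K j i) * laplace (conv (gk al) (?W i)) p) = (\<Sum>i\<le>j. of_real (K j i) * (p powr (- of_real al) * laplace (?W i) p))"
    by (intro sum.cong refl arg_cong2[where f = "(*)"] laplace_conv_g_kernel(1) a0 p Wint_le) auto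
   finally show ?thesis .
  qed
  define CC where "CC = (1 + (\<Sum>i<j. K j i * C i)) / ka"
  have S0: "(\<Sum>i<j. K j i * C i) >= 0" using K0 C by (intro sum_nonneg mult_nonneg_nonneg) auto
  have lapB: "norm (laplace (?W j) p) <= CC * Hc (norm p)" if p: "Re p > 0" for p
  proof -
   define q where "q = p powr (- cr al)"
   define x where "x = norm p"
   have x: "x > 0" using p by (auto simp: x_def)
   have nq: "norm q = x powr (- al)" using p norm_powr_real_powr'[of "- cr al" p]
    by (simp add: q_def x_def)
   have Hx: "Hc x * (1 + x powr (- al)) = 1 / x\<^sup>2"
   proof -
    have "x powr (2 - al) = x\<^sup>2 * x powr (- al)" using x powr_add[of x 2 "- al"] by (simp add: powr_numeral)
    then have "x\<^sup>2 + x powr (2 - al) = x\<^sup>2 * (1 + x powr (- al))" by (simp add: algebra_simps)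
    moreover have "1 + x powr (- al) > 0" by (simp add: add_pos_nonneg)
    ultimately show ?thesis using x by (simp add: Hc_def)
   qed
   have H0: "Hc x >= 0" by (simp add: Hc_def)
   have p2: "norm (p powr (- 2)) = 1 / x\<^sup>2"
    using p norm_powr_real_powr'[of "-2" p] x by (auto simp: x_def powr_minus_divide powr_numeral)
   have "(1 + q) * laplace (?W j) p = p powr (- 2) - (\<Sum>i<j. of_real (K j i) * (q * laplace (?W i) p))"
    using lapW[OF p] by (simp add: lessThan_Suc_atMost[symmetric] Kjj q_def algebra_simps)
   then have "norm (1 + q) * norm (laplace (?W j) p) = norm (p powr (- 2) - (\<Sum>i<j. of_real (K j i) * (q * laplace (?W i) p)))"
    by (metis norm_mult)
   also have "... <= 1 / x\<^sup>2 + (\<Sum>i<j. norm (of_real (K j i) * (q * laplace (?W i) p)))"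
    by (rule order_trans[OF norm_triangle_ineq4]) (simp add: p2 norm_sum)
   also have "... <= 1 / x\<^sup>2 + (\<Sum>i<j. K j i * (x powr (- al) * (C i * Hc x)))"
    using K0 C p by (intro add_mono sum_mono) (auto simp: norm_mult nq x_def intro!: mult_left_mono)
   also have "... = Hc x * (1 + x powr (- al)) + (\<Sum>i<j. K j i * C i) * (x powr (- al) * Hc x)"
    by (simp add: Hx sum_distrib_left sum_distrib_right mult_ac)
   also have "... <= Hc x * (1 + x powr (- al)) + (\<Sum>i<j. K j i * C i) * (Hc x * (1 + x powr (- al)))"
    using S0 H0 by (intro add_mono mult_left_mono) (auto simp: algebra_simps)
   also have "... = (1 + (\<Sum>i<j. K j i * C i)) * Hc x * (1 + x powr (- al))" by (simp add: algebra_simps)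
   finally have 1: "norm (1 + q) * norm (laplace (?W j) p) <= (1 + (\<Sum>i<j. K j i * C i)) * Hc x * (1 + x powr (- al))" .
   have "ka * (1 + x powr (- al)) * norm (laplace (?W j) p) <= norm (1 + q) * norm (laplace (?W j) p)"
    using sect[OF p] by (intro mult_right_mono) (auto simp: q_def x_def)
   with 1 have "(1 + x powr (- al)) * (ka * norm (laplace (?W j) p)) <= (1 + x powr (- al)) * ((1 + (\<Sum>i<j. K j i * C i)) * Hc x)"
    by (simp add: mult_ac)
   moreover have "1 + x powr (- al) > 0" by (simp add: add_pos_nonneg)
   ultimately have "ka * norm (laplace (?W j) p) <= (1 + (\<Sum>i<j. K j i * C i)) * Hc x"
    by (simp only: mult_le_cancel_left_pos)
   then show ?thesis using ka by (simp add: CC_def x_def field_simps)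
  qed
  have CC0: "CC >= 0" using S0 ka by (simp add: CC_def)
  \<comment> \<open>the bound \<open>L\<close> is the same on all lines \<open>Re p = c\<close>, so \<open>c\<close> may tend to \<open>0\<close>\<close>
  let ?H = "%y. CC * (1 / (\<bar>y\<bar>\<^sup>2 + \<bar>y\<bar> powr (2 - al)))"
  have iH: "integrable lborel ?H" by (intro integrable_mult_right volterra_kernel_integrable al)
  define L where "L = (LL y. ?H y)"
  have bound_c: "\<bar>?W j t * exp (- (c * t))\<bar> <= L" if c: "c > 0" and t: "t > 0" for c t
   unfolding L_def
  proof (rule fourier_sup_bound[where h = "%t. ?W j t * exp (- (c * t))"])
   show "integrable lborel (%t. ?W j t * exp (- (c * t)))" by (rule Wint[OF c])
   show "\<bar>?W j s * exp (- (c * s))\<bar> <= A * (1 / c + (1 + 2 / c\<^sup>2))" for s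
   proof (cases "s > 0")
    case True
    have e1: "s * exp (- (c * s)) <= 1 / c"
     using power_le_fact_exp[of "c * s" 1] True c by (simp add: exp_minus field_simps)
    have e2: "s\<^sup>2 * exp (- (c * s)) <= 2 / c\<^sup>2"
     using power_le_fact_exp[of "c * s" 2] True c by (simp add: exp_minus field_simps power_mult_distrib fact_numeral)
    have e3: "s powr al <= 1 + s\<^sup>2"
    proof (cases "s <= 1")
     case True
     then have "s powr al <= 1 powr al" using \<open>s > 0\<close> a0 by (intro powr_mono2) auto
     then show ?thesis by (simp add: add_increasing2)
    next
     case False
     then have "s powr al <= s powr 2" using al by (intro powr_mono) auto
     then show ?thesis using \<open>s > 0\<close> by (simp add: powr_numeral)
    qed
    have e0: "exp (- (c * s)) <= 1" using True c by simp
    have "gk (al + 1) s * al * Gamma al = s powr al"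
     using True a0 G by (simp add: g_kernel_def Gp Gn)
    moreover have "gk 2 s = s" using True by (simp add: g_kernel_def Gamma_numeral)
    ultimately have "\<bar>?W j s\<bar> * exp (- (c * s)) <= A * (s + s powr al) * exp (- (c * s))"
     using poly[of s] by (simp add: mult_right_mono)
    also have "... <= A * (s + (1 + s\<^sup>2)) * exp (- (c * s))" using e3 A0 by (intro mult_right_mono mult_left_mono) auto
    also have "... = A * (s * exp (- (c * s)) + (exp (- (c * s)) + s\<^sup>2 * exp (- (c * s))))" by (simp add: algebra_simps)
    also have "... <= A * (1 / c + (1 + 2 / c\<^sup>2))" using e0 e1 e2 A0 by (intro mult_left_mono add_mono) auto
    finally show ?thesis by (simp add: abs_mult)
   next
    case False
    then show ?thesis using A0 c by (simp add: W0)
   qed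
   have "isCont (?W j) t"
    using continuous_on_ser[OF a0(1) geo, of j 2] t unfolding moment_def
    by (simp add: continuous_on_eq_continuous_at)
   then show "isCont (%t. ?W j t * exp (- (c * t))) t" by (intro continuous_intros)
   show "integrable lborel ?H" by (rule iH)
   show "norm (LL s. cr (?W j s * exp (- (c * s))) * exp (- (\<i> * cr y * cr s))) <= ?H y" if y: "y \<noteq> 0" for y
   proof -
    let ?p = "Complex c y"
    have "cr (?W j s * exp (- (c * s))) * exp (- (\<i> * cr y * cr s)) =
     cr (?W j s) * exp (- (?p * cr s))" for s
    proof -
     have "- (?p * cr s) = cr (- (c * s)) + - (\<i> * cr y * cr s)"
      by (simp add: complex_eq_iff)
     then show ?thesis by (simp only: exp_add exp_of_real of_real_mult mult_ac)
    qed
    then have "norm (LL s. cr (?W j s * exp (- (c * s))) * exp (- (\<i> * cr y * cr s))) = norm (laplace (?W j) ?p)"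
     unfolding laplace_def by (simp only:)
    also have "... <= CC * Hc (norm ?p)" using lapB[of ?p] c by simp
    also have "... <= ?H y"
    proof -
     have "\<bar>y\<bar> <= norm ?p" using abs_Im_le_cmod[of ?p] by simp
     moreover have "0 < \<bar>y\<bar>\<^sup>2 + \<bar>y\<bar> powr (2 - al)" using y by (simp add: add_pos_nonneg)
     moreover from calculation(1) have "\<bar>y\<bar>\<^sup>2 + \<bar>y\<bar> powr (2 - al) <= (norm ?p)\<^sup>2 + norm ?p powr (2 - al)"
      using al by (intro add_mono power_mono powr_mono2) auto
     ultimately show ?thesis unfolding Hc_def using CC0
      by (intro mult_left_mono divide_left_mono mult_pos_pos) linarith+
    qed
    finally show ?thesis .
   qed
  qed measurable
  have Wb: "\<bar>?W j t\<bar> <= L * gk 1 t" for t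
  proof (cases "t > 0")
   case True
   have "(%k. \<bar>?W j t * exp (- (1 / real (Suc k) * t))\<bar>) \<longlonglongrightarrow> \<bar>?W j t * exp (- (0 * t))\<bar>"
    by (intro tendsto_intros LIMSEQ_Suc lim_inverse_n')
   then have "\<bar>?W j t * exp (- (0 * t))\<bar> <= L"
    by (rule LIMSEQ_le_const2) (intro exI[of _ 0] allI impI bound_c True, simp)
   then show ?thesis using True by (simp add: g_kernel_1)
  qed (simp add: W0 g_kernel_1)
  have "L >= 0" using Wb[of 1] by (auto simp: g_kernel_1 intro: order_trans[OF abs_ge_zero])
  then show ?case using Wb lapB CC0 by blast
 qed
 then show ?thesis by blast
qed

lemma Gamma_rec: "z > 0 ==> Gamma (z + 1) = z * Gamma (z :: real)"
 using Gamma_plus1[of z] nonpos_Ints_nonpos[of z] by fastforce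

lemma moment_eq:
 assumes "al > 0" "t > 0"
 shows "moment al j t = t * (\<Sum>n. (-1) ^ n * (al * real n + 1) ^ j / Gamma (al * real n + 2) * (t powr al) ^ n)"
 unfolding moment_def using assms by (subst ser_eq) (auto intro: geo_bounded_poly)

lemma moment_summable:
 assumes "al > 0"
 shows "summable (%n. (-1) ^ n * (al * real n + 1) ^ j / Gamma (al * real n + 2) * x ^ n)"
 using summable_Gamma_series[OF assms geo_bounded_poly[OF assms], of j 2 x] by (rule summable_rabs_cancel)

lemma ml_summable:
 assumes "al > 0"
 shows "summable (%n. 1 / Gamma (al * real n + be) * x ^ n)"
 using summable_Gamma_series[OF assms geo_bounded_power[of 1], of be x] by (simp add: summable_rabs_cancel)

lemma moment_0: "al > 0 ==> t > 0 ==> moment al 0 t = t * mittag_leffler al 2 (- (t powr al))"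
 unfolding mittag_leffler_eq by (subst moment_eq) (auto simp: power_minus[of "t powr al"] mult_ac)

lemma moment_1:
 assumes "al > 0" "t > 0"
 shows "moment al 1 t = t * mittag_leffler al 1 (- (t powr al))"
proof -
 have "(-1) ^ n * (al * real n + 1) ^ 1 / Gamma (al * real n + 2) * x ^ n = 1 / Gamma (al * real n + 1) * (- x) ^ n" for n x
  using Gamma_rec[of "al * real n + 1"] assms
  by (simp add: power_minus[of x] add_nonneg_pos add.assoc)
 then show ?thesis unfolding moment_eq[OF assms] mittag_leffler_eq by simp
qed

text \<open>A polynomial factor \<open>q n\<close> that vanishes at \<open>n = 0\<close> and cancels factors of \<open>Gamma (al n + 2)\<close> lowers the
second index of the Mittag-Leffler function after an index shift.\<close>

lemma moment_shift:
 assumes al: "al > 0" and t: "t > 0"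
  and q: "\<And>n. q (Suc n) / Gamma (al * real (Suc n) + 2) = 1 / Gamma (al * real n + be)" and q0: "q 0 = 0"
 shows "t * (\<Sum>n. (-1) ^ n * q n / Gamma (al * real n + 2) * (t powr al) ^ n) = - (t * t powr al * mittag_leffler al be (- (t powr al)))"
proof -
 let ?x = "t powr al"
 let ?f = "%n. (-1) ^ n * q n / Gamma (al * real n + 2) * ?x ^ n"
 have fS: "?f (Suc n) = - ?x * (1 / Gamma (al * real n + be) * (- ?x) ^ n)" for n
 proof -
  have "?f (Suc n) = (-1) ^ Suc n * ?x ^ Suc n * (q (Suc n) / Gamma (al * real (Suc n) + 2))" by simp
  also have "... = (-1) ^ Suc n * ?x ^ Suc n * (1 / Gamma (al * real n + be))" by (simp only: q)
  finally show ?thesis by (simp add: power_minus[of ?x] mult_ac)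
 qed
 have s: "summable (%n. 1 / Gamma (al * real n + be) * (- ?x) ^ n)" by (rule ml_summable[OF al])
 then have "summable (%n. ?f (Suc n))" unfolding fS by (rule summable_mult)
 then have "summable ?f" using summable_Suc_iff[of ?f] by blast
 then have "(\<Sum>n. ?f n) = (\<Sum>n. ?f (Suc n))" using suminf_split_head[of ?f] q0 by simp
 also have "... = - ?x * mittag_leffler al be (- ?x)"
  unfolding fS mittag_leffler_eq by (rule suminf_mult[OF s])
 finally show ?thesis by simp
qed

lemma moment_2:
 assumes al: "1 < al" and t: "t > 0"
 shows "moment al 2 t - moment al 1 t = - (t * t powr al * mittag_leffler al al (- (t powr al)))"
proof -
 have a0: "al > 0" using al by simp
 let ?q = "%n. (al * real n + 1) * (al * real n)"
 have "moment al 2 t - moment al 1 t = t * (\<Sum>n. (-1) ^ n * ?q n / Gamma (al * real n + 2) * (t powr al) ^ n)"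
  unfolding moment_eq[OF a0 t] right_diff_distrib[symmetric]
  by (subst suminf_diff[OF moment_summable[OF a0] moment_summable[OF a0]])
   (simp add: power2_eq_square algebra_simps diff_divide_distrib add_divide_distrib)
 also have "... = - (t * t powr al * mittag_leffler al al (- (t powr al)))"
 proof (rule moment_shift[OF a0 t])
  fix n
  have p: "al * real n + al > 0" using a0 by (simp add: add_nonneg_pos)
  have "Gamma (al * real (Suc n) + 2) = (al * real n + al + 1) * ((al * real n + al) * Gamma (al * real n + al))"
   using Gamma_rec[OF p] Gamma_rec[of "al * real n + al + 1"] p by (simp add: algebra_simps)
  moreover have "?q (Suc n) = (al * real n + al + 1) * (al * real n + al)" by (simp add: algebra_simps)
  moreover have "al * real n + al + 1 \<noteq> 0" "al * real n + al \<noteq> 0" using p by linarith+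
  ultimately show "?q (Suc n) / Gamma (al * real (Suc n) + 2) = 1 / Gamma (al * real n + al)"
   by (simp only: mult.assoc[symmetric]) simp
 qed simp
 finally show ?thesis .
qed

lemma moment_3:
 assumes al: "1 < al" and t: "t > 0"
 shows "moment al 3 t - 3 * moment al 2 t + 2 * moment al 1 t =
  - (t * t powr al * mittag_leffler al (al - 1) (- (t powr al)))"
proof -
 have a0: "al > 0" using al by simp
 let ?q = "%n. (al * real n + 1) * (al * real n) * (al * real n - 1)"
 let ?m = "%j n. (-1) ^ n * (al * real n + 1) ^ j / Gamma (al * real n + 2) * (t powr al) ^ n"
 note s = moment_summable[OF a0, of _ "t powr al"]
 have "(\<Sum>n. (-1) ^ n * ?q n / Gamma (al * real n + 2) * (t powr al) ^ n) = (\<Sum>n. ?m 3 n - 3 * ?m 2 n + 2 * ?m 1 n)"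
 proof (intro suminf_cong)
  fix n
  have "a * (v * (v - 1) * (v - 2)) / G * X = a * v ^ 3 / G * X - 3 * (a * v ^ 2 / G * X) + 2 * (a * v ^ 1 / G * X)" for a v G X :: real
   by (simp add: divide_inverse power3_eq_cube power2_eq_square algebra_simps)
  from this[of "(-1) ^ n" "al * real n + 1"]
  show "(-1) ^ n * ?q n / Gamma (al * real n + 2) * (t powr al) ^ n = ?m 3 n - 3 * ?m 2 n + 2 * ?m 1 n"
   by simp
 qed
 also have "... = (\<Sum>n. ?m 3 n) - 3 * (\<Sum>n. ?m 2 n) + 2 * (\<Sum>n. ?m 1 n)"
  by (rule sums_unique[symmetric]) (intro sums_add sums_diff sums_mult summable_sums s)
 finally have eq: "(\<Sum>n. (-1) ^ n * ?q n / Gamma (al * real n + 2) * (t powr al) ^ n) = (\<Sum>n. ?m 3 n) - 3 * (\<Sum>n. ?m 2 n) + 2 * (\<Sum>n. ?m 1 n)" .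
 have "t * A - 3 * (t * B) + 2 * (t * C) = t * (A - 3 * B + 2 * C)" for A B C :: real
  by (simp add: algebra_simps)
 then have "moment al 3 t - 3 * moment al 2 t + 2 * moment al 1 t = t * (\<Sum>n. (-1) ^ n * ?q n / Gamma (al * real n + 2) * (t powr al) ^ n)"
  unfolding moment_eq[OF a0 t] eq .
 also have "... = - (t * t powr al * mittag_leffler al (al - 1) (- (t powr al)))"
 proof (rule moment_shift[OF a0 t])
  fix n
  define z where "z = al * real n + (al - 1)"
  have p: "z > 0" using al by (simp add: z_def add_nonneg_pos)
  have "al * real (Suc n) + 2 = z + 1 + 1 + 1" by (simp add: z_def algebra_simps)
  moreover have "Gamma (z + 1 + 1 + 1) = (z + 1 + 1) * ((z + 1) * (z * Gamma z))"
   using Gamma_rec[OF p] Gamma_rec[of "z + 1"] Gamma_rec[of "z + 1 + 1"] p by (simp only:)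
  ultimately have "Gamma (al * real (Suc n) + 2) = (z + 2) * ((z + 1) * (z * Gamma z))" by simp
  moreover have "?q (Suc n) = (z + 2) * (z + 1) * z" by (simp add: z_def algebra_simps)
  moreover have "z + 2 \<noteq> 0" "z + 1 \<noteq> 0" "z \<noteq> 0" using p by linarith+
  ultimately have "?q (Suc n) / Gamma (al * real (Suc n) + 2) = 1 / Gamma z"
   by (simp only: mult.assoc[symmetric]) simp
  then show "?q (Suc n) / Gamma (al * real (Suc n) + 2) = 1 / Gamma (al * real n + (al - 1))"
   by (simp only: z_def)
 qed simp
 finally show ?thesis .
qed

lemma mittag_leffler_small:
 assumes "al > 0"
 shows "\<exists>C. \<forall>x\<in>{0..1}. \<bar>mittag_leffler al be (- x)\<bar> <= C"
proof -
 have "continuous_on UNIV (mittag_leffler al be)"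
  using isCont_mittag_leffler[OF assms] by (simp add: continuous_on_eq_continuous_at)
 then have "continuous_on {0..1} (%x. mittag_leffler al be (- x))"
  by (rule continuous_on_compose2) (auto intro!: continuous_intros)
 then have "bounded ((%x. mittag_leffler al be (- x)) ` {0..1})"
  by (intro compact_imp_bounded compact_continuous_image) auto
 then show ?thesis by (auto simp: bounded_iff)
qed

text \<open>Small arguments are covered by continuity. For \<open>x = t powr al \<ge> 1\<close> divide the bounded moments by the
power of \<open>t\<close> that multiplies the Mittag-Leffler function; this gives even more decay than is stated.\<close>

lemma mittag_leffler_bounds:
 assumes al: "1 < al" "al < 2"
 shows "\<exists>C>0. \<forall>x\<ge>0. \<bar>mittag_leffler al 1 (- x)\<bar> <= C \<and>
  \<bar>mittag_leffler al 2 (- x)\<bar> <= C \<and> sqrt x * \<bar>mittag_leffler al 2 (- x)\<bar> <= C \<and>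
  \<bar>mittag_leffler al al (- x)\<bar> <= C \<and> sqrt x * \<bar>mittag_leffler al al (- x)\<bar> <= C \<and>
  \<bar>mittag_leffler al (al - 1) (- x)\<bar> <= C"
proof -
 have a0: "al > 0" using al by simp
 have "\<forall>j. \<exists>K\<ge>0. \<forall>t. \<bar>moment al j t\<bar> <= K * gk 1 t" using moment_bounded[OF al] by blast
 then obtain K where K0: "\<And>j. K j >= 0" and K: "\<And>j t. \<bar>moment al j t\<bar> <= K j * gk 1 t" by metis
 have "\<forall>be. \<exists>C. \<forall>x\<in>{0..1}. \<bar>mittag_leffler al be (- x)\<bar> <= C" using mittag_leffler_small[OF a0] by blast
 then obtain S where S: "\<And>be x. x \<in> {0..1} ==> \<bar>mittag_leffler al be (- x)\<bar> <= S be" by metis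
 have S0: "S be >= 0" for be using S[of 0 be] by (auto intro: order_trans[OF abs_ge_zero])
 define C where "C = 1 + K 0 + 3 * K 1 + 4 * K 2 + K 3 + S 1 + S 2 + S al + S (al - 1)"
 have C: "C > 0" "S 1 <= C" "S 2 <= C" "S al <= C" "S (al - 1) <= C" "K 0 <= C" "K 1 <= C" "K 2 + K 1 <= C" "K 3 + 3 * K 2 + 2 * K 1 <= C"
  unfolding C_def using K0[of 0] K0[of 1] K0[of 2] K0[of 3] S0[of 1] S0[of 2] S0[of al] S0[of "al - 1"] by linarith+
 have small: "\<bar>mittag_leffler al be (- x)\<bar> <= C \<and> sqrt x * \<bar>mittag_leffler al be (- x)\<bar> <= C" if "x \<in> {0..1}" "S be <= C" for x be
 proof -
  have 1: "\<bar>mittag_leffler al be (- x)\<bar> <= C" using S[OF that(1), of be] that(2) by linarith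
  have "sqrt x * \<bar>mittag_leffler al be (- x)\<bar> <= 1 * \<bar>mittag_leffler al be (- x)\<bar>"
   using that by (intro mult_right_mono) auto
  then show ?thesis using 1 by linarith
 qed
 have large: "\<bar>mittag_leffler al 1 (- x)\<bar> <= C \<and>
  \<bar>mittag_leffler al 2 (- x)\<bar> <= C \<and> sqrt x * \<bar>mittag_leffler al 2 (- x)\<bar> <= C \<and>
  \<bar>mittag_leffler al al (- x)\<bar> <= C \<and> sqrt x * \<bar>mittag_leffler al al (- x)\<bar> <= C \<and>
  \<bar>mittag_leffler al (al - 1) (- x)\<bar> <= C" if x: "x >= 1" for x
 proof -
  define t where "t = x powr (1 / al)"
  have tx: "t powr al = x" using x a0 by (simp add: t_def powr_powr)
  have t1: "t >= 1" using x a0 by (simp add: t_def ge_one_powr_ge_zero)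
  then have t0: "t > 0" by simp
  have g: "gk 1 t = 1" using t0 by (simp add: g_kernel_1)
  have sx: "sqrt x <= t"
  proof -
   have "sqrt x = x powr (1/2)" using x by (simp add: powr_half_sqrt)
   also have "... <= t" unfolding t_def using x al by (intro powr_mono) (auto simp: field_simps)
   finally show ?thesis .
  qed
  have b1: "t * \<bar>mittag_leffler al 1 (- x)\<bar> <= K 1"
   using K[of 1 t] t0 unfolding moment_1[OF a0 t0] tx g by (simp add: abs_mult)
  have b2: "t * \<bar>mittag_leffler al 2 (- x)\<bar> <= K 0"
   using K[of 0 t] t0 unfolding moment_0[OF a0 t0] tx g by (simp add: abs_mult)
  have b3: "t * x * \<bar>mittag_leffler al al (- x)\<bar> <= K 2 + K 1"
  proof -
   have "\<bar>moment al 2 t - moment al 1 t\<bar> <= K 2 + K 1" using K[of 2 t] K[of 1 t] unfolding g by linarith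
   then show ?thesis using t0 x unfolding moment_2[OF al(1) t0] tx by (simp add: abs_mult)
  qed
  have b4: "t * x * \<bar>mittag_leffler al (al - 1) (- x)\<bar> <= K 3 + 3 * K 2 + 2 * K 1"
  proof -
   have "\<bar>moment al 3 t - 3 * moment al 2 t + 2 * moment al 1 t\<bar> <= K 3 + 3 * K 2 + 2 * K 1"
    using K[of 3 t] K[of 2 t] K[of 1 t] unfolding g by linarith
   then show ?thesis using t0 x unfolding moment_3[OF al(1) t0] tx by (simp add: abs_mult)
  qed
  have up: "c * \<bar>y\<bar> <= B" if "d * \<bar>y\<bar> <= B" "c <= d" for c d y B :: real
   using mult_right_mono[OF that(2), of "\<bar>y\<bar>"] that(1) by linarith
  have tx1: "1 <= t * x" "sqrt x <= t * x"
  proof -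
   show "1 <= t * x" using mult_mono[of 1 t 1 x] t1 x by simp
   have "t * 1 <= t * x" using t0 x by (intro mult_left_mono) auto
   then show "sqrt x <= t * x" using sx by linarith
  qed
  show ?thesis
   using up[OF b1 t1] up[OF b2 t1] up[OF b2 sx] up[OF b3 tx1(1)] up[OF b3 tx1(2)] up[OF b4 tx1(1)] C by simp
 qed
 show ?thesis
 proof (intro exI[of _ C] conjI[OF C(1)] allI impI)
  fix x :: real assume x: "x >= 0"
  show "\<bar>mittag_leffler al 1 (- x)\<bar> <= C \<and>
   \<bar>mittag_leffler al 2 (- x)\<bar> <= C \<and> sqrt x * \<bar>mittag_leffler al 2 (- x)\<bar> <= C \<and>
   \<bar>mittag_leffler al al (- x)\<bar> <= C \<and> sqrt x * \<bar>mittag_leffler al al (- x)\<bar> <= C \<and>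
   \<bar>mittag_leffler al (al - 1) (- x)\<bar> <= C"
   using small[of x 1] small[of x 2] small[of x al] small[of x "al - 1"] large[of x] C x by (cases "x <= 1") auto
 qed
qed

section \<open>Solution kernels\<close>

text \<open>The function \<open>t powr (be - 1) E(-m t powr al)\<close>. Here \<open>mlk al 1\<close>, \<open>mlk al 2\<close> and \<open>mlk al al\<close> are the responses to
the initial value, to the initial velocity and to an impulse; \<open>mlk al (al - 1)\<close> is the derivative of the last.\<close>

definition mlk :: "real => real => real => real => real" where
 "mlk al be m t = (if t > 0 then t powr (be - 1) * mittag_leffler al be (- m * t powr al) else 0)"

lemma mlk_ser: "al > 0 ==> mlk al be m = ser (%n. (- m) ^ n) al be"
proof
 fix t assume a: "al > 0"
 show "mlk al be m t = ser (%n. (- m) ^ n) al be t"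
 proof (cases "t > 0")
  case True
  then show ?thesis using a ser_eq[OF True a geo_bounded_power, of "- m" be]
   by (simp only: mlk_def mittag_leffler_eq power_mult_distrib if_True) (simp add: mult_ac)
 qed (simp add: mlk_def)
qed

lemma mlk_nonpos [simp]: "t <= 0 ==> mlk al be m t = 0"
 by (simp add: mlk_def)

lemma mlk_measurable2:
 assumes "al > 0" and [measurable]: "f \<in> borel_measurable N" "h \<in> borel_measurable N"
 shows "(%x. mlk al be (f x) (h x)) \<in> borel_measurable N"
proof -
 note [measurable] = mittag_leffler_measurable[OF assms(1)]
 show ?thesis unfolding mlk_def by measurable
qed

lemma mlk_measurable: "al > 0 ==> mlk al be m \<in> bor"
 by (rule mlk_measurable2) auto

lemma mlk_conv: "al > 0 ==> be > 0 ==> d > 0 ==> conv (gk d) (mlk al be m) t = mlk al (be + d) m t"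
 by (simp add: mlk_ser conv_g_ser geo_bounded_power)

lemma mlk_rec: "al > 0 ==> mlk al be m t = gk be t - m * mlk al (be + al) m t"
proof -
 assume a: "al > 0"
 have "summable (%n. (- m) ^ n * gk (al * real n + (be + al)) t)"
  using ser_summable[OF a geo_bounded_power] by (rule summable_rabs_cancel)
 from suminf_mult[OF this, of "-m"] show ?thesis
  using ser_shift[OF a geo_bounded_power, of "-m" be t] a by (simp add: mlk_ser ser_def mult.assoc)
qed

lemma mlk_isCont: "al > 0 ==> t > 0 ==> isCont (mlk al be m) t"
 using continuous_on_ser[of al "%n. (- m) ^ n" be] geo_bounded_power[of "- m"]
 by (simp add: mlk_ser continuous_on_eq_continuous_at)

definition mlC :: "real => real" where
 "mlC al = (SOME C. C > 0 \<and> (\<forall>x\<ge>0. \<bar>mittag_leffler al 1 (- x)\<bar> <= C \<and>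
  \<bar>mittag_leffler al 2 (- x)\<bar> <= C \<and> sqrt x * \<bar>mittag_leffler al 2 (- x)\<bar> <= C \<and>
  \<bar>mittag_leffler al al (- x)\<bar> <= C \<and> sqrt x * \<bar>mittag_leffler al al (- x)\<bar> <= C \<and>
  \<bar>mittag_leffler al (al - 1) (- x)\<bar> <= C))"

text \<open>Scaling by \<open>x = m t powr al\<close> makes the constants independent of \<open>m\<close>. The factor \<open>\<surd>m\<close>, which measures the
\<open>V\<^sub>1\<^sub>/\<^sub>2\<close>-norm, costs \<open>t powr (-al/2)\<close>.\<close>

lemma mlk_bounds:
 assumes al: "1 < al" "al < 2"
 defines "C \<equiv> mlC al"
 shows "C > 0"
  and "m >= 0 ==> \<bar>mlk al 1 m t\<bar> <= C"
  and "m >= 0 ==> t >= 0 ==> \<bar>mlk al 2 m t\<bar> <= C * t"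
  and "m >= 0 ==> \<bar>sqrt m * mlk al 2 m t\<bar> <= C * t powr (1 - al / 2)"
  and "m >= 0 ==> \<bar>mlk al al m t\<bar> <= C * t powr (al - 1)"
  and "m >= 0 ==> \<bar>sqrt m * mlk al al m t\<bar> <= C * t powr (al / 2 - 1)"
  and "m >= 0 ==> \<bar>mlk al (al - 1) m t\<bar> <= C * t powr (al - 2)"
proof -
 have *: "C > 0 \<and> (\<forall>x\<ge>0. \<bar>mittag_leffler al 1 (- x)\<bar> <= C \<and>
  \<bar>mittag_leffler al 2 (- x)\<bar> <= C \<and> sqrt x * \<bar>mittag_leffler al 2 (- x)\<bar> <= C \<and>
  \<bar>mittag_leffler al al (- x)\<bar> <= C \<and> sqrt x * \<bar>mittag_leffler al al (- x)\<bar> <= C \<and>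
  \<bar>mittag_leffler al (al - 1) (- x)\<bar> <= C)"
  unfolding C_def mlC_def using mittag_leffler_bounds[OF al] by (rule someI_ex)
 then show C: "C > 0" by simp
 have nn: "m * t powr al >= 0" if "m >= 0" using that by simp
 have sq: "sqrt (m * t powr al) = sqrt m * t powr (al / 2)" if "m >= 0"
  using that by (simp add: real_sqrt_mult powr_half_sqrt[symmetric] powr_powr)
 show "\<bar>mlk al 1 m t\<bar> <= C" if "m >= 0" using * nn[OF that] by (simp add: mlk_def)
 show "\<bar>mlk al 2 m t\<bar> <= C * t" if "m >= 0" "t >= 0"
  using * nn[OF that(1)] that(2) by (auto simp: mlk_def abs_mult mult.commute intro!: mult_right_mono)
 show "\<bar>mlk al al m t\<bar> <= C * t powr (al - 1)" if "m >= 0"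
  using * nn[OF that] by (auto simp: mlk_def abs_mult mult.commute intro!: mult_right_mono)
 show "\<bar>mlk al (al - 1) m t\<bar> <= C * t powr (al - 2)" if "m >= 0"
  using * nn[OF that] by (auto simp: mlk_def abs_mult mult.commute intro!: mult_right_mono)
 have aux: "\<bar>sqrt m * mlk al be m t\<bar> <= C * t powr (be - 1 - al / 2)"
  if m: "m >= 0" and b: "\<And>x. x >= 0 ==> sqrt x * \<bar>mittag_leffler al be (- x)\<bar> <= C" for be
 proof (cases "t > 0")
  case True
  have "t powr (be - 1) = t powr (be - 1 - al / 2) * t powr (al / 2)" by (simp add: powr_add[symmetric])
  then have "\<bar>sqrt m * mlk al be m t\<bar> = t powr (be - 1 - al / 2) * (sqrt (m * t powr al) * \<bar>mittag_leffler al be (- (m * t powr al))\<bar>)"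
   using True m by (simp add: mlk_def abs_mult sq mult_ac)
  also have "... <= t powr (be - 1 - al / 2) * C" using b[OF nn[OF m]] by (intro mult_left_mono) auto
  finally show ?thesis by (simp add: mult.commute)
 qed (use C in simp)
 show "\<bar>sqrt m * mlk al 2 m t\<bar> <= C * t powr (1 - al / 2)" if "m >= 0" using aux[OF that, of 2] * by simp
 show "\<bar>sqrt m * mlk al al m t\<bar> <= C * t powr (al / 2 - 1)" if "m >= 0" using aux[OF that, of al] * by (simp add: field_simps)
qed

text \<open>The class of functions on the line within which all convolutions with \<open>mlk\<close> and \<open>g\<close> are
associative.\<close>

definition causal_L1loc :: "(real => real) => bool" where
 "causal_L1loc f \<longleftrightarrow> f \<in> bor \<and> (\<forall>s<0. f s = 0) \<and>
  (\<forall>S. (NN s. ennreal \<bar>f s\<bar> * ind {..S} s) < \<infinity>)"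

lemma causal_L1locD:
 assumes "causal_L1loc f"
 shows "f \<in> bor" "s < 0 ==> f s = 0"
  "(NN s. ennreal \<bar>f s\<bar> * ind {..S} s) < \<infinity>"
 using assms by (auto simp: causal_L1loc_def)

lemma aconv_g1:
 assumes [measurable]: "f \<in> bor"
 shows "aconv (gk 1) f t = (NN s. ennreal \<bar>f s\<bar> * ind {..t} s)"
proof -
 have "AE s in lborel. s \<noteq> (t::real)" by (simp add: AE_lborel_singleton)
 then show ?thesis unfolding aconv_def
  by (intro nn_integral_cong_AE, eventually_elim) (auto simp: g_kernel_1 indicator_def)
qed

lemma causal_L1loc_iff:
 "causal_L1loc f \<longleftrightarrow> f \<in> bor \<and> (\<forall>s<0. f s = 0) \<and> (\<forall>S. aconv (gk 1) f S < \<infinity>)"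
 unfolding causal_L1loc_def using aconv_g1[of f] by auto

lemma aconv_conv_le:
 assumes [measurable]: "a \<in> bor" "b \<in> bor" "c \<in> bor"
 shows "aconv a (conv b c) t <= (NN ta. aconv a b (t - ta) * ennreal \<bar>c ta\<bar>)"
proof -
 have shift: "(NN s. ennreal \<bar>a (t - s) * b (s - ta)\<bar>) = aconv a b (t - ta)" for ta
  unfolding aconv_def
  using nn_integral_lborel_shift[of "%s. ennreal \<bar>a (t - ta - s) * b s\<bar>" ta] by simp
 have "aconv a (conv b c) t <= (NN s. \<integral>\<^sup>+ta. ennreal \<bar>a (t - s) * b (s - ta) * c ta\<bar> \<partial>lborel)"
  unfolding aconv_def
 proof (intro nn_integral_mono)
  fix s
  have "ennreal \<bar>a (t - s) * conv b c s\<bar> = ennreal \<bar>a (t - s)\<bar> * ennreal \<bar>conv b c s\<bar>"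
   by (simp add: abs_mult ennreal_mult)
  also have "... <= ennreal \<bar>a (t - s)\<bar> * aconv b c s"
   by (intro mult_left_mono abs_conv_le_aconv) auto
  also have "... = (NN ta. ennreal \<bar>a (t - s) * b (s - ta) * c ta\<bar>)"
   unfolding aconv_def by (subst nn_integral_cmult[symmetric]) (auto simp: abs_mult ennreal_mult mult.assoc)
  finally show "ennreal \<bar>a (t - s) * conv b c s\<bar> <= (NN ta. ennreal \<bar>a (t - s) * b (s - ta) * c ta\<bar>)" .
 qed
 also have "... = (NN ta. \<integral>\<^sup>+s. ennreal \<bar>a (t - s) * b (s - ta) * c ta\<bar> \<partial>lborel)"
  by (rule lborel_pair.Fubini') measurable
 also have "... = (NN ta. aconv a b (t - ta) * ennreal \<bar>c ta\<bar>)"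
  by (simp add: abs_mult[of "_ * _" "c _"] ennreal_mult nn_integral_multc shift)
 finally show ?thesis .
qed

lemma aconv_mlk:
 assumes "al > 0" "be > 0" "d > 0"
 shows "aconv (gk d) (mlk al be m) t < \<infinity>"
 using aconv_g_ser[of al be d "%n. (- m) ^ n" t] assms geo_bounded_power[of "- m"]
 by (simp add: mlk_ser) (meson ennreal_less_top order_le_less_trans)

lemma mlk_fin:
 assumes al: "al > 0" and be: "be > 0" and d: "d > 0" and bd: "be + d >= 1" and f: "causal_L1loc f"
 shows "(NN ta. aconv (gk d) (mlk al be m) (t - ta) * ennreal \<bar>f ta\<bar>) < \<infinity>"
proof -
 note [measurable] = causal_L1locD(1)[OF f] mlk_measurable[OF al]
 let ?s = "ser (%n. \<bar>(- m) ^ n\<bar>) al (be + d)"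
 obtain C where C: "\<And>u. u <= t ==> \<bar>?s u\<bar> <= C"
  using ser_bounded[OF al geo_bounded_abs[OF geo_bounded_power] bd] by metis
 have le: "aconv (gk d) (mlk al be m) u <= ennreal (?s u)" for u
  using aconv_g_ser[OF al be d geo_bounded_power, of "- m" u] by (simp add: mlk_ser al)
 have "(NN ta. aconv (gk d) (mlk al be m) (t - ta) * ennreal \<bar>f ta\<bar>) \<le>
  (NN ta. ennreal C * (ennreal \<bar>f ta\<bar> * ind {..t} ta))"
 proof (intro nn_integral_mono)
  fix ta
  consider "ta < 0" | "ta > t" | "0 <= ta" "ta <= t" by linarith
  then show "aconv (gk d) (mlk al be m) (t - ta) * ennreal \<bar>f ta\<bar> <= ennreal C * (ennreal \<bar>f ta\<bar> * ind {..t} ta)"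
  proof cases
   case 1 then show ?thesis using causal_L1locD(2)[OF f] by simp
  next
   case 2 then show ?thesis using le[of "t - ta"] by simp
  next
   case 3
   have "?s (t - ta) <= C" using C[of "t - ta"] 3 by simp
   then have "aconv (gk d) (mlk al be m) (t - ta) <= ennreal C"
    using le[of "t - ta"] by (meson ennreal_leI order_trans)
   then show ?thesis using 3 by (simp add: mult_right_mono)
  qed
 qed
 also have "... < \<infinity>" using causal_L1locD(3)[OF f, of t]
  by (subst nn_integral_cmult) (auto simp: ennreal_mult_less_top)
 finally show ?thesis .
qed

lemma conv_nonpos:
 assumes "\<And>s. s <= 0 ==> a s = 0" "\<And>s. s < 0 ==> b s = 0" "t <= 0"
 shows "conv a b t = 0"
proof -
 have "a (t - s) * b s = 0" for s using assms by (cases "s < 0") auto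
 then show ?thesis unfolding conv_def by (simp only:) simp
qed

lemma g_kernel_nonpos [simp]: "t <= 0 ==> gk d t = 0" by (simp add: g_kernel_def)

lemma L1loc_mlk: "al > 0 ==> be > 0 ==> causal_L1loc (mlk al be m)"
 unfolding causal_L1loc_iff using aconv_mlk[of al be 1] mlk_measurable by auto

lemma L1loc_g: "d > 0 ==> causal_L1loc (gk d)"
 unfolding causal_L1loc_iff using aconv_g_kernel[of 1 d] by auto

lemma L1loc_conv_mlk:
 assumes al: "al > 0" and be: "be > 0" and f: "causal_L1loc f"
 shows "causal_L1loc (conv (mlk al be m) f)"
 unfolding causal_L1loc_iff
proof (intro conjI allI impI)
 note [measurable] = causal_L1locD(1)[OF f] mlk_measurable[OF al]
 show "conv (mlk al be m) f \<in> bor" by measurable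
 show "conv (mlk al be m) f s = 0" if "s < 0" for s
  using that causal_L1locD(2)[OF f] by (intro conv_nonpos) auto
 show "aconv (gk 1) (conv (mlk al be m) f) S < \<infinity>" for S
  by (rule order_le_less_trans[OF aconv_conv_le mlk_fin]) (use al be f in auto)
qed

lemma mlk_0: "al > 0 ==> mlk al be 0 = gk be"
 using mlk_rec[of al be 0] by auto

lemma L1loc_conv_g: "d > 0 ==> causal_L1loc f ==> causal_L1loc (conv (gk d) f)"
 using L1loc_conv_mlk[of 1 d f 0] by (simp add: mlk_0)

lemma aconv_lin:
 assumes [measurable]: "a \<in> bor" "f \<in> bor" "g \<in> bor"
  and fin: "aconv a f t < \<infinity>" "aconv a g t < \<infinity>"
 shows "aconv a (%s. c * f s + d * g s) t < \<infinity>"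
  and "conv a (%s. c * f s + d * g s) t = c * conv a f t + d * conv a g t"
proof -
 have "aconv a (%s. c * f s + d * g s) t <= (NN s. ennreal \<bar>c\<bar> * ennreal \<bar>a (t - s) * f s\<bar> + ennreal \<bar>d\<bar> * ennreal \<bar>a (t - s) * g s\<bar>)"
  unfolding aconv_def
 proof (intro nn_integral_mono)
  fix s
  have "\<bar>a (t - s) * (c * f s + d * g s)\<bar> <= \<bar>c\<bar> * \<bar>a (t - s) * f s\<bar> + \<bar>d\<bar> * \<bar>a (t - s) * g s\<bar>"
   using abs_triangle_ineq[of "c * (a (t - s) * f s)" "d * (a (t - s) * g s)"]
   by (simp add: abs_mult algebra_simps)
  then show "ennreal \<bar>a (t - s) * (c * f s + d * g s)\<bar> <= ennreal \<bar>c\<bar> * ennreal \<bar>a (t - s) * f s\<bar> + ennreal \<bar>d\<bar> * ennreal \<bar>a (t - s) * g s\<bar>"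
   by (simp only: ennreal_mult[symmetric] ennreal_plus[symmetric] abs_ge_zero mult_nonneg_nonneg) (rule ennreal_leI)
 qed
 also have "... = ennreal \<bar>c\<bar> * aconv a f t + ennreal \<bar>d\<bar> * aconv a g t"
  unfolding aconv_def by (subst nn_integral_add) (auto simp: nn_integral_cmult)
 also have "... < \<infinity>" using fin by (simp add: ennreal_mult_less_top)
 finally show "aconv a (%s. c * f s + d * g s) t < \<infinity>" .
 have "conv a (%s. c * f s + d * g s) t = (LL s. c * (a (t - s) * f s) + d * (a (t - s) * g s))"
  unfolding conv_def by (simp add: algebra_simps)
 then show "conv a (%s. c * f s + d * g s) t = c * conv a f t + d * conv a g t"
  using aconv_integrable[OF _ _ fin(1)] aconv_integrable[OF _ _ fin(2)] by (simp add: conv_def)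
qed

lemma L1loc_lin: "causal_L1loc f ==> causal_L1loc g ==> causal_L1loc (%s. c * f s + d * g s)"
 unfolding causal_L1loc_iff using aconv_lin(1)[of "gk 1" f g _ c d] by auto

text \<open>Convolve the equation with \<open>mlk al (al - 1)\<close>. As \<open>g\<^sub>2\<^sub>-\<^sub>a\<^sub>l * mlk al (al - 1) = mlk al 1 = g\<^sub>1 - m (g\<^sub>1 * mlk al al)\<close>,
the terms with \<open>m y\<close> cancel.\<close>

lemma resolvent_solution:
 assumes al: "1 < al" "al < 2" and w: "causal_L1loc w" and F: "causal_L1loc F"
  and y: "\<And>s. y s = y1 * gk 1 s + conv (gk 1) w s"
  and eq: "\<And>s. conv (gk (2 - al)) w s = conv (gk 1) (%r. F r - m * y r) s"
 shows "y s = y1 * mlk al 1 m s + conv (mlk al al m) F s"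
proof -
 have a0: "al > 0" "al - 1 > 0" "2 - al > 0" using al by auto
 note [measurable] = causal_L1locD(1)[OF w] causal_L1locD(1)[OF F] mlk_measurable[OF a0(1)]
 let ?k = "mlk al al m" and ?k' = "mlk al (al - 1) m" and ?e = "mlk al 1 m" and ?k1 = "mlk al (al + 1) m"
 let ?g = "gk (2 - al)" and ?g1 = "gk 1"
 have yeq: "y = (%s. y1 * ?g1 s + 1 * conv ?g1 w s)" using y by auto
 have L1w: "causal_L1loc (conv ?g1 w)" by (intro L1loc_conv_g w) simp
 have Ly: "causal_L1loc y" unfolding yeq by (intro L1loc_lin L1loc_g L1w) auto
 note [measurable] = causal_L1locD(1)[OF Ly]
 have ek: "?e = (%u. ?g1 u - m * ?k1 u)" using mlk_rec[OF a0(1), of 1] by (auto simp: add.commute)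
 have fin_k: "aconv ?k f s < \<infinity>" if "causal_L1loc f" for f s
 proof -
  note [measurable] = causal_L1locD(1)[OF that]
  have "mlk al al m = conv ?g1 ?k'" using mlk_conv[OF a0(1,2), of 1] by auto
  then have "aconv ?k f s = aconv f (conv ?g1 ?k') s" by (simp add: aconv_commute)
  also have "... = aconv (conv ?g1 ?k') f s" by (simp add: aconv_commute)
  also have "... < \<infinity>"
  proof -
   have "aconv (conv ?g1 ?k') f s <= (NN ta. aconv ?g1 ?k' (s - ta) * ennreal \<bar>f ta\<bar>)"
    unfolding aconv_def[of "conv _ _"] by (intro nn_integral_mono) (auto simp: abs_mult ennreal_mult intro!: mult_right_mono abs_conv_le_aconv)
   also have "... < \<infinity>" by (rule mlk_fin) (use a0 al that in auto)
   finally show ?thesis .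
  qed
  finally show ?thesis .
 qed
 have A1: "conv ?k' (conv ?g w) s = conv ?e w s"
 proof -
  have "conv ?k' (conv ?g w) s = conv (conv ?k' ?g) w s"
   using mlk_fin[OF a0(1) a0(2) a0(3) _ w, of m s] by (intro conv_assoc) (auto simp: aconv_commute[of ?k'])
  also have "conv ?k' ?g = ?e" using mlk_conv[OF a0(1,2,3)] by (auto simp: conv_commute[of ?k'])
  finally show ?thesis .
 qed
 have LG: "causal_L1loc (%r. 1 * F r + (- m) * y r)" by (intro L1loc_lin F Ly)
 have A2: "conv ?k' (conv ?g1 (%r. F r - m * y r)) s = conv ?k F s - m * conv ?k y s"
 proof -
  have "conv ?k' (conv ?g1 (%r. 1 * F r + (- m) * y r)) s = conv (conv ?k' ?g1) (%r. 1 * F r + (- m) * y r) s"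
   using mlk_fin[OF a0(1) a0(2) zero_less_one _ LG, of m s] a0 by (intro conv_assoc) (auto simp: aconv_commute[of ?k'])
  also have "conv ?k' ?g1 = ?k" using mlk_conv[OF a0(1,2), of 1] by (auto simp: conv_commute[of ?k'])
  also have "conv ?k (%r. 1 * F r + (- m) * y r) s = 1 * conv ?k F s + (- m) * conv ?k y s"
   by (rule aconv_lin(2)) (use fin_k F Ly in auto)
  finally show ?thesis by simp
 qed
 have A3: "conv ?k y s = y1 * ?k1 s + conv ?k1 w s"
 proof -
  have "conv ?k y s = y1 * conv ?k ?g1 s + 1 * conv ?k (conv ?g1 w) s"
   unfolding yeq by (rule aconv_lin(2)) (use fin_k L1w L1loc_g[of 1] in auto)
  also have "conv ?k ?g1 s = ?k1 s" using mlk_conv[OF a0(1,1), of 1] by (simp add: conv_commute[of ?k])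
  also have "conv ?k (conv ?g1 w) s = conv (conv ?k ?g1) w s"
   using mlk_fin[OF a0(1) a0(1) zero_less_one _ w, of m s] a0 by (intro conv_assoc) (auto simp: aconv_commute[of ?k])
  also have "conv ?k ?g1 = ?k1" using mlk_conv[OF a0(1,1), of 1] by (auto simp: conv_commute[of ?k])
  finally show ?thesis by simp
 qed
 have fin1: "aconv w ?g1 s < \<infinity>" using w aconv_commute[of w ?g1 s] unfolding causal_L1loc_iff by auto
 have fink1: "aconv w ?k1 s < \<infinity>"
 proof -
  have "?k1 = conv ?g1 ?k" using mlk_conv[OF a0(1,1), of 1] by auto
  then have "aconv w ?k1 s = aconv (conv ?g1 ?k) w s" by (simp add: aconv_commute[of w])
  also have "... <= (NN ta. aconv ?g1 ?k (s - ta) * ennreal \<bar>w ta\<bar>)"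
   unfolding aconv_def[of "conv _ _"] by (intro nn_integral_mono) (auto simp: abs_mult ennreal_mult intro!: mult_right_mono abs_conv_le_aconv)
  also have "... < \<infinity>" by (rule mlk_fin) (use a0 al w in auto)
  finally show ?thesis .
 qed
 have A4: "conv ?e w s = conv ?g1 w s - m * conv ?k1 w s"
 proof -
  have "conv w (%u. 1 * ?g1 u + (- m) * ?k1 u) s = 1 * conv w ?g1 s + (- m) * conv w ?k1 s"
   by (rule aconv_lin(2)) (use fin1 fink1 in auto)
  then show ?thesis by (simp add: ek conv_commute[of _ w])
 qed
 have "conv ?e w s = conv ?k F s - m * conv ?k y s" using A1 A2 eq by (metis (no_types, lifting) ext)
 then have "conv ?g1 w s - m * conv ?k1 w s = conv ?k F s - m * (y1 * ?k1 s + conv ?k1 w s)"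
  unfolding A3 A4 .
 then have "conv ?g1 w s = conv ?k F s - m * y1 * ?k1 s" by (simp add: algebra_simps)
 moreover have "y1 * ?e s = y1 * ?g1 s - m * y1 * ?k1 s" by (simp add: ek right_diff_distrib)
 ultimately show ?thesis unfolding y by linarith
qed

section \<open>The scalar linear problem\<close>

text \<open>The solution of the scalar problem with frequency \<open>m\<close>, initial data \<open>a0\<close>, \<open>a1\<close> and source \<open>f\<close>; \<open>lin_w\<close>
below is its derivative.\<close>

definition lin_y :: "real => real => real => real => (real => real) => real => real" where
 "lin_y al m a0 a1 f t = a0 * mlk al 1 m t + a1 * mlk al 2 m t + conv (mlk al al m) f t"

definition lin_w :: "real => real => real => real => (real => real) => real => real" where
 "lin_w al m a0 a1 f t = - m * a0 * mlk al al m t + a1 * mlk al 1 m t + conv (mlk al (al - 1) m) f t"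

lemma lin_y_L1loc: "al > 0 ==> causal_L1loc f ==> causal_L1loc (lin_y al m a0 a1 f)"
proof -
 assume a: "al > 0" and f: "causal_L1loc f"
 have "causal_L1loc (%s. 1 * (a0 * mlk al 1 m s + a1 * mlk al 2 m s) + 1 * conv (mlk al al m) f s)"
  by (intro L1loc_lin L1loc_mlk L1loc_conv_mlk f a) auto
 then show ?thesis by (simp add: lin_y_def[abs_def])
qed

lemma lin_w_L1loc: "al > 1 ==> causal_L1loc f ==> causal_L1loc (lin_w al m a0 a1 f)"
proof -
 assume a: "al > 1" and f: "causal_L1loc f"
 have "causal_L1loc (%s. 1 * ((- m * a0) * mlk al al m s + a1 * mlk al 1 m s) + 1 * conv (mlk al (al - 1) m) f s)"
  using a by (intro L1loc_lin L1loc_mlk L1loc_conv_mlk f) auto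
 then show ?thesis by (simp add: lin_w_def[abs_def])
qed

lemma conv_lin_w:
 assumes al: "1 < al" and d: "d > 0" "al - 1 + d >= 1" and f: "causal_L1loc f"
 shows "aconv (gk d) (lin_w al m a0 a1 f) t < \<infinity>"
  and "conv (gk d) (lin_w al m a0 a1 f) t =
   - m * a0 * mlk al (al + d) m t + a1 * mlk al (1 + d) m t + conv (mlk al (al - 1 + d) m) f t"
proof -
 have a: "al > 0" "al - 1 > 0" using al by auto
 note [measurable] = causal_L1locD(1)[OF f] mlk_measurable[OF a(1)]
 have w: "lin_w al m a0 a1 f = (%s. 1 * ((- m * a0) * mlk al al m s + a1 * mlk al 1 m s) + 1 * conv (mlk al (al - 1) m) f s)"
  by (simp add: lin_w_def[abs_def])
 have f1: "aconv (gk d) (%s. (- m * a0) * mlk al al m s + a1 * mlk al 1 m s) t < \<infinity>"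
  using a d by (intro aconv_lin aconv_mlk) auto
 have fin: "(NN ta. aconv (gk d) (mlk al (al - 1) m) (t - ta) * ennreal \<bar>f ta\<bar>) < \<infinity>"
  using a d f by (intro mlk_fin) auto
 have f2: "aconv (gk d) (conv (mlk al (al - 1) m) f) t < \<infinity>"
  by (rule order_le_less_trans[OF aconv_conv_le fin]) auto
 show "aconv (gk d) (lin_w al m a0 a1 f) t < \<infinity>"
  unfolding w by (rule aconv_lin(1)) (use f1 f2 in auto)
 have "conv (gk d) (lin_w al m a0 a1 f) t = 1 * conv (gk d) (%s. (- m * a0) * mlk al al m s + a1 * mlk al 1 m s) t
  + 1 * conv (gk d) (conv (mlk al (al - 1) m) f) t"
  unfolding w by (rule aconv_lin(2)) (use f1 f2 in auto)
 also have "conv (gk d) (%s. (- m * a0) * mlk al al m s + a1 * mlk al 1 m s) t = (- m * a0) * conv (gk d) (mlk al al m) t + a1 * conv (gk d) (mlk al 1 m) t"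
  using a d by (intro aconv_lin aconv_mlk) auto
 also have "conv (gk d) (conv (mlk al (al - 1) m) f) t = conv (conv (gk d) (mlk al (al - 1) m)) f t"
  by (rule conv_assoc) (use fin in auto)
 also have "conv (gk d) (mlk al (al - 1) m) = mlk al (al - 1 + d) m"
  using mlk_conv[OF a(1,2) d(1)] by auto
 finally show "conv (gk d) (lin_w al m a0 a1 f) t =
   - m * a0 * mlk al (al + d) m t + a1 * mlk al (1 + d) m t + conv (mlk al (al - 1 + d) m) f t"
  using mlk_conv[OF a(1,1) d(1)] mlk_conv[OF a(1) _ d(1), of 1] by simp
qed

lemma lin_y_eq_integral:
 assumes al: "1 < al" and f: "causal_L1loc f"
 shows "lin_y al m a0 a1 f t = a0 * gk 1 t + conv (gk 1) (lin_w al m a0 a1 f) t"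
proof -
 have "mlk al 1 m t = gk 1 t - m * mlk al (1 + al) m t" using al by (intro mlk_rec) simp
 then have "a0 * mlk al 1 m t = a0 * gk 1 t - m * a0 * mlk al (al + 1) m t"
  by (simp add: right_diff_distrib add.commute)
 then show ?thesis using conv_lin_w(2)[OF al _ _ f, of 1 m a0 a1 t] al by (simp add: lin_y_def)
qed

lemma conv_mlk_add:
 assumes al: "al > 0" and be: "be > 0" and d: "d > 0" "be + d >= 1" and f: "causal_L1loc f"
 shows "aconv (gk d) (conv (mlk al be m) f) t < \<infinity>"
  and "conv (gk d) (conv (mlk al be m) f) t = conv (mlk al (be + d) m) f t"
proof -
 note [measurable] = causal_L1locD(1)[OF f] mlk_measurable[OF al]
 note fin = mlk_fin[OF al be d f, of m t]
 show "aconv (gk d) (conv (mlk al be m) f) t < \<infinity>"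
  by (rule order_le_less_trans[OF aconv_conv_le fin]) auto
 have "conv (gk d) (conv (mlk al be m) f) t = conv (conv (gk d) (mlk al be m)) f t"
  by (rule conv_assoc) (use fin in auto)
 also have "conv (gk d) (mlk al be m) = mlk al (be + d) m" using mlk_conv[OF al be d(1)] by auto
 finally show "conv (gk d) (conv (mlk al be m) f) t = conv (mlk al (be + d) m) f t" .
qed

text \<open>The differential equation, integrated once in time. Since \<open>w(0) = a1\<close>, the Caputo derivative is
\<open>\<partial>\<^sub>t (g\<^sub>2\<^sub>-\<^sub>a\<^sub>l * w)\<close> minus \<open>a1 g\<^sub>2\<^sub>-\<^sub>a\<^sub>l\<close>, whence the term with \<open>a1\<close>.\<close>

lemma lin_caputo:
 assumes al: "1 < al" "al < 2" and f: "causal_L1loc f"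
 shows "conv (gk (2 - al)) (lin_w al m a0 a1 f) t =
  a1 * gk (3 - al) t + conv (gk 1) (%s. f s - m * lin_y al m a0 a1 f s) t"
proof -
 have a: "al > 0" "al - 1 > 0" "2 - al > 0" using al by auto
 note [measurable] = causal_L1locD(1)[OF f] mlk_measurable[OF a(1)]
 note Ly = lin_y_L1loc[OF a(1) f, of m a0 a1]
 let ?g1 = "gk 1"
 have fin1: "aconv ?g1 h t < top" if "causal_L1loc h" for h using that by (auto simp: causal_L1loc_iff)
 have "conv ?g1 (%s. 1 * f s + (- m) * lin_y al m a0 a1 f s) t = 1 * conv ?g1 f t + (- m) * conv ?g1 (lin_y al m a0 a1 f) t"
  by (rule aconv_lin(2)) (use fin1 f Ly causal_L1locD(1) in auto)
 moreover have "conv ?g1 (lin_y al m a0 a1 f) t = a0 * mlk al 2 m t + a1 * mlk al 3 m t + conv (mlk al (al + 1) m) f t"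
 proof -
  have "conv ?g1 (%s. 1 * (a0 * mlk al 1 m s + a1 * mlk al 2 m s) + 1 * conv (mlk al al m) f s) t =
   1 * conv ?g1 (%s. a0 * mlk al 1 m s + a1 * mlk al 2 m s) t + 1 * conv ?g1 (conv (mlk al al m) f) t"
   by (rule aconv_lin(2)) (auto intro!: fin1 L1loc_lin L1loc_mlk L1loc_conv_mlk f a)
  also have "conv ?g1 (%s. a0 * mlk al 1 m s + a1 * mlk al 2 m s) t = a0 * conv ?g1 (mlk al 1 m) t + a1 * conv ?g1 (mlk al 2 m) t"
   by (rule aconv_lin(2)) (auto intro!: fin1 L1loc_mlk a)
  finally show ?thesis
   using conv_mlk_add(2)[OF a(1) a(1) zero_less_one _ f, of m t] mlk_conv[OF a(1), of 1 1 m t] mlk_conv[OF a(1), of 2 1 m t] a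
   by (simp add: lin_y_def[abs_def])
 qed
 moreover have "conv (gk (2 - al)) (lin_w al m a0 a1 f) t =
  - m * a0 * mlk al 2 m t + a1 * mlk al (3 - al) m t + conv (mlk al 1 m) f t"
  using conv_lin_w(2)[OF al(1) a(3) _ f, of m a0 a1 t] by simp
 moreover have "mlk al (3 - al) m t = gk (3 - al) t - m * mlk al 3 m t"
  using mlk_rec[OF a(1), of "3 - al" m t] by simp
 moreover have "conv (mlk al 1 m) f t = conv ?g1 f t - m * conv (mlk al (al + 1) m) f t"
 proof -
  have fk: "aconv f (mlk al (al + 1) m) t < \<infinity>"
  proof -
   have "mlk al (al + 1) m = conv ?g1 (mlk al al m)" using mlk_conv[OF a(1,1), of 1] by auto
   then have "aconv f (mlk al (al + 1) m) t = aconv (conv ?g1 (mlk al al m)) f t" by (simp add: aconv_commute[of f])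
   also have "... <= (NN ta. aconv ?g1 (mlk al al m) (t - ta) * ennreal \<bar>f ta\<bar>)"
    unfolding aconv_def[of "conv _ _"] by (intro nn_integral_mono) (auto simp: abs_mult ennreal_mult intro!: mult_right_mono abs_conv_le_aconv)
   also have "... < \<infinity>" by (rule mlk_fin) (use a al f in auto)
   finally show ?thesis .
  qed
  have fg: "aconv f ?g1 t < \<infinity>" using fin1[OF f] by (simp add: aconv_commute[of f])
  have "conv f (%u. 1 * ?g1 u + (- m) * mlk al (al + 1) m u) t = 1 * conv f ?g1 t + (- m) * conv f (mlk al (al + 1) m) t"
   by (rule aconv_lin(2)) (use fk fg in auto)
  moreover have "mlk al 1 m = (%u. 1 * ?g1 u + (- m) * mlk al (al + 1) m u)"
   using mlk_rec[OF a(1), of 1 m] by (auto simp: add.commute)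
  ultimately show ?thesis by (simp add: conv_commute[of _ f])
 qed
 ultimately show ?thesis by (simp add: algebra_simps)
qed

section \<open>Restarting a problem with memory\<close>

definition shift :: "real => (real => real) => real => real" where
 "shift t1 f s = (if s > 0 then f (t1 + s) else 0)"

lemma shift_measurable [measurable]:
 assumes [measurable]: "f \<in> bor" shows "shift t1 f \<in> bor"
 unfolding shift_def[abs_def] by measurable

lemma AE_neq_lborel: "AE s in lborel. s \<noteq> (t::real)" by (simp add: AE_lborel_singleton)

lemma conv_shift:
 assumes [measurable]: "a \<in> bor" "f \<in> bor"
  and fin: "aconv a f (t1 + s) < \<infinity>"
 shows "conv a (shift t1 f) s = conv a f (t1 + s) - (LL ta. a (t1 + s - ta) * (ind {..<t1} ta * f ta))"
proof -
 have int: "integrable lborel (%ta. a (t1 + s - ta) * f ta)" by (rule aconv_integrable) (use fin in auto)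
 have int1: "integrable lborel (%ta. a (t1 + s - ta) * (ind {..<t1} ta * f ta))"
  by (rule Bochner_Integration.integrable_bound[OF int]) (auto simp: indicator_def)
 have int2: "integrable lborel (%ta. a (t1 + s - ta) * shift t1 f (ta - t1))"
  by (rule Bochner_Integration.integrable_bound[OF int]) (auto simp: shift_def)
 have "conv a (shift t1 f) s = (LL ta. a (t1 + s - ta) * shift t1 f (ta - t1))"
  unfolding conv_def using integral_lborel_shift[of "%ta. a (s - ta) * shift t1 f ta" t1]
  by (simp add: algebra_simps)
 also have "... + (LL ta. a (t1 + s - ta) * (ind {..<t1} ta * f ta)) = conv a f (t1 + s)"
  unfolding conv_def using AE_neq_lborel[of t1]
  by (subst Bochner_Integration.integral_add[OF int2 int1, symmetric], intro integral_cong_AE)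
   (auto simp: shift_def indicator_def elim!: eventually_mono)
 finally show ?thesis by simp
qed

lemma L1loc_shift:
 assumes "causal_L1loc f" shows "causal_L1loc (shift t1 f)"
 unfolding causal_L1loc_def
proof (intro conjI allI impI)
 note [measurable] = causal_L1locD(1)[OF assms]
 show "shift t1 f \<in> bor" by measurable
 fix S
 have "(NN s. ennreal \<bar>shift t1 f s\<bar> * ind {..S} s) =
  (NN s. ennreal \<bar>shift t1 f (s - t1)\<bar> * ind {..S} (s - t1))"
  by (rule nn_integral_lborel_shift[symmetric]) measurable
 also have "... <= (NN s. ennreal \<bar>f s\<bar> * ind {..t1 + S} s)"
  by (intro nn_integral_mono) (auto simp: shift_def indicator_def)
 also have "... < \<infinity>" by (rule causal_L1locD(3)[OF assms])
 finally show "(NN s. ennreal \<bar>shift t1 f s\<bar> * ind {..S} s) < \<infinity>" .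
qed (simp add: shift_def)

lemma conv_g1_shift:
 assumes f: "causal_L1loc f" and s: "s > 0"
 shows "conv (gk 1) (shift t1 f) s = conv (gk 1) f (t1 + s) - conv (gk 1) f t1"
proof -
 note [measurable] = causal_L1locD(1)[OF f]
 have "(LL ta. gk 1 (t1 + s - ta) * (ind {..<t1} ta * f ta)) = conv (gk 1) f t1"
  unfolding conv_def using s by (intro Bochner_Integration.integral_cong) (auto simp: g_kernel_1 indicator_def)
 then show ?thesis using conv_shift[of "gk 1" f t1 s] f by (auto simp: causal_L1loc_iff)
qed

text \<open>This is \<open>-g'\<^sub>2\<^sub>-\<^sub>a\<^sub>l\<close>: it appears when the part of the memory integral that belongs to times before \<open>t1\<close> is
differentiated.\<close>

definition hist_kernel :: "real => real => real" where
 "hist_kernel al s = (if s > 0 then (al - 1) / Gamma (2 - al) * s powr (- al) else 0)"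

text \<open>The force that the motion before \<open>t1\<close> exerts at a later time \<open>rh\<close>.\<close>

definition hist :: "real => real => (real => real) => real => real" where
 "hist al t1 w rh = (LL ta. hist_kernel al (rh - ta) * (ind {..<t1} ta * w ta))"

lemma hist_kernel_measurable [measurable]: "hist_kernel al \<in> bor"
 unfolding hist_kernel_def[abs_def] by measurable

lemma hist_kernel_nonneg: "1 < al ==> al < 2 ==> hist_kernel al s >= 0"
 by (auto simp: hist_kernel_def Gamma_real_pos less_imp_le)

lemma nn_integral_hist_kernel:
 assumes al: "1 < al" "al < 2" and u: "u > 0" and S: "S >= 0"
 shows "(NN s. ennreal (hist_kernel al (u + s)) * ind {0..S} s) =
  ennreal (gk (2 - al) u - gk (2 - al) (u + S))"
proof -
 have "(NN s. ennreal (hist_kernel al (u + s)) * ind {0..S} s) =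
  ennreal (- gk (2 - al) (u + S) - (- gk (2 - al) (u + 0)))"
 proof (rule nn_integral_FTC_Icc[where F = "%s. - gk (2 - al) (u + s)"])
  fix s assume "s \<in> {0..S}" then have "0 <= s" "s <= S" by auto
  then have us: "u + s > 0" using u by simp
  define c where "c = 1 / Gamma (2 - al)"
  have "((%s. - (c * (u + s) powr (1 - al))) has_real_derivative (al - 1) * c * (u + s) powr (- al)) (at s)"
   using us by (auto intro!: derivative_eq_intros simp: algebra_simps)
  then have d: "((%s. - ((u + s) powr (1 - al) / Gamma (2 - al))) has_real_derivative hist_kernel al (u + s)) (at s)"
   using us by (simp add: hist_kernel_def c_def)
  have "eventually (%s. s \<in> {-u<..}) (nhds s)"
   by (rule eventually_nhds_in_open) (use us in auto)
  then have ev: "eventually (%s. - ((u + s) powr (1 - al) / Gamma (2 - al)) = - gk (2 - al) (u + s)) (nhds s)"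
   by eventually_elim (simp add: g_kernel_def)
  show "DERIV (%s. - gk (2 - al) (u + s)) s :> hist_kernel al (u + s)"
   by (rule iffD1[OF DERIV_cong_ev[OF refl ev refl] d])
 qed (use al S hist_kernel_nonneg in auto)
 then show ?thesis by simp
qed

lemma hist_measurable [measurable]:
 assumes [measurable]: "w \<in> bor" shows "hist al t1 w \<in> bor"
 unfolding hist_def[abs_def] by measurable

text \<open>Integrating \<open>hist_kernel\<close> over \<open>s\<close> gives differences of \<open>g\<^sub>2\<^sub>-\<^sub>a\<^sub>l\<close>, which are at most \<open>g\<^sub>2\<^sub>-\<^sub>a\<^sub>l(t1 - ta)\<close>. So the
history is integrable in time even though its kernel is not.\<close>

lemma hist_double_integral:
 assumes al: "1 < al" "al < 2" and [measurable]: "w \<in> bor"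
  and S: "S >= 0" and p: "\<And>s. p s = ennreal (if 0 < s \<and> s < S then 1 else 0)"
 shows "(NN ta. \<integral>\<^sup>+s. p s * ennreal \<bar>hist_kernel al (t1 + s - ta) * (ind {..<t1} ta * w ta)\<bar> \<partial>lborel)
  <= aconv (gk (2 - al)) w t1"
 unfolding aconv_def
proof (intro nn_integral_mono)
 fix ta
 have pm [measurable]: "p \<in> bor"
 proof -
  have "p = (%s. ennreal (if 0 < s \<and> s < S then 1 else 0))" using p by auto
  then show ?thesis by simp
 qed
 show "(NN s. p s * ennreal \<bar>hist_kernel al (t1 + s - ta) * (ind {..<t1} ta * w ta)\<bar>)
  <= ennreal \<bar>gk (2 - al) (t1 - ta) * w ta\<bar>"
 proof (cases "ta < t1")
  case True
  have "(NN s. p s * ennreal \<bar>hist_kernel al (t1 + s - ta) * (ind {..<t1} ta * w ta)\<bar>) \<le>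
   (NN s. (ennreal (hist_kernel al ((t1 - ta) + s)) * ind {0..S} s) * ennreal \<bar>w ta\<bar>)"
   using True hist_kernel_nonneg[OF al]
   by (intro nn_integral_mono) (auto simp: p indicator_def abs_mult ennreal_mult algebra_simps)
  also have "... = ennreal (gk (2 - al) (t1 - ta) - gk (2 - al) (t1 - ta + S)) * ennreal \<bar>w ta\<bar>"
   using nn_integral_hist_kernel[OF al, of "t1 - ta" S] True S by (subst nn_integral_multc) auto
  also have "... <= ennreal (gk (2 - al) (t1 - ta)) * ennreal \<bar>w ta\<bar>"
   using al by (intro mult_right_mono ennreal_leI) (auto simp: g_kernel_nonneg)
  also have "... = ennreal \<bar>gk (2 - al) (t1 - ta) * w ta\<bar>"
   using al by (simp add: abs_mult ennreal_mult g_kernel_nonneg)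
  finally show ?thesis .
 qed simp
qed

lemma
 assumes al: "1 < al" "al < 2" and w: "causal_L1loc w"
  and fin: "aconv (gk (2 - al)) w t1 < \<infinity>"
 shows L1loc_shift_hist: "causal_L1loc (shift t1 (hist al t1 w))"
  and conv_g1_shift_hist: "sg > 0 ==> conv (gk 1) (shift t1 (hist al t1 w)) sg =
   (LL ta. (gk (2 - al) (t1 - ta) - gk (2 - al) (t1 + sg - ta)) * (ind {..<t1} ta * w ta))"
proof -
 note [measurable] = causal_L1locD(1)[OF w]
 let ?k = "hist_kernel al" and ?v = "%ta. ind {..<t1} ta * w ta" and ?g = "gk (2 - al)"
 show "causal_L1loc (shift t1 (hist al t1 w))"
  unfolding causal_L1loc_def
 proof (intro conjI allI impI)
  fix S :: real
  define S' where "S' = max 0 S + 1"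
  define p where "p s = ennreal (if 0 < s \<and> s < S' then 1 else 0)" for s :: real
  have [measurable]: "p \<in> bor" unfolding p_def[abs_def] by measurable
  have "(NN s. ennreal \<bar>shift t1 (hist al t1 w) s\<bar> * ind {..S} s) \<le>
   (NN s. \<integral>\<^sup>+ta. p s * ennreal \<bar>?k (t1 + s - ta) * ?v ta\<bar> \<partial>lborel)"
  proof (intro nn_integral_mono)
   fix s
   have "ennreal \<bar>hist al t1 w (t1 + s)\<bar> <= (NN ta. ennreal \<bar>?k (t1 + s - ta) * ?v ta\<bar>)"
    using abs_conv_le_aconv[of ?k ?v "t1 + s"] by (simp add: conv_def aconv_def hist_def)
   then show "ennreal \<bar>shift t1 (hist al t1 w) s\<bar> * ind {..S} s <= (NN ta. p s * ennreal \<bar>?k (t1 + s - ta) * ?v ta\<bar>)"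
    by (subst nn_integral_cmult) (auto simp: shift_def indicator_def p_def S'_def)
  qed
  also have "... = (NN ta. \<integral>\<^sup>+s. p s * ennreal \<bar>?k (t1 + s - ta) * ?v ta\<bar> \<partial>lborel)"
   by (rule lborel_pair.Fubini') measurable
  also have "... <= aconv ?g w t1" by (rule hist_double_integral[OF al]) (auto simp: p_def S'_def)
  also note fin
  finally show "(NN s. ennreal \<bar>shift t1 (hist al t1 w) s\<bar> * ind {..S} s) < \<infinity>" .
 qed (auto simp: shift_def)
 show "conv (gk 1) (shift t1 (hist al t1 w)) sg =
   (LL ta. (?g (t1 - ta) - ?g (t1 + sg - ta)) * ?v ta)" if sg: "sg > 0"
 proof -
  define P :: "real => real" where "P s = (if 0 < s \<and> s < sg then 1 else 0)" for s
  have [measurable]: "P \<in> bor" unfolding P_def[abs_def] by measurable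
  let ?F = "%ta s. P s * (?k (t1 + s - ta) * ?v ta)"
  have "(NN ta. \<integral>\<^sup>+s. ennreal \<bar>?F ta s\<bar> \<partial>lborel) =
   (NN ta. \<integral>\<^sup>+s. ennreal (P s) * ennreal \<bar>?k (t1 + s - ta) * ?v ta\<bar> \<partial>lborel)"
   by (intro nn_integral_cong) (auto simp: P_def)
  also have "... <= aconv ?g w t1" using sg by (intro hist_double_integral[OF al]) (auto simp: P_def)
  also note fin
  finally have iF: "integrable (lborel \<Otimes>\<^sub>M lborel) (%(ta, s). ?F ta s)"
   by (intro integrableI_bounded) (auto simp: lborel.nn_integral_fst[symmetric])
  have "conv (gk 1) (shift t1 (hist al t1 w)) sg = (LL s. \<integral>ta. ?F ta s \<partial>lborel)"
   unfolding conv_def hist_def shift_def P_def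
   by (intro Bochner_Integration.integral_cong) (auto simp: g_kernel_1)
  also have "... = (LL ta. \<integral>s. ?F ta s \<partial>lborel)" by (rule lborel_pair.Fubini_integral[OF iF])
  also have "... = (LL ta. (?g (t1 - ta) - ?g (t1 + sg - ta)) * ?v ta)"
  proof (rule Bochner_Integration.integral_cong[OF refl])
   fix ta
   show "(LL s. ?F ta s) = (?g (t1 - ta) - ?g (t1 + sg - ta)) * ?v ta"
   proof (cases "ta < t1")
    case True
    have nn: "(NN s. ennreal (P s * ?k ((t1 - ta) + s))) = ennreal (?g (t1 - ta) - ?g (t1 - ta + sg))"
    proof -
     have "(NN s. ennreal (P s * ?k ((t1 - ta) + s))) = (NN s. ennreal (?k ((t1 - ta) + s)) * ind {0..sg} s)"
      using AE_neq_lborel[of 0] AE_neq_lborel[of sg]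
      by (intro nn_integral_cong_AE, eventually_elim) (auto simp: P_def indicator_def)
     then show ?thesis using nn_integral_hist_kernel[OF al, of "t1 - ta" sg] True sg by simp
    qed
    have "?g (t1 - ta + sg) <= ?g (t1 - ta)"
     using True sg al Gamma_real_pos[of "2 - al"] powr_mono2'[of "1 - al" "t1 - ta" "t1 - ta + sg"]
     by (auto simp: g_kernel_def divide_right_mono)
    then have "(LL s. P s * ?k ((t1 - ta) + s)) = ?g (t1 - ta) - ?g (t1 - ta + sg)"
     using nn hist_kernel_nonneg[OF al] nn_integral_eq_integrable[of "%s. P s * ?k ((t1 - ta) + s)" lborel "?g (t1 - ta) - ?g (t1 - ta + sg)"]
     by (auto simp: P_def)
    moreover have "(LL s. ?F ta s) = (LL s. P s * ?k ((t1 - ta) + s)) * ?v ta"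
     by (subst integral_mult_left_zero[symmetric]) (simp add: algebra_simps)
    moreover have "t1 - ta + sg = t1 + sg - ta" by simp
    ultimately show ?thesis by (simp only:)
   qed simp
  qed
  finally show ?thesis .
 qed
qed

text \<open>Subtract the equation integrated up to \<open>t1\<close> from the one integrated up to \<open>t1 + s\<close>. The shifted solution then
satisfies a problem of the same type on \<open>{0<..}\<close> with zero initial velocity, in which the history and the
initial velocity have become sources, and \<open>resolvent_solution\<close> solves it.\<close>

lemma memory_representation:
 fixes a0 a1 m :: real
 assumes al: "1 < al" "al < 2" and f: "causal_L1loc f" and t1: "t1 > 0" and sg: "sg > 0"
 defines "w \<equiv> lin_w al m a0 a1 f"
 shows "lin_y al m a0 a1 f (t1 + sg) = lin_y al m a0 a1 f t1 * mlk al 1 m sg +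
  conv (mlk al al m) (shift t1 (%rh. a1 * gk (2 - al) rh + f rh + hist al t1 w rh)) sg"
proof -
 have a: "al > 0" "al - 1 > 0" "2 - al > 0" using al by auto
 let ?y = "lin_y al m a0 a1 f" and ?g = "gk (2 - al)" and ?g1 = "gk 1"
 let ?F = "shift t1 (%rh. a1 * ?g rh + f rh + hist al t1 w rh)"
 have Lw: "causal_L1loc w" unfolding w_def by (intro lin_w_L1loc al f)
 have Ly: "causal_L1loc ?y" by (intro lin_y_L1loc a f)
 note [measurable] = causal_L1locD(1)[OF f] causal_L1locD(1)[OF Lw] causal_L1locD(1)[OF Ly]
 have fin: "aconv ?g w t < \<infinity>" for t unfolding w_def using al by (intro conv_lin_w f) auto
 have Lh: "causal_L1loc (shift t1 (hist al t1 w))" by (rule L1loc_shift_hist[OF al Lw fin])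
 have Lsg: "causal_L1loc (shift t1 ?g)" by (intro L1loc_shift L1loc_g a)
 have Lsf: "causal_L1loc (shift t1 f)" by (intro L1loc_shift f)
 have Lsy: "causal_L1loc (shift t1 ?y)" by (intro L1loc_shift Ly)
 have Feq: "?F = (%s. 1 * (a1 * shift t1 ?g s + 1 * shift t1 f s) + 1 * shift t1 (hist al t1 w) s)"
  by (auto simp: shift_def)
 have LF: "causal_L1loc ?F" unfolding Feq by (intro L1loc_lin Lsg Lsf Lh)
 have fin1: "aconv ?g1 h s < top" if "causal_L1loc h" for h s using that by (auto simp: causal_L1loc_iff)
 have yint: "?y t = a0 * ?g1 t + conv ?g1 w t" for t unfolding w_def by (rule lin_y_eq_integral[OF al(1) f])
 have conv0: "conv d (shift t1 h) s = 0" if "s <= 0" "\<And>s. s <= 0 ==> d s = 0" for d h s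
  using that by (intro conv_nonpos) (auto simp: shift_def)
 have 1: "shift t1 ?y s = ?y t1 * ?g1 s + conv ?g1 (shift t1 w) s" for s
 proof (cases "s > 0")
  case True
  then show ?thesis using t1 conv_g1_shift[OF Lw True, of t1] yint[of t1] yint[of "t1 + s"]
   by (simp add: shift_def g_kernel_1)
 qed (simp add: shift_def g_kernel_1 conv0)
 have 2: "conv ?g (shift t1 w) s = conv ?g1 (%r. ?F r - m * shift t1 ?y r) s" for s
 proof (cases "s > 0")
  case s: True
  let ?G = "%r. 1 * f r + (- m) * ?y r"
  have LG: "causal_L1loc ?G" by (intro L1loc_lin f Ly)
  have cap: "conv ?g w t = a1 * gk (3 - al) t + conv ?g1 ?G t" for t
   using lin_caputo[OF al f, of m a0 a1 t] by (simp add: w_def)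
  have g3: "conv ?g1 ?g t = gk (3 - al) t" for t using conv_g_kernel[of 1 "2 - al" t] a by simp
  have i: "integrable lborel (%ta. ?g (t - ta) * (ind {..<t1} ta * w ta))" for t
   by (rule Bochner_Integration.integrable_bound[OF aconv_integrable[OF _ _ fin[of t]]]) (auto simp: indicator_def)
  have "conv ?g (shift t1 w) s = conv ?g w (t1 + s) - (LL ta. ?g (t1 + s - ta) * (ind {..<t1} ta * w ta))"
   by (rule conv_shift) (use fin in auto)
  moreover have "conv ?g w t1 = (LL ta. ?g (t1 - ta) * (ind {..<t1} ta * w ta))"
   unfolding conv_def by (intro Bochner_Integration.integral_cong) (auto simp: indicator_def)
  moreover have "conv ?g1 (shift t1 (hist al t1 w)) s =
   (LL ta. ?g (t1 - ta) * (ind {..<t1} ta * w ta)) - (LL ta. ?g (t1 + s - ta) * (ind {..<t1} ta * w ta))"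
   using conv_g1_shift_hist[OF al Lw fin s] i by (simp add: left_diff_distrib)
  ultimately have "conv ?g (shift t1 w) s = conv ?g w (t1 + s) - conv ?g w t1 + conv ?g1 (shift t1 (hist al t1 w)) s"
   by linarith
  also have "conv ?g w (t1 + s) - conv ?g w t1 = a1 * conv ?g1 (shift t1 ?g) s + conv ?g1 (shift t1 ?G) s"
   unfolding cap conv_g1_shift[OF LG s] conv_g1_shift[OF L1loc_g[OF a(3)] s] g3 by (simp add: algebra_simps)
  finally have l: "conv ?g (shift t1 w) s = a1 * conv ?g1 (shift t1 ?g) s + conv ?g1 (shift t1 ?G) s + conv ?g1 (shift t1 (hist al t1 w)) s"
   by simp
  have e1: "(%r. ?F r - m * shift t1 ?y r) = (%r. 1 * (a1 * shift t1 ?g r + 1 * shift t1 ?G r) + 1 * shift t1 (hist al t1 w) r)"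
   by (auto simp: shift_def)
  have e2: "conv ?g1 (%r. 1 * (a1 * shift t1 ?g r + 1 * shift t1 ?G r) + 1 * shift t1 (hist al t1 w) r) s =
   1 * conv ?g1 (%r. a1 * shift t1 ?g r + 1 * shift t1 ?G r) s + 1 * conv ?g1 (shift t1 (hist al t1 w)) s"
  proof -
   have LsG: "causal_L1loc (%r. a1 * shift t1 ?g r + 1 * shift t1 ?G r)"
    by (intro L1loc_lin Lsg L1loc_shift[OF LG])
   show ?thesis
    by (rule aconv_lin(2)) (use fin1[OF LsG] fin1[OF Lh] causal_L1locD(1)[OF LsG] in auto)
  qed
  have e3: "conv ?g1 (%r. a1 * shift t1 ?g r + 1 * shift t1 ?G r) s = a1 * conv ?g1 (shift t1 ?g) s + 1 * conv ?g1 (shift t1 ?G) s"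
   by (rule aconv_lin(2)) (use fin1[OF Lsg] fin1[OF L1loc_shift[OF LG]] causal_L1locD(1)[OF L1loc_shift[OF LG]] in auto)
  show ?thesis unfolding e1 e2 e3 l by simp
 next
  case False
  have "conv ?g (shift t1 w) s = 0" using False by (intro conv0) auto
  moreover have "conv ?g1 (%r. ?F r - m * shift t1 ?y r) s = 0"
   using False by (intro conv_nonpos) (auto simp: shift_def)
  ultimately show ?thesis by simp
 qed
 have "shift t1 ?y sg = ?y t1 * mlk al 1 m sg + conv (mlk al al m) ?F sg"
  by (rule resolvent_solution[OF al L1loc_shift[OF Lw] LF 1 2])
 then show ?thesis using sg by (simp add: shift_def)
qed

section \<open>The space of square integrable functions\<close>

lemma abs_powr_2: "\<bar>x\<bar> powr 2 = (x::real)\<^sup>2"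
 by (simp add: powr_numeral)

lemma L2_iff: "g \<in> L2 M \<longleftrightarrow> g \<in> borel_measurable M \<and> integrable M (%x. (g x)\<^sup>2)"
 by (simp add: Lp_def abs_powr_2)

lemma L2_norm_eq: "nrm M g = sqrt (\<integral>x. (g x)\<^sup>2 \<partial>M)"
 by (simp add: Lp_norm_def abs_powr_2 powr_half_sqrt)

lemma L2D: "g \<in> L2 M ==> g \<in> borel_measurable M" "g \<in> L2 M ==> integrable M (%x. (g x)\<^sup>2)"
 by (auto simp: L2_iff)

lemma L2_norm_nonneg [simp]: "nrm M g >= 0" by (simp add: L2_norm_eq)

lemma L2_norm_sq: "(nrm M g)\<^sup>2 = (\<integral>x. (g x)\<^sup>2 \<partial>M)" by (simp add: L2_norm_eq)

lemma nn_L2_norm: "g \<in> L2 M ==> (\<integral>\<^sup>+x. ennreal ((g x)\<^sup>2) \<partial>M) = ennreal ((nrm M g)\<^sup>2)"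
 unfolding L2_norm_sq by (rule nn_integral_eq_integral) (auto simp: L2_iff)

text \<open>Membership and norm bound in one step, from an integral that is defined without knowing integrability.\<close>

lemma L2I_nn:
 assumes [measurable]: "g \<in> borel_measurable M" and B: "(\<integral>\<^sup>+x. ennreal ((g x)\<^sup>2) \<partial>M) <= ennreal (B\<^sup>2)" "B >= 0"
 shows "g \<in> L2 M" "nrm M g <= B"
proof -
 have "integrable M (%x. (g x)\<^sup>2)"
  by (rule integrableI_bounded) (use B in \<open>auto intro: order_le_less_trans\<close>)
 then show g: "g \<in> L2 M" by (simp add: L2_iff)
 have "(nrm M g)\<^sup>2 <= B\<^sup>2" using nn_L2_norm[OF g] B by simp
 then show "nrm M g <= B" using B(2) by (rule power2_le_imp_le)
qed

lemma L2_norm_AE_cong: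
 assumes "AE x in M. g x = h x" "g \<in> borel_measurable M" "h \<in> borel_measurable M"
 shows "nrm M g = nrm M h" "g \<in> L2 M \<longleftrightarrow> h \<in> L2 M"
proof -
 have ae: "AE x in M. (g x)\<^sup>2 = (h x)\<^sup>2" using assms(1) by eventually_elim simp
 show "nrm M g = nrm M h" unfolding L2_norm_eq
  using assms ae by (intro arg_cong[where f = sqrt] integral_cong_AE) auto
 show "g \<in> L2 M \<longleftrightarrow> h \<in> L2 M" unfolding L2_iff using assms(2,3) integrable_cong_AE[OF _ _ ae] by auto
qed

lemma L2_mono:
 assumes [measurable]: "g \<in> borel_measurable M" and h: "h \<in> L2 M" and C: "C >= 0"
  and le: "AE x in M. \<bar>g x\<bar> <= C * \<bar>h x\<bar>"
 shows "g \<in> L2 M" "nrm M g <= C * nrm M h"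
proof -
 note [measurable] = L2D(1)[OF h]
 have "(\<integral>\<^sup>+x. ennreal ((g x)\<^sup>2) \<partial>M) <= (\<integral>\<^sup>+x. ennreal (C\<^sup>2) * ennreal ((h x)\<^sup>2) \<partial>M)"
 proof (rule nn_integral_mono_AE, use le in eventually_elim)
  fix x assume "\<bar>g x\<bar> <= C * \<bar>h x\<bar>"
  then have "\<bar>g x\<bar>\<^sup>2 <= (C * \<bar>h x\<bar>)\<^sup>2" by (intro power_mono) auto
  then show "ennreal ((g x)\<^sup>2) <= ennreal (C\<^sup>2) * ennreal ((h x)\<^sup>2)"
   by (simp add: ennreal_mult[symmetric] power_mult_distrib ennreal_leI)
 qed
 also have "... = ennreal ((C * nrm M h)\<^sup>2)"
  by (subst nn_integral_cmult) (auto simp: nn_L2_norm[OF h] ennreal_mult[symmetric] power_mult_distrib)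
 finally show "g \<in> L2 M" "nrm M g <= C * nrm M h"
  using L2I_nn[of g M "C * nrm M h"] C by auto
qed

lemma L2_scale: "g \<in> L2 M ==> (%x. c * g x) \<in> L2 M"
 by (auto simp: L2_iff power_mult_distrib)

lemma L2_norm_scale: "nrm M (%x. c * g x) = \<bar>c\<bar> * nrm M g"
 by (simp add: L2_norm_eq power_mult_distrib real_sqrt_mult)

lemma L2_zero [simp]: "(%x. 0) \<in> L2 M" by (simp add: L2_iff)

lemma L2_norm_zero [simp]: "nrm M (%x. 0) = 0" by (simp add: L2_norm_eq)

lemma L2_norm_uminus: "nrm M (%x. - g x) = nrm M g" by (simp add: L2_norm_eq)

lemma L2_norm_minus_commute: "nrm M (%x. g x - h x) = nrm M (%x. h x - g x)"
 by (simp add: L2_norm_eq power2_commute)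

lemma L2_norm_eq_0D:
 assumes "g \<in> L2 M" "nrm M g <= 0" shows "AE x in M. g x = 0"
proof -
 have "(\<integral>x. (g x)\<^sup>2 \<partial>M) = 0" using assms(2) L2_norm_nonneg[of M g] L2_norm_sq[of M g] by simp
 then have "AE x in M. (g x)\<^sup>2 = 0"
  using integral_nonneg_eq_0_iff_AE[OF L2D(2)[OF assms(1)]] by simp
 then show ?thesis by eventually_elim simp
qed

lemma L2_product_integrable:
 assumes "g \<in> L2 M" "h \<in> L2 M" shows "integrable M (%x. g x * h x)"
proof (rule Bochner_Integration.integrable_bound)
 show "integrable M (%x. (g x)\<^sup>2 + (h x)\<^sup>2)" using assms by (auto simp: L2_iff)
 show "(%x. g x * h x) \<in> borel_measurable M" using assms by (auto simp: L2_iff)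
 have "\<bar>a * b\<bar> <= \<bar>a\<^sup>2 + b\<^sup>2\<bar>" for a b :: real
 proof -
  have "0 <= (\<bar>a\<bar> - \<bar>b\<bar>)\<^sup>2" by simp
  then have "2 * \<bar>a * b\<bar> <= a\<^sup>2 + b\<^sup>2" by (simp add: power2_diff abs_mult)
  then show ?thesis by linarith
 qed
 then show "AE x in M. norm (g x * h x) <= norm ((g x)\<^sup>2 + (h x)\<^sup>2)" by simp
qed

lemma L2_Cauchy_Schwarz:
 assumes g: "g \<in> L2 M" and h: "h \<in> L2 M"
 shows "(\<integral>x. g x * h x \<partial>M) <= nrm M g * nrm M h"
proof -
 define a b where "a = nrm M g" and "b = nrm M h"
 have ab: "a >= 0" "b >= 0" by (auto simp: a_def b_def)
 have i: "integrable M (%x. g x * h x)" by (rule L2_product_integrable[OF g h])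
 show ?thesis
 proof (cases "a = 0 \<or> b = 0")
  case True
  then have "AE x in M. g x * h x = 0"
   using L2_norm_eq_0D[OF g] L2_norm_eq_0D[OF h] by (auto simp: a_def b_def elim!: eventually_mono)
  then have "(\<integral>x. g x * h x \<partial>M) = (\<integral>x. 0 \<partial>M)" using i by (intro integral_cong_AE) auto
  then show ?thesis using ab by (simp add: a_def b_def)
 next
  case False
  have "0 <= (\<integral>x. (b * g x - a * h x)\<^sup>2 \<partial>M)" by simp
  also have "... = (\<integral>x. b\<^sup>2 * (g x)\<^sup>2 - 2 * a * b * (g x * h x) + a\<^sup>2 * (h x)\<^sup>2 \<partial>M)"
   by (intro Bochner_Integration.integral_cong) (auto simp: power2_eq_square algebra_simps)
  also have "... = b\<^sup>2 * a\<^sup>2 - 2 * a * b * (\<integral>x. g x * h x \<partial>M) + a\<^sup>2 * b\<^sup>2"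
   using i L2D(2)[OF g] L2D(2)[OF h] L2_norm_sq[of M g] L2_norm_sq[of M h] by (simp add: a_def b_def)
  finally have "2 * (a * b) * (\<integral>x. g x * h x \<partial>M) <= 2 * (a * b) * (a * b)"
   by (simp add: power2_eq_square algebra_simps)
  moreover have "2 * (a * b) > 0" using False ab by auto
  ultimately show ?thesis by (simp only: a_def[symmetric] b_def[symmetric] mult_le_cancel_left_pos)
 qed
qed

lemma L2_add: "g \<in> L2 M ==> h \<in> L2 M ==> (%x. g x + h x) \<in> L2 M"
 using L2_product_integrable[of g M h] by (auto simp: L2_iff power2_sum mult.assoc)

lemma L2_norm_triangle:
 assumes g: "g \<in> L2 M" and h: "h \<in> L2 M"
 shows "nrm M (%x. g x + h x) <= nrm M g + nrm M h"
proof (rule power2_le_imp_le)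
 have "(nrm M (%x. g x + h x))\<^sup>2 = (\<integral>x. (g x)\<^sup>2 + 2 * (g x * h x) + (h x)\<^sup>2 \<partial>M)"
  unfolding L2_norm_sq by (intro Bochner_Integration.integral_cong) (auto simp: power2_sum)
 also have "... = (nrm M g)\<^sup>2 + 2 * (\<integral>x. g x * h x \<partial>M) + (nrm M h)\<^sup>2"
  using g h L2_product_integrable[OF g h] by (simp add: L2_norm_sq L2_iff)
 also have "... <= (nrm M g)\<^sup>2 + 2 * (nrm M g * nrm M h) + (nrm M h)\<^sup>2"
  using L2_Cauchy_Schwarz[OF g h] by simp
 finally show "(nrm M (%x. g x + h x))\<^sup>2 <= (nrm M g + nrm M h)\<^sup>2"
  by (simp add: power2_sum mult.assoc)
qed simp

lemma L2_uminus: "g \<in> L2 M ==> (%x. - g x) \<in> L2 M" by (auto simp: L2_iff)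

lemma L2_diff: "g \<in> L2 M ==> h \<in> L2 M ==> (%x. g x - h x) \<in> L2 M"
 using L2_add[of g M "%x. - h x"] L2_uminus[of h M] by simp

lemma L2_norm_diff_triangle:
 assumes "g \<in> L2 M" "h \<in> L2 M" "k \<in> L2 M"
 shows "nrm M (%x. g x - k x) <= nrm M (%x. g x - h x) + nrm M (%x. h x - k x)"
 using L2_norm_triangle[OF L2_diff[OF assms(1,2)] L2_diff[OF assms(2,3)]] by simp

lemma L2_norm_le_add_diff:
 assumes "g \<in> L2 M" "h \<in> L2 M"
 shows "nrm M g <= nrm M h + nrm M (%x. g x - h x)"
 using L2_norm_triangle[OF assms(2) L2_diff[OF assms]] by simp

lemma L2_norm_abs_diff:
 assumes "g \<in> L2 M" "h \<in> L2 M"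
 shows "\<bar>nrm M g - nrm M h\<bar> <= nrm M (%x. g x - h x)"
 using L2_norm_le_add_diff[OF assms] L2_norm_le_add_diff[OF assms(2,1)] L2_norm_minus_commute[of M g h] by linarith

lemma L2_mult_bounded:
 assumes [measurable]: "b \<in> borel_measurable M" and g: "g \<in> L2 M" and C: "C >= 0" "AE x in M. \<bar>b x\<bar> <= C"
 shows "(%x. b x * g x) \<in> L2 M" "nrm M (%x. b x * g x) <= C * nrm M g"
proof -
 note [measurable] = L2D(1)[OF g]
 have "AE x in M. \<bar>b x * g x\<bar> <= C * \<bar>g x\<bar>"
  using C(2) by eventually_elim (simp add: abs_mult mult_right_mono)
 then show "(%x. b x * g x) \<in> L2 M" "nrm M (%x. b x * g x) <= C * nrm M g"
  using L2_mono[of "%x. b x * g x" M g C] g C by auto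
qed

lemma L2_norm_measurable:
 assumes "sigma_finite_measure M" "(%(ta, x). F ta x) \<in> borel_measurable (N \<Otimes>\<^sub>M M)"
 shows "(%ta. nrm M (F ta)) \<in> borel_measurable N"
proof -
 interpret sigma_finite_measure M by fact
 note [measurable] = assms(2)
 show ?thesis unfolding L2_norm_eq by measurable
qed

text \<open>Square the inner integral, write it as a double integral and apply the Cauchy--Schwarz inequality in \<open>x\<close>
for each pair of parameters. All operators on curves are defined pointwise in \<open>x\<close> below, and this
inequality is what makes them act between spaces of square integrable functions.\<close>

lemma Minkowski_integral:
 assumes N: "sigma_finite_measure N" and M: "sigma_finite_measure M"
  and [measurable]: "(%(ta, x). F ta x) \<in> borel_measurable (N \<Otimes>\<^sub>M M)" "ph \<in> borel_measurable N"
  and le: "AE ta in N. F ta \<in> L2 M \<and> nrm M (F ta) <= ph ta"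
  and B: "(\<integral>\<^sup>+ta. ennreal (ph ta) \<partial>N) <= ennreal B" "B >= 0"
 shows "AE x in M. integrable N (%ta. F ta x)"
  and "(%x. \<integral>ta. F ta x \<partial>N) \<in> L2 M"
  and "nrm M (%x. \<integral>ta. F ta x \<partial>N) <= B"
proof -
 interpret NM: pair_sigma_finite N M by (intro pair_sigma_finite.intro N M)
 interpret N: sigma_finite_measure N by fact
 interpret M: sigma_finite_measure M by fact
 have [measurable]: "(%(x, ta). F ta x) \<in> borel_measurable (M \<Otimes>\<^sub>M N)"
  using measurable_pair_swap[OF assms(3)] by (simp add: split_beta')
 define G where "G x = (\<integral>\<^sup>+ta. ennreal \<bar>F ta x\<bar> \<partial>N)" for x
 have [measurable]: "G \<in> borel_measurable M" unfolding G_def by measurable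
 have "(\<integral>\<^sup>+x. G x * G x \<partial>M) = (\<integral>\<^sup>+x. \<integral>\<^sup>+ta. ennreal \<bar>F ta x\<bar> * G x \<partial>N \<partial>M)"
  unfolding G_def by (intro nn_integral_cong) (auto simp: nn_integral_multc)
 also have "... = (\<integral>\<^sup>+ta. \<integral>\<^sup>+x. ennreal \<bar>F ta x\<bar> * G x \<partial>M \<partial>N)"
  by (rule NM.Fubini') measurable
 also have "... = (\<integral>\<^sup>+ta. \<integral>\<^sup>+x. \<integral>\<^sup>+sg. ennreal \<bar>F ta x\<bar> * ennreal \<bar>F sg x\<bar> \<partial>N \<partial>M \<partial>N)"
  unfolding G_def by (intro nn_integral_cong) (auto simp: nn_integral_cmult)
 also have "... = (\<integral>\<^sup>+ta. \<integral>\<^sup>+sg. \<integral>\<^sup>+x. ennreal \<bar>F ta x\<bar> * ennreal \<bar>F sg x\<bar> \<partial>M \<partial>N \<partial>N)"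
  by (intro nn_integral_cong NM.Fubini') measurable
 also have "... <= (\<integral>\<^sup>+ta. \<integral>\<^sup>+sg. ennreal (ph ta) * ennreal (ph sg) \<partial>N \<partial>N)"
 proof (rule nn_integral_mono_AE, use le in eventually_elim, rule nn_integral_mono_AE, use le in eventually_elim)
  fix ta sg assume 1: "F ta \<in> L2 M \<and> nrm M (F ta) <= ph ta" and 2: "F sg \<in> L2 M \<and> nrm M (F sg) <= ph sg"
  have abs: "(%x. \<bar>F rh x\<bar>) \<in> L2 M" "nrm M (%x. \<bar>F rh x\<bar>) = nrm M (F rh)" if "F rh \<in> L2 M" for rh
   using that by (auto simp: L2_iff L2_norm_eq)
  have "(\<integral>\<^sup>+x. ennreal \<bar>F ta x\<bar> * ennreal \<bar>F sg x\<bar> \<partial>M) = ennreal (\<integral>x. \<bar>F ta x\<bar> * \<bar>F sg x\<bar> \<partial>M)"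
   using L2_product_integrable[OF abs(1) abs(1)] 1 2 by (subst nn_integral_eq_integral[symmetric]) (auto simp: ennreal_mult)
  also have "... <= ennreal (nrm M (F ta) * nrm M (F sg))"
   using L2_Cauchy_Schwarz[OF abs(1) abs(1)] 1 2 abs(2) by (intro ennreal_leI) simp
  also have "... <= ennreal (ph ta * ph sg)"
   using 1 2 by (intro ennreal_leI mult_mono) (auto intro: order_trans[OF L2_norm_nonneg])
  also have "... = ennreal (ph ta) * ennreal (ph sg)"
   using 1 2 order_trans[OF L2_norm_nonneg] by (intro ennreal_mult) blast+
  finally show "(\<integral>\<^sup>+x. ennreal \<bar>F ta x\<bar> * ennreal \<bar>F sg x\<bar> \<partial>M) <= ennreal (ph ta) * ennreal (ph sg)" .
 qed
 also have "... = (\<integral>\<^sup>+ta. ennreal (ph ta) \<partial>N) * (\<integral>\<^sup>+ta. ennreal (ph ta) \<partial>N)"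
  by (simp add: nn_integral_cmult nn_integral_multc)
 also have "... <= ennreal B * ennreal B" using B by (intro mult_mono) auto
 finally have GB: "(\<integral>\<^sup>+x. G x * G x \<partial>M) <= ennreal (B\<^sup>2)" using B by (simp add: ennreal_mult[symmetric] power2_eq_square)
 have "AE x in M. G x * G x \<noteq> \<infinity>"
  by (rule nn_integral_PInf_AE) (use GB in \<open>auto simp: top_unique\<close>)
 then have Gfin: "AE x in M. G x < \<infinity>" by eventually_elim (auto simp: less_top[symmetric] ennreal_mult_eq_top_iff)
 show "AE x in M. integrable N (%ta. F ta x)"
  using Gfin AE_space
 proof eventually_elim
  fix x assume "G x < \<infinity>" and [measurable]: "x \<in> space M"
  then show "integrable N (%ta. F ta x)" by (intro integrableI_bounded) (auto simp: G_def)
 qed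
 let ?w = "%x. \<integral>ta. F ta x \<partial>N"
 have [measurable]: "?w \<in> borel_measurable M" by measurable
 have wG: "ennreal \<bar>?w x\<bar> <= G x" if [measurable]: "x \<in> space M" for x
  unfolding G_def using integral_norm_bound_ennreal[of N "%ta. F ta x"]
  by (cases "integrable N (%ta. F ta x)") (auto simp: not_integrable_integral_eq)
 have "(\<integral>\<^sup>+x. ennreal ((?w x)\<^sup>2) \<partial>M) <= (\<integral>\<^sup>+x. G x * G x \<partial>M)"
 proof (rule nn_integral_mono)
  fix x assume "x \<in> space M"
  have "ennreal ((?w x)\<^sup>2) = ennreal \<bar>?w x\<bar> * ennreal \<bar>?w x\<bar>"
   by (simp add: ennreal_mult[symmetric] power2_eq_square)
  then show "ennreal ((?w x)\<^sup>2) <= G x * G x" using wG[OF \<open>x \<in> space M\<close>] by (simp add: mult_mono)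
 qed
 also note GB
 finally show "?w \<in> L2 M" "nrm M ?w <= B" using L2I_nn[of ?w M B] B(2) by auto
qed

section \<open>The vector valued integral\<close>

lemma simple_value_append: "sval (P @ Q) ta x = sval P ta x + sval Q ta x"
 by (simp add: simple_value_def)

lemma simple_value_map_mult:
 "sval (map (%(A, c). (A, %x. b x * c x)) P) ta x = b x * sval P ta x"
 by (induction P) (auto simp: simple_value_def algebra_simps)

lemma simple_integral_append: "sint N (P @ Q) x = sint N P x + sint N Q x"
 by (simp add: simple_integral_def)

lemma simple_integral_map_mult:
 "sint N (map (%(A, c). (A, %x. b x * c x)) P) x = b x * sint N P x"
 by (induction P) (auto simp: simple_integral_def algebra_simps)

lemma L2_simple_append: "L2_simple N M P ==> L2_simple N M Q ==> L2_simple N M (P @ Q)"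
 by (auto simp: L2_simple_def)

lemma L2_simple_map_mult:
 assumes "L2_simple N M P" "b \<in> borel_measurable M" "C >= 0" "AE x in M. \<bar>b x\<bar> <= C"
 shows "L2_simple N M (map (%(A, c). (A, %x. b x * c x)) P)"
 using assms(1) L2_mult_bounded(1)[OF assms(2) _ assms(3,4)] by (auto simp: L2_simple_def)

lemma L2_simple_Cons: "L2_simple N M (p # P) \<longleftrightarrow> fst p \<in> sets N \<and> emeasure N (fst p) < \<infinity> \<and> snd p \<in> L2 M \<and> L2_simple N M P"
 by (auto simp: L2_simple_def split_beta)

lemma simple_value_Cons: "sval (p # P) ta x = ind (fst p) ta * snd p x + sval P ta x"
 by (simp add: simple_value_def split_beta)

lemma simple_integral_Cons: "sint N (p # P) x = measure N (fst p) * snd p x + sint N P x"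
 by (simp add: simple_integral_def split_beta)

lemma simple_value_Nil [simp]: "sval [] ta x = 0" by (simp add: simple_value_def)

lemma simple_value_L2: "L2_simple N M P ==> sval P ta \<in> L2 M"
proof (induction P)
 case Nil then show ?case by (simp add: simple_value_def[abs_def])
next
 case (Cons p P)
 then show ?case using L2_add[OF L2_scale[of "snd p" M "ind (fst p) ta"], of "sval P ta"]
  by (simp add: L2_simple_Cons simple_value_Cons[abs_def])
qed

lemma simple_integral_L2: "L2_simple N M P ==> sint N P \<in> L2 M"
proof (induction P)
 case Nil then show ?case by (simp add: simple_integral_def[abs_def])
next
 case (Cons p P)
 then show ?case using L2_add[OF L2_scale[of "snd p" M "measure N (fst p)"], of "sint N P"]
  by (simp add: L2_simple_Cons simple_integral_Cons[abs_def])
qed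

lemma simple_value_jm: "L2_simple N M P ==> (%(ta, x). sval P ta x) \<in> borel_measurable (N \<Otimes>\<^sub>M M)"
proof (induction P)
 case Nil then show ?case by simp
next
 case (Cons p P)
 have [measurable]: "fst p \<in> sets N" "snd p \<in> borel_measurable M" using Cons.prems by (auto simp: L2_simple_Cons L2_iff)
 have [measurable]: "(%(ta, x). sval P ta x) \<in> borel_measurable (N \<Otimes>\<^sub>M M)"
  using Cons by (simp add: L2_simple_Cons)
 have "(%z. ind (fst p) (fst z) * snd p (snd z) + (%(ta, x). sval P ta x) z :: real) \<in> borel_measurable (N \<Otimes>\<^sub>M M)"
  by measurable
 then show ?case by (simp add: simple_value_Cons split_beta')
qed

lemma simple_integral_eq: "L2_simple N M P ==> integrable N (%ta. sval P ta x) \<and> (\<integral>ta. sval P ta x \<partial>N) = sint N P x"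
proof (induction P)
 case Nil then show ?case by (simp add: simple_integral_def)
next
 case (Cons p P)
 then have "integrable N (%ta. ind (fst p) ta * snd p x)"
  "(\<integral>ta. ind (fst p) ta * snd p x \<partial>N) = measure N (fst p) * snd p x"
  by (auto simp: L2_simple_Cons)
 then show ?case using Cons by (simp add: L2_simple_Cons simple_value_Cons simple_integral_Cons)
qed

lemma simple_integral_norm_le:
 assumes "sigma_finite_measure N" "sigma_finite_measure M" "L2_simple N M P"
  and "(\<integral>\<^sup>+ta. ennreal (nrm M (sval P ta)) \<partial>N) <= ennreal B" "B >= 0"
 shows "nrm M (sint N P) <= B"
proof -
 have "sint N P = (%x. \<integral>ta. sval P ta x \<partial>N)" using simple_integral_eq[OF assms(3)] by auto
 then show ?thesis
  using Minkowski_integral(3)[OF assms(1,2) simple_value_jm[OF assms(3)]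
    L2_norm_measurable[OF assms(2) simple_value_jm[OF assms(3)]] AE_I2 assms(4,5)]
   simple_value_L2[OF assms(3)] by simp
qed

lemma null_sandwich:
 fixes f g :: "'b => real"
 assumes "\<And>n. 0 <= f n" "\<And>n. f n <= g n" "(g \<longlongrightarrow> 0) F"
 shows "(f \<longlongrightarrow> 0) F"
 by (rule tendsto_sandwich[OF _ _ tendsto_const assms(3)]) (use assms in auto)

text \<open>The curve \<open>F\<close> need not be jointly measurable, so the measurability of the error is not automatic. It is an
almost everywhere limit of distances between simple functions.\<close>

lemma approximation_error_measurable:
 assumes M: "sigma_finite_measure M" and FL: "\<And>ta. ta \<in> space N ==> F ta \<in> L2 M"
  and P: "\<And>n. L2_simple N M (P n)"
  and ae: "AE ta in N. (%n. nrm M (%x. F ta x - sval (P n) ta x)) \<longlonglongrightarrow> 0"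
 shows "\<exists>h. (\<forall>n. h n \<in> borel_measurable N \<and> (\<forall>ta. h n ta >= 0) \<and> (AE ta in N. nrm M (%x. F ta x - sval (P n) ta x) = h n ta))"
proof -
 let ?S = "%n ta. sval (P n) ta"
 define h where "h n ta = nrm M (%x. F ta x - ?S n ta x)" for n ta
 define h' where "h' n ta = max 0 (lim (%k. nrm M (%x. ?S k ta x - ?S n ta x)))" for n ta
 have [measurable]: "(%ta. nrm M (%x. ?S k ta x - ?S n ta x)) \<in> borel_measurable N" for k n
 proof -
  note [measurable] = simple_value_jm[OF P, of k] simple_value_jm[OF P, of n]
  show ?thesis by (rule L2_norm_measurable[OF M]) measurable
 qed
 have hm: "h' n \<in> borel_measurable N" for n unfolding h'_def[abs_def] by measurable
 have hh: "AE ta in N. h n ta = h' n ta" for n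
  using ae AE_space
 proof eventually_elim
  fix ta assume l: "(%n. nrm M (%x. F ta x - ?S n ta x)) \<longlonglongrightarrow> 0" and "ta \<in> space N"
  then have F': "F ta \<in> L2 M" using FL by auto
  have SL: "?S k ta \<in> L2 M" for k by (rule simple_value_L2[OF P])
  have "(%k. nrm M (%x. ?S k ta x - ?S n ta x) - h n ta) \<longlonglongrightarrow> 0"
  proof (rule Lim_null_comparison[OF _ l], rule always_eventually, rule allI)
   fix k
   show "norm (nrm M (%x. ?S k ta x - ?S n ta x) - h n ta) <= nrm M (%x. F ta x - ?S k ta x)"
    using L2_norm_abs_diff[OF L2_diff[OF SL SL] L2_diff[OF F' SL], of k n n] L2_norm_minus_commute[of M "F ta" "?S k ta"]
    by (simp add: h_def)
  qed
  then have "(%k. nrm M (%x. ?S k ta x - ?S n ta x)) \<longlonglongrightarrow> h n ta" by (simp add: LIM_zero_iff)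
  then show "h n ta = h' n ta" unfolding h'_def by (simp add: limI h_def)
 qed
 show ?thesis by (rule exI[of _ h']) (use hm hh in \<open>auto simp: h_def h'_def\<close>)
qed

text \<open>Holds for simple functions by Minkowski's inequality and passes to the limit. It is applied to weak
solutions, of which only strong measurability is known.\<close>

lemma has_L2_integral_norm_le:
 assumes N: "sigma_finite_measure N" and M: "sigma_finite_measure M"
  and F: "has_L2_integral N M F w" and [measurable]: "ph \<in> borel_measurable N"
  and le: "AE ta in N. nrm M (F ta) <= ph ta" and B: "(\<integral>\<^sup>+ta. ennreal (ph ta) \<partial>N) <= ennreal B" "B >= 0"
 shows "nrm M w <= B"
proof -
 have FL: "\<And>ta. ta \<in> space N ==> F ta \<in> L2 M" and wL: "w \<in> L2 M" using F by (auto simp: has_L2_integral_def)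
 obtain P where P: "\<And>n. L2_simple N M (P n)"
  and ae: "AE ta in N. (%n. nrm M (%x. F ta x - sval (P n) ta x)) \<longlonglongrightarrow> 0"
  and lim: "(%n. \<integral>\<^sup>+ ta. ennreal (nrm M (%x. F ta x - sval (P n) ta x)) \<partial>N) \<longlonglongrightarrow> 0"
  and lw: "(%n. nrm M (%x. sint N (P n) x - w x)) \<longlonglongrightarrow> 0"
  using F unfolding has_L2_integral_def by blast
 let ?S = "%n ta. sval (P n) ta"
 define h where "h n ta = nrm M (%x. F ta x - ?S n ta x)" for n ta
 obtain h' where h'm [measurable]: "\<And>n. h' n \<in> borel_measurable N"
  and hh: "\<And>n. AE ta in N. h n ta = h' n ta"
  using approximation_error_measurable[OF M FL P ae] unfolding h_def by blast
 have [measurable]: "(%ta. nrm M (?S n ta)) \<in> borel_measurable N" for n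
  by (rule L2_norm_measurable[OF M simple_value_jm[OF P]])
 have lim': "(%n. \<integral>\<^sup>+ ta. ennreal (h' n ta) \<partial>N) \<longlonglongrightarrow> 0"
 proof -
  have "(\<integral>\<^sup>+ ta. ennreal (h' n ta) \<partial>N) = (\<integral>\<^sup>+ ta. ennreal (h n ta) \<partial>N)" for n
   using hh[of n] by (intro nn_integral_cong_AE) (auto elim!: eventually_mono)
  then show ?thesis using lim by (simp add: h_def)
 qed
 have est: "nrm M w <= B + ep + ep" if ep: "ep > 0" for ep
 proof -
  have "eventually (%n. (\<integral>\<^sup>+ ta. ennreal (h' n ta) \<partial>N) < ennreal ep) sequentially"
   using ep by (intro order_tendstoD(2)[OF lim']) simp
  moreover have "eventually (%n. nrm M (%x. sint N (P n) x - w x) < ep) sequentially"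
   by (rule order_tendstoD(2)[OF lw ep])
  ultimately have "eventually (%n. (\<integral>\<^sup>+ ta. ennreal (h' n ta) \<partial>N) < ennreal ep \<and> nrm M (%x. sint N (P n) x - w x) < ep) sequentially"
   by (rule eventually_conj)
  then obtain n where n: "(\<integral>\<^sup>+ ta. ennreal (h' n ta) \<partial>N) < ennreal ep" "nrm M (%x. sint N (P n) x - w x) < ep"
   by (auto simp: eventually_sequentially)
  have "(\<integral>\<^sup>+ta. ennreal (nrm M (?S n ta)) \<partial>N) <= (\<integral>\<^sup>+ta. ennreal (ph ta) + ennreal (h' n ta) \<partial>N)"
  proof (rule nn_integral_mono_AE, use le hh[of n] AE_space in eventually_elim)
   fix ta assume 1: "nrm M (F ta) <= ph ta" "h n ta = h' n ta" "ta \<in> space N"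
   have "nrm M (?S n ta) <= ph ta + h' n ta"
    using L2_norm_le_add_diff[OF simple_value_L2[OF P] FL[OF 1(3)], of n ta] 1
     L2_norm_minus_commute[of M "F ta" "?S n ta"] by (simp add: h_def)
   moreover have "ph ta >= 0" using order_trans[OF L2_norm_nonneg 1(1)] .
   moreover have "h n ta >= 0" by (simp add: h_def)
   then have "h' n ta >= 0" using 1(2) by simp
   ultimately show "ennreal (nrm M (?S n ta)) <= ennreal (ph ta) + ennreal (h' n ta)"
    by (simp add: ennreal_plus[symmetric] ennreal_leI del: ennreal_plus)
  qed
  also have "... = (\<integral>\<^sup>+ta. ennreal (ph ta) \<partial>N) + (\<integral>\<^sup>+ta. ennreal (h' n ta) \<partial>N)" by (rule nn_integral_add) auto
  also have "... <= ennreal (B + ep)" using B n(1) ep by (simp add: add_mono less_imp_le)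
  finally have "nrm M (sint N (P n)) <= B + ep"
   using B ep by (intro simple_integral_norm_le[OF N M P]) auto
  then show ?thesis using L2_norm_le_add_diff[OF wL simple_integral_L2[OF P], of n] n(2)
    L2_norm_minus_commute[of M w "sint N (P n)"] by simp
 qed
 show ?thesis
 proof (rule field_le_epsilon)
  fix e :: real assume "e > 0" then show "nrm M w <= B + e" using est[of "e/2"] by simp
 qed
qed

text \<open>The simple functions of the two integrands are combined in the same way as the integrands; the error is at
most \<open>C\<close> times the sum of the errors.\<close>

lemma has_L2_integral_mult_diff:
 assumes M: "sigma_finite_measure M" and F: "has_L2_integral N M F w" and G: "has_L2_integral N M G v"
  and b: "b \<in> borel_measurable M" "C >= 0" "AE x in M. \<bar>b x\<bar> <= C"
 shows "has_L2_integral N M (%ta x. b x * (F ta x - G ta x)) (%x. b x * (w x - v x))"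
proof -
 have FL: "\<And>ta. ta \<in> space N ==> F ta \<in> L2 M" and wL: "w \<in> L2 M" using F by (auto simp: has_L2_integral_def)
 have GL: "\<And>ta. ta \<in> space N ==> G ta \<in> L2 M" and vL: "v \<in> L2 M" using G by (auto simp: has_L2_integral_def)
 let ?e = "%F P n ta. nrm M (%x. F ta x - sval (P n) ta x)"
 let ?i = "%P n w. nrm M (%x. sint N (P n) x - w x)"
 obtain P where P: "\<And>n. L2_simple N M (P n)" and aeP: "AE ta in N. (%n. ?e F P n ta) \<longlonglongrightarrow> 0"
  and limP: "(%n. \<integral>\<^sup>+ ta. ennreal (?e F P n ta) \<partial>N) \<longlonglongrightarrow> 0" and lw: "(%n. ?i P n w) \<longlonglongrightarrow> 0"
  using F unfolding has_L2_integral_def by blast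
 obtain Q where Q: "\<And>n. L2_simple N M (Q n)" and aeQ: "AE ta in N. (%n. ?e G Q n ta) \<longlonglongrightarrow> 0"
  and limQ: "(%n. \<integral>\<^sup>+ ta. ennreal (?e G Q n ta) \<partial>N) \<longlonglongrightarrow> 0" and lv: "(%n. ?i Q n v) \<longlonglongrightarrow> 0"
  using G unfolding has_L2_integral_def by blast
 obtain h where h: "\<And>n. h n \<in> borel_measurable N \<and> (\<forall>ta. h n ta >= 0) \<and> (AE ta in N. ?e F P n ta = h n ta)"
  using approximation_error_measurable[OF M FL P aeP] by blast
 obtain k where k: "\<And>n. k n \<in> borel_measurable N \<and> (\<forall>ta. k n ta >= 0) \<and> (AE ta in N. ?e G Q n ta = k n ta)"
  using approximation_error_measurable[OF M GL Q aeQ] by blast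
 define R where "R n = map (%(A, c). (A, %x. b x * c x)) (P n @ map (%(A, c). (A, %x. (-1) * c x)) (Q n))" for n
 have RS: "L2_simple N M (R n)" for n
  unfolding R_def by (intro L2_simple_map_mult[OF _ b] L2_simple_append P L2_simple_map_mult[OF Q, where C = 1]) auto
 have Rv: "sval (R n) ta x = b x * (sval (P n) ta x - sval (Q n) ta x)" for n ta x
  unfolding R_def simple_value_map_mult simple_value_append by simp
 have Ri: "sint N (R n) x = b x * (sint N (P n) x - sint N (Q n) x)" for n x
  unfolding R_def simple_integral_map_mult simple_integral_append by simp
 have est: "nrm M (%x. b x * (p x - q x)) <= C * (nrm M p + nrm M q)" if "p \<in> L2 M" "q \<in> L2 M" for p q
 proof -
  have "nrm M (%x. p x - q x) <= nrm M p + nrm M q"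
   using L2_norm_triangle[OF that(1) L2_uminus[OF that(2)]] by (simp add: L2_norm_uminus)
  then show ?thesis using L2_mult_bounded(2)[OF b(1) L2_diff[OF that] b(2,3)] mult_left_mono[OF _ b(2)] order_trans by blast
 qed
 have n1: "nrm M (%x. b x * (F ta x - G ta x) - sval (R n) ta x) <= C * (?e F P n ta + ?e G Q n ta)" if "ta \<in> space N" for n ta
  using est[OF L2_diff[OF FL[OF that] simple_value_L2[OF P[of n], of ta]] L2_diff[OF GL[OF that] simple_value_L2[OF Q[of n], of ta]]]
  by (simp add: Rv algebra_simps)
 have n2: "nrm M (%x. sint N (R n) x - b x * (w x - v x)) <= C * (?i P n w + ?i Q n v)" for n
  using est[OF L2_diff[OF simple_integral_L2[OF P[of n]] wL] L2_diff[OF simple_integral_L2[OF Q[of n]] vL]]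
  by (simp add: Ri algebra_simps)
 show ?thesis unfolding has_L2_integral_def
 proof (intro conjI ballI exI[of _ R] allI)
  show "(%x. b x * (F ta x - G ta x)) \<in> L2 M" if "ta \<in> space N" for ta
   by (rule L2_mult_bounded(1)[OF b(1) L2_diff[OF FL[OF that] GL[OF that]] b(2,3)])
  show "(%x. b x * (w x - v x)) \<in> L2 M" by (rule L2_mult_bounded(1)[OF b(1) L2_diff[OF wL vL] b(2,3)])
  show "L2_simple N M (R n)" for n by (rule RS)
  show "AE ta in N. (%n. nrm M (%x. b x * (F ta x - G ta x) - sval (R n) ta x)) \<longlonglongrightarrow> 0"
   using aeP aeQ AE_space
  proof eventually_elim
   fix ta assume l: "(%n. ?e F P n ta) \<longlonglongrightarrow> 0" "(%n. ?e G Q n ta) \<longlonglongrightarrow> 0" and t: "ta \<in> space N"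
   show "(%n. nrm M (%x. b x * (F ta x - G ta x) - sval (R n) ta x)) \<longlonglongrightarrow> 0"
    by (rule null_sandwich[OF _ n1[OF t] tendsto_mult_right_zero[OF tendsto_add_zero[OF l]]]) simp
  qed
  let ?I = "%g. \<integral>\<^sup>+ ta. ennreal (g ta) \<partial>N"
  have nn: "?I (%ta. nrm M (%x. b x * (F ta x - G ta x) - sval (R n) ta x)) <= ennreal C * (?I (?e F P n) + ?I (?e G Q n))" for n
  proof -
   have "?I (%ta. nrm M (%x. b x * (F ta x - G ta x) - sval (R n) ta x)) <= (\<integral>\<^sup>+ ta. ennreal C * (ennreal (?e F P n ta) + ennreal (?e G Q n ta)) \<partial>N)"
    using n1 b(2) by (intro nn_integral_mono) (simp add: ennreal_mult'[symmetric] ennreal_plus[symmetric] ennreal_leI del: ennreal_plus)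
   also have "... = (\<integral>\<^sup>+ ta. ennreal C * (ennreal (h n ta) + ennreal (k n ta)) \<partial>N)"
    using h[of n] k[of n] by (intro nn_integral_cong_AE) (auto elim!: AE_mp)
   also have "... = ennreal C * (?I (h n) + ?I (k n))"
   proof -
    have [measurable]: "h n \<in> borel_measurable N" "k n \<in> borel_measurable N" using h k by auto
    show ?thesis by (simp add: nn_integral_cmult nn_integral_add)
   qed
   also have "?I (h n) = ?I (?e F P n)" using h[of n] by (intro nn_integral_cong_AE) (auto elim!: eventually_mono)
   also have "?I (k n) = ?I (?e G Q n)" using k[of n] by (intro nn_integral_cong_AE) (auto elim!: eventually_mono)
   finally show ?thesis .
  qed
  have "(%n. ennreal C * (?I (?e F P n) + ?I (?e G Q n))) \<longlonglongrightarrow> ennreal C * (0 + 0)"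
   by (intro ennreal_tendsto_cmult tendsto_add limP limQ) simp
  then have l0: "(%n. ennreal C * (?I (?e F P n) + ?I (?e G Q n))) \<longlonglongrightarrow> 0" by simp
  show "(%n. ?I (%ta. nrm M (%x. b x * (F ta x - G ta x) - sval (R n) ta x))) \<longlonglongrightarrow> 0"
   by (rule tendsto_sandwich[OF _ _ tendsto_const l0]) (use nn in \<open>auto intro!: always_eventually\<close>)
  show "(%n. nrm M (%x. sint N (R n) x - b x * (w x - v x))) \<longlonglongrightarrow> 0"
   by (rule null_sandwich[OF _ n2 tendsto_mult_right_zero[OF tendsto_add_zero[OF lw lv]]]) simp
 qed
qed

lemma has_L2_integral_unique:
 assumes N: "sigma_finite_measure N" and M: "sigma_finite_measure M"
  and F: "has_L2_integral N M F w" and G: "has_L2_integral N M F v"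
 shows "AE x in M. w x = v x"
proof -
 have d: "has_L2_integral N M (%ta x. F ta x - F ta x) (%x. w x - v x)"
  using has_L2_integral_mult_diff[OF M F G, of "%_. 1" 1] by simp
 have "nrm M (%x. w x - v x) <= 0"
  by (rule has_L2_integral_norm_le[OF N M d, where ph = "%_. 0"]) auto
 moreover have "(%x. w x - v x) \<in> L2 M" using d by (auto simp: has_L2_integral_def)
 ultimately have "AE x in M. w x - v x = 0" by (intro L2_norm_eq_0D)
 then show ?thesis by eventually_elim simp
qed

lemma has_L2_integral_cong:
 assumes "\<And>ta. ta \<in> space N ==> (AE x in M. F ta x = G ta x)" "\<And>ta. ta \<in> space N ==> G ta \<in> borel_measurable M"
  and F: "has_L2_integral N M F w"
 shows "has_L2_integral N M G w"
proof -
 have FL: "\<And>ta. ta \<in> space N ==> F ta \<in> L2 M" using F by (auto simp: has_L2_integral_def)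
 obtain P where P: "\<And>n. L2_simple N M (P n)"
  and ae: "AE ta in N. (%n. nrm M (%x. F ta x - sval (P n) ta x)) \<longlonglongrightarrow> 0"
  and lim: "(%n. \<integral>\<^sup>+ ta. ennreal (nrm M (%x. F ta x - sval (P n) ta x)) \<partial>N) \<longlonglongrightarrow> 0"
  and lw: "(%n. nrm M (%x. sint N (P n) x - w x)) \<longlonglongrightarrow> 0"
  using F unfolding has_L2_integral_def by blast
 have eq: "nrm M (%x. G ta x - sval (P n) ta x) = nrm M (%x. F ta x - sval (P n) ta x)"
  if t: "ta \<in> space N" for ta n
 proof (rule L2_norm_AE_cong(1))
  show "AE x in M. G ta x - sval (P n) ta x = F ta x - sval (P n) ta x"
   using assms(1)[OF t] by eventually_elim simp
 qed (use assms(2)[OF t] L2D(1)[OF FL[OF t]] L2D(1)[OF simple_value_L2[OF P]] in auto)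
 have GL: "G ta \<in> L2 M" if "ta \<in> space N" for ta
  using L2_norm_AE_cong(2)[OF assms(1)[OF that] L2D(1)[OF FL[OF that]] assms(2)[OF that]] FL[OF that] by simp
 show ?thesis unfolding has_L2_integral_def
 proof (intro conjI ballI exI[of _ P] allI)
  show "AE ta in N. (%n. nrm M (%x. G ta x - sval (P n) ta x)) \<longlonglongrightarrow> 0"
   using ae AE_space by eventually_elim (simp add: eq)
  have "(\<integral>\<^sup>+ ta. ennreal (nrm M (%x. G ta x - sval (P n) ta x)) \<partial>N) = (\<integral>\<^sup>+ ta. ennreal (nrm M (%x. F ta x - sval (P n) ta x)) \<partial>N)" for n
   by (intro nn_integral_cong) (simp add: eq)
  then show "(%n. \<integral>\<^sup>+ ta. ennreal (nrm M (%x. G ta x - sval (P n) ta x)) \<partial>N) \<longlonglongrightarrow> 0"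
   using lim by simp
 qed (use GL P lw F in \<open>auto simp: has_L2_integral_def\<close>)
qed

section \<open>Continuous curves\<close>

definition L2_cont :: "'a measure => real set => (real => 'a => real) => bool" where
 "L2_cont M S F \<longleftrightarrow> (\<forall>t\<in>S. F t \<in> L2 M \<and> ((%ta. nrm M (%x. F ta x - F t x)) \<longlongrightarrow> 0) (at t within S))"

lemma L2_contD: "L2_cont M S F ==> t \<in> S ==> F t \<in> L2 M"
 "L2_cont M S F ==> t \<in> S ==> ((%ta. nrm M (%x. F ta x - F t x)) \<longlongrightarrow> 0) (at t within S)"
 by (auto simp: L2_cont_def)

lemma L2_cont_subset: "L2_cont M S F ==> S' \<subseteq> S ==> L2_cont M S' F"
 unfolding L2_cont_def by (meson subsetD tendsto_within_subset)

lemma null_sandwich_within: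
 fixes f g :: "'b::topological_space => real"
 assumes "\<And>n. n \<in> S ==> 0 <= f n" "\<And>n. n \<in> S ==> f n <= g n" "(g \<longlongrightarrow> 0) (at t within S)"
 shows "(f \<longlongrightarrow> 0) (at t within S)"
proof (rule tendsto_sandwich[OF _ _ tendsto_const assms(3)])
 show "\<forall>\<^sub>F n in at t within S. 0 <= f n" "\<forall>\<^sub>F n in at t within S. f n <= g n"
  using assms(1,2) by (auto simp: eventually_at_filter intro!: always_eventually)
qed

lemma L2_cont_norm: 
 assumes "L2_cont M S F" shows "continuous_on S (%t. nrm M (F t))"
 unfolding continuous_on_def
proof
 fix t assume t: "t \<in> S"
 have "((%ta. \<bar>nrm M (F ta) - nrm M (F t)\<bar>) \<longlongrightarrow> 0) (at t within S)"
  by (rule null_sandwich_within[OF _ L2_norm_abs_diff L2_contD(2)[OF assms t]]) (auto intro: L2_contD(1)[OF assms] t)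
 then show "((%t. nrm M (F t)) \<longlongrightarrow> nrm M (F t)) (at t within S)"
  by (simp add: tendsto_rabs_zero_iff LIM_zero_iff)
qed

lemma L2_cont_add:
 assumes F: "L2_cont M S F" and G: "L2_cont M S G"
 shows "L2_cont M S (%t x. F t x + G t x)"
 unfolding L2_cont_def
proof (intro ballI conjI)
 fix t assume t: "t \<in> S"
 show "(%x. F t x + G t x) \<in> L2 M" using L2_contD(1)[OF F t] L2_contD(1)[OF G t] by (rule L2_add)
 show "((%ta. nrm M (%x. F ta x + G ta x - (F t x + G t x))) \<longlongrightarrow> 0) (at t within S)"
 proof (rule null_sandwich_within[OF _ _ tendsto_add_zero[OF L2_contD(2)[OF F t] L2_contD(2)[OF G t]]])
  fix ta assume "ta \<in> S"
  then have "(%x. F ta x - F t x) \<in> L2 M" "(%x. G ta x - G t x) \<in> L2 M"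
   using L2_contD(1)[OF F] L2_contD(1)[OF G] t by (auto intro: L2_diff)
  from L2_norm_triangle[OF this]
  show "nrm M (%x. F ta x + G ta x - (F t x + G t x)) <= nrm M (%x. F ta x - F t x) + nrm M (%x. G ta x - G t x)"
   by (simp add: algebra_simps)
 qed simp
qed

lemma L2_cont_const: "g \<in> L2 M ==> L2_cont M S (%t. g)"
 by (simp add: L2_cont_def)

text \<open>The multiplier is continuous only for each \<open>x\<close>, not uniformly in \<open>x\<close>; dominated convergence in \<open>x\<close>
compensates for this.\<close>

lemma L2_cont_mult:
 assumes F: "L2_cont M S F" and B: "continuous_on S B"
  and bm [measurable]: "\<And>t. b t \<in> borel_measurable M"
  and bB: "\<And>t x. t \<in> S ==> x \<in> space M ==> \<bar>b t x\<bar> <= B t"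
  and bc: "\<And>x. x \<in> space M ==> continuous_on S (%t. b t x)"
 shows "L2_cont M S (%t x. b t x * F t x)"
 unfolding L2_cont_def
proof (intro ballI conjI)
 fix t assume t: "t \<in> S"
 have B0: "B ta >= 0" if "ta \<in> S" "space M \<noteq> {}" for ta using bB[OF that(1)] that(2) by (metis abs_ge_zero all_not_in_conv order_trans)
 have mb: "g \<in> L2 M ==> (%x. b ta x * g x) \<in> L2 M \<and> nrm M (%x. b ta x * g x) <= \<bar>B ta\<bar> * nrm M g" if "ta \<in> S" for ta g
  using L2_mult_bounded[of "b ta" M g "\<bar>B ta\<bar>"] bB[OF that] by (force intro: order_trans[OF _ abs_ge_self])
 note Ft = L2_contD(1)[OF F t]
 note [measurable] = L2D(1)[OF Ft]
 show "(%x. b t x * F t x) \<in> L2 M" using mb[OF t Ft] by simp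
 have l1: "((%ta. \<bar>B ta\<bar> * nrm M (%x. F ta x - F t x)) \<longlongrightarrow> 0) (at t within S)"
 proof -
  have "((%ta. \<bar>B ta\<bar>) \<longlongrightarrow> \<bar>B t\<bar>) (at t within S)" using B t by (intro tendsto_rabs) (auto simp: continuous_on_def)
  from tendsto_mult[OF this L2_contD(2)[OF F t]] show ?thesis by simp
 qed
 have l2: "((%ta. nrm M (%x. (b ta x - b t x) * F t x)) \<longlongrightarrow> 0) (at t within S)"
  unfolding tendsto_at_iff_sequentially
 proof (intro allI impI)
  fix X assume X: "\<forall>i. X i \<in> S - {t}" and Xt: "X \<longlonglongrightarrow> t"
  have XS: "X i \<in> S" for i using X by auto
  have BX: "(%i. B (X i)) \<longlonglongrightarrow> B t"
   using B t XS Xt by (auto simp: continuous_on_sequentially comp_def)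
  then obtain K where K: "\<And>i. \<bar>B (X i)\<bar> <= K" using convergent_imp_Bseq[of "%i. B (X i)"] by (auto simp: convergent_def Bseq_def)
  have "(%i. \<integral>x. ((b (X i) x - b t x) * F t x)\<^sup>2 \<partial>M) \<longlonglongrightarrow> (\<integral>x. (0 * F t x)\<^sup>2 \<partial>M)"
  proof (rule integral_dominated_convergence[where w = "%x. (K + \<bar>B t\<bar>)\<^sup>2 * (F t x)\<^sup>2"])
   show "integrable M (%x. (K + \<bar>B t\<bar>)\<^sup>2 * (F t x)\<^sup>2)" using L2D(2)[OF Ft] by simp
   show "AE x in M. (%i. ((b (X i) x - b t x) * F t x)\<^sup>2) \<longlonglongrightarrow> (0 * F t x)\<^sup>2"
   proof (rule AE_I2)
    fix x assume x: "x \<in> space M"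
    have "(%i. b (X i) x) \<longlonglongrightarrow> b t x"
     using bc[OF x] t XS Xt by (auto simp: continuous_on_sequentially comp_def)
    then have "(%i. b (X i) x - b t x) \<longlonglongrightarrow> 0" by (simp add: LIM_zero)
    then show "(%i. ((b (X i) x - b t x) * F t x)\<^sup>2) \<longlonglongrightarrow> (0 * F t x)\<^sup>2" by (intro tendsto_intros)
   qed
   show "AE x in M. norm (((b (X i) x - b t x) * F t x)\<^sup>2) <= (K + \<bar>B t\<bar>)\<^sup>2 * (F t x)\<^sup>2" for i
   proof (rule AE_I2)
    fix x assume x: "x \<in> space M"
    have "\<bar>b (X i) x - b t x\<bar> <= K + \<bar>B t\<bar>"
     using bB[OF XS x, of i] bB[OF t x] K[of i] abs_triangle_ineq4[of "b (X i) x" "b t x"] by linarith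
    then have "\<bar>b (X i) x - b t x\<bar>\<^sup>2 <= (K + \<bar>B t\<bar>)\<^sup>2" by (intro power_mono) auto
    then show "norm (((b (X i) x - b t x) * F t x)\<^sup>2) <= (K + \<bar>B t\<bar>)\<^sup>2 * (F t x)\<^sup>2"
     by (simp add: power_mult_distrib mult_right_mono)
   qed
  qed measurable
  then have "(%i. sqrt (\<integral>x. ((b (X i) x - b t x) * F t x)\<^sup>2 \<partial>M)) \<longlonglongrightarrow> sqrt 0" by (intro tendsto_real_sqrt) simp
  then show "((%ta. nrm M (%x. (b ta x - b t x) * F t x)) \<circ> X) \<longlonglongrightarrow> 0" by (simp add: comp_def L2_norm_eq)
 qed
 show "((%ta. nrm M (%x. b ta x * F ta x - b t x * F t x)) \<longlongrightarrow> 0) (at t within S)"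
 proof (rule null_sandwich_within[OF _ _ tendsto_add_zero[OF l1 l2]])
  fix ta assume ta: "ta \<in> S"
  have d: "(%x. F ta x - F t x) \<in> L2 M" using L2_contD(1)[OF F] ta t by (auto intro: L2_diff)
  have a2: "(%x. (b ta x - b t x) * F t x) \<in> L2 M"
   using L2_diff[of "%x. b ta x * F t x" M "%x. b t x * F t x"] mb[OF ta Ft] mb[OF t Ft] by (simp add: left_diff_distrib)
  have a1: "(%x. b ta x * (F ta x - F t x)) \<in> L2 M" "nrm M (%x. b ta x * (F ta x - F t x)) <= \<bar>B ta\<bar> * nrm M (%x. F ta x - F t x)"
   using mb[OF ta d] by auto
  have "(%x. b ta x * F ta x - b t x * F t x) = (%x. b ta x * (F ta x - F t x) + (b ta x - b t x) * F t x)"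
   by (auto simp: algebra_simps)
  then show "nrm M (%x. b ta x * F ta x - b t x * F t x) <= \<bar>B ta\<bar> * nrm M (%x. F ta x - F t x) + nrm M (%x. (b ta x - b t x) * F t x)"
   using L2_norm_triangle[OF a1(1) a2] a1(2) by simp
 qed simp
qed

lemma L2_cont_uniform:
 assumes F: "L2_cont M K F" and K: "compact K" and ep: "ep > 0"
 shows "\<exists>de>0. \<forall>sg\<in>K. \<forall>ta\<in>K. \<bar>sg - ta\<bar> < de --> nrm M (%x. F sg x - F ta x) < ep"
proof -
 let ?d = "%p. nrm M (%x. F (fst p) x - F (snd p) x)"
 have "continuous_on (K \<times> K) ?d" unfolding continuous_on_def
 proof
  fix p assume p: "p \<in> K \<times> K"
  obtain a b where ab: "p = (a, b)" "a \<in> K" "b \<in> K" using p by auto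
  have fa: "((%q. nrm M (%x. F (fst q) x - F a x)) \<longlongrightarrow> 0) (at p within K \<times> K)"
  proof -
   have "continuous_on K (%ta. nrm M (%x. F ta x - F a x))"
    using L2_cont_norm[OF L2_cont_add[OF F L2_cont_const[OF L2_uminus[OF L2_contD(1)[OF F ab(2)]]]]] by simp
   then have "continuous_on (K \<times> K) (%q. nrm M (%x. F (fst q) x - F a x))"
    by (rule continuous_on_compose2) (auto intro: continuous_intros)
   then have "((%q. nrm M (%x. F (fst q) x - F a x)) \<longlongrightarrow> nrm M (%x. F (fst p) x - F a x)) (at p within K \<times> K)"
    using p unfolding continuous_on_def by blast
   then show ?thesis by (simp add: ab)
  qed
  have fb: "((%q. nrm M (%x. F (snd q) x - F b x)) \<longlongrightarrow> 0) (at p within K \<times> K)"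
  proof -
   have "continuous_on K (%ta. nrm M (%x. F ta x - F b x))"
    using L2_cont_norm[OF L2_cont_add[OF F L2_cont_const[OF L2_uminus[OF L2_contD(1)[OF F ab(3)]]]]] by simp
   then have "continuous_on (K \<times> K) (%q. nrm M (%x. F (snd q) x - F b x))"
    by (rule continuous_on_compose2) (auto intro: continuous_intros)
   then have "((%q. nrm M (%x. F (snd q) x - F b x)) \<longlongrightarrow> nrm M (%x. F (snd p) x - F b x)) (at p within K \<times> K)"
    using p unfolding continuous_on_def by blast
   then show ?thesis by (simp add: ab)
  qed
  have "((%q. \<bar>?d q - ?d p\<bar>) \<longlongrightarrow> 0) (at p within K \<times> K)"
  proof (rule null_sandwich_within[OF _ _ tendsto_add_zero[OF fa fb]])
   fix q assume "q \<in> K \<times> K"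
   then have L: "F (fst q) \<in> L2 M" "F (snd q) \<in> L2 M" "F a \<in> L2 M" "F b \<in> L2 M"
    using L2_contD(1)[OF F] ab by auto
   have "\<bar>?d q - ?d p\<bar> <= nrm M (%x. (F (fst q) x - F (snd q) x) - (F a x - F b x))"
    using L2_norm_abs_diff[OF L2_diff[OF L(1,2)] L2_diff[OF L(3,4)]] ab by simp
   also have "(%x. (F (fst q) x - F (snd q) x) - (F a x - F b x)) = (%x. (F (fst q) x - F a x) + - (F (snd q) x - F b x))" by auto
   also have "nrm M ... <= nrm M (%x. F (fst q) x - F a x) + nrm M (%x. F (snd q) x - F b x)"
    using L2_norm_triangle[OF L2_diff[OF L(1,3)] L2_uminus[OF L2_diff[OF L(2,4)]]] L2_norm_uminus[of M "%x. F (snd q) x - F b x"] by simp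
   finally show "\<bar>?d q - ?d p\<bar> <= nrm M (%x. F (fst q) x - F a x) + nrm M (%x. F (snd q) x - F b x)" .
  qed simp
  then show "(?d \<longlongrightarrow> ?d p) (at p within K \<times> K)" by (simp add: tendsto_rabs_zero_iff LIM_zero_iff)
 qed
 then have "uniformly_continuous_on (K \<times> K) ?d" by (rule compact_uniformly_continuous) (intro compact_Times K)
 from this[unfolded uniformly_continuous_on_def, rule_format, OF ep]
 obtain de where de: "de > 0" and u: "\<forall>p\<in>K \<times> K. \<forall>q\<in>K \<times> K. dist q p < de --> dist (?d q) (?d p) < ep"
  by (elim exE conjE)
 show ?thesis
 proof (intro exI[of _ de] conjI de ballI impI)
  fix sg ta assume "sg \<in> K" "ta \<in> K" "\<bar>sg - ta\<bar> < de"
  then have "dist (?d (sg, ta)) (?d (ta, ta)) < ep"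
   by (intro u[rule_format]) (auto simp: dist_Pair_Pair dist_real_def)
  then show "nrm M (%x. F sg x - F ta x) < ep" by (simp add: dist_real_def)
 qed
qed

abbreviation time_measure :: "real => real measure" where
 "time_measure t \<equiv> restrict_space lborel {0..t}"

lemma sigma_finite_time: "sigma_finite_measure (time_measure t)"
 by (intro finite_measure.sigma_finite_measure finite_measureI)
  (auto simp: emeasure_restrict_space emeasure_lborel_Icc_eq space_restrict_space)

text \<open>The integral of a continuous curve may be computed pointwise in \<open>x\<close>. The approximating simple functions are
constant on a uniform grid, and uniform continuity on \<open>{0..t}\<close> controls the error.\<close>

lemma has_L2_integral_continuous:
 assumes M: "sigma_finite_measure M" and t: "t >= 0" and F: "L2_cont M {0..t} F"
  and Fm: "(%(ta, x). F ta x) \<in> jmeas M"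
 shows "has_L2_integral (time_measure t) M F (%x. LL ta. ind {0..t} ta * F ta x)"
proof -
 let ?N = "time_measure t"
 note N = sigma_finite_time[of t]
 have spN: "space ?N = {0..t}" by (simp add: space_restrict_space)
 have FmN [measurable]: "(%(ta, x). F ta x) \<in> borel_measurable (?N \<Otimes>\<^sub>M M)"
 proof -
  have "(%z. (fst z, snd z)) \<in> ?N \<Otimes>\<^sub>M M \<rightarrow>\<^sub>M lborel \<Otimes>\<^sub>M M"
   by (intro measurable_Pair measurable_compose[OF measurable_fst] measurable_snd) (auto intro: measurable_restrict_space1)
  from measurable_compose[OF this Fm] show ?thesis by simp
 qed
 have FL: "F ta \<in> L2 M" if "ta \<in> {0..t}" for ta using L2_contD(1)[OF F that] .
 define w where "w x = (\<integral>ta. F ta x \<partial>?N)" for x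
 have w_eq: "w = (%x. LL ta. ind {0..t} ta * F ta x)"
  unfolding w_def by (subst integral_restrict_space) auto
 have normm [measurable]: "(%ta. nrm M (F ta)) \<in> borel_measurable ?N" by (rule L2_norm_measurable[OF M FmN])
 have "bounded ((%ta. nrm M (F ta)) ` {0..t})"
  by (intro compact_imp_bounded compact_continuous_image L2_cont_norm[OF F] compact_Icc)
 then obtain B where "\<forall>y\<in>(%ta. nrm M (F ta)) ` {0..t}. norm y <= B" unfolding bounded_iff by blast
 then have B: "nrm M (F ta) <= B" if "ta \<in> {0..t}" for ta using that by simp
 have B0: "B >= 0" using order_trans[OF L2_norm_nonneg B[of 0]] t by simp
 have nnB: "(\<integral>\<^sup>+ta. ennreal C \<partial>?N) = ennreal (C * t)" if "C >= 0" for C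
  using t that by (simp add: emeasure_restrict_space space_restrict_space ennreal_mult)
 have wL: "w \<in> L2 M" and iF: "AE x in M. integrable ?N (%ta. F ta x)"
 proof -
  have le: "AE ta in ?N. F ta \<in> L2 M \<and> nrm M (F ta) <= B" using FL B spN by (intro AE_I2) auto
  show "w \<in> L2 M" unfolding w_def by (rule Minkowski_integral(2)[OF N M FmN _ le, where B = "B * t"]) (use nnB[OF B0] B0 t in auto)
  show "AE x in M. integrable ?N (%ta. F ta x)" by (rule Minkowski_integral(1)[OF N M FmN _ le, where B = "B * t"]) (use nnB[OF B0] B0 t in auto)
 qed
 \<comment> \<open>the index of the grid cell of \<open>ta\<close>; for \<open>ta = t\<close> it is \<open>Suc n\<close>, so there are \<open>Suc (Suc n)\<close> cells\<close>
 define io where "io n ta = nat \<lfloor>ta * real (Suc n) / t\<rfloor>" for n and ta :: real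
 define A where "A n i = {ta \<in> {0..t}. io n ta = i}" for n i
 define c where "c n i = F (real i * t / real (Suc n))" for n i
 define P where "P n = map (%i. (A n i, c n i)) [0..<Suc (Suc n)]" for n
 have iole: "io n ta < Suc (Suc n)" and near: "\<bar>real (io n ta) * t / real (Suc n) - ta\<bar> <= t / real (Suc n)"
  and inK: "real (io n ta) * t / real (Suc n) \<in> {0..t}" if ta: "ta \<in> {0..t}" for n ta
 proof -
  have *: "io n ta < Suc (Suc n) \<and> \<bar>real (io n ta) * t / real (Suc n) - ta\<bar> <= t / real (Suc n) \<and> real (io n ta) * t / real (Suc n) \<in> {0..t}"
  proof (cases "t = 0")
   case True then show ?thesis using ta by (simp add: io_def)
  next
   case False
   then have t0: "t > 0" using t by simp
   define q where "q = ta * real (Suc n) / t"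
   have "ta * real (Suc n) <= t * real (Suc n)" using ta by (intro mult_right_mono) auto
   then have q: "0 <= q" "q <= real (Suc n)" using ta t0 by (auto simp: q_def pos_divide_le_eq mult.commute)
   have i: "real (io n ta) = of_int \<lfloor>q\<rfloor>" using q by (simp add: io_def q_def)
   then have i1: "real (io n ta) <= q" "q < real (io n ta) + 1" using floor_correct[of q] by simp_all
   have taq: "ta = q * (t / real (Suc n))" using t0 by (simp add: q_def)
   have h: "t / real (Suc n) > 0" using t0 by simp
   have e: "real (io n ta) * t / real (Suc n) = real (io n ta) * (t / real (Suc n))" by simp
   have u: "real (io n ta) * (t / real (Suc n)) <= ta" using i1(1) h unfolding taq by (intro mult_right_mono) auto
   have l: "ta <= (real (io n ta) + 1) * (t / real (Suc n))" using i1(2) h by (subst (1) taq, intro mult_right_mono) auto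
   then have l': "ta <= real (io n ta) * (t / real (Suc n)) + t / real (Suc n)" by (simp only: distrib_right mult_1)
   have nn: "0 <= real (io n ta) * (t / real (Suc n))" using h by (intro mult_nonneg_nonneg) auto
   have gen: "a <= ta ==> ta <= a + h ==> \<bar>a - ta\<bar> <= h" for a h by linarith
   have "real (io n ta) <= real (Suc n)" using i1(1) q(2) by linarith
   then have lt: "io n ta < Suc (Suc n)" by simp
   show ?thesis unfolding e
   proof (intro conjI)
    show "io n ta < Suc (Suc n)" by (rule lt)
    show "\<bar>real (io n ta) * (t / real (Suc n)) - ta\<bar> <= t / real (Suc n)" by (rule gen[OF u l'])
    show "real (io n ta) * (t / real (Suc n)) \<in> {0..t}" using nn order_trans[OF u, of t] ta by simp
   qed
  qed
  then show "io n ta < Suc (Suc n)" "\<bar>real (io n ta) * t / real (Suc n) - ta\<bar> <= t / real (Suc n)"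
   "real (io n ta) * t / real (Suc n) \<in> {0..t}" by blast+
 qed
 have [measurable]: "A n i \<in> sets ?N" for n i
 proof -
  have "A n i = {0..t} \<inter> {ta. io n ta = i}" by (auto simp: A_def)
  moreover have "{ta. io n ta = i} \<in> sets lborel" unfolding io_def by measurable
  ultimately show ?thesis by (auto simp: sets_restrict_space)
 qed
 have ps: "L2_simple ?N M (P n)" for n
  unfolding L2_simple_def
 proof (intro ballI)
  fix p assume "p \<in> set (P n)"
  then obtain i where i: "p = (A n i, c n i)" "i < Suc (Suc n)" by (auto simp: P_def simp del: upt_Suc)
  have fin: "emeasure ?N (A n i) < \<infinity>"
   by (rule order_le_less_trans[OF emeasure_space]) (use t in \<open>simp add: emeasure_restrict_space space_restrict_space\<close>)
  have "real i * t / real (Suc n) \<in> {0..t} \<or> A n i = {}"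
  proof -
   { fix ta assume "ta \<in> A n i" then have "real i * t / real (Suc n) \<in> {0..t}" using inK[of ta n] by (auto simp: A_def) }
   then show ?thesis by auto
  qed
  then show "case p of (A, c) => A \<in> sets ?N \<and> emeasure ?N A < \<infinity> \<and> c \<in> L2 M"
  proof
   assume "real i * t / real (Suc n) \<in> {0..t}"
   then show ?thesis using i fin FL by (simp add: c_def)
  next
   assume "A n i = {}"
   have "real i <= real (Suc n)" using i(2) by simp
   then have "real i * t <= real (Suc n) * t" using t by (intro mult_right_mono) auto
   then have "real i * t / real (Suc n) \<in> {0..t}" using t by (simp add: field_simps)
   then show ?thesis using i fin FL by (simp add: c_def)
  qed
 qed
 have sv: "sval (P n) ta x = F (real (io n ta) * t / real (Suc n)) x" if ta: "ta \<in> {0..t}" for n ta x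
 proof -
  have "sval (P n) ta x = (\<Sum>i\<in>{0..<Suc (Suc n)}. ind (A n i) ta * c n i x)"
   unfolding simple_value_def P_def by (simp add: comp_def interv_sum_list_conv_sum_set_nat del: upt_Suc)
  also have "... = (\<Sum>i\<in>{0..<Suc (Suc n)}. if i = io n ta then c n i x else 0)"
   using ta by (intro sum.cong) (auto simp: A_def)
  also have "... = c n (io n ta) x" using iole[OF ta, of n] by (simp del: sum.op_ivl_Suc)
  finally show ?thesis by (simp add: c_def)
 qed
 have unif: "\<exists>N0. \<forall>n\<ge>N0. \<forall>ta\<in>{0..t}. nrm M (%x. F ta x - sval (P n) ta x) < ep" if ep: "ep > 0" for ep
 proof -
  obtain de where de: "de > 0" "\<And>sg ta. sg \<in> {0..t} ==> ta \<in> {0..t} ==> \<bar>sg - ta\<bar> < de ==> nrm M (%x. F sg x - F ta x) < ep"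
   using L2_cont_uniform[OF F compact_Icc ep] by blast
  obtain N0 where N0: "t / de < real N0" using reals_Archimedean2 by blast
  show ?thesis
  proof (intro exI[of _ N0] allI impI ballI)
   fix n ta assume n: "n >= N0" and ta: "ta \<in> {0..t}"
   have "t / de < real (Suc n)" using N0 n by simp
   then have "t / real (Suc n) < de" using de(1) by (simp add: field_simps)
   then show "nrm M (%x. F ta x - sval (P n) ta x) < ep"
    using near[OF ta, of n] unfolding sv[OF ta] by (intro de(2) ta inK) (simp add: abs_minus_commute)
  qed
 qed
 have nnlim: "\<exists>N0. \<forall>n\<ge>N0. (\<integral>\<^sup>+ ta. ennreal (nrm M (%x. F ta x - sval (P n) ta x)) \<partial>?N) <= ennreal (ep * t)" if ep: "ep > 0" for ep
 proof -
  obtain N0 where N0: "\<And>n ta. n >= N0 ==> ta \<in> {0..t} ==> nrm M (%x. F ta x - sval (P n) ta x) < ep"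
   using unif[OF ep] by blast
  have "(\<integral>\<^sup>+ ta. ennreal (nrm M (%x. F ta x - sval (P n) ta x)) \<partial>?N) <= (\<integral>\<^sup>+ ta. ennreal ep \<partial>?N)" if "n >= N0" for n
   using N0[OF that] spN by (intro nn_integral_mono ennreal_leI) (auto intro: less_imp_le)
  then show ?thesis using nnB[of ep] ep by auto
 qed
 have intlim: "\<exists>N0. \<forall>n\<ge>N0. nrm M (%x. sint ?N (P n) x - w x) <= ep * t" if ep: "ep > 0" for ep
 proof -
  obtain N0 where N0: "\<And>n ta. n >= N0 ==> ta \<in> {0..t} ==> nrm M (%x. F ta x - sval (P n) ta x) < ep"
   using unif[OF ep] by blast
  have "nrm M (%x. sint ?N (P n) x - w x) <= ep * t" if n: "n >= N0" for n
  proof -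
   note [measurable] = simple_value_jm[OF ps, of n]
   have D [measurable]: "(%(ta, x). sval (P n) ta x - F ta x) \<in> borel_measurable (?N \<Otimes>\<^sub>M M)" by measurable
   have le: "AE ta in ?N. (%x. sval (P n) ta x - F ta x) \<in> L2 M \<and> nrm M (%x. sval (P n) ta x - F ta x) <= ep"
   proof (rule AE_I2)
    fix ta assume "ta \<in> space ?N"
    then have ta: "ta \<in> {0..t}" by (simp add: spN)
    show "(%x. sval (P n) ta x - F ta x) \<in> L2 M \<and> nrm M (%x. sval (P n) ta x - F ta x) <= ep"
     using L2_diff[OF simple_value_L2[OF ps] FL[OF ta]] N0[OF n ta] L2_norm_minus_commute[of M "F ta" "sval (P n) ta"] by auto
   qed
   have m: "nrm M (%x. \<integral>ta. sval (P n) ta x - F ta x \<partial>?N) <= ep * t"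
    by (rule Minkowski_integral(3)[OF N M D _ le, where B = "ep * t"]) (use nnB[of ep] ep t in auto)
   have "nrm M (%x. sint ?N (P n) x - w x) = nrm M (%x. \<integral>ta. sval (P n) ta x - F ta x \<partial>?N)"
   proof (rule L2_norm_AE_cong(1))
    show "AE x in M. sint ?N (P n) x - w x = (\<integral>ta. sval (P n) ta x - F ta x \<partial>?N)"
     using iF
    proof eventually_elim
     fix x assume "integrable ?N (%ta. F ta x)"
     then show "sint ?N (P n) x - w x = (\<integral>ta. sval (P n) ta x - F ta x \<partial>?N)"
      using simple_integral_eq[OF ps, of n x] by (simp add: w_def)
    qed
    show "(%x. sint ?N (P n) x - w x) \<in> borel_measurable M"
     using L2D(1)[OF simple_integral_L2[OF ps]] L2D(1)[OF wL] by auto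
    show "(%x. \<integral>ta. sval (P n) ta x - F ta x \<partial>?N) \<in> borel_measurable M"
     by (rule L2D(1), rule Minkowski_integral(2)[OF N M D _ le, where B = "ep * t"]) (use nnB[of ep] ep t in auto)
   qed
   then show ?thesis using m by simp
  qed
  then show ?thesis by blast
 qed
 have scale: "\<exists>ep>0. ep * t < e" if "e > 0" for e :: real
  using that t by (intro exI[of _ "e / (t + 1)"]) (simp add: field_simps)
 have "has_L2_integral ?N M F w" unfolding has_L2_integral_def
 proof (intro conjI exI[of _ P] ballI allI)
  show "F ta \<in> L2 M" if "ta \<in> space ?N" for ta using FL that spN by simp
  show "w \<in> L2 M" by (rule wL)
  show "L2_simple ?N M (P n)" for n by (rule ps)
  show "AE ta in ?N. (%n. nrm M (%x. F ta x - sval (P n) ta x)) \<longlonglongrightarrow> 0"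
  proof (rule AE_I2)
   fix ta assume "ta \<in> space ?N"
   then have "ta \<in> {0..t}" by (simp add: spN)
   then show "(%n. nrm M (%x. F ta x - sval (P n) ta x)) \<longlonglongrightarrow> 0"
    using unif by (intro LIMSEQ_I) fastforce
  qed
  show "(%n. \<integral>\<^sup>+ ta. ennreal (nrm M (%x. F ta x - sval (P n) ta x)) \<partial>?N) \<longlonglongrightarrow> 0"
  proof (rule order_tendstoI)
   fix a :: ennreal assume "a > 0"
   have "\<exists>e>0. ennreal e < a"
   proof (cases a)
    case (real r)
    then have "r > 0" using \<open>a > 0\<close> by simp
    then show ?thesis using real by (intro exI[of _ "r / 2"]) (simp add: ennreal_less_iff)
   qed (auto intro: exI[of _ 1])
   then obtain e where e: "e > 0" "ennreal e < a" by blast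
   obtain ep where ep: "ep > 0" "ep * t < e" using scale[OF e(1)] by blast
   obtain N0 where N0: "\<And>n. n >= N0 ==> (\<integral>\<^sup>+ ta. ennreal (nrm M (%x. F ta x - sval (P n) ta x)) \<partial>?N) <= ennreal (ep * t)"
    using nnlim[OF ep(1)] by blast
   have "ennreal (ep * t) < a" using ep e by (meson ennreal_leI less_imp_le order_le_less_trans)
   then show "\<forall>\<^sub>F n in sequentially. (\<integral>\<^sup>+ ta. ennreal (nrm M (%x. F ta x - sval (P n) ta x)) \<partial>?N) < a"
    using N0 unfolding eventually_sequentially by (meson order_le_less_trans)
  qed simp
  show "(%n. nrm M (%x. sint ?N (P n) x - w x)) \<longlonglongrightarrow> 0"
  proof (rule LIMSEQ_I)
   fix e :: real assume "e > 0"
   then obtain ep where ep: "ep > 0" "ep * t < e" using scale by blast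
   then show "\<exists>no. \<forall>n\<ge>no. norm (nrm M (%x. sint ?N (P n) x - w x) - 0) < e"
    using intlim[OF ep(1)] by fastforce
  qed
 qed
 then show ?thesis unfolding w_eq .
qed

section \<open>Convolution with a singular kernel\<close>

lemma Minkowski_ennreal:
 assumes N: "sigma_finite_measure N" and M: "sigma_finite_measure M"
  and F: "(%(ta, x). F ta x) \<in> borel_measurable (N \<Otimes>\<^sub>M M)" "ph \<in> borel_measurable N"
  and le: "AE ta in N. F ta \<in> L2 M \<and> nrm M (F ta) <= ph ta"
 shows "ennreal (nrm M (%x. \<integral>ta. F ta x \<partial>N)) <= (\<integral>\<^sup>+ta. ennreal (ph ta) \<partial>N)"
proof (cases "(\<integral>\<^sup>+ta. ennreal (ph ta) \<partial>N)")
 case (real B)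
 then show ?thesis using Minkowski_integral(3)[OF N M F le, of B] by (simp add: ennreal_leI)
qed simp

text \<open>The class of source terms. Joint measurability allows pointwise convolution in time for fixed \<open>x\<close>; vanishing for negative
times makes convolution over the whole line the causal one.\<close>

definition admissible :: "'a measure => (real => 'a => real) => bool" where
 "admissible M ph \<longleftrightarrow> (%(t, x). ph t x) \<in> jmeas M \<and>
  (\<forall>t<0. \<forall>x. ph t x = 0) \<and> L2_cont M {0..} ph"

lemma admissible_L2: "admissible M ph ==> ph t \<in> L2 M"
proof -
 assume a: "admissible M ph"
 show "ph t \<in> L2 M"
 proof (cases "t >= 0")
  case True
  then show ?thesis using a L2_contD(1)[of M "{0..}" ph t] by (simp add: admissible_def)
 next
  case False
  then have "ph t = (%x. 0)" using a by (auto simp: admissible_def)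
  then show ?thesis by simp
 qed
qed

lemma admissible_bounded:
 assumes "admissible M ph"
 shows "\<exists>B\<ge>0. \<forall>t\<le>T. nrm M (ph t) <= B"
proof -
 have c: "continuous_on {0..T} (%t. nrm M (ph t))"
 proof (rule L2_cont_norm, rule L2_cont_subset)
  show "L2_cont M {0..} ph" using assms by (simp add: admissible_def)
 qed auto
 have "bounded ((%t. nrm M (ph t)) ` {0..T})"
  by (intro compact_imp_bounded compact_continuous_image c compact_Icc)
 then obtain B where "\<forall>y\<in>(%t. nrm M (ph t)) ` {0..T}. norm y <= B" unfolding bounded_iff by blast
 then have B: "nrm M (ph t) <= B" if "t \<in> {0..T}" for t using that by simp
 have "nrm M (ph t) <= max 0 B" if "t <= T" for t
 proof (cases "t >= 0")
  case False
  then have "ph t = (%x. 0)" using assms by (auto simp: admissible_def)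
  then show ?thesis by simp
 qed (use B[of t] that in auto)
 then show ?thesis by (intro exI[of _ "max 0 B"]) auto
qed

lemma nn_integral_powr_Ioo:
 assumes "th > -1" "t >= 0"
 shows "(NN sg. ennreal (sg powr th * ind {0<..<t} sg)) = ennreal (t powr (th + 1) / (th + 1))"
proof -
 have "(NN sg. ennreal (sg powr th * ind {0<..<t} sg)) = (NN sg. ennreal (ind {0..t} sg * sg powr th))"
  using AE_neq_lborel[of 0] AE_neq_lborel[of t]
  by (intro nn_integral_cong_AE, eventually_elim) (auto simp: indicator_def)
 then show ?thesis using nn_integral_powr_from_0[OF assms] by simp
qed

text \<open>Both the solution in \<open>V\<^sub>1\<^sub>/\<^sub>2\<close> and its time derivative are convolutions of the source with kernels that are singular at
\<open>0\<close> but integrable, with a bound uniform in \<open>x\<close>.\<close>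

locale singular_convolution =
 fixes M :: "'a measure" and ka :: "real => 'a => real" and th C :: real and ph :: "real => 'a => real"
 assumes M: "sigma_finite_measure M"
  and km [measurable]: "(%(t, x). ka t x) \<in> jmeas M"
  and k0: "\<And>t x. t <= 0 ==> ka t x = 0"
  and kb: "\<And>t x. t > 0 ==> x \<in> space M ==> \<bar>ka t x\<bar> <= C * t powr th"
  and th: "th > -1" and C: "C >= 0" and ph: "admissible M ph"
begin

sublocale sigma_finite_measure M by (rule M)

lemma pm [measurable]: "(%(t, x). ph t x) \<in> jmeas M"
 using ph by (simp add: admissible_def)

lemma p0: "t < 0 ==> ph t x = 0" using ph by (simp add: admissible_def)

lemma pL2: "ph t \<in> L2 M" using admissible_L2[OF ph] .

definition W :: "real => 'a => real" where
 "W t x = conv (%s. ka s x) (%s. ph s x) t"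

lemma W_reflect: "W t x = (LL sg. ka sg x * ph (t - sg) x)"
 unfolding W_def using conv_commute[of "%s. ka s x" "%s. ph s x" t] by (simp add: conv_def mult.commute)

lemma integrand:
 assumes g: "g \<in> L2 M" and s: "sg > 0"
 shows "(%x. ka sg x * g x) \<in> L2 M \<and> nrm M (%x. ka sg x * g x) <= C * sg powr th * nrm M g"
 using L2_mult_bounded[of "ka sg" M g "C * sg powr th"] g kb[OF s] C by auto

lemma pnorm_m [measurable]: "(%s. nrm M (ph s)) \<in> bor"
 using L2_norm_measurable[OF M pm] by simp

lemma W_norm:
 "ennreal (nrm M (W t)) <= (NN s. ennreal (C * (t - s) powr th * nrm M (ph s) * ind {0<..<t} s))"
proof -
 have [measurable]: "(%(s, x). ka (t - s) x) \<in> jmeas M"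
 proof -
  have "(%z. (t - fst z, snd z)) \<in> (lborel :: real measure) \<Otimes>\<^sub>M M \<rightarrow>\<^sub>M lborel \<Otimes>\<^sub>M M" by measurable
  from measurable_compose[OF this km] show ?thesis by (simp add: split_beta')
 qed
 have "ennreal (nrm M (%x. LL s. ka (t - s) x * ph s x)) \<le>
  (NN s. ennreal (C * (t - s) powr th * nrm M (ph s) * ind {0<..<t} s))"
 proof (rule Minkowski_ennreal[OF lborel.sigma_finite_measure_axioms M])
  show "(%(s, x). ka (t - s) x * ph s x) \<in> jmeas M" by measurable
  show "(%s. C * (t - s) powr th * nrm M (ph s) * ind {0<..<t} s) \<in> borel_measurable lborel" by measurable
  show "AE s in lborel. (%x. ka (t - s) x * ph s x) \<in> L2 M \<and>
   nrm M (%x. ka (t - s) x * ph s x) <= C * (t - s) powr th * nrm M (ph s) * ind {0<..<t} s"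
   using AE_neq_lborel[of 0]
  proof eventually_elim
   fix s :: real assume "s \<noteq> 0"
   then consider "s < 0" | "s >= t" | "0 < s" "s < t" by linarith
   then show "(%x. ka (t - s) x * ph s x) \<in> L2 M \<and>
    nrm M (%x. ka (t - s) x * ph s x) <= C * (t - s) powr th * nrm M (ph s) * ind {0<..<t} s"
   proof cases
    case 3 then show ?thesis using integrand[OF pL2, of "t - s" s] by simp
   qed (use p0 k0 C in simp_all)
  qed
 qed
 then show ?thesis by (simp add: W_def[abs_def] conv_def)
qed

lemma
 shows W_integrable: "AE x in M. integrable lborel (%sg. ka sg x * ph (t - sg) x)"
  and W_L2: "W t \<in> L2 M"
proof -
 obtain B where B: "B >= 0" "\<And>s. s <= \<bar>t\<bar> ==> nrm M (ph s) <= B" using admissible_bounded[OF ph] by blast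
 have m1 [measurable]: "(%(sg, x). ph (t - sg) x) \<in> jmeas M"
 proof -
  have "(%z. (t - fst z, snd z)) \<in> (lborel :: real measure) \<Otimes>\<^sub>M M \<rightarrow>\<^sub>M lborel \<Otimes>\<^sub>M M" by measurable
  from measurable_compose[OF this pm] show ?thesis by (simp add: split_beta')
 qed
 have m2: "(%(sg, x). ka sg x * ph (t - sg) x) \<in> jmeas M" by measurable
 let ?psi = "%sg. (C * B) * (sg powr th * ind {0<..<\<bar>t\<bar> + 1} sg)"
 have le: "AE sg in lborel. (%x. ka sg x * ph (t - sg) x) \<in> L2 M \<and> nrm M (%x. ka sg x * ph (t - sg) x) <= ?psi sg"
 proof (rule AE_I2)
  fix sg :: real
  consider "sg <= 0" | "sg >= \<bar>t\<bar> + 1" | "0 < sg" "sg < \<bar>t\<bar> + 1" by linarith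
  then show "(%x. ka sg x * ph (t - sg) x) \<in> L2 M \<and> nrm M (%x. ka sg x * ph (t - sg) x) <= ?psi sg"
  proof cases
   case 1 then show ?thesis using k0 by simp
  next
   case 2 then have "t - sg < 0" by linarith
   then show ?thesis using p0 C B by simp
  next
   case 3
   have "nrm M (ph (t - sg)) <= B" using B(2)[of "t - sg"] 3 by linarith
   then have "C * sg powr th * nrm M (ph (t - sg)) <= C * sg powr th * B" using C by (intro mult_left_mono) auto
   then show ?thesis using integrand[OF pL2, of sg "t - sg"] 3 by (auto simp: mult_ac)
  qed
 qed
 have nn: "(NN sg. ennreal (?psi sg)) <= ennreal ((C * B) * ((\<bar>t\<bar> + 1) powr (th + 1) / (th + 1)))"
 proof -
  have "(NN sg. ennreal (?psi sg)) = ennreal (C * B) * (NN sg. ennreal (sg powr th * ind {0<..<\<bar>t\<bar> + 1} sg))"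
   using C B by (subst nn_integral_cmult[symmetric]) (auto simp: ennreal_mult intro!: nn_integral_cong)
  also have "(NN sg. ennreal (sg powr th * ind {0<..<\<bar>t\<bar> + 1} sg)) = ennreal ((\<bar>t\<bar> + 1) powr (th + 1) / (th + 1))"
   by (rule nn_integral_powr_Ioo[OF th]) simp
  also have "ennreal (C * B) * ... = ennreal ((C * B) * ((\<bar>t\<bar> + 1) powr (th + 1) / (th + 1)))"
   using C B th by (intro ennreal_mult[symmetric]) auto
  finally show ?thesis by simp
 qed
 have nonneg: "(C * B) * ((\<bar>t\<bar> + 1) powr (th + 1) / (th + 1)) >= 0" using C B th by simp
 note mk = Minkowski_integral[OF lborel.sigma_finite_measure_axioms M m2 _ le nn nonneg]
 show "AE x in M. integrable lborel (%sg. ka sg x * ph (t - sg) x)" by (rule mk(1)) measurable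
 have "(%x. LL sg. ka sg x * ph (t - sg) x) \<in> L2 M" by (rule mk(2)) measurable
 then show "W t \<in> L2 M" by (simp add: W_reflect[abs_def])
qed

text \<open>Shift the time increment to the source: the increment of \<open>W\<close> is at most the integral of \<open>C sg powr th\<close>
times the norm of the increment of \<open>ph\<close>, which tends to \<open>0\<close> by dominated convergence. At
\<open>sg = t\<close> the source may jump because it vanishes for negative times; this is a null set.\<close>

lemma W_cont: "L2_cont M {0..} W"
 unfolding L2_cont_def
proof (intro ballI conjI)
 fix t :: real assume t: "t \<in> {0..}"
 show "W t \<in> L2 M" by (rule W_L2)
 show "((%ta. nrm M (%x. W ta x - W t x)) \<longlongrightarrow> 0) (at t within {0..})"
  unfolding tendsto_at_iff_sequentially
 proof (intro allI impI)
  fix X assume X: "\<forall>i. X i \<in> {0..} - {t}" and Xt: "X \<longlonglongrightarrow> t"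
  obtain T where T: "\<And>i. X i < T" "t < T" "T > 0"
  proof -
   obtain K where "\<And>i. norm (X i) <= K" using convergent_imp_Bseq[of X] Xt by (auto simp: convergent_def Bseq_def)
   then have K: "X i < \<bar>K\<bar> + \<bar>t\<bar> + 1" for i by (smt (verit) real_norm_def)
   show ?thesis by (rule that[of "\<bar>K\<bar> + \<bar>t\<bar> + 1"]) (use K in auto)
  qed
  obtain B where B: "B >= 0" "\<And>s. s <= T ==> nrm M (ph s) <= B" using admissible_bounded[OF ph] by blast
  let ?d = "%i sg. nrm M (%x. ph (X i - sg) x - ph (t - sg) x)"
  let ?psi = "%i sg. C * (sg powr th * ind {0<..<T} sg) * ?d i sg"
  have ms [measurable]: "(%(sg, x). ph (s - sg) x) \<in> jmeas M" for s
  proof -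
   have "(%z. (s - fst z, snd z)) \<in> (lborel :: real measure) \<Otimes>\<^sub>M M \<rightarrow>\<^sub>M lborel \<Otimes>\<^sub>M M" by measurable
   from measurable_compose[OF this pm] show ?thesis by (simp add: split_beta')
  qed
  have [measurable]: "(%sg. ?d i sg) \<in> bor" for i
  proof -
   note [measurable] = ms[of "X i"] ms[of t]
   have "(%sg. ?d i sg) \<in> borel_measurable lborel" by (rule L2_norm_measurable[OF M]) measurable
   then show ?thesis by simp
  qed
  have est: "nrm M (%x. W (X i) x - W t x) <= (LL sg. ?psi i sg)" and intpsi: "integrable lborel (?psi i)" for i
  proof -
   note [measurable] = ms[of "X i"] ms[of t]
   have m2: "(%(sg, x). ka sg x * (ph (X i - sg) x - ph (t - sg) x)) \<in> jmeas M" by measurable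
   have dB: "?d i sg <= 2 * B" if "sg > 0" for sg
   proof -
    have "?d i sg <= nrm M (ph (X i - sg)) + nrm M (%x. - ph (t - sg) x)"
     using L2_norm_triangle[OF pL2 L2_uminus[OF pL2]] by simp
    moreover have "nrm M (ph (X i - sg)) <= B" "nrm M (ph (t - sg)) <= B"
     using that T(1)[of i] T(2) by (auto intro!: B(2))
    ultimately show ?thesis by (simp add: L2_norm_uminus)
   qed
   have ipow: "integrable lborel (%sg. sg powr th * ind {0<..<T} sg)"
    by (rule integrableI_bounded) (use nn_integral_powr_Ioo[OF th, of T] T in auto)
   show ip: "integrable lborel (?psi i)"
   proof (rule Bochner_Integration.integrable_bound[OF integrable_mult_right[OF ipow, of "C * (2 * B)"]])
    show "AE sg in lborel. norm (?psi i sg) <= norm (C * (2 * B) * (sg powr th * ind {0<..<T} sg))"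
    proof (rule AE_I2)
     fix sg :: real
     show "norm (?psi i sg) <= norm (C * (2 * B) * (sg powr th * ind {0<..<T} sg))"
     proof (cases "sg \<in> {0<..<T}")
      case True
      then have "C * sg powr th * ?d i sg <= C * sg powr th * (2 * B)" using dB[of sg] C by (intro mult_left_mono) auto
      then show ?thesis using True C B by (simp add: abs_mult mult_ac)
     qed simp
    qed
   qed measurable
   have le: "AE sg in lborel. (%x. ka sg x * (ph (X i - sg) x - ph (t - sg) x)) \<in> L2 M \<and>
    nrm M (%x. ka sg x * (ph (X i - sg) x - ph (t - sg) x)) <= ?psi i sg"
   proof (rule AE_I2)
    fix sg :: real
    consider "sg <= 0" | "sg >= T" | "0 < sg" "sg < T" by linarith
    then show "(%x. ka sg x * (ph (X i - sg) x - ph (t - sg) x)) \<in> L2 M \<and>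
     nrm M (%x. ka sg x * (ph (X i - sg) x - ph (t - sg) x)) <= ?psi i sg"
    proof cases
     case 2
     then have "X i - sg < 0" "t - sg < 0" using T(1)[of i] T(2) by linarith+
     then show ?thesis using p0 2 T(3) by simp
    next
     case 3 then show ?thesis using integrand[OF L2_diff[OF pL2 pL2], of sg "X i - sg" "t - sg"] by (simp add: mult_ac)
    qed (use k0 in simp)
   qed
   have psi0: "?psi i sg >= 0" for sg using C by simp
   have nn: "(NN sg. ennreal (?psi i sg)) <= ennreal (LL sg. ?psi i sg)"
    using nn_integral_eq_integral[OF ip] psi0 by simp
   have "nrm M (%x. LL sg. ka sg x * (ph (X i - sg) x - ph (t - sg) x)) <= (LL sg. ?psi i sg)"
    by (rule Minkowski_integral(3)[OF lborel.sigma_finite_measure_axioms M m2 _ le nn]) (use psi0 in \<open>auto intro!: integral_nonneg_AE\<close>)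
   moreover have "nrm M (%x. W (X i) x - W t x) = nrm M (%x. LL sg. ka sg x * (ph (X i - sg) x - ph (t - sg) x))"
   proof (rule L2_norm_AE_cong(1))
    show "AE x in M. W (X i) x - W t x = (LL sg. ka sg x * (ph (X i - sg) x - ph (t - sg) x))"
     using W_integrable[of "X i"] W_integrable[of t]
     by eventually_elim (simp add: W_reflect right_diff_distrib)
    show "(%x. W (X i) x - W t x) \<in> borel_measurable M" using L2D(1)[OF W_L2] by auto
    show "(%x. LL sg. ka sg x * (ph (X i - sg) x - ph (t - sg) x)) \<in> borel_measurable M"
     by (rule L2D(1), rule Minkowski_integral(2)[OF lborel.sigma_finite_measure_axioms M m2 _ le nn]) (use psi0 in \<open>auto intro!: integral_nonneg_AE\<close>)
   qed
   ultimately show "nrm M (%x. W (X i) x - W t x) <= (LL sg. ?psi i sg)" by simp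
  qed
  have "(%i. LL sg. ?psi i sg) \<longlonglongrightarrow> (\<integral>sg. 0 \<partial>(lborel :: real measure))"
  proof (rule integral_dominated_convergence[where w = "%sg. (C * (2 * B)) * (sg powr th * ind {0<..<T} sg)"])
   show "integrable lborel (%sg. (C * (2 * B)) * (sg powr th * ind {0<..<T} sg))"
    by (intro integrable_mult_right integrableI_bounded) (use nn_integral_powr_Ioo[OF th, of T] T in auto)
   show "AE sg in lborel. (%i. ?psi i sg) \<longlonglongrightarrow> 0"
    using AE_neq_lborel[of t]
   proof eventually_elim
    fix sg :: real assume "sg \<noteq> t"
    have "(%i. ?d i sg) \<longlonglongrightarrow> 0"
    proof (cases "sg < t")
     case True
     have ev: "eventually (%i. X i - sg \<in> {0..}) sequentially"
      using order_tendstoD(1)[OF Xt True] by (auto elim: eventually_mono)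
     have c0: "((%ta. nrm M (%x. ph ta x - ph (t - sg) x)) \<longlongrightarrow> nrm M (%x. ph (t - sg) x - ph (t - sg) x)) (at (t - sg) within {0..})"
      using ph True unfolding admissible_def L2_cont_def by simp
     have lim: "(%i. X i - sg) \<longlonglongrightarrow> t - sg" by (intro tendsto_intros Xt)
     have "continuous (at (t - sg) within {0..}) (%ta. nrm M (%x. ph ta x - ph (t - sg) x))"
      using c0 by (simp add: continuous_within)
     from continuous_within_tendsto_compose[OF this ev lim] show ?thesis by simp
    next
     case False
     then have "t < sg" using \<open>sg \<noteq> t\<close> by simp
     then have ev: "eventually (%i. X i < sg) sequentially" using order_tendstoD(2)[OF Xt] by blast
     have "eventually (%i. ?d i sg = 0) sequentially"
      using ev by eventually_elim (use p0 \<open>t < sg\<close> in simp)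
     then show ?thesis by (rule tendsto_eventually)
    qed
    then show "(%i. ?psi i sg) \<longlonglongrightarrow> 0" by (intro tendsto_mult_right_zero)
   qed
   show "AE sg in lborel. norm (?psi i sg) <= (C * (2 * B)) * (sg powr th * ind {0<..<T} sg)" for i
   proof (rule AE_I2)
    fix sg :: real
    show "norm (?psi i sg) <= (C * (2 * B)) * (sg powr th * ind {0<..<T} sg)"
    proof (cases "sg \<in> {0<..<T}")
     case True
     have "?d i sg <= nrm M (ph (X i - sg)) + nrm M (%x. - ph (t - sg) x)"
      using L2_norm_triangle[OF pL2 L2_uminus[OF pL2]] by simp
     moreover have "nrm M (ph (X i - sg)) <= B" "nrm M (ph (t - sg)) <= B"
      using True T(1)[of i] T(2) by (auto intro!: B(2))
     ultimately have "?d i sg <= 2 * B" by (simp add: L2_norm_uminus)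
     then have "C * sg powr th * ?d i sg <= C * sg powr th * (2 * B)" using C by (intro mult_left_mono) auto
     then show ?thesis using True C B by (simp add: abs_mult mult_ac)
    qed simp
   qed
  qed auto
  then have "(%i. LL sg. ?psi i sg) \<longlonglongrightarrow> 0" by simp
  then show "((%ta. nrm M (%x. W ta x - W t x)) \<circ> X) \<longlonglongrightarrow> 0"
   unfolding comp_def by (rule null_sandwich[OF L2_norm_nonneg est])
 qed
qed

end

text \<open>The difference quotient minus \<open>W t\<close> is a mean value of \<open>W rh - W t\<close>, small by Minkowski's
inequality.\<close>

lemma has_L2_derivative_of_integral:
 assumes M: "sigma_finite_measure M"
  and Wm [measurable]: "(%(t, x). W t x) \<in> jmeas M" and W: "L2_cont M {0<..} W"
  and U: "\<And>t. t > 0 ==> U t \<in> borel_measurable M"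
  and UW: "\<And>s t. 0 < s ==> s < t ==> AE x in M. integrable lborel (%rh. ind {s<..<t} rh * W rh x) \<and>
    U t x - U s x = (LL rh. ind {s<..<t} rh * W rh x)"
  and t: "t > 0" and S: "S \<subseteq> {0<..}"
 shows "has_L2_derivative M U (W t) t S"
 unfolding has_L2_derivative_def
proof
 interpret sigma_finite_measure M by (rule M)
 show WL: "W t \<in> L2 M" using L2_contD(1)[OF W] t by simp
 note [measurable] = L2D(1)[OF WL]
 have "((%ta. nrm M (%x. (U ta x - U t x) / (ta - t) - W t x)) \<longlongrightarrow> 0) (at t within {0<..})"
 proof (rule tendstoI)
  fix e :: real assume e: "e > 0"
  then have e2: "e / 2 > 0" by simp
  have "((%ta. nrm M (%x. W ta x - W t x)) \<longlongrightarrow> 0) (at t within {0<..})" using L2_contD(2)[OF W] t by simp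
  from tendstoD[OF this e2] obtain de where de: "de > 0" and near: "\<And>ta. ta > 0 ==> ta \<noteq> t ==> \<bar>ta - t\<bar> < de ==> nrm M (%x. W ta x - W t x) < e / 2"
   by (auto simp: eventually_at dist_real_def)
  have near': "nrm M (%x. W ta x - W t x) <= e / 2" if "ta > 0" "\<bar>ta - t\<bar> < de" for ta
   using near[OF that(1) _ that(2)] e2 by (cases "ta = t") auto
  have main: "nrm M (%x. (U b x - U a x) / (b - a) - W t x) <= e / 2"
   if ab: "0 < a" "a < b" "t - de < a" "a <= t" "t <= b" "b < t + de" for a b
  proof -
   have m: "(%(rh, x). ind {a<..<b} rh / (b - a) * (W rh x - W t x)) \<in> jmeas M" by measurable
   have le: "AE rh in lborel. (%x. ind {a<..<b} rh / (b - a) * (W rh x - W t x)) \<in> L2 M \<and>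
    nrm M (%x. ind {a<..<b} rh / (b - a) * (W rh x - W t x)) <= e / 2 / (b - a) * ind {a<..<b} rh"
   proof (rule AE_I2)
    fix rh :: real
    show "(%x. ind {a<..<b} rh / (b - a) * (W rh x - W t x)) \<in> L2 M \<and>
    nrm M (%x. ind {a<..<b} rh / (b - a) * (W rh x - W t x)) <= e / 2 / (b - a) * ind {a<..<b} rh"
    proof (cases "rh \<in> {a<..<b}")
     case True
     then have r: "rh > 0" "\<bar>rh - t\<bar> < de" using ab by auto
     have d: "(%x. W rh x - W t x) \<in> L2 M" using L2_contD(1)[OF W, of rh] r WL by (auto intro: L2_diff)
     have "1 / (b - a) * nrm M (%x. W rh x - W t x) <= 1 / (b - a) * (e / 2)"
      using near'[OF r] ab by (intro mult_left_mono) auto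
     moreover have "(%x. ind {a<..<b} rh / (b - a) * (W rh x - W t x)) = (%x. 1 / (b - a) * (W rh x - W t x))"
      using True by auto
     moreover have "e / 2 / (b - a) * ind {a<..<b} rh = 1 / (b - a) * (e / 2)" using True by simp
     moreover have "\<bar>1 / (b - a)\<bar> = 1 / (b - a)" using ab by simp
     ultimately show ?thesis using L2_scale[OF d, of "1 / (b - a)"] by (simp only: L2_norm_scale)
    qed simp
   qed
   have nn: "(NN rh. ennreal (e / 2 / (b - a) * ind {a<..<b} rh)) <= ennreal (e / 2)"
   proof -
    have "(NN rh. ennreal (e / 2 / (b - a) * ind {a<..<b} rh)) = (NN rh. ennreal (e / 2 / (b - a)) * ind {a<..<b} rh)"
     by (intro nn_integral_cong) (auto simp: indicator_def)
    also have "... = ennreal (e / 2 / (b - a)) * ennreal (b - a)" using ab by (simp add: nn_integral_cmult_indicator)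
    also have "... = ennreal (e / 2 / (b - a) * (b - a))" by (rule ennreal_mult[symmetric]) (use ab e in auto)
    also have "e / 2 / (b - a) * (b - a) = e / 2"
     using ab by (subst times_divide_eq_left, subst nonzero_mult_div_cancel_right) auto
    finally show ?thesis by simp
   qed
   note mk = Minkowski_integral[OF lborel.sigma_finite_measure_axioms M m _ le nn]
   have "nrm M (%x. LL rh. ind {a<..<b} rh / (b - a) * (W rh x - W t x)) <= e / 2" by (rule mk(3)) (use e in auto)
   moreover have "nrm M (%x. (U b x - U a x) / (b - a) - W t x) = nrm M (%x. LL rh. ind {a<..<b} rh / (b - a) * (W rh x - W t x))"
   proof (rule L2_norm_AE_cong(1))
    show "AE x in M. (U b x - U a x) / (b - a) - W t x = (LL rh. ind {a<..<b} rh / (b - a) * (W rh x - W t x))"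
     using UW[OF ab(1,2)]
    proof eventually_elim
     fix x assume *: "integrable lborel (%rh. ind {a<..<b} rh * W rh x) \<and> U b x - U a x = (LL rh. ind {a<..<b} rh * W rh x)"
     have ii: "integrable lborel (%rh::real. ind {a<..<b} rh * (W t x / (b - a)))" by (intro integrable_mult_left) (use ab in simp)
     have "(LL rh. ind {a<..<b} rh / (b - a) * (W rh x - W t x)) =
      (LL rh. (1 / (b - a)) * (ind {a<..<b} rh * W rh x) - ind {a<..<b} rh * (W t x / (b - a)))"
      by (intro Bochner_Integration.integral_cong refl) (simp add: algebra_simps diff_divide_distrib)
     also have "... = (1 / (b - a)) * (LL rh. ind {a<..<b} rh * W rh x) - (b - a) * (W t x / (b - a))"
      using * ii ab by (subst Bochner_Integration.integral_diff) auto
     finally show "(U b x - U a x) / (b - a) - W t x = (LL rh. ind {a<..<b} rh / (b - a) * (W rh x - W t x))"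
      using * ab by simp
    qed
    show "(%x. (U b x - U a x) / (b - a) - W t x) \<in> borel_measurable M" using U[of a] U[of b] ab by auto
    show "(%x. LL rh. ind {a<..<b} rh / (b - a) * (W rh x - W t x)) \<in> borel_measurable M"
     by (rule L2D(1), rule mk(2)) (use e in auto)
   qed
   ultimately show ?thesis by simp
  qed
  have "nrm M (%x. (U ta x - U t x) / (ta - t) - W t x) < e" if ta: "ta > 0" "ta \<noteq> t" "\<bar>ta - t\<bar> < de" for ta
  proof (cases "ta > t")
   case True
   then show ?thesis using main[of t ta] t ta de e by auto
  next
   case False
   then have "ta < t" using ta by simp
   moreover have "(U ta x - U t x) / (ta - t) = (U t x - U ta x) / (t - ta)" for x
    using \<open>ta < t\<close> by (simp add: field_simps)
   ultimately show ?thesis using main[of ta t] t ta de e by auto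
  qed
  then show "\<forall>\<^sub>F ta in at t within {0<..}. dist (nrm M (%x. (U ta x - U t x) / (ta - t) - W t x)) 0 < e"
   unfolding eventually_at using de by (intro exI[of _ de]) (auto simp: dist_real_def)
 qed
 then show "((%ta. nrm M (%x. (U ta x - U t x) / (ta - t) - W t x)) \<longlongrightarrow> 0) (at t within S)"
  by (rule tendsto_within_subset[OF _ S])
qed

section \<open>The linear evolution\<close>

lemma conv_jm:
 assumes km [measurable]: "(%(t, x). ka t x) \<in> jmeas M"
  and pm [measurable]: "(%(t, x). psi t x) \<in> jmeas M"
 shows "(%(t, x). conv (%s. ka s x) (%s. psi s x) t) \<in> jmeas M"
proof -
 have [measurable]: "(%z. ka (fst (fst z) - snd z) (snd (fst z))) \<in> borel_measurable ((lborel \<Otimes>\<^sub>M M) \<Otimes>\<^sub>M lborel)"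
 proof -
  have "(%z. (fst (fst z) - snd z, snd (fst z))) \<in> ((lborel :: real measure) \<Otimes>\<^sub>M M) \<Otimes>\<^sub>M lborel \<rightarrow>\<^sub>M lborel \<Otimes>\<^sub>M M" by measurable
  from measurable_compose[OF this km] show ?thesis by simp
 qed
 have [measurable]: "(%z. psi (snd z) (snd (fst z))) \<in> borel_measurable (((lborel :: real measure) \<Otimes>\<^sub>M M) \<Otimes>\<^sub>M lborel)"
 proof -
  have "(%z. (snd z, snd (fst z))) \<in> ((lborel :: real measure) \<Otimes>\<^sub>M M) \<Otimes>\<^sub>M lborel \<rightarrow>\<^sub>M lborel \<Otimes>\<^sub>M M" by measurable
  from measurable_compose[OF this pm] show ?thesis by simp
 qed
 have "(%z. LL s. ka (fst z - s) (snd z) * psi s (snd z)) \<in> jmeas M"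
  by (rule lborel.borel_measurable_lebesgue_integral) (simp add: split_beta')
 then show ?thesis by (simp add: conv_def split_beta')
qed

lemma section_measurable:
 assumes "(%(t :: real, x). psi t x) \<in> jmeas M" "x \<in> space M"
 shows "(%t. psi t x) \<in> bor"
proof -
 have "(%t. (t, x)) \<in> lborel \<rightarrow>\<^sub>M (lborel :: real measure) \<Otimes>\<^sub>M M" using assms(2) by measurable
 from measurable_compose[OF this assms(1)] show ?thesis by simp
qed

text \<open>Allows the scalar theory to be applied for almost every \<open>x\<close>.\<close>

lemma AE_causal_L1loc:
 assumes M: "sigma_finite_measure M" and ph: "admissible M ph"
 shows "AE x in M. causal_L1loc (%s. ph s x)"
proof -
 have pm [measurable]: "(%(t, x). ph t x) \<in> jmeas M" using ph by (simp add: admissible_def)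
 have p0: "ph t x = 0" if "t < 0" for t x using ph that by (simp add: admissible_def)
 have "AE x in M. integrable lborel (%s. ind {0..real n} s * ph s x)" for n
 proof -
  obtain B where B: "B >= 0" "\<And>s. s <= real n ==> nrm M (ph s) <= B" using admissible_bounded[OF ph] by blast
  have m: "(%(s, x). ind {0..real n} s * ph s x) \<in> jmeas M" by measurable
  show ?thesis
  proof (rule Minkowski_integral(1)[OF lborel.sigma_finite_measure_axioms M m, where ph = "%s. B * ind {0..real n} s" and B = "B * real n"])
   show "AE s in lborel. (%x. ind {0..real n} s * ph s x) \<in> L2 M \<and> nrm M (%x. ind {0..real n} s * ph s x) <= B * ind {0..real n} s"
    using B admissible_L2[OF ph] by (intro AE_I2) (auto simp: indicator_def)
   have "(NN s. ennreal (B * ind {0..real n} s)) = (NN s. ennreal B * ind {0..real n} s)"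
    by (intro nn_integral_cong) (auto simp: indicator_def)
   then show "(NN s. ennreal (B * ind {0..real n} s)) <= ennreal (B * real n)"
    using B by (simp add: nn_integral_cmult_indicator ennreal_mult)
  qed (use B in auto)
 qed
 then have "AE x in M. \<forall>n::nat. integrable lborel (%s. ind {0..real n} s * ph s x)" by (simp add: AE_all_countable)
 then show ?thesis using AE_space
 proof eventually_elim
  fix x assume i: "\<forall>n::nat. integrable lborel (%s. ind {0..real n} s * ph s x)" and x: "x \<in> space M"
  show "causal_L1loc (%s. ph s x)" unfolding causal_L1loc_def
  proof (intro conjI allI impI)
   show "(%s. ph s x) \<in> bor" by (rule section_measurable[OF pm x])
   fix S :: real
   obtain n where n: "S <= real n" using real_arch_simple by blast
   have "(NN s. ennreal \<bar>ph s x\<bar> * ind {..S} s) <= (NN s. ennreal (norm (ind {0..real n} s * ph s x)))"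
   proof (intro nn_integral_mono)
    fix s show "ennreal \<bar>ph s x\<bar> * ind {..S} s <= ennreal (norm (ind {0..real n} s * ph s x))"
     using n p0[of s x] by (cases "s < 0") (auto simp: indicator_def)
   qed
   also have "... < \<infinity>" using i by (auto simp: integrable_iff_bounded)
   finally show "(NN s. ennreal \<bar>ph s x\<bar> * ind {..S} s) < \<infinity>" .
  qed (use p0 in auto)
 qed
qed

lemma admissible_diff:
 assumes "admissible M ph" "admissible M psi" shows "admissible M (%t x. ph t x - psi t x)"
proof -
 have "L2_cont M {0..} (%t x. - psi t x)"
 proof -
  have "nrm M (%x. - psi ta x - - psi t x) = nrm M (%x. psi ta x - psi t x)" for ta t
   using L2_norm_uminus[of M "%x. psi ta x - psi t x"] by simp
  then show ?thesis using assms(2) unfolding admissible_def L2_cont_def by (auto intro: L2_uminus)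
 qed
 then have "L2_cont M {0..} (%t x. ph t x + - psi t x)" using assms(1) by (intro L2_cont_add) (auto simp: admissible_def)
 moreover have "(%(t, x). ph t x - psi t x) \<in> jmeas M"
 proof -
  have [measurable]: "(%(t, x). ph t x) \<in> jmeas M" "(%(t, x). psi t x) \<in> jmeas M"
   using assms by (auto simp: admissible_def)
  show ?thesis by measurable
 qed
 ultimately show ?thesis using assms by (auto simp: admissible_def)
qed

text \<open>The lower bound for \<open>m\<close> is required everywhere; the general case is reduced to this one at the end.\<close>

locale wave =
 fixes M :: "'a measure" and m :: "'a => real" and m0 al :: real and u0 u1 :: "'a => real"
 assumes fm: "finite_measure M" and mm [measurable]: "m \<in> borel_measurable M" and m0: "m0 > 0"
  and mge: "\<And>x. m x >= m0" and al: "1 < al" "al < 2"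
  and u0V: "u0 \<in> V M m (1/2)" and u1L: "u1 \<in> L2 M"
begin

lemma M: "sigma_finite_measure M" by (rule finite_measure.axioms(1)[OF fm])

sublocale finite_measure M by (rule fm)

lemma a0: "al > 0" "al - 1 > 0" "2 - al > 0" using al by auto

lemma mpos: "m x > 0" using mge[of x] m0 by linarith

abbreviation "C \<equiv> mlC al"
abbreviation "sm x \<equiv> sqrt (m x)"

lemma C0: "C > 0" using mlk_bounds(1)[OF al] .

lemma powr_half: "m x powr (1/2) = sm x" using mpos[of x] by (simp add: powr_half_sqrt)

lemma V_norm_half: "V_norm M m (1/2) g = nrm M (%x. sm x * g x)"
 by (simp add: V_norm_def powr_half)

abbreviation "nV \<equiv> V_norm M m (1/2)"

lemma L2_of_weighted:
 assumes [measurable]: "g \<in> borel_measurable M" and "(%x. sm x * g x) \<in> L2 M"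
 shows "g \<in> L2 M" "nrm M g <= 1 / sqrt m0 * nrm M (%x. sm x * g x)"
proof -
 have "\<bar>g x\<bar> <= 1 / sqrt m0 * \<bar>sm x * g x\<bar>" for x
 proof -
  have "sqrt m0 <= sm x" using mge by simp
  then have "sqrt m0 * \<bar>g x\<bar> <= sm x * \<bar>g x\<bar>" by (intro mult_right_mono) auto
  then show ?thesis using m0 mpos[of x] by (simp add: abs_mult field_simps)
 qed
 then have ae: "AE x in M. \<bar>g x\<bar> <= 1 / sqrt m0 * \<bar>sm x * g x\<bar>" by (intro AE_I2)
 have c: "1 / sqrt m0 >= 0" using m0 by simp
 show "g \<in> L2 M" by (rule L2_mono(1)[OF assms(1,2) c ae])
 show "nrm M g <= 1 / sqrt m0 * nrm M (%x. sm x * g x)" by (rule L2_mono(2)[OF assms(1,2) c ae])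
qed

lemma V_iff: "g \<in> V M m (1/2) \<longleftrightarrow> g \<in> borel_measurable M \<and> (%x. sm x * g x) \<in> L2 M"
 using L2_of_weighted[of g] by (auto simp: V_def powr_half L2_iff)

lemma u0m [measurable]: "u0 \<in> borel_measurable M" and u0w: "(%x. sm x * u0 x) \<in> L2 M" and u0L: "u0 \<in> L2 M"
 using u0V L2_of_weighted[of u0] by (auto simp: V_iff)

lemma u1m [measurable]: "u1 \<in> borel_measurable M" using u1L by (simp add: L2_iff)

text \<open>The solution of the linear problem with source \<open>ph\<close> and the fixed initial data; \<open>w\<close> is its time derivative.\<close>

definition U :: "(real => 'a => real) => real => 'a => real" where
 "U ph t x = mittag_leffler al 1 (- m x * t powr al) * u0 x + t * mittag_leffler al 2 (- m x * t powr al) * u1 x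
  + conv (mlk al al (m x)) (%s. ph s x) t"

definition w :: "(real => 'a => real) => real => 'a => real" where
 "w ph t x = lin_w al (m x) (u0 x) (u1 x) (%s. ph s x) t"

lemma U_pos: "t > 0 ==> U ph t x = lin_y al (m x) (u0 x) (u1 x) (%s. ph s x) t"
 by (simp add: U_def lin_y_def mlk_def powr_numeral mult_ac)

lemma U_zero: "(\<And>s. s < 0 ==> ph s x = 0) ==> U ph 0 x = u0 x"
proof -
 assume p: "\<And>s. s < 0 ==> ph s x = 0"
 have "conv (mlk al al (m x)) (%s. ph s x) 0 = 0" by (rule conv_nonpos) (use p in auto)
 moreover have "mittag_leffler al 1 0 = 1" unfolding mittag_leffler_eq by (subst powser_zero) simp
 ultimately show ?thesis by (simp add: U_def)
qed

lemma mlk_jm [measurable]: "(%(t, x). mlk al be (m x) t) \<in> jmeas M"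
proof -
 have "(%z. mlk al be (m (snd z)) (fst z)) \<in> borel_measurable ((lborel :: real measure) \<Otimes>\<^sub>M M)"
  by (rule mlk_measurable2[OF a0(1)]) measurable
 then show ?thesis by (simp add: split_beta')
qed

lemma mlk_x [measurable]: "(%x. mlk al be (m x) t) \<in> borel_measurable M"
 by (rule mlk_measurable2[OF a0(1)]) measurable

lemma ml_x [measurable]: "f \<in> borel_measurable N ==> (%x. mittag_leffler al be (f x)) \<in> borel_measurable N"
 by (rule measurable_compose[OF _ mittag_leffler_measurable[OF a0(1)]])

context
 fixes ph assumes ph: "admissible M ph"
begin

lemma pm: "(%(t, x). ph t x) \<in> jmeas M"
 using ph by (simp add: admissible_def)

lemma p0: "t < 0 ==> ph t x = 0" using ph by (simp add: admissible_def)

lemma U_jm: "(%(t, x). U ph t x) \<in> jmeas M"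
proof -
 note [measurable] = conv_jm[OF mlk_jm[of al] pm]
 show ?thesis unfolding U_def by measurable
qed

lemma w_jm: "(%(t, x). w ph t x) \<in> jmeas M"
proof -
 note [measurable] = conv_jm[OF mlk_jm[of "al - 1"] pm]
 show ?thesis unfolding w_def lin_w_def by measurable
qed

lemma U_measurable: "U ph t \<in> borel_measurable M"
proof -
 have "(%x. (t, x)) \<in> M \<rightarrow>\<^sub>M lborel \<Otimes>\<^sub>M M" by measurable
 from measurable_compose[OF this U_jm] show ?thesis by simp
qed

lemma w_measurable: "w ph t \<in> borel_measurable M"
proof -
 have "(%x. (t, x)) \<in> M \<rightarrow>\<^sub>M lborel \<Otimes>\<^sub>M M" by measurable
 from measurable_compose[OF this w_jm] show ?thesis by simp
qed

lemma w_nonpos: "t <= 0 ==> w ph t x = 0"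
 using conv_nonpos[of "mlk al (al - 1) (m x)" "%s. ph s x" t] p0 by (simp add: w_def lin_w_def)

lemma sc1: "singular_convolution M (%t x. sm x * mlk al al (m x) t) (al / 2 - 1) C ph"
proof
 show "(%(t, x). sm x * mlk al al (m x) t) \<in> jmeas M" by measurable
 show "\<bar>sm x * mlk al al (m x) t\<bar> <= C * t powr (al / 2 - 1)" for t x
  using mlk_bounds(6)[OF al, of "m x" t] mpos[of x] by simp
qed (use M C0 ph a0 in \<open>auto simp: sigma_finite_measure_def\<close>)

lemma sc2: "singular_convolution M (%t x. mlk al (al - 1) (m x) t) (al - 2) C ph"
proof
 show "(%(t, x). mlk al (al - 1) (m x) t) \<in> jmeas M" by measurable
 show "\<bar>mlk al (al - 1) (m x) t\<bar> <= C * t powr (al - 2)" for t x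
  using mlk_bounds(7)[OF al, of "m x" t] mpos[of x] by simp
qed (use M C0 ph a0 in \<open>auto simp: sigma_finite_measure_def\<close>)

lemma sconv: "conv (%s. sm x * mlk al be (m x) s) f t = sm x * conv (mlk al be (m x)) f t"
 unfolding conv_def by (subst integral_mult_right_zero[symmetric]) (simp add: mult_ac)

abbreviation "W1 \<equiv> singular_convolution.W (%t x. sm x * mlk al al (m x) t) ph"
abbreviation "W2 \<equiv> singular_convolution.W (%t x. mlk al (al - 1) (m x) t) ph"

lemma W1_eq: "W1 t x = sm x * conv (mlk al al (m x)) (%s. ph s x) t"
 unfolding singular_convolution.W_def[OF sc1] by (rule sconv)

lemma W2_eq: "W2 t x = conv (mlk al (al - 1) (m x)) (%s. ph s x) t"
 unfolding singular_convolution.W_def[OF sc2] ..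

lemma sU_eq: "sm x * U ph t x = (mittag_leffler al 1 (- m x * t powr al) * (sm x * u0 x) +
  (sm x * (t * mittag_leffler al 2 (- m x * t powr al))) * u1 x) + W1 t x"
 by (simp add: U_def W1_eq algebra_simps)

lemma ml_bound1: "\<bar>mittag_leffler al 1 (- m x * s)\<bar> <= C" if "s >= 0"
 using mlk_bounds(2)[OF al, of "m x * s" 1] that mpos[of x] by (simp add: mlk_def)

lemma ml_cont: "continuous_on {0..} (%t. mittag_leffler al be (- m x * t powr al))"
proof -
 have "continuous_on UNIV (mittag_leffler al be)"
  using isCont_mittag_leffler[OF a0(1)] by (simp add: continuous_on_eq_continuous_at)
 then show ?thesis
  by (rule continuous_on_compose2) (use a0 in \<open>auto intro!: continuous_intros continuous_on_powr'\<close>)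
qed

lemma b2_bound: "t >= 0 ==> \<bar>sm x * (t * mittag_leffler al 2 (- m x * t powr al))\<bar> <= C * t powr (1 - al / 2)"
 using mlk_bounds(4)[OF al, of "m x" t] mpos[of x] C0 by (cases "t = 0") (auto simp: mlk_def)

lemma sU_cont: "L2_cont M {0..} (%t x. sm x * U ph t x)"
 unfolding sU_eq
proof (intro L2_cont_add)
 show "L2_cont M {0..} W1" by (rule singular_convolution.W_cont[OF sc1])
 show "L2_cont M {0..} (%t x. mittag_leffler al 1 (- m x * t powr al) * (sm x * u0 x))"
 proof (rule L2_cont_mult[OF L2_cont_const[OF u0w]])
  show "continuous_on {0..} (%_. C)" by simp
  show "(%x. mittag_leffler al 1 (- m x * t powr al)) \<in> borel_measurable M" for t by measurable
  show "\<bar>mittag_leffler al 1 (- m x * t powr al)\<bar> <= C" for t x by (rule ml_bound1) simp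
  show "continuous_on {0..} (%t. mittag_leffler al 1 (- m x * t powr al))" for x by (rule ml_cont)
 qed
 have "continuous_on {0..} (%t. C * t powr (1 - al / 2))" using al by (auto intro!: continuous_intros continuous_on_powr')
 then show "L2_cont M {0..} (%t x. sm x * (t * mittag_leffler al 2 (- m x * t powr al)) * u1 x)"
 proof (rule L2_cont_mult[OF L2_cont_const[OF u1L]])
  show "(%x. sm x * (t * mittag_leffler al 2 (- m x * t powr al))) \<in> borel_measurable M" for t by measurable
  show "\<bar>sm x * (t * mittag_leffler al 2 (- m x * t powr al))\<bar> <= C * t powr (1 - al / 2)" if "t \<in> {0..}" for t x
   using that by (intro b2_bound) simp
  show "continuous_on {0..} (%t. sm x * (t * mittag_leffler al 2 (- m x * t powr al)))" for x
   by (intro continuous_intros ml_cont)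
 qed
qed

lemma U_V: "t >= 0 ==> U ph t \<in> V M m (1/2)"
 using L2_contD(1)[OF sU_cont] U_measurable by (simp add: V_iff)

lemma U_continuous_V: "S \<subseteq> {0..} ==> continuous_V M m (1/2) S (U ph)"
 unfolding continuous_V_def
proof (intro ballI conjI)
 fix t assume S: "S \<subseteq> {0..}" and t: "t \<in> S"
 show "U ph t \<in> V M m (1/2)" using U_V S t by auto
 show "((%ta. nV (%x. U ph ta x - U ph t x)) \<longlongrightarrow> 0) (at t within S)"
  using L2_contD(2)[OF L2_cont_subset[OF sU_cont S] t] by (simp add: V_norm_half right_diff_distrib)
qed

lemma U_V_norm_cont: "continuous_on {0..} (%t. nV (U ph t))"
 using L2_cont_norm[OF sU_cont] by (simp add: V_norm_half)

text \<open>Writing \<open>m = \<surd>m \<surd>m\<close> distributes the operator evenly between the kernel, which is \<open>O(t powr (al/2 - 1))\<close>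
afterwards, and \<open>u0\<close>, which lies in \<open>V\<^sub>1\<^sub>/\<^sub>2\<close>.\<close>

lemma w_eq: "w ph t x = (- (sm x * mlk al al (m x) t)) * (sm x * u0 x) + mlk al 1 (m x) t * u1 x + W2 t x"
proof -
 have "sm x * sm x = m x" using mpos[of x] by simp
 then have "m x * u0 x * mlk al al (m x) t = sm x * mlk al al (m x) t * (sm x * u0 x)" by (metis mult.assoc mult.commute)
 then show ?thesis by (simp add: w_def lin_w_def W2_eq mult_ac)
qed

lemma w_cont: "L2_cont M {0<..} (w ph)"
proof -
 have "L2_cont M {0<..} (%t x. (- (sm x * mlk al al (m x) t)) * (sm x * u0 x) + mlk al 1 (m x) t * u1 x + W2 t x)"
 proof (intro L2_cont_add)
  show "L2_cont M {0<..} W2" by (rule L2_cont_subset[OF singular_convolution.W_cont[OF sc2]]) auto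
  have mc: "continuous_on {0<..} (mlk al be (m x))" for be x
   by (intro continuous_at_imp_continuous_on ballI mlk_isCont a0) auto
  have c: "continuous_on {0<..} (%t. C * t powr (al / 2 - 1))" by (auto intro!: continuous_intros)
  show "L2_cont M {0<..} (%t x. (- (sm x * mlk al al (m x) t)) * (sm x * u0 x))"
   by (rule L2_cont_mult[OF L2_cont_const[OF u0w] c])
    (use mlk_bounds(6)[OF al] mpos in \<open>auto intro!: continuous_intros mc simp: less_imp_le\<close>)
  show "L2_cont M {0<..} (%t x. mlk al 1 (m x) t * u1 x)"
   by (rule L2_cont_mult[OF L2_cont_const[OF u1L], where B = "%_. C"])
    (use mlk_bounds(2)[OF al] mpos in \<open>auto intro!: mc simp: less_imp_le\<close>)
 qed
 then show ?thesis by (simp add: w_eq[abs_def])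
qed

lemma w_L2: "w ph t \<in> L2 M"
proof (cases "t > 0")
 case False
 then have "w ph t = (%x. 0)" using w_nonpos by auto
 then show ?thesis by simp
qed (use L2_contD(1)[OF w_cont] in auto)

lemma W2_norm_le:
 assumes T: "T >= 0"
 shows "\<exists>D\<ge>0. \<forall>t\<in>{0..T}. nrm M (W2 t) <= D * t powr (al - 1)"
proof -
 obtain B where B: "B >= 0" "\<And>s. s <= T ==> nrm M (ph s) <= B" using admissible_bounded[OF ph] by blast
 have "nrm M (W2 t) <= C * B / (al - 1) * t powr (al - 1)" if t: "t \<in> {0..T}" for t
 proof -
  have "ennreal (nrm M (W2 t)) <= (NN s. ennreal (C * (t - s) powr (al - 2) * nrm M (ph s) * ind {0<..<t} s))"
   by (rule singular_convolution.W_norm[OF sc2])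
  also have "... <= (NN s. ennreal (C * B) * ennreal ((t - s) powr (al - 2) * ind {0<..<t} (t - s)))"
  proof (intro nn_integral_mono)
   fix s
   show "ennreal (C * (t - s) powr (al - 2) * nrm M (ph s) * ind {0<..<t} s) <= ennreal (C * B) * ennreal ((t - s) powr (al - 2) * ind {0<..<t} (t - s))"
   proof (cases "s \<in> {0<..<t}")
    case True
    then have "nrm M (ph s) <= B" using B t by auto
    then have "C * (t - s) powr (al - 2) * nrm M (ph s) <= C * (t - s) powr (al - 2) * B" using C0 by (intro mult_left_mono) auto
    then show ?thesis using True C0 B by (simp add: ennreal_mult[symmetric] mult_ac ennreal_leI)
   qed simp
  qed
  also have "... = ennreal (C * B) * (NN s. ennreal ((t - s) powr (al - 2) * ind {0<..<t} (t - s)))"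
   by (rule nn_integral_cmult) measurable
  also have "(NN s. ennreal ((t - s) powr (al - 2) * ind {0<..<t} (t - s))) = ennreal (t powr (al - 1) / (al - 1))"
   using nn_integral_lborel_reflect[of "%s. ennreal (s powr (al - 2) * ind {0<..<t} s)" t] nn_integral_powr_Ioo[of "al - 2" t] a0 t by simp
  also have "ennreal (C * B) * ... = ennreal (C * B * (t powr (al - 1) / (al - 1)))"
   using C0 B a0 by (intro ennreal_mult[symmetric]) auto
  finally show ?thesis using C0 B a0 by (simp add: mult_ac)
 qed
 then show ?thesis using C0 B a0 by (intro exI[of _ "C * B / (al - 1)"]) auto
qed

lemma w_norm_le:
 assumes T: "T > 0"
 shows "\<exists>D\<ge>0. \<forall>t\<in>{0<..T}. nrm M (w ph t) <= D * t powr (al / 2 - 1)"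
proof -
 obtain D where D: "D >= 0" "\<And>t. t \<in> {0..T} ==> nrm M (W2 t) <= D * t powr (al - 1)" using W2_norm_le[of T] T by auto
 define E where "E = C * nrm M (%x. sm x * u0 x) + C * nrm M u1 * T powr (1 - al / 2) + D * T powr (al / 2)"
 have "nrm M (w ph t) <= E * t powr (al / 2 - 1)" if t: "t \<in> {0<..T}" for t
 proof -
  have 1: "(%x. (- (sm x * mlk al al (m x) t)) * (sm x * u0 x)) \<in> L2 M \<and> nrm M (%x. (- (sm x * mlk al al (m x) t)) * (sm x * u0 x)) <= C * t powr (al / 2 - 1) * nrm M (%x. sm x * u0 x)"
   using L2_mult_bounded[OF _ u0w, of "%x. - (sm x * mlk al al (m x) t)" "C * t powr (al / 2 - 1)"] mlk_bounds(6)[OF al] mpos C0 by (auto simp: less_imp_le)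
  have 2: "(%x. mlk al 1 (m x) t * u1 x) \<in> L2 M \<and> nrm M (%x. mlk al 1 (m x) t * u1 x) <= C * nrm M u1"
   using L2_mult_bounded[OF _ u1L, of "%x. mlk al 1 (m x) t" C] mlk_bounds(2)[OF al] mpos C0 by (auto simp: less_imp_le)
  have 3: "W2 t \<in> L2 M" by (rule singular_convolution.W_L2[OF sc2])
  have "nrm M (w ph t) <= nrm M (%x. (- (sm x * mlk al al (m x) t)) * (sm x * u0 x) + mlk al 1 (m x) t * u1 x) + nrm M (W2 t)"
   unfolding w_eq[abs_def] using L2_norm_triangle[OF L2_add[OF conjunct1[OF 1] conjunct1[OF 2]] 3] .
  also have "... <= (C * t powr (al / 2 - 1) * nrm M (%x. sm x * u0 x) + C * nrm M u1) + D * t powr (al - 1)"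
   using L2_norm_triangle[OF conjunct1[OF 1] conjunct1[OF 2]] conjunct2[OF 1] conjunct2[OF 2] D(2)[of t] t by auto
  also have "C * nrm M u1 <= C * nrm M u1 * T powr (1 - al / 2) * t powr (al / 2 - 1)"
  proof -
   have "t powr (1 - al / 2) <= T powr (1 - al / 2)" using t al by (intro powr_mono2) auto
   then have "t powr (1 - al / 2) * t powr (al / 2 - 1) <= T powr (1 - al / 2) * t powr (al / 2 - 1)" by (intro mult_right_mono) auto
   moreover have "t powr (1 - al / 2) * t powr (al / 2 - 1) = 1" using t by (simp add: powr_add[symmetric])
   ultimately have "1 <= T powr (1 - al / 2) * t powr (al / 2 - 1)" by linarith
   then show ?thesis using mult_left_mono[of 1 "T powr (1 - al / 2) * t powr (al / 2 - 1)" "C * nrm M u1"] C0 by (simp add: mult.assoc)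
  qed
  also have "D * t powr (al - 1) <= D * T powr (al / 2) * t powr (al / 2 - 1)"
  proof -
   have "t powr (al / 2) <= T powr (al / 2)" using t al by (intro powr_mono2) auto
   then have "t powr (al / 2) * t powr (al / 2 - 1) <= T powr (al / 2) * t powr (al / 2 - 1)" by (intro mult_right_mono) auto
   moreover have "t powr (al / 2) * t powr (al / 2 - 1) = t powr (al - 1)" by (simp add: powr_add[symmetric])
   ultimately show ?thesis using D(1) mult_left_mono[of "t powr (al - 1)" "T powr (al / 2) * t powr (al / 2 - 1)" D] by (simp add: mult.assoc)
  qed
  finally show ?thesis by (simp add: E_def algebra_simps)
 qed
 then show ?thesis using C0 D by (intro exI[of _ E]) (auto simp: E_def)
qed

lemma U_increment:
 assumes s: "0 < s" "s < t"
 shows "AE x in M. integrable lborel (%rh. ind {s<..<t} rh * w ph rh x) \<and>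
    U ph t x - U ph s x = (LL rh. ind {s<..<t} rh * w ph rh x)"
 using AE_causal_L1loc[OF M ph] AE_space
proof eventually_elim
 fix x assume f: "causal_L1loc (%s. ph s x)" and x: "x \<in> space M"
 let ?v = "lin_w al (m x) (u0 x) (u1 x) (%s. ph s x)"
 have wv: "w ph rh x = ?v rh" for rh by (simp add: w_def)
 note Lw = lin_w_L1loc[OF al(1) f, of "m x" "u0 x" "u1 x"]
 note [measurable] = causal_L1locD(1)[OF Lw]
 have i: "integrable lborel (%rh. gk 1 (r - rh) * ?v rh)" for r
  using Lw by (intro aconv_integrable) (auto simp: causal_L1loc_iff)
 have eq: "ind {s<..<t} rh * w ph rh x = gk 1 (t - rh) * ?v rh - gk 1 (s - rh) * ?v rh" if "rh \<noteq> s" for rh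
  using s that by (auto simp: wv g_kernel_1 indicator_def)
 have ae: "AE rh in lborel. gk 1 (t - rh) * ?v rh - gk 1 (s - rh) * ?v rh = ind {s<..<t} rh * w ph rh x"
  using AE_neq_lborel[of s] by eventually_elim (simp add: eq)
 have "integrable lborel (%rh. ind {s<..<t} rh * w ph rh x)"
  by (rule integrable_cong_AE_imp[OF Bochner_Integration.integrable_diff[OF i[of t] i[of s]] _ ae]) (simp add: wv)
 moreover have "U ph t x - U ph s x = (LL rh. ind {s<..<t} rh * w ph rh x)"
 proof -
  have "U ph t x - U ph s x = conv (gk 1) ?v t - conv (gk 1) ?v s"
   using s lin_y_eq_integral[OF al(1) f] by (simp add: U_pos g_kernel_1)
  also have "... = (LL rh. gk 1 (t - rh) * ?v rh - gk 1 (s - rh) * ?v rh)"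
   unfolding conv_def by (rule Bochner_Integration.integral_diff[symmetric, OF i i])
  also have "... = (LL rh. ind {s<..<t} rh * w ph rh x)"
   by (rule integral_cong_AE) (use ae in \<open>auto simp: wv\<close>)
  finally show ?thesis .
 qed
 ultimately show "integrable lborel (%rh. ind {s<..<t} rh * w ph rh x) \<and>
    U ph t x - U ph s x = (LL rh. ind {s<..<t} rh * w ph rh x)" by simp
qed

lemma U_has_derivative: "t > 0 ==> S \<subseteq> {0<..} ==> has_L2_derivative M (U ph) (w ph t) t S"
 by (rule has_L2_derivative_of_integral[OF M w_jm w_cont U_measurable U_increment])

lemma w_norm_measurable [measurable]: "(%ta. nrm M (w ph ta)) \<in> bor"
 using L2_norm_measurable[OF M w_jm] by simp

end

end

section \<open>Regularity of linear solutions\<close>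

lemma admissible_cont: "admissible M ph ==> L2_cont M {0..} ph" by (simp add: admissible_def)

lemma has_L2_derivative_unique:
 assumes d: "has_L2_derivative M u d t S" and d': "has_L2_derivative M u d' t S"
  and u: "\<And>ta. ta \<in> S ==> u ta \<in> L2 M" and t: "u t \<in> L2 M" and lim: "t islimpt S"
 shows "AE x in M. d x = d' x"
proof -
 let ?q = "%ta x. (u ta x - u t x) / (ta - t)"
 have dL: "d \<in> L2 M" "d' \<in> L2 M" using d d' by (auto simp: has_L2_derivative_def)
 have l: "((%ta. nrm M (%x. ?q ta x - d x) + nrm M (%x. ?q ta x - d' x)) \<longlongrightarrow> 0) (at t within S)"
  using d d' unfolding has_L2_derivative_def by (intro tendsto_add_zero) auto
 have "((%ta. nrm M (%x. d x - d' x)) \<longlongrightarrow> 0) (at t within S)"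
 proof (rule null_sandwich_within[OF _ _ l])
  fix ta assume ta: "ta \<in> S"
  have q: "?q ta \<in> L2 M" using L2_scale[OF L2_diff[OF u[OF ta] t], of "1 / (ta - t)"] by simp
  show "nrm M (%x. d x - d' x) <= nrm M (%x. ?q ta x - d x) + nrm M (%x. ?q ta x - d' x)"
   using L2_norm_diff_triangle[OF dL(1) q dL(2)] L2_norm_minus_commute[of M d "?q ta"] by simp
 qed simp
 moreover have "at t within S \<noteq> bot" using lim by (simp add: trivial_limit_within)
 ultimately have "nrm M (%x. d x - d' x) = 0" using tendsto_unique[OF _ tendsto_const] by blast
 then have "AE x in M. d x - d' x = 0" using L2_norm_eq_0D[OF L2_diff[OF dL]] by simp
 then show ?thesis by eventually_elim simp
qed

lemma L2_deriv_AE: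
 assumes d: "has_L2_derivative M u d t S"
  and u: "\<And>ta. ta \<in> S ==> u ta \<in> L2 M" and t: "u t \<in> L2 M" and lim: "t islimpt S"
 shows "has_L2_derivative M u (L2_deriv M S u t) t S" "AE x in M. L2_deriv M S u t x = d x"
proof -
 show h: "has_L2_derivative M u (L2_deriv M S u t) t S" unfolding L2_deriv_def by (rule someI[of "%d. has_L2_derivative M u d t S", OF d])
 show "AE x in M. L2_deriv M S u t x = d x" by (rule has_L2_derivative_unique[OF h d u t lim])
qed

context wave
begin

lemma U_L2: "admissible M ph ==> t >= 0 ==> U ph t \<in> L2 M"
 using U_V[of ph t] by (simp add: V_def)

text \<open>The estimate behind the contraction and the uniqueness argument: differences of solutions depend on differences
of sources with an integrable singularity.\<close>

lemma U_diff_norm: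
 assumes ph: "admissible M ph" and psi: "admissible M psi"
 shows "ennreal (nV (%x. U ph t x - U psi t x)) \<le>
  (NN s. ennreal (C * (t - s) powr (al / 2 - 1) * nrm M (%x. ph s x - psi s x) * ind {0<..<t} s))"
proof -
 let ?d = "%t x. ph t x - psi t x"
 have d: "admissible M ?d" by (rule admissible_diff[OF ph psi])
 let ?W = "singular_convolution.W (%t x. sm x * mlk al al (m x) t)"
 have "nV (%x. U ph t x - U psi t x) = nrm M (?W ?d t)"
  unfolding V_norm_half
 proof (rule L2_norm_AE_cong(1))
  show "AE x in M. sm x * (U ph t x - U psi t x) = ?W ?d t x"
   using singular_convolution.W_integrable[OF sc1[OF ph], of t] singular_convolution.W_integrable[OF sc1[OF psi], of t]
  proof eventually_elim
   fix x assume i: "integrable lborel (%sg. sm x * mlk al al (m x) sg * ph (t - sg) x)" "integrable lborel (%sg. sm x * mlk al al (m x) sg * psi (t - sg) x)"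
   have "sm x * (U ph t x - U psi t x) = ?W ph t x - ?W psi t x"
    using sU_eq[OF ph, of x t] sU_eq[OF psi, of x t] by (simp add: right_diff_distrib)
   also have "... = ?W ?d t x"
    unfolding singular_convolution.W_reflect[OF sc1[OF ph]] singular_convolution.W_reflect[OF sc1[OF psi]] singular_convolution.W_reflect[OF sc1[OF d]]
    using i by (simp add: right_diff_distrib)
   finally show "sm x * (U ph t x - U psi t x) = ?W ?d t x" .
  qed
  show "(%x. sm x * (U ph t x - U psi t x)) \<in> borel_measurable M"
   using U_measurable[OF ph, of t] U_measurable[OF psi, of t] by auto
  show "?W ?d t \<in> borel_measurable M" by (rule L2D(1)[OF singular_convolution.W_L2[OF sc1[OF d]]])
 qed
 then show ?thesis using singular_convolution.W_norm[OF sc1[OF d], of t] by simp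
qed

lemma Duhamel_integral:
 assumes ph: "admissible M ph" and t: "t >= 0"
 shows "has_L2_integral (time_measure t) M
  (%ta x. ph ta x * (t - ta) powr (al - 1) * mittag_leffler al al (- m x * (t - ta) powr al))
  (%x. conv (mlk al al (m x)) (%s. ph s x) t)"
proof -
 let ?b = "%ta x. (t - ta) powr (al - 1) * mittag_leffler al al (- m x * (t - ta) powr al)"
 have bm: "?b ta x = mlk al al (m x) (t - ta)" if "ta \<in> {0..t}" for ta x using that by (auto simp: mlk_def)
 have c: "L2_cont M {0..t} (%ta x. ?b ta x * ph ta x)"
 proof (rule L2_cont_mult)
  show "L2_cont M {0..t} ph" by (rule L2_cont_subset[OF admissible_cont[OF ph]]) auto
  show "continuous_on {0..t} (%ta. C * (t - ta) powr (al - 1))"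
   using al by (auto intro!: continuous_intros continuous_on_powr')
  show "?b ta \<in> borel_measurable M" for ta by measurable
  show "\<bar>?b ta x\<bar> <= C * (t - ta) powr (al - 1)" if "ta \<in> {0..t}" for ta x
   unfolding bm[OF that] using mlk_bounds(5)[OF al, of "m x" "t - ta"] mpos[of x] by simp
  have "continuous_on {0..t} (%ta. mittag_leffler al al (- m x * (t - ta) powr al))" for x
   by (rule continuous_on_compose2[OF ml_cont[OF ph, of al x], of "{0..t}" "%ta. t - ta"]) (auto intro!: continuous_intros)
  then show "continuous_on {0..t} (%ta. ?b ta x)" for x
   using al by (intro continuous_on_mult continuous_on_powr' continuous_intros) auto
 qed
 have m: "(%(ta, x). ?b ta x * ph ta x) \<in> jmeas M"
 proof -
  note [measurable] = pm[OF ph]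
  show ?thesis by measurable
 qed
 have "(LL ta. ind {0..t} ta * (?b ta x * ph ta x)) = conv (mlk al al (m x)) (%s. ph s x) t" for x
  unfolding conv_def
 proof (rule Bochner_Integration.integral_cong[OF refl])
  fix ta
  show "ind {0..t} ta * (?b ta x * ph ta x) = mlk al al (m x) (t - ta) * ph ta x"
  proof (cases "ta \<in> {0..t}")
   case True
   then show ?thesis unfolding bm[OF True] by simp
  next
   case False
   then have "ta < 0 \<or> mlk al al (m x) (t - ta) = 0" by (auto simp: mlk_def)
   then show ?thesis using False p0[OF ph, of ta x] by auto
  qed
 qed
 then show ?thesis using has_L2_integral_continuous[OF M t c m] by (simp add: mult_ac)
qed

text \<open>The derivative chosen by \<open>L2_deriv\<close> is \<open>w\<close> up to a null set, for each time interval \<open>S\<close> that reaches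
down to \<open>0\<close>.\<close>

lemma deriv_AE:
 assumes ph: "admissible M ph" and S: "S \<subseteq> {0<..}" "t \<in> S" "{0<..<t} \<subseteq> S"
 shows "has_L2_derivative M (U ph) (L2_deriv M S (U ph) t) t S"
  and "AE x in M. L2_deriv M S (U ph) t x = w ph t x"
  and "nrm M (L2_deriv M S (U ph) t) = nrm M (w ph t)"
  and "L2_deriv M S (U ph) t \<in> L2 M"
proof -
 have t: "t > 0" using S by auto
 have "t islimpt {0<..<t}" using islimpt_greaterThanLessThan2[OF t] .
 then have lim: "t islimpt S" using S(3) by (rule islimpt_subset)
 have UL: "U ph ta \<in> L2 M" if "ta \<in> S" for ta using U_L2[OF ph, of ta] that S(1) by auto
 note d = L2_deriv_AE[OF U_has_derivative[OF ph t S(1)] UL UL[OF S(2)] lim]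
 show h: "has_L2_derivative M (U ph) (L2_deriv M S (U ph) t) t S" and ae: "AE x in M. L2_deriv M S (U ph) t x = w ph t x"
  using d by auto
 show L: "L2_deriv M S (U ph) t \<in> L2 M" using h by (simp add: has_L2_derivative_def)
 show "nrm M (L2_deriv M S (U ph) t) = nrm M (w ph t)"
  by (rule L2_norm_AE_cong(1)[OF ae L2D(1)[OF L] w_measurable[OF ph]])
qed

lemma energy_eq:
 assumes ph: "admissible M ph" and S: "S \<subseteq> {0<..}" "t \<in> S" "\<And>ta. ta \<in> S ==> {0<..<ta} \<subseteq> S"
 shows "energy M m al s S (U ph) t =
  ennreal ((nV (U ph t))\<^sup>2 + t powr (2 * s) * (nrm M (w ph t))\<^sup>2) +
  g_conv (2 - al) (%ta. (nrm M (w ph ta))\<^sup>2) t"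
proof -
 have "nrm M (L2_deriv M S (U ph) ta) = nrm M (w ph ta)" if "ta \<in> S" for ta
  using deriv_AE(3)[OF ph S(1) that S(3)[OF that]] .
 then have "g_conv (2 - al) (%ta. (nrm M (L2_deriv M S (U ph) ta))\<^sup>2) t = g_conv (2 - al) (%ta. (nrm M (w ph ta))\<^sup>2) t"
  unfolding g_conv_def using S(3)[OF S(2)] by (intro nn_integral_cong) (auto simp: indicator_def)
 then show ?thesis using deriv_AE(3)[OF ph S(1,2) S(3)[OF S(2)]] by (simp add: energy_def)
qed

lemma C1_L2_U:
 assumes ph: "admissible M ph" and S: "S \<subseteq> {0<..}" "\<And>ta. ta \<in> S ==> {0<..<ta} \<subseteq> S"
 shows "C1_L2 M S (U ph)"
 unfolding C1_L2_def
proof (intro ballI conjI)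
 fix t assume t: "t \<in> S"
 then have t0: "t > 0" using S by auto
 show "U ph t \<in> L2 M" using U_L2[OF ph, of t] t0 by simp
 show "has_L2_derivative M (U ph) (L2_deriv M S (U ph) t) t S" by (rule deriv_AE(1)[OF ph S(1) t S(2)[OF t]])
 have c: "((%ta. nrm M (%x. w ph ta x - w ph t x)) \<longlongrightarrow> 0) (at t within S)"
  using L2_contD(2)[OF L2_cont_subset[OF w_cont[OF ph] S(1)] t] .
 show "((%ta. nrm M (%x. L2_deriv M S (U ph) ta x - L2_deriv M S (U ph) t x)) \<longlongrightarrow> 0) (at t within S)"
 proof (rule null_sandwich_within[OF _ _ c])
  fix ta assume ta: "ta \<in> S"
  have "nrm M (%x. L2_deriv M S (U ph) ta x - L2_deriv M S (U ph) t x) = nrm M (%x. w ph ta x - w ph t x)"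
  proof (rule L2_norm_AE_cong(1))
   show "AE x in M. L2_deriv M S (U ph) ta x - L2_deriv M S (U ph) t x = w ph ta x - w ph t x"
    using deriv_AE(2)[OF ph S(1) ta S(2)[OF ta]] deriv_AE(2)[OF ph S(1) t S(2)[OF t]] by eventually_elim simp
  qed (use L2D(1)[OF deriv_AE(4)[OF ph S(1) ta S(2)[OF ta]]] L2D(1)[OF deriv_AE(4)[OF ph S(1) t S(2)[OF t]]] w_measurable[OF ph] in auto)
  then show "nrm M (%x. L2_deriv M S (U ph) ta x - L2_deriv M S (U ph) t x) <= nrm M (%x. w ph ta x - w ph t x)" by simp
 qed simp
qed

text \<open>Near \<open>0\<close> the velocity is at most \<open>D t powr (al/2 - 1)\<close>. Its square weighted with \<open>t powr (2 s)\<close> is bounded since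
\<open>s > 1 - al/2\<close>, and its square is a multiple of \<open>g\<^sub>a\<^sub>l\<^sub>-\<^sub>1\<close>, whose convolution with \<open>g\<^sub>2\<^sub>-\<^sub>a\<^sub>l\<close> is the constant \<open>g\<^sub>1\<close>.\<close>

lemma U_in_X:
 assumes ph: "admissible M ph" and T: "T > 0" and s: "1 - al / 2 < s"
 shows "U ph \<in> X_space M m al s T"
proof -
 let ?S = "{0<..T}"
 have S: "?S \<subseteq> {0<..}" "\<And>ta. ta \<in> ?S ==> {0<..<ta} \<subseteq> ?S" by auto
 obtain D where D: "D >= 0" "\<And>t. t \<in> ?S ==> nrm M (w ph t) <= D * t powr (al / 2 - 1)"
  using w_norm_le[OF ph T] by auto
 have "bounded ((%t. nV (U ph t)) ` {0..T})"
  by (intro compact_imp_bounded compact_continuous_image compact_Icc continuous_on_subset[OF U_V_norm_cont[OF ph]]) auto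
 then obtain B where "\<forall>y\<in>(%t. nV (U ph t)) ` {0..T}. norm y <= B" unfolding bounded_iff by blast
 then have B: "\<bar>nV (U ph t)\<bar> <= B" if "t \<in> ?S" for t using that by simp
 have D2: "(nrm M (w ph t))\<^sup>2 <= D\<^sup>2 * t powr (al - 2)" if t: "t \<in> ?S" for t
 proof -
  have "(nrm M (w ph t))\<^sup>2 <= (D * t powr (al / 2 - 1))\<^sup>2" using D(2)[OF t] by (intro power_mono) auto
  also have "... = D\<^sup>2 * (t powr (al / 2 - 1) * t powr (al / 2 - 1))" by (simp add: power2_eq_square)
  also have "t powr (al / 2 - 1) * t powr (al / 2 - 1) = t powr (al - 2)" by (simp add: powr_add[symmetric])
  finally show ?thesis .
 qed
 define K where "K = B\<^sup>2 + T powr (2 * s + al - 2) * D\<^sup>2"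
 define G where "G = Gamma (al - 1)"
 have G: "G > 0" using a0 by (simp add: G_def Gamma_real_pos)
 have en: "energy M m al s ?S (U ph) t <= ennreal (K + D\<^sup>2 * G)" if t: "t \<in> ?S" for t
 proof -
  have 1: "(nV (U ph t))\<^sup>2 + t powr (2 * s) * (nrm M (w ph t))\<^sup>2 <= K"
  proof -
   have "(nV (U ph t))\<^sup>2 <= B\<^sup>2" using power_mono[OF B[OF t], of 2] by simp
   moreover have "t powr (2 * s) * (nrm M (w ph t))\<^sup>2 <= t powr (2 * s) * (D\<^sup>2 * t powr (al - 2))"
    using D2[OF t] by (intro mult_left_mono) auto
   moreover have "t powr (2 * s) * (D\<^sup>2 * t powr (al - 2)) = t powr (2 * s + al - 2) * D\<^sup>2"
    using powr_add[of t "2 * s" "al - 2"] by (simp add: algebra_simps)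
   moreover have "t powr (2 * s + al - 2) * D\<^sup>2 <= T powr (2 * s + al - 2) * D\<^sup>2"
    using t s by (intro mult_right_mono powr_mono2) auto
   ultimately show ?thesis unfolding K_def by linarith
  qed
  have 2: "g_conv (2 - al) (%ta. (nrm M (w ph ta))\<^sup>2) t <= ennreal (D\<^sup>2 * G)"
  proof -
   have "g_conv (2 - al) (%ta. (nrm M (w ph ta))\<^sup>2) t \<le>
    (NN ta. ennreal (D\<^sup>2 * G) * ennreal \<bar>gk (2 - al) (t - ta) * gk (al - 1) ta\<bar>)"
    unfolding g_conv_def
   proof (intro nn_integral_mono)
    fix ta :: real
    show "ennreal (gk (2 - al) (t - ta) * (nrm M (w ph ta))\<^sup>2) * ind {0<..<t} ta \<le>
     ennreal (D\<^sup>2 * G) * ennreal \<bar>gk (2 - al) (t - ta) * gk (al - 1) ta\<bar>"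
    proof (cases "ta \<in> {0<..<t}")
     case True
     then have ta: "ta \<in> ?S" using t by auto
     have "gk (al - 1) ta * G = ta powr (al - 2)" using True G by (simp add: g_kernel_def G_def)
     then have "(nrm M (w ph ta))\<^sup>2 <= D\<^sup>2 * G * gk (al - 1) ta" using D2[OF ta]
      by (metis mult.assoc mult.commute)
     then have "gk (2 - al) (t - ta) * (nrm M (w ph ta))\<^sup>2 <= gk (2 - al) (t - ta) * (D\<^sup>2 * G * gk (al - 1) ta)"
      using g_kernel_nonneg[OF a0(3)] by (intro mult_left_mono) auto
     then show ?thesis using True G a0 by (simp add: ennreal_mult[symmetric] g_kernel_nonneg mult_ac ennreal_leI)
    qed simp
   qed
   also have "... = ennreal (D\<^sup>2 * G) * aconv (gk (2 - al)) (gk (al - 1)) t"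
    unfolding aconv_def by (rule nn_integral_cmult) simp
   also have "... = ennreal (D\<^sup>2 * G)" using aconv_g_kernel[OF a0(3,2), of t] t by (simp add: g_kernel_1)
   finally show ?thesis .
  qed
  have K0: "K >= 0" by (simp add: K_def)
  have "energy M m al s ?S (U ph) t <= ennreal K + ennreal (D\<^sup>2 * G)"
   using add_mono[OF ennreal_leI[OF 1] 2] energy_eq[OF ph S(1) t S(2), of s] by simp
  then show ?thesis using K0 G by simp
 qed
 have "(SUP t\<in>?S. energy M m al s ?S (U ph) t) <= ennreal (K + D\<^sup>2 * G)" by (rule SUP_least) (rule en)
 then have "(SUP t\<in>?S. energy M m al s ?S (U ph) t) < \<infinity>" by (rule order_le_less_trans) simp
 then show ?thesis using U_continuous_V[OF ph, of "{0..T}"] C1_L2_U[OF ph S] by (simp add: X_space_def)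
qed

text \<open>In \<open>L\<^sup>2\<close> the velocity is in general unbounded near \<open>0\<close>, because of the term with \<open>u0\<close>. In the weaker norm with exponent
\<open>-1/2\<close> the factor \<open>\<surd>m\<close> is gone and the term is \<open>O(t powr (al - 1))\<close>.\<close>

lemma initial_velocity:
 assumes ph: "admissible M ph" and T: "T > 0"
 shows "((%t. V_norm M m (- (1/2)) (%x. L2_deriv M {0<..T} (U ph) t x - u1 x)) \<longlongrightarrow> 0) (at_right 0)"
proof -
 obtain D where D: "D >= 0" "\<And>t. t \<in> {0..T} ==> nrm M (W2 ph t) <= D * t powr (al - 1)" using W2_norm_le[OF ph, of T] T by auto
 let ?i = "%x. m x powr (- (1/2))"
 have i: "?i x = 1 / sm x" for x using mpos[of x] by (simp add: powr_minus_divide powr_half)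
 have ib: "\<bar>?i x\<bar> <= 1 / sqrt m0" for x using mge[of x] m0 mpos[of x] by (simp add: i frac_le)
 let ?e = "%t x. mittag_leffler al 1 (- m x * t powr al)"
 have ec: "L2_cont M {0..} (%t x. ?e t x * u1 x)"
 proof (rule L2_cont_mult[OF L2_cont_const[OF u1L]])
  show "continuous_on {0..} (%_. C)" by simp
  show "(%x. ?e t x) \<in> borel_measurable M" for t by measurable
  show "\<bar>?e t x\<bar> <= C" for t x by (rule ml_bound1[OF ph]) simp
  show "continuous_on {0..} (%t. ?e t x)" for x by (rule ml_cont[OF ph])
 qed
 have e0: "?e 0 x = 1" for x 
 proof -
  have "mittag_leffler al 1 0 = 1" unfolding mittag_leffler_eq by (subst powser_zero) simp
  then show ?thesis by simp
 qed
 have e1: "((%t. nrm M (%x. ?e t x * u1 x - u1 x)) \<longlongrightarrow> 0) (at_right 0)"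
 proof -
  have "((%t. nrm M (%x. ?e t x * u1 x - ?e 0 x * u1 x)) \<longlongrightarrow> 0) (at 0 within {0..})"
   by (rule L2_contD(2)[OF ec]) simp
  then have "((%t. nrm M (%x. ?e t x * u1 x - ?e 0 x * u1 x)) \<longlongrightarrow> 0) (at 0 within {0<..})"
   by (rule tendsto_within_subset) auto
  then show ?thesis by (simp only: e0 mult_1)
 qed
 have pw: "((%t. t powr (al - 1)) \<longlongrightarrow> 0) (at_right 0)"
 proof -
  have "continuous_on {0..} (%t::real. t powr (al - 1))" using al by (auto intro!: continuous_intros continuous_on_powr')
  then have "((%t. t powr (al - 1)) \<longlongrightarrow> 0 powr (al - 1)) (at 0 within {0..})" unfolding continuous_on_def by fastforce
  then have "((%t. t powr (al - 1)) \<longlongrightarrow> 0 powr (al - 1)) (at 0 within {0<..})" by (rule tendsto_within_subset) auto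
  then show ?thesis by simp
 qed
 define A where "A = nrm M (%x. sm x * u0 x)"
 have lim: "((%t. C * t powr (al - 1) * A + 1 / sqrt m0 * nrm M (%x. ?e t x * u1 x - u1 x) + 1 / sqrt m0 * (D * t powr (al - 1))) \<longlongrightarrow> 0) (at_right 0)"
 proof -
  have "((%t. C * t powr (al - 1) * A + 1 / sqrt m0 * nrm M (%x. ?e t x * u1 x - u1 x) + 1 / sqrt m0 * (D * t powr (al - 1))) \<longlongrightarrow> C * 0 * A + 1 / sqrt m0 * 0 + 1 / sqrt m0 * (D * 0)) (at_right 0)"
   by (intro tendsto_intros pw e1)
  then show ?thesis by simp
 qed
 show ?thesis
 proof (rule tendsto_sandwich[OF _ _ tendsto_const lim])
  show "\<forall>\<^sub>F t in at_right 0. 0 <= V_norm M m (- (1/2)) (%x. L2_deriv M {0<..T} (U ph) t x - u1 x)"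
   by (simp add: V_norm_def)
  have "\<forall>\<^sub>F t in at_right 0. t \<in> {0<..<T}" using T by (rule eventually_at_rightI[rotated]) simp
  then show "\<forall>\<^sub>F t in at_right 0. V_norm M m (- (1/2)) (%x. L2_deriv M {0<..T} (U ph) t x - u1 x) \<le>
   C * t powr (al - 1) * A + 1 / sqrt m0 * nrm M (%x. ?e t x * u1 x - u1 x) + 1 / sqrt m0 * (D * t powr (al - 1))"
  proof eventually_elim
   fix t assume t: "t \<in> {0<..<T}"
   let ?a = "%x. (- mlk al al (m x) t) * (sm x * u0 x)"
   let ?b = "%x. ?i x * (?e t x * u1 x - u1 x)" and ?c = "%x. ?i x * W2 ph t x"
   have a: "?a \<in> L2 M" "nrm M ?a <= C * t powr (al - 1) * A"
    using L2_mult_bounded[OF _ u0w, of "%x. - mlk al al (m x) t" "C * t powr (al - 1)"] mlk_bounds(5)[OF al] mpos C0 by (auto simp: less_imp_le A_def)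
   have c0: "1 / sqrt m0 >= 0" using m0 by simp
   have eu: "(%x. ?e t x * u1 x - u1 x) \<in> L2 M" using L2_contD(1)[OF ec, of t] t u1L by (auto intro: L2_diff)
   have b: "?b \<in> L2 M" "nrm M ?b <= 1 / sqrt m0 * nrm M (%x. ?e t x * u1 x - u1 x)"
    using L2_mult_bounded[OF _ eu c0, of ?i] ib by auto
   have wl: "W2 ph t \<in> L2 M" by (rule singular_convolution.W_L2[OF sc2[OF ph]])
   have c: "?c \<in> L2 M" "nrm M ?c <= 1 / sqrt m0 * (D * t powr (al - 1))"
   proof -
    have "?c \<in> L2 M \<and> nrm M ?c <= 1 / sqrt m0 * nrm M (W2 ph t)" using L2_mult_bounded[OF _ wl c0, of ?i] ib by auto
    moreover have "1 / sqrt m0 * nrm M (W2 ph t) <= 1 / sqrt m0 * (D * t powr (al - 1))" using D(2)[of t] t c0 by (intro mult_left_mono) auto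
    ultimately show "?c \<in> L2 M" "nrm M ?c <= 1 / sqrt m0 * (D * t powr (al - 1))" by auto
   qed
   have S: "{0<..T} \<subseteq> {0<..}" "t \<in> {0<..T}" "{0<..<t} \<subseteq> {0<..T}" using t by auto
   have "V_norm M m (- (1/2)) (%x. L2_deriv M {0<..T} (U ph) t x - u1 x) = nrm M (%x. (?a x + ?b x) + ?c x)"
    unfolding V_norm_def
   proof (rule L2_norm_AE_cong(1))
    show "AE x in M. ?i x * (L2_deriv M {0<..T} (U ph) t x - u1 x) = (?a x + ?b x) + ?c x"
     using deriv_AE(2)[OF ph S]
    proof eventually_elim
     fix x assume e: "L2_deriv M {0<..T} (U ph) t x = w ph t x"
     have "mlk al 1 (m x) t = ?e t x" using t by (simp add: mlk_def)
     then have "?i x * (w ph t x - u1 x) = ?i x * ((- (sm x * mlk al al (m x) t)) * (sm x * u0 x)) + ?b x + ?c x"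
      unfolding w_eq[OF ph] by (simp add: algebra_simps)
     also have "?i x * ((- (sm x * mlk al al (m x) t)) * (sm x * u0 x)) = ?a x" using mpos[of x] by (simp add: i)
     finally show "?i x * (L2_deriv M {0<..T} (U ph) t x - u1 x) = (?a x + ?b x) + ?c x" using e by simp
    qed
    show "(%x. ?i x * (L2_deriv M {0<..T} (U ph) t x - u1 x)) \<in> borel_measurable M"
     using L2D(1)[OF deriv_AE(4)[OF ph S]] by auto
    show "(%x. (?a x + ?b x) + ?c x) \<in> borel_measurable M" by (rule L2D(1)[OF L2_add[OF L2_add[OF a(1) b(1)] c(1)]])
   qed
   also have "... <= nrm M ?a + nrm M ?b + nrm M ?c"
    using L2_norm_triangle[OF L2_add[OF a(1) b(1)] c(1)] L2_norm_triangle[OF a(1) b(1)] by simp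
   finally show "V_norm M m (- (1/2)) (%x. L2_deriv M {0<..T} (U ph) t x - u1 x) \<le>
    C * t powr (al - 1) * A + 1 / sqrt m0 * nrm M (%x. ?e t x * u1 x - u1 x) + 1 / sqrt m0 * (D * t powr (al - 1))"
    using a(2) b(2) c(2) by linarith
  qed
 qed
qed

text \<open>The exponent \<open>1/2\<close> is admissible in the initial condition for the velocity because \<open>1/al - 1/2 < 1/2\<close>.\<close>

lemma weak_solution_of_fixed_point:
 assumes ph: "admissible M ph" and T: "T > 0" and s: "1 - al / 2 < s"
  and f [measurable]: "f \<in> bor"
  and fp: "\<And>ta. ta \<in> {0..T} ==> AE x in M. ph ta x = f (U ph ta x)"
 shows "weak_energy_solution M m f al s u0 u1 T (U ph)"
 unfolding weak_energy_solution_def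
proof (intro conjI ballI)
 show "U ph \<in> X_space M m al s T" by (rule U_in_X[OF ph T s])
 show "AE x in M. U ph 0 x = u0 x" using U_zero[of ph] p0[OF ph] by simp
 have "1 / al < 1" using al by simp
 then show "\<exists>be>1 / al - 1 / 2. ((%t. V_norm M m (- be) (%x. L2_deriv M {0<..T} (U ph) t x - u1 x)) \<longlongrightarrow> 0) (at_right 0)"
  using initial_velocity[OF ph T] by (intro exI[of _ "1/2"]) auto
 fix t assume t: "t \<in> {0..T}"
 have h: "has_L2_integral (time_measure t) M (Duhamel_integrand m f al (U ph) t) (%x. conv (mlk al al (m x)) (%s. ph s x) t)"
 proof (rule has_L2_integral_cong[OF _ _ Duhamel_integral[OF ph]])
  fix ta assume "ta \<in> space (time_measure t)"
  then have ta: "ta \<in> {0..T}" using t by (auto simp: space_restrict_space)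
  show "AE x in M. ph ta x * (t - ta) powr (al - 1) * mittag_leffler al al (- m x * (t - ta) powr al) = Duhamel_integrand m f al (U ph) t ta x"
   using fp[OF ta] by eventually_elim (simp add: Duhamel_integrand_def)
  note [measurable] = U_measurable[OF ph, of ta]
  show "Duhamel_integrand m f al (U ph) t ta \<in> borel_measurable M" unfolding Duhamel_integrand_def[abs_def] by measurable
 qed (use t in auto)
 then show "L2_integrable (time_measure t) M (Duhamel_integrand m f al (U ph) t)" by (auto simp: L2_integrable_def)
 have "has_L2_integral (time_measure t) M (Duhamel_integrand m f al (U ph) t) (L2_integral (time_measure t) M (Duhamel_integrand m f al (U ph) t))"
  unfolding L2_integral_def by (rule someI[where P = "has_L2_integral (time_measure t) M (Duhamel_integrand m f al (U ph) t)", OF h])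
 from has_L2_integral_unique[OF sigma_finite_time M this h]
 show "AE x in M. Phi M m f al u0 u1 (U ph) t x = U ph t x"
  by eventually_elim (simp add: Phi_def U_def)
qed

end

section \<open>Control of the memory by the energy\<close>

context wave
begin

text \<open>The history contains \<open>\<parallel>w\<parallel>\<close>, while the energy controls \<open>g\<^sub>2\<^sub>-\<^sub>a\<^sub>l * \<parallel>w\<parallel>\<^sup>2\<close>. Young's inequality with the weight
\<open>(t1 - ta) powr (1 - al)\<close> passes from one to the other, at the price of the singularity \<open>s powr (-al/2)\<close> after \<open>t1\<close>.\<close>

lemma hist_norm:
 assumes ph: "admissible M ph" and t1: "t1 > 0" and s: "s > 0" and E: "E >= 0"
  and e: "g_conv (2 - al) (%ta. (nrm M (w ph ta))\<^sup>2) t1 <= ennreal E"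
 defines "H \<equiv> (al - 1) / Gamma (2 - al) / 2 * (1 / al + Gamma (2 - al) * E)"
 shows "(%x. hist al t1 (%ta. w ph ta x) (t1 + s)) \<in> L2 M"
  and "nrm M (%x. hist al t1 (%ta. w ph ta x) (t1 + s)) <= H * s powr (- al / 2)"
proof -
 note [measurable] = w_jm[OF ph] w_norm_measurable[OF ph]
 have G: "Gamma (2 - al) > 0" using a0 by (simp add: Gamma_real_pos)
 define c where "c = (al - 1) / Gamma (2 - al)"
 have c: "c > 0" using G al by (simp add: c_def)
 let ?F = "%ta x. hist_kernel al (t1 + s - ta) * (ind {..<t1} ta * w ph ta x)"
 let ?p = "%ta. ind {0<..<t1} ta * (hist_kernel al (t1 + s - ta) * nrm M (w ph ta))"
 let ?q = "%ta. ind {s..} (t1 + s - ta) * (t1 + s - ta) powr (- al - 1)"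
 let ?r = "%ta. ind {0<..<t1} ta * (gk (2 - al) (t1 - ta) * (nrm M (w ph ta))\<^sup>2)"
 have Fm: "(%(ta, x). ?F ta x) \<in> jmeas M" by measurable
 have le: "AE ta in lborel. ?F ta \<in> L2 M \<and> nrm M (?F ta) <= ?p ta"
 proof (rule AE_I2)
  fix ta :: real
  have F: "?F ta = (%x. (hist_kernel al (t1 + s - ta) * ind {..<t1} ta) * w ph ta x)" by (simp add: mult_ac)
  have p: "\<bar>hist_kernel al (t1 + s - ta) * ind {..<t1} ta\<bar> * nrm M (w ph ta) = ?p ta"
  proof (cases "ta <= 0")
   case True
   then have "w ph ta = (%x. 0)" using w_nonpos[OF ph True] by auto
   then show ?thesis using True by simp
  qed (auto simp: indicator_def hist_kernel_nonneg al)
  show "?F ta \<in> L2 M \<and> nrm M (?F ta) <= ?p ta"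
   unfolding F L2_norm_scale p by (intro conjI L2_scale w_L2[OF ph] order_refl)
 qed
 have pq: "ennreal (?p ta) <= ennreal (c / 2 * s powr (al / 2)) * ennreal (?q ta) +
   ennreal (c / 2 * Gamma (2 - al) * s powr (- al / 2)) * ennreal (?r ta)" for ta
 proof (cases "ta \<in> {0<..<t1}")
  case True
  define d where "d = t1 - ta"
  define n where "n = nrm M (w ph ta)"
  have d: "d > 0" using True by (simp add: d_def)
  have ds: "t1 + s - ta = d + s" by (simp add: d_def)
  \<comment> \<open>Young's inequality, with the weight \<open>s powr (al/2)\<close> that balances the two integrals\<close>
  let ?a = "s powr (al / 4) * ((d + s) powr (- al) * d powr ((al - 1) / 2))"
  let ?b = "s powr (- al / 4) * (d powr ((1 - al) / 2) * n)"
  have sq: "(x powr y)\<^sup>2 = x powr (2 * y)" for x y :: real by (simp add: power2_eq_square powr_add[symmetric])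
  have ab: "?a * ?b = (d + s) powr (- al) * n"
  proof -
   have "s powr (al / 4) * s powr (- al / 4) = 1" using s by (simp add: powr_add[symmetric])
   moreover have "d powr ((al - 1) / 2) * d powr ((1 - al) / 2) = 1"
    using d by (simp add: powr_add[symmetric] add_divide_distrib[symmetric])
   moreover have "?a * ?b = (s powr (al / 4) * s powr (- al / 4)) * (d powr ((al - 1) / 2) * d powr ((1 - al) / 2)) * ((d + s) powr (- al) * n)"
    by (simp only: mult_ac)
   ultimately show ?thesis by simp
  qed
  have a2: "?a\<^sup>2 <= s powr (al / 2) * (d + s) powr (- al - 1)"
  proof -
   have "?a\<^sup>2 = s powr (al / 2) * ((d + s) powr (- 2 * al) * d powr (al - 1))" by (simp add: power_mult_distrib sq diff_divide_distrib)
   also have "... <= s powr (al / 2) * ((d + s) powr (- 2 * al) * (d + s) powr (al - 1))"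
    using d s al by (intro mult_left_mono powr_mono2) auto
   also have "(d + s) powr (- 2 * al) * (d + s) powr (al - 1) = (d + s) powr (- al - 1)" by (simp add: powr_add[symmetric])
   finally show ?thesis .
  qed
  have b2: "?b\<^sup>2 = s powr (- al / 2) * (d powr (1 - al) * n\<^sup>2)" by (simp add: power_mult_distrib sq diff_divide_distrib)
  have gen: "Z <= (X + Y) / 2" if "2 * A * B <= A\<^sup>2 + B\<^sup>2" "A * B = Z" "A\<^sup>2 <= X" "B\<^sup>2 = Y" for A B X Y Z :: real
   using that by simp
  have *: "(d + s) powr (- al) * n <= (s powr (al / 2) * (d + s) powr (- al - 1) + s powr (- al / 2) * (d powr (1 - al) * n\<^sup>2)) / 2"
   by (rule gen[OF sum_squares_bound ab a2 b2])
  have g: "d powr (1 - al) = Gamma (2 - al) * gk (2 - al) d" using d G by (simp add: g_kernel_def)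
  have "?p ta = c * ((d + s) powr (- al) * n)"
   using True d s by (simp add: hist_kernel_def ds n_def c_def)
  also have "... <= c * ((s powr (al / 2) * (d + s) powr (- al - 1) + s powr (- al / 2) * (d powr (1 - al) * n\<^sup>2)) / 2)"
   using * c by (intro mult_left_mono) auto
  also have "... = c / 2 * s powr (al / 2) * ?q ta + c / 2 * Gamma (2 - al) * s powr (- al / 2) * ?r ta"
  proof -
   have "?q ta = (d + s) powr (- al - 1)" "?r ta = gk (2 - al) d * n\<^sup>2"
    using True d by (simp_all add: ds d_def[symmetric] n_def[symmetric])
   then show ?thesis unfolding g by (simp only:) (simp add: field_simps)
  qed
  finally show ?thesis using c G a0
   by (simp add: ennreal_mult'[symmetric] ennreal_plus[symmetric] g_kernel_nonneg ennreal_leI del: ennreal_plus)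
 qed (auto simp: indicator_def)
 have qi: "(NN ta. ennreal (?q ta)) = ennreal (s powr (- al) / al)"
  using nn_integral_lborel_reflect[of "%u. ennreal (ind {s..} u * u powr (- al - 1))" "t1 + s"]
   nn_integral_powr_to_inf[of "- al - 1" s] s a0 by simp
 have ri: "(NN ta. ennreal (?r ta)) <= ennreal E"
 proof -
  have "(NN ta. ennreal (?r ta)) = g_conv (2 - al) (%ta. (nrm M (w ph ta))\<^sup>2) t1"
   unfolding g_conv_def by (intro nn_integral_cong) (auto simp: indicator_def)
  then show ?thesis using e by simp
 qed
 have H0: "H >= 0" using c G E al by (simp add: H_def c_def[symmetric])
 have "(NN ta. ennreal (?p ta)) <= (NN ta. ennreal (c / 2 * s powr (al / 2)) * ennreal (?q ta) +
   ennreal (c / 2 * Gamma (2 - al) * s powr (- al / 2)) * ennreal (?r ta))"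
  by (intro nn_integral_mono pq)
 also have "... = ennreal (c / 2 * s powr (al / 2)) * ennreal (s powr (- al) / al) +
   ennreal (c / 2 * Gamma (2 - al) * s powr (- al / 2)) * (NN ta. ennreal (?r ta))"
  by (subst nn_integral_add) (auto simp: nn_integral_cmult qi)
 also have "... <= ennreal (c / 2 * s powr (al / 2)) * ennreal (s powr (- al) / al) +
   ennreal (c / 2 * Gamma (2 - al) * s powr (- al / 2)) * ennreal E"
  using ri by (intro add_left_mono mult_left_mono) auto
 also have "... = ennreal (c / 2 * (s powr (al / 2) * s powr (- al)) / al + c / 2 * Gamma (2 - al) * s powr (- al / 2) * E)"
  using c G E a0 by (simp add: ennreal_mult'[symmetric] ennreal_plus[symmetric] mult_ac del: ennreal_plus)
 also have "s powr (al / 2) * s powr (- al) = s powr (- al / 2)" by (simp add: powr_add[symmetric])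
 also have "c / 2 * s powr (- al / 2) / al + c / 2 * Gamma (2 - al) * s powr (- al / 2) * E = H * s powr (- al / 2)"
  unfolding H_def c_def[symmetric] by (simp add: algebra_simps)
 finally have "(NN ta. ennreal (?p ta)) <= ennreal (H * s powr (- al / 2))" .
 moreover have "H * s powr (- al / 2) >= 0" using H0 by simp
 moreover have "?p \<in> borel_measurable lborel" by measurable
 moreover have "sigma_finite_measure lborel" by (rule lborel.sigma_finite_measure_axioms)
 ultimately show "(%x. hist al t1 (%ta. w ph ta x) (t1 + s)) \<in> L2 M"
  "nrm M (%x. hist al t1 (%ta. w ph ta x) (t1 + s)) <= H * s powr (- al / 2)"
  using Minkowski_integral(2,3)[OF _ M Fm _ le] unfolding hist_def by blast+
qed

text \<open>Insert \<open>hist_norm\<close> into \<open>memory_representation\<close>. The product of the two singularities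
\<open>(sg - s) powr (al/2 - 1)\<close> and \<open>s powr (-al/2)\<close> integrates to a constant, since \<open>g\<^sub>a\<^sub>l\<^sub>/\<^sub>2 * g\<^sub>1\<^sub>-\<^sub>a\<^sub>l\<^sub>/\<^sub>2 = g\<^sub>1\<close>. The constant \<open>K\<close> is
independent of \<open>t1\<close> and of the source.\<close>

lemma memory_bound:
 "\<exists>K\<ge>0. \<forall>ph t1 sg E P. admissible M ph --> 0 < t1 --> 0 < sg --> sg <= 1 --> 0 <= E --> 0 <= P \<longrightarrow>
  g_conv (2 - al) (%ta. (nrm M (w ph ta))\<^sup>2) t1 <= ennreal E \<longrightarrow>
  (\<forall>s\<in>{0<..<sg}. nrm M (ph (t1 + s)) <= P) \<longrightarrow>
  nV (U ph (t1 + sg)) \<le>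
   K * (nV (U ph t1) + t1 powr (1 - al) + 1 + E + P * sg powr (al / 2))"
proof -
 define G where "G = Gamma (2 - al)"
 define c where "c = (al - 1) / G / 2"
 define N1 where "N1 = nrm M u1"
 define k1 where "k1 = C * Gamma (al / 2) / Gamma (al / 2 + 1)"
 define k2 where "k2 = C * Gamma (al / 2) * Gamma (1 - al / 2)"
 have pos: "G > 0" "c > 0" "N1 >= 0" "k1 > 0" "k2 > 0"
  using al C0 by (auto simp: G_def c_def N1_def k1_def k2_def Gamma_real_pos intro!: mult_pos_pos divide_pos_pos)
 define K where "K = C + k1 * N1 / G + k2 * c / al + k2 * c * G + k1"
 have K0: "C >= 0" "k1 * N1 / G >= 0" "k2 * c / al >= 0" "k2 * c * G >= 0" "k1 >= 0"
  using pos C0 al by simp_all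
 have Kge: "C <= K" "k1 * N1 / G <= K" "k2 * c / al <= K" "k2 * c * G <= K" "k1 <= K" "K >= 0"
  using K0 by (simp_all add: K_def)
 have "nV (U ph (t1 + sg)) \<le>
   K * (nV (U ph t1) + t1 powr (1 - al) + 1 + E + P * sg powr (al / 2))"
  if ph: "admissible M ph" and t1: "0 < t1" and sg: "0 < sg" "sg <= 1" and E: "0 <= E" and P: "0 <= P"
   and e: "g_conv (2 - al) (%ta. (nrm M (w ph ta))\<^sup>2) t1 <= ennreal E"
   and p: "\<And>s. s \<in> {0<..<sg} ==> nrm M (ph (t1 + s)) <= P" for ph t1 sg E P
 proof -
  define H where "H = c * (1 / al + G * E)"
  have H0: "H >= 0" using pos E al by (simp add: H_def)
  define Q where "Q = N1 * (t1 powr (1 - al) / G) + P"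
  have Q0: "Q >= 0" using pos P by (simp add: Q_def)
  let ?h = "%rh x. hist al t1 (%ta. w ph ta x) rh"
  let ?S = "%x. shift t1 (%rh. u1 x * gk (2 - al) rh + ph rh x + ?h rh x)"
  let ?F = "%s x. sm x * mlk al al (m x) (sg - s) * ?S x s"
  let ?p = "%s. ind {0<..<sg} s * (C * (sg - s) powr (al / 2 - 1) * (Q + H * s powr (- al / 2)))"
  have Fm: "(%(s, x). ?F s x) \<in> jmeas M"
  proof -
   note [measurable] = w_jm[OF ph] pm[OF ph]
   have h [measurable]: "(%(rh, x). ?h rh x) \<in> jmeas M"
   proof -
    have 1: "(%(t, x). hist_kernel al t) \<in> jmeas M"
     and 2: "(%(ta, x). ind {..<t1} ta * w ph ta x) \<in> jmeas M" by measurable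
    show ?thesis using conv_jm[OF 1 2] by (simp add: hist_def conv_def)
   qed
   have sh: "(%z. (t1 + fst z, snd z)) \<in> (lborel :: real measure) \<Otimes>\<^sub>M M \<rightarrow>\<^sub>M lborel \<Otimes>\<^sub>M M" by measurable
   have [measurable]: "(%z. ?h (t1 + fst z) (snd z)) \<in> jmeas M"
    "(%z. ph (t1 + fst z) (snd z)) \<in> jmeas M"
    using measurable_compose[OF sh h] measurable_compose[OF sh pm[OF ph]] by simp_all
   have rf: "(%z. (sg - fst z, snd z)) \<in> (lborel :: real measure) \<Otimes>\<^sub>M M \<rightarrow>\<^sub>M lborel \<Otimes>\<^sub>M M" by measurable
   have [measurable]: "(%z. mlk al al (m (snd z)) (sg - fst z)) \<in> jmeas M"
    using measurable_compose[OF rf mlk_jm[of al]] by simp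
   have "(%z. ?F (fst z) (snd z)) \<in> jmeas M" unfolding shift_def by measurable
   then show ?thesis by (simp add: split_beta')
  qed
  have pM: "?p \<in> borel_measurable lborel" by measurable
  have le: "AE s in lborel. ?F s \<in> L2 M \<and> nrm M (?F s) <= ?p s"
  proof (rule AE_I2)
   fix s :: real
   show "?F s \<in> L2 M \<and> nrm M (?F s) <= ?p s"
   proof (cases "s \<in> {0<..<sg}")
    case False
    then have "s <= 0 \<or> sg - s <= 0" by auto
    then have "?F s = (%x. 0)" by (auto simp: shift_def mlk_def)
    then show ?thesis using False by simp
   next
    case True
    then have s: "s > 0" "s < sg" by auto
    define k where "k = gk (2 - al) (t1 + s)"
    have k: "0 <= k" "k <= t1 powr (1 - al) / G"
    proof -
     show "0 <= k" using g_kernel_nonneg[OF a0(3)] by (simp add: k_def)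
     have "(t1 + s) powr (1 - al) <= t1 powr (1 - al)" using t1 s al by (intro powr_mono2') auto
     then show "k <= t1 powr (1 - al) / G" using t1 s pos by (simp add: k_def g_kernel_def G_def divide_right_mono)
    qed
    let ?g = "%x. (k * u1 x + ph (t1 + s) x) + ?h (t1 + s) x"
    note h = hist_norm[OF ph t1 s(1) E e]
    have 1: "(%x. k * u1 x) \<in> L2 M" "nrm M (%x. k * u1 x) = k * N1"
     using L2_scale[OF u1L, of k] L2_norm_scale[of M k u1] k by (auto simp: N1_def)
    have "k * N1 <= t1 powr (1 - al) / G * N1" using k pos by (intro mult_right_mono) auto
    then have k': "k * N1 <= N1 * (t1 powr (1 - al) / G)" by (simp add: mult.commute)
    have 2: "(%x. k * u1 x + ph (t1 + s) x) \<in> L2 M" by (rule L2_add[OF 1(1) admissible_L2[OF ph]])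
    have gL: "?g \<in> L2 M" by (rule L2_add[OF 2 h(1)])
    have h2: "nrm M (?h (t1 + s)) <= H * s powr (- al / 2)" using h(2) by (simp add: H_def c_def G_def)
    have gN: "nrm M ?g <= Q + H * s powr (- al / 2)"
     using L2_norm_triangle[OF 2 h(1)] L2_norm_triangle[OF 1(1) admissible_L2[OF ph, of "t1 + s"]] 1(2) k' p[OF True] h2
     unfolding Q_def by linarith
    have B0: "C * (sg - s) powr (al / 2 - 1) >= 0" using C0 by simp
    have bd: "AE x in M. \<bar>sm x * mlk al al (m x) (sg - s)\<bar> <= C * (sg - s) powr (al / 2 - 1)"
     using mlk_bounds(6)[OF al, of _ "sg - s"] mpos s by (auto simp: less_imp_le)
    have Fe: "?F s = (%x. (sm x * mlk al al (m x) (sg - s)) * ?g x)" using s by (simp add: shift_def k_def mult.commute)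
    have bm: "(%x. sm x * mlk al al (m x) (sg - s)) \<in> borel_measurable M" by measurable
    note r = L2_mult_bounded[OF bm gL B0 bd]
    have "C * (sg - s) powr (al / 2 - 1) * nrm M ?g <= ?p s"
     using mult_left_mono[OF gN B0] True by simp
    then show ?thesis using r unfolding Fe by linarith
   qed
  qed
  have G2: "Gamma (al / 2) > 0" "Gamma (1 - al / 2) > 0" "Gamma (al / 2 + 1) > 0" using al by (auto simp: Gamma_real_pos)
  have "(NN s. ennreal (?p s)) \<le>
   (NN s. ennreal (C * Gamma (al / 2) * Q) * ennreal \<bar>gk (al / 2) (sg - s) * gk 1 s\<bar> +
    ennreal (k2 * H) * ennreal \<bar>gk (al / 2) (sg - s) * gk (1 - al / 2) s\<bar>)"
  proof (intro nn_integral_mono)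
   fix s :: real
   show "ennreal (?p s) <= ennreal (C * Gamma (al / 2) * Q) * ennreal \<bar>gk (al / 2) (sg - s) * gk 1 s\<bar> +
    ennreal (k2 * H) * ennreal \<bar>gk (al / 2) (sg - s) * gk (1 - al / 2) s\<bar>"
   proof (cases "s \<in> {0<..<sg}")
    case True
    have "?p s = C * Gamma (al / 2) * Q * \<bar>gk (al / 2) (sg - s) * gk 1 s\<bar> +
      k2 * H * \<bar>gk (al / 2) (sg - s) * gk (1 - al / 2) s\<bar>"
     using True G2 by (simp add: g_kernel_def k2_def field_simps)
    then show ?thesis using C0 G2 Q0 pos H0
     by (simp add: ennreal_mult'[symmetric] ennreal_plus[symmetric] del: ennreal_plus)
   qed simp
  qed
  also have "... = ennreal (C * Gamma (al / 2) * Q) * aconv (gk (al / 2)) (gk 1) sg +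
    ennreal (k2 * H) * aconv (gk (al / 2)) (gk (1 - al / 2)) sg"
   unfolding aconv_def by (subst nn_integral_add) (auto simp: nn_integral_cmult)
  also have "... = ennreal (C * Gamma (al / 2) * Q) * ennreal (gk (al / 2 + 1) sg) + ennreal (k2 * H) * ennreal 1"
   using al sg by (simp add: aconv_g_kernel g_kernel_1)
  also have "... = ennreal (C * Gamma (al / 2) * Q * gk (al / 2 + 1) sg + k2 * H)"
   using C0 G2 Q0 pos H0 al by (simp add: ennreal_mult'[symmetric] ennreal_plus[symmetric] g_kernel_nonneg del: ennreal_plus)
  also have "C * Gamma (al / 2) * Q * gk (al / 2 + 1) sg + k2 * H = k1 * Q * sg powr (al / 2) + k2 * H"
   using sg by (simp add: g_kernel_def k1_def)
  finally have int: "(NN s. ennreal (?p s)) <= ennreal (k1 * Q * sg powr (al / 2) + k2 * H)" .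
  have B0: "k1 * Q * sg powr (al / 2) + k2 * H >= 0" using pos Q0 H0 by simp
  note mk = Minkowski_integral[OF lborel.sigma_finite_measure_axioms M Fm pM le int B0]
  let ?a = "%x. mlk al 1 (m x) sg * (sm x * U ph t1 x)" and ?b = "%x. \<integral>s. ?F s x \<partial>lborel"
  have sU: "(%x. sm x * U ph t1 x) \<in> L2 M" using U_V[OF ph, of t1] t1 by (simp add: V_iff)
  have "AE x in M. \<bar>mlk al 1 (m x) sg\<bar> <= C" using mlk_bounds(2)[OF al, of _ sg] mpos sg by (auto simp: less_imp_le)
  then have a: "?a \<in> L2 M" "nrm M ?a <= C * nV (U ph t1)"
   using L2_mult_bounded[OF _ sU, of "%x. mlk al 1 (m x) sg" C] C0 by (auto simp: V_norm_half)
  have "nV (U ph (t1 + sg)) = nrm M (%x. ?a x + ?b x)"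
   unfolding V_norm_half
  proof (rule L2_norm_AE_cong(1))
   show "AE x in M. sm x * U ph (t1 + sg) x = ?a x + ?b x" using AE_causal_L1loc[OF M ph]
   proof eventually_elim
    fix x assume f: "causal_L1loc (%s. ph s x)"
    have wx: "(%ta. w ph ta x) = lin_w al (m x) (u0 x) (u1 x) (%s. ph s x)" by (simp add: w_def fun_eq_iff)
    have "U ph (t1 + sg) x = U ph t1 x * mlk al 1 (m x) sg + conv (mlk al al (m x)) (?S x) sg"
     using memory_representation[OF al f t1 sg(1), of "m x" "u0 x" "u1 x"] t1 sg by (simp add: U_pos wx)
    moreover have "sm x * conv (mlk al al (m x)) (?S x) sg = ?b x"
     unfolding conv_def by (rule sconv[OF ph, symmetric, unfolded conv_def])
    ultimately show "sm x * U ph (t1 + sg) x = ?a x + ?b x" by (simp add: algebra_simps)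
   qed
   show "(%x. sm x * U ph (t1 + sg) x) \<in> borel_measurable M" using U_measurable[OF ph, of "t1 + sg"] by simp
   show "(%x. ?a x + ?b x) \<in> borel_measurable M" by (rule L2D(1)[OF L2_add[OF a(1) mk(2)]])
  qed
  also have "... <= C * nV (U ph t1) + (k1 * Q * sg powr (al / 2) + k2 * H)"
   using L2_norm_triangle[OF a(1) mk(2)] a(2) mk(3) by linarith
  also have "... <= K * (nV (U ph t1) + t1 powr (1 - al) + 1 + E + P * sg powr (al / 2))"
  proof -
   have "sg powr (al / 2) <= 1" using powr_mono2[of "al / 2" sg 1] sg al by simp
   then have "k1 * N1 / G * t1 powr (1 - al) * sg powr (al / 2) <= k1 * N1 / G * t1 powr (1 - al) * 1"
    by (intro mult_left_mono mult_nonneg_nonneg K0(2)) auto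
   moreover have "k1 * N1 / G * t1 powr (1 - al) <= K * t1 powr (1 - al)" using Kge by (intro mult_right_mono) auto
   moreover have "C * nV (U ph t1) <= K * nV (U ph t1)"
    using Kge by (intro mult_right_mono) (auto simp: V_norm_def)
   moreover have "k2 * c * G * E <= K * E" using Kge E by (intro mult_right_mono) auto
   moreover have "k1 * (P * sg powr (al / 2)) <= K * (P * sg powr (al / 2))" using Kge P by (intro mult_right_mono) auto
   moreover have "k1 * Q * sg powr (al / 2) + k2 * H = k1 * N1 / G * t1 powr (1 - al) * sg powr (al / 2) + k1 * (P * sg powr (al / 2)) + k2 * c / al + k2 * c * G * E"
    by (simp add: Q_def H_def algebra_simps)
   moreover have "K * (nV (U ph t1) + t1 powr (1 - al) + 1 + E + P * sg powr (al / 2)) =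
    K * nV (U ph t1) + K * t1 powr (1 - al) + K + K * E + K * (P * sg powr (al / 2))" by (simp add: algebra_simps)
   ultimately show ?thesis using Kge by linarith
  qed
  finally show ?thesis .
 qed
 then show ?thesis using Kge(6) by (intro exI[of _ K]) blast
qed

end

section \<open>The nonlinearity\<close>

locale nonlinear_wave = wave +
 fixes f :: "real => real" and r Cf :: real
 assumes fC1: "f C1_differentiable_on UNIV" and Cf: "Cf > 0" and r: "r > 1" and f0: "f 0 = 0"
  and f': "\<And>sg. \<bar>deriv f sg\<bar> <= Cf * \<bar>sg\<bar> powr (r - 1)" and emb: "V_embeds_Lp M m (1/2) (2 * r)"
begin

lemma f_deriv: "(f has_field_derivative deriv f x) (at x)"
 using fC1 by (simp add: C1_differentiable_on_eq DERIV_deriv_iff_real_differentiable)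

lemma f_meas [measurable]: "f \<in> bor"
 by (intro borel_measurable_continuous_onI continuous_at_imp_continuous_on ballI DERIV_isCont[OF f_deriv])

lemma f_increment: "\<bar>f a - f b\<bar> <= Cf * (\<bar>a\<bar> + \<bar>b\<bar>) powr (r - 1) * \<bar>a - b\<bar>"
proof -
 let ?S = "{- (\<bar>a\<bar> + \<bar>b\<bar>)..\<bar>a\<bar> + \<bar>b\<bar>}"
 have "norm (f a - f b) <= Cf * (\<bar>a\<bar> + \<bar>b\<bar>) powr (r - 1) * norm (a - b)"
 proof (rule field_differentiable_bound)
  show "convex ?S" by simp
  show "(f has_field_derivative deriv f z) (at z within ?S)" for z
   using f_deriv by (rule has_field_derivative_at_within)
  show "norm (deriv f z) <= Cf * (\<bar>a\<bar> + \<bar>b\<bar>) powr (r - 1)" if "z \<in> ?S" for z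
  proof -
   have "\<bar>z\<bar> powr (r - 1) <= (\<bar>a\<bar> + \<bar>b\<bar>) powr (r - 1)" using that r by (intro powr_mono2) auto
   then have "Cf * \<bar>z\<bar> powr (r - 1) <= Cf * (\<bar>a\<bar> + \<bar>b\<bar>) powr (r - 1)" using Cf by (intro mult_left_mono) auto
   then show ?thesis using f'[of z] by simp
  qed
 qed auto
 then show ?thesis by simp
qed

lemma V_norm_nonneg [simp]: "nV g >= 0" by (simp add: V_norm_def)

lemma V_m: "g \<in> V M m (1/2) ==> g \<in> borel_measurable M" by (simp add: V_iff)

lemma V_scale: "g \<in> V M m (1/2) ==> (%x. c * g x) \<in> V M m (1/2)"
 using L2_scale[of "%x. sm x * g x" M c] by (auto simp: V_iff mult.left_commute)

lemma V_norm_scale: "nV (%x. c * g x) = \<bar>c\<bar> * nV g"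
 using L2_norm_scale[of M c "%x. sm x * g x"] by (simp add: V_norm_half mult.left_commute)

lemma V_diff: "g \<in> V M m (1/2) ==> h \<in> V M m (1/2) ==> (%x. g x - h x) \<in> V M m (1/2)"
 using L2_diff[of "%x. sm x * g x" M "%x. sm x * h x"] by (auto simp: V_iff right_diff_distrib)

lemma V_norm_triangle: "g \<in> V M m (1/2) ==> h \<in> V M m (1/2) ==>
  nV (%x. g x + h x) <= nV g + nV h"
 using L2_norm_triangle[of "%x. sm x * g x" M "%x. sm x * h x"] by (simp add: V_norm_half V_iff distrib_left)

lemma V_norm_abs_diff: "g \<in> V M m (1/2) ==> h \<in> V M m (1/2) ==>
  \<bar>nV g - nV h\<bar> <= nV (%x. g x - h x)"
 using L2_norm_abs_diff[of "%x. sm x * g x" M "%x. sm x * h x"] by (simp add: V_norm_half V_iff right_diff_distrib)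

lemma V_norm_eq_0D: "g \<in> V M m (1/2) ==> nV g <= 0 ==> AE x in M. g x = 0"
proof -
 assume "g \<in> V M m (1/2)" "nV g <= 0"
 then have "AE x in M. sm x * g x = 0" by (intro L2_norm_eq_0D) (auto simp: V_iff V_norm_half)
 then show "AE x in M. g x = 0" by eventually_elim (use mpos in \<open>simp add: less_imp_neq[symmetric]\<close>)
qed

text \<open>By the mean value theorem \<open>\<bar>f a - f b\<bar>\<close> is at most \<open>Cf P powr (r - 1) \<bar>a - b\<bar>\<close> with \<open>P = \<bar>a\<bar> + \<bar>b\<bar>\<close>.
With \<open>d\<close> the norm of \<open>a - b\<close> and \<open>Q = \<bar>a - b\<bar>/d\<close>, the pointwise bound
\<open>(P powr (r - 1) Q)\<^sup>2 \<le> P powr (2 r) + Q powr (2 r)\<close> reduces the claim to the embedding into \<open>L\<^sup>2\<^sup>r\<close>, because \<open>Q\<close>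
has norm \<open>1\<close>.\<close>

lemma nonlinearity_Lipschitz:
 "\<exists>L\<ge>0. \<forall>a\<in>V M m (1/2). \<forall>b\<in>V M m (1/2). nV a <= R --> nV b <= R \<longrightarrow>
  (%x. f (a x) - f (b x)) \<in> L2 M \<and> nrm M (%x. f (a x) - f (b x)) <= L * nV (%x. a x - b x)"
proof -
 let ?V = "V M m (1/2)" and ?N = "nV"
 obtain C1 where C1: "\<And>g. g \<in> ?V ==> g \<in> Lp M (2 * r) \<and> Lp_norm M (2 * r) g <= C1 * ?N g"
  using emb unfolding V_embeds_Lp_def by blast
 define K where "K = max C1 0"
 have K0: "K >= 0" by (simp add: K_def)
 have K: "(\<integral>\<^sup>+x. ennreal (\<bar>g x\<bar> powr (2 * r)) \<partial>M) <= ennreal ((K * n) powr (2 * r))" if g: "g \<in> ?V" "?N g <= n" for g n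
 proof -
  have i: "integrable M (%x. \<bar>g x\<bar> powr (2 * r))" using C1[OF g(1)] by (simp add: Lp_def)
  define I where "I = (\<integral>x. \<bar>g x\<bar> powr (2 * r) \<partial>M)"
  have I0: "I >= 0" by (simp add: I_def)
  have n0: "n >= 0" using g(2) V_norm_nonneg[of g] by linarith
  have "I powr (1 / (2 * r)) <= C1 * ?N g" using C1[OF g(1)] by (simp add: Lp_norm_def I_def)
  also have "... <= K * ?N g" by (intro mult_right_mono) (auto simp: K_def)
  also have "... <= K * n" using g(2) K0 by (intro mult_left_mono)
  finally have "(I powr (1 / (2 * r))) powr (2 * r) <= (K * n) powr (2 * r)" using r by (intro powr_mono2) auto
  moreover have "(I powr (1 / (2 * r))) powr (2 * r) = I" using I0 r by (simp add: powr_powr)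
  ultimately show ?thesis using i by (subst nn_integral_eq_integral) (auto simp: I_def intro: ennreal_leI)
 qed
 define R' where "R' = max R 0"
 define B where "B = 2 powr (2 * r) * (2 * (K * R') powr (2 * r)) + (K * 1) powr (2 * r)"
 have B0: "B >= 0" by (simp add: B_def)
 define L where "L = Cf * sqrt B"
 have L0: "L >= 0" using Cf B0 by (simp add: L_def)
 have "(%x. f (a x) - f (b x)) \<in> L2 M \<and> nrm M (%x. f (a x) - f (b x)) <= L * ?N (%x. a x - b x)"
  if a: "a \<in> ?V" "?N a <= R" and b: "b \<in> ?V" "?N b <= R" for a b
 proof -
  note [measurable] = V_m[OF a(1)] V_m[OF b(1)]
  define d where "d = ?N (%x. a x - b x)"
  note ab = V_diff[OF a(1) b(1)]
  have d0: "d >= 0" by (simp add: d_def)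
  show ?thesis
  proof (cases "d = 0")
   case True
   have "AE x in M. a x - b x = 0" using V_norm_eq_0D[OF ab] True by (simp add: d_def)
   then have e: "AE x in M. f (a x) - f (b x) = 0" by eventually_elim simp
   have "nrm M (%x. f (a x) - f (b x)) = 0" "(%x. f (a x) - f (b x)) \<in> L2 M"
    using L2_norm_AE_cong[OF e] by simp_all
   then show ?thesis using True by (simp add: d_def)
  next
   case False
   then have d: "d > 0" using d0 by simp
   \<comment> \<open>the case \<open>d = 0\<close> was separated because \<open>?Q\<close> divides by \<open>d\<close>\<close>
   let ?P = "%x. \<bar>a x\<bar> + \<bar>b x\<bar>" and ?Q = "%x. \<bar>1 / d * (a x - b x)\<bar>"
   have pt: "(f (a x) - f (b x))\<^sup>2 <= (Cf * d)\<^sup>2 * (2 powr (2 * r) * (\<bar>a x\<bar> powr (2 * r) + \<bar>b x\<bar> powr (2 * r)) + ?Q x powr (2 * r))" for x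
   proof -
    let ?p = "?P x" and ?q = "?Q x"
    have sq: "(y powr z)\<^sup>2 = y powr (2 * z)" for y z :: real by (simp add: power2_eq_square powr_add[symmetric])
    have dq: "\<bar>a x - b x\<bar> = d * ?q" using d by (simp add: abs_mult)
    have "\<bar>f (a x) - f (b x)\<bar> <= Cf * d * (?p powr (r - 1) * ?q)"
     using f_increment[of "a x" "b x"] unfolding dq by (simp only: mult_ac)
    then have "\<bar>f (a x) - f (b x)\<bar>\<^sup>2 <= (Cf * d * (?p powr (r - 1) * ?q))\<^sup>2" by (intro power_mono) auto
    then have 1: "(f (a x) - f (b x))\<^sup>2 <= (Cf * d)\<^sup>2 * (?p powr (r - 1) * ?q)\<^sup>2" by (simp only: power2_abs power_mult_distrib)
    have mx: "y powr (r - 1) * z <= (max y z) powr r" if "y >= 0" "z >= 0" for y z :: real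
    proof -
     have "y powr (r - 1) * z <= (max y z) powr (r - 1) * (max y z)" using that r by (intro mult_mono powr_mono2) auto
     also have "... = (max y z) powr r"
     proof (cases "max y z = 0")
      case False
      then show ?thesis using that powr_add[of "max y z" "r - 1" 1] by simp
     qed (use r in simp)
     finally show ?thesis .
    qed
    have "(?p powr (r - 1) * ?q)\<^sup>2 <= (max ?p ?q powr r)\<^sup>2" by (intro power_mono mx) auto
    also have "... <= ?p powr (2 * r) + ?q powr (2 * r)" unfolding sq by (simp add: max_def)
    also have "?p powr (2 * r) <= 2 powr (2 * r) * (\<bar>a x\<bar> powr (2 * r) + \<bar>b x\<bar> powr (2 * r))"
    proof -
     have "?p powr (2 * r) <= (2 * max \<bar>a x\<bar> \<bar>b x\<bar>) powr (2 * r)" using r by (intro powr_mono2) auto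
     also have "... = 2 powr (2 * r) * max \<bar>a x\<bar> \<bar>b x\<bar> powr (2 * r)" by (rule powr_mult)
     also have "... <= 2 powr (2 * r) * (\<bar>a x\<bar> powr (2 * r) + \<bar>b x\<bar> powr (2 * r))" by (intro mult_left_mono) (auto simp: max_def)
     finally show ?thesis .
    qed
    finally have "(?p powr (r - 1) * ?q)\<^sup>2 <= 2 powr (2 * r) * (\<bar>a x\<bar> powr (2 * r) + \<bar>b x\<bar> powr (2 * r)) + ?q powr (2 * r)" by simp
    from mult_left_mono[OF this, of "(Cf * d)\<^sup>2"] 1 show ?thesis by simp
   qed
   have q1: "(%x. 1 / d * (a x - b x)) \<in> ?V" "?N (%x. 1 / d * (a x - b x)) <= 1"
    using V_scale[OF ab, of "1 / d"] V_norm_scale[of "1 / d" "%x. a x - b x"] d by (auto simp: d_def[symmetric])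
   have "(\<integral>\<^sup>+x. ennreal ((f (a x) - f (b x))\<^sup>2) \<partial>M) \<le>
    (\<integral>\<^sup>+x. ennreal ((Cf * d)\<^sup>2) * (ennreal (2 powr (2 * r)) * (ennreal (\<bar>a x\<bar> powr (2 * r)) + ennreal (\<bar>b x\<bar> powr (2 * r))) + ennreal (?Q x powr (2 * r))) \<partial>M)"
    using ennreal_leI[OF pt]
    by (intro nn_integral_mono) (simp add: ennreal_mult'[symmetric] ennreal_plus[symmetric] del: ennreal_plus)
   also have "... = ennreal ((Cf * d)\<^sup>2) * (ennreal (2 powr (2 * r)) * ((\<integral>\<^sup>+x. ennreal (\<bar>a x\<bar> powr (2 * r)) \<partial>M) + (\<integral>\<^sup>+x. ennreal (\<bar>b x\<bar> powr (2 * r)) \<partial>M)) + (\<integral>\<^sup>+x. ennreal (?Q x powr (2 * r)) \<partial>M))"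
    by (simp add: nn_integral_cmult nn_integral_add)
   also have "... <= ennreal ((Cf * d)\<^sup>2) * (ennreal (2 powr (2 * r)) * (ennreal ((K * R') powr (2 * r)) + ennreal ((K * R') powr (2 * r))) + ennreal ((K * 1) powr (2 * r)))"
    using a(2) b(2) by (intro mult_left_mono add_mono K a(1) b(1) q1) (auto simp: R'_def)
   also have "... = ennreal ((Cf * d)\<^sup>2 * B)"
    by (simp add: B_def ennreal_mult'[symmetric] ennreal_plus[symmetric] del: ennreal_plus)
   also have "(Cf * d)\<^sup>2 * B = (L * d)\<^sup>2" using B0 by (simp add: L_def power_mult_distrib)
   finally show ?thesis using L2I_nn[of "%x. f (a x) - f (b x)" M "L * d"] L0 d0 by (simp add: d_def[symmetric])
  qed
 qed
 then show ?thesis using L0 by blast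
qed

definition Lip :: "real => real" where
 "Lip R = (SOME L. L >= 0 \<and> (\<forall>a\<in>V M m (1/2). \<forall>b\<in>V M m (1/2). nV a <= R --> nV b <= R \<longrightarrow>
  (%x. f (a x) - f (b x)) \<in> L2 M \<and> nrm M (%x. f (a x) - f (b x)) <= L * nV (%x. a x - b x)))"

lemma Lip_nonneg: "Lip R >= 0"
 and f_Lip: "a \<in> V M m (1/2) ==> b \<in> V M m (1/2) ==> nV a <= R ==> nV b <= R ==>
  nrm M (%x. f (a x) - f (b x)) <= Lip R * nV (%x. a x - b x)"
 and f_diff_L2: "a \<in> V M m (1/2) ==> b \<in> V M m (1/2) ==> nV a <= R ==> nV b <= R ==>
  (%x. f (a x) - f (b x)) \<in> L2 M"
 using someI_ex[OF nonlinearity_Lipschitz[of R, unfolded Bex_def]] unfolding Lip_def by blast+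

lemma f_L2: assumes a: "a \<in> V M m (1/2)" "nV a <= R"
 shows "(%x. f (a x)) \<in> L2 M" "nrm M (%x. f (a x)) <= Lip R * R"
proof -
 have z: "(%x. 0) \<in> V M m (1/2)" by (simp add: V_iff)
 have R: "nV (%x. 0) <= R" using order_trans[OF V_norm_nonneg a(2)] by (simp add: V_norm_half)
 show "(%x. f (a x)) \<in> L2 M" using f_diff_L2[OF a(1) z a(2) R] f0 by simp
 have "nrm M (%x. f (a x)) <= Lip R * nV a" using f_Lip[OF a(1) z a(2) R] f0 by simp
 also have "... <= Lip R * R" using a(2) Lip_nonneg by (rule mult_left_mono)
 finally show "nrm M (%x. f (a x)) <= Lip R * R" .
qed

text \<open>The radial retraction onto the ball of radius \<open>R\<close>. Truncating with the norm rather than pointwise keeps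
\<open>f\<close> itself untouched inside the ball.\<close>

definition trunc :: "real => ('a => real) => 'a => real" where
 "trunc R a x = R / max R (nV a) * a x"

lemma trunc_V: "a \<in> V M m (1/2) ==> trunc R a \<in> V M m (1/2)"
 using V_scale[of a "R / max R (nV a)"] by (simp add: trunc_def[abs_def])

lemma trunc_le: "R > 0 ==> nV (trunc R a) <= R"
 using V_norm_scale[of "R / max R (nV a)" a] by (simp add: trunc_def[abs_def] divide_le_eq)

lemma trunc_id: "R > 0 ==> nV a <= R ==> trunc R a = a"
 by (simp add: trunc_def[abs_def] max_def)

text \<open>True in every normed space: the difference is \<open>R/p (a - b) + (R/p - R/q) b\<close> with \<open>p, q \<ge> R\<close> the two
denominators, and each part is at most the norm of \<open>a - b\<close>.\<close>

lemma trunc_Lipschitz: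
 assumes R: "R > 0" and a: "a \<in> V M m (1/2)" and b: "b \<in> V M m (1/2)"
 shows "nV (%x. trunc R a x - trunc R b x) <= 2 * nV (%x. a x - b x)"
proof -
 let ?N = "nV"
 define p q where "p = max R (?N a)" and "q = max R (?N b)"
 have pq: "p > 0" "q > 0" "R <= p" "?N b <= q" using R by (auto simp: p_def q_def)
 have eq: "(%x. trunc R a x - trunc R b x) = (%x. R / p * (a x - b x) + (R / p - R / q) * b x)"
 proof -
  have "X * y - Y * z = X * (y - z) + (X - Y) * z" for X Y y z :: real by (simp add: algebra_simps)
  then show ?thesis unfolding trunc_def p_def q_def by blast
 qed
 have "?N (%x. trunc R a x - trunc R b x) <= \<bar>R / p\<bar> * ?N (%x. a x - b x) + \<bar>R / p - R / q\<bar> * ?N b"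
  using V_norm_triangle[OF V_scale[OF V_diff[OF a b], of "R / p"] V_scale[OF b, of "R / p - R / q"]]
  unfolding eq V_norm_scale .
 also have "\<bar>R / p\<bar> * ?N (%x. a x - b x) <= 1 * ?N (%x. a x - b x)" using pq R by (intro mult_right_mono) auto
 also have "\<bar>R / p - R / q\<bar> * ?N b <= ?N (%x. a x - b x)"
 proof -
  have "R / p - R / q = R / p * ((q - p) / q)" using pq by (simp add: field_simps)
  then have "\<bar>R / p - R / q\<bar> = R / p * (\<bar>p - q\<bar> / q)" using pq R by (simp add: abs_mult abs_minus_commute)
  also have "... <= 1 * (\<bar>p - q\<bar> / q)" using pq by (intro mult_right_mono) auto
  finally have "\<bar>R / p - R / q\<bar> * ?N b <= \<bar>p - q\<bar> / q * q" using pq by (intro mult_mono) auto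
  also have "... <= \<bar>?N a - ?N b\<bar>" using pq by (simp add: p_def q_def max_def)
  finally show ?thesis using V_norm_abs_diff[OF a b] by linarith
 qed
 finally show ?thesis by simp
qed

definition V_curve :: "(real => 'a => real) => bool" where
 "V_curve v \<longleftrightarrow> (%(t, x). v t x) \<in> jmeas M \<and> L2_cont M {0..} (%t x. sm x * v t x) \<and>
  (\<forall>t\<ge>0. v t \<in> V M m (1/2))"

lemma V_curve_U: "admissible M ph ==> V_curve (U ph)"
 using U_jm sU_cont U_V by (simp add: V_curve_def)

text \<open>The truncated nonlinearity as an operator from curves to source terms.\<close>

definition N :: "real => (real => 'a => real) => real => 'a => real" where
 "N R v t x = (if t >= 0 then f (trunc R (v t) x) else 0)"

lemma N_diff:
 assumes R: "R > 0" and v: "v t \<in> V M m (1/2)" and u: "u t \<in> V M m (1/2)" and t: "t >= 0"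
 shows "nrm M (%x. N R v t x - N R u t x) <= 2 * Lip R * nV (%x. v t x - u t x)"
proof -
 have "nrm M (%x. N R v t x - N R u t x) <= Lip R * nV (%x. trunc R (v t) x - trunc R (u t) x)"
  using f_Lip[OF trunc_V[OF v] trunc_V[OF u] trunc_le[OF R] trunc_le[OF R]] t by (simp add: N_def)
 also have "... <= Lip R * (2 * nV (%x. v t x - u t x))"
  by (intro mult_left_mono trunc_Lipschitz R v u Lip_nonneg)
 finally show ?thesis by simp
qed

lemma N_L2: "R > 0 ==> v t \<in> V M m (1/2) ==> t >= 0 ==> N R v t \<in> L2 M \<and> nrm M (N R v t) <= Lip R * R"
 using f_L2[OF trunc_V trunc_le] by (simp add: N_def[abs_def])

lemma N_admissible:
 assumes R: "R > 0" and v: "V_curve v"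
 shows "admissible M (N R v)"
proof -
 have vm [measurable]: "(%(t, x). v t x) \<in> jmeas M" and vc: "L2_cont M {0..} (%t x. sm x * v t x)"
  and vV: "\<And>t. t >= 0 ==> v t \<in> V M m (1/2)" using v by (auto simp: V_curve_def)
 have [measurable]: "(%t. nV (v t)) \<in> borel_measurable lborel"
  unfolding V_norm_half by (rule L2_norm_measurable[OF M]) measurable
 have "(%(t, x). N R v t x) \<in> jmeas M"
  unfolding N_def trunc_def by measurable
 moreover have "L2_cont M {0..} (N R v)" unfolding L2_cont_def
 proof (intro ballI conjI)
  fix t :: real assume t: "t \<in> {0..}"
  show "N R v t \<in> L2 M" using N_L2[OF R vV] t by simp
  have "((%ta. 2 * Lip R * nV (%x. v ta x - v t x)) \<longlongrightarrow> 2 * Lip R * 0) (at t within {0..})"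
   using L2_contD(2)[OF vc t] by (intro tendsto_intros) (simp add: V_norm_half right_diff_distrib)
  then have l: "((%ta. 2 * Lip R * nV (%x. v ta x - v t x)) \<longlongrightarrow> 0) (at t within {0..})" by simp
  show "((%ta. nrm M (%x. N R v ta x - N R v t x)) \<longlongrightarrow> 0) (at t within {0..})"
  proof (rule null_sandwich_within[OF _ _ l])
   fix ta :: real assume ta: "ta \<in> {0..}"
   have "N R v t = N R (%_. v t) ta" using t ta by (simp add: N_def[abs_def])
   then show "nrm M (%x. N R v ta x - N R v t x) <= 2 * Lip R * nV (%x. v ta x - v t x)"
    using N_diff[OF R, of v ta "%_. v t"] vV t ta by simp
  qed simp
 qed
 ultimately show ?thesis by (auto simp: admissible_def N_def)
qed

text \<open>Chosen such that \<open>2 Lip R C Gamma (al/2) rate powr (-al/2) \<le> 1/2\<close> in \<open>weighted_contraction\<close>; the additional \<open>1\<close>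
keeps the rate positive when \<open>Lip R = 0\<close>.\<close>

definition rate :: "real => real" where
 "rate R = (2 * (2 * Lip R * C * Gamma (al / 2)) + 1) powr (2 / al)"

text \<open>The weight \<open>exp (rate R * t)\<close> turns the singular kernel into one with integral at most \<open>1/2\<close> on all of \<open>{0<..}\<close>, so
that a single iteration covers every time interval.\<close>

lemma weighted_contraction:
 assumes d: "\<And>s. s \<in> {0<..<t} ==> d s <= D * exp (rate R * s)" and D: "D >= 0"
 shows "(NN s. ennreal (2 * Lip R * (C * (t - s) powr (al / 2 - 1) * d s) * ind {0<..<t} s))
  <= ennreal (D / 2 * exp (rate R * t))"
proof -
 let ?l = "rate R"
 define k where "k = 2 * Lip R * C * Gamma (al / 2)"
 have rk: "rate R = (2 * k + 1) powr (2 / al)" by (simp add: rate_def k_def)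
 have G: "Gamma (al / 2) > 0" using a0 by (simp add: Gamma_real_pos)
 have k0: "k >= 0" using Lip_nonneg C0 G by (simp add: k_def)
 then have l: "?l > 0" by (simp add: rk)
 have e: "?l powr (- (al / 2)) = 1 / (2 * k + 1)"
  using k0 a0 by (simp add: rk powr_powr powr_minus_divide)
 have kl: "k * ?l powr (- (al / 2)) <= 1 / 2" unfolding e using k0 by (simp add: field_simps)
 have "(NN s. ennreal (2 * Lip R * (C * (t - s) powr (al / 2 - 1) * d s) * ind {0<..<t} s)) \<le>
  (NN s. ennreal (k * D * exp (?l * t)) * ennreal (gk (al / 2) (t - s) * exp (- (?l * (t - s)))))"
 proof (intro nn_integral_mono)
  fix s :: real
  show "ennreal (2 * Lip R * (C * (t - s) powr (al / 2 - 1) * d s) * ind {0<..<t} s) \<le>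
   ennreal (k * D * exp (?l * t)) * ennreal (gk (al / 2) (t - s) * exp (- (?l * (t - s))))"
  proof (cases "s \<in> {0<..<t}")
   case True
   have p: "(t - s) powr (al / 2 - 1) = Gamma (al / 2) * gk (al / 2) (t - s)" using True G by (simp add: g_kernel_def)
   have "2 * Lip R * (C * (t - s) powr (al / 2 - 1) * d s) <= 2 * Lip R * (C * (t - s) powr (al / 2 - 1) * (D * exp (?l * s)))"
    using d[OF True] Lip_nonneg C0 by (intro mult_left_mono) auto
   also have "exp (?l * s) = exp (?l * t) * exp (- (?l * (t - s)))" by (simp add: exp_add[symmetric] algebra_simps)
   finally have "2 * Lip R * (C * (t - s) powr (al / 2 - 1) * d s) <= (k * D * exp (?l * t)) * (gk (al / 2) (t - s) * exp (- (?l * (t - s))))"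
    by (simp add: k_def p mult_ac)
   then show ?thesis using True k0 D by (simp add: ennreal_mult'[symmetric] ennreal_leI)
  qed simp
 qed
 also have "... = ennreal (k * D * exp (?l * t)) * (NN s. ennreal (gk (al / 2) (t - s) * exp (- (?l * (t - s)))))"
  by (intro nn_integral_cmult) measurable
 also have "(NN s. ennreal (gk (al / 2) (t - s) * exp (- (?l * (t - s))))) = ennreal (?l powr (- (al / 2)))"
  using nn_integral_lborel_reflect[of "%u. ennreal (gk (al / 2) u * exp (- (?l * u)))" t]
   nn_integral_g_kernel_exp[of "al / 2" ?l] l a0 by simp
 also have "ennreal (k * D * exp (?l * t)) * ennreal (?l powr (- (al / 2))) = ennreal ((k * ?l powr (- (al / 2))) * (D * exp (?l * t)))"
  using k0 D by (simp add: ennreal_mult'[symmetric] mult_ac)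
 also have "... <= ennreal (1 / 2 * (D * exp (?l * t)))" using kl D by (intro ennreal_leI mult_right_mono) auto
 finally show ?thesis by simp
qed

lemma N_contraction:
 assumes R: "R > 0" and ph: "admissible M ph" and psi: "admissible M psi" and t: "t >= 0" and D: "D >= 0"
  and d: "\<And>s. s \<in> {0<..<t} ==> nrm M (%x. ph s x - psi s x) <= D * exp (rate R * s)"
 shows "nrm M (%x. N R (U ph) t x - N R (U psi) t x) <= D / 2 * exp (rate R * t)"
proof -
 have "ennreal (nrm M (%x. N R (U ph) t x - N R (U psi) t x)) <= ennreal (2 * Lip R * nV (%x. U ph t x - U psi t x))"
  by (intro ennreal_leI N_diff R U_V ph psi t)
 also have "... = ennreal (2 * Lip R) * ennreal (nV (%x. U ph t x - U psi t x))"
  using Lip_nonneg by (simp add: ennreal_mult')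
 also have "... <= ennreal (2 * Lip R) * (NN s. ennreal (C * (t - s) powr (al / 2 - 1) * nrm M (%x. ph s x - psi s x) * ind {0<..<t} s))"
  by (intro mult_left_mono U_diff_norm ph psi) simp
 also have "... = (NN s. ennreal (2 * Lip R * (C * (t - s) powr (al / 2 - 1) * nrm M (%x. ph s x - psi s x)) * ind {0<..<t} s))"
 proof (subst nn_integral_cmult[symmetric])
  have [measurable]: "(%s. nrm M (%x. ph s x - psi s x)) \<in> borel_measurable lborel"
   by (rule L2_norm_measurable[OF M pm[OF admissible_diff[OF ph psi]]])
  show "(%s. ennreal (C * (t - s) powr (al / 2 - 1) * nrm M (%x. ph s x - psi s x) * ind {0<..<t} s)) \<in> borel_measurable lborel"
   by measurable
 qed (use Lip_nonneg in \<open>simp add: ennreal_mult'[symmetric] mult_ac\<close>)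
 also have "... <= ennreal (D / 2 * exp (rate R * t))" by (rule weighted_contraction[OF d D])
 finally show ?thesis using D by simp
qed

end

section \<open>The truncated problem\<close>

lemma admissible_zero: "admissible M (%t x. 0)"
 by (simp add: admissible_def L2_cont_const)

text \<open>Completeness in the form needed for curves: the limit is the pointwise sum, which is jointly measurable in time
and space. It is Minkowski's inequality for the counting measure.\<close>

lemma L2_telescope:
 fixes F :: "nat => 'a => real"
 assumes M: "sigma_finite_measure M" and F: "\<And>n. F n \<in> L2 M"
  and d: "\<And>n. nrm M (%x. F (Suc n) x - F n x) <= D * (1 / 2) ^ n" and D: "D >= 0"
 shows "(%x. F 0 x + (\<Sum>k. F (Suc k) x - F k x)) \<in> L2 M"
  and "nrm M (%x. F 0 x + (\<Sum>k. F (Suc k) x - F k x) - F n x) <= 2 * D * (1 / 2) ^ n"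
proof -
 let ?G = "%k x. F (Suc k) x - F k x"
 have [measurable]: "F k \<in> borel_measurable M" for k using F by (simp add: L2_iff)
 have sf: "sigma_finite_measure (count_space (UNIV :: nat set))" by (rule sigma_finite_measure_count_space)
 have key: "(AE x in M. summable (%k. ?G (k + n) x)) \<and> (%x. \<Sum>k. ?G (k + n) x) \<in> L2 M \<and>
   nrm M (%x. \<Sum>k. ?G (k + n) x) <= 2 * D * (1 / 2) ^ n" for n
 proof -
  have m: "(%(k, x). ?G (k + n) x) \<in> borel_measurable (count_space (UNIV :: nat set) \<Otimes>\<^sub>M M)"
   by (rule measurable_pair_measure_countable1) auto
  have le: "AE k in count_space UNIV. ?G (k + n) \<in> L2 M \<and> nrm M (?G (k + n)) <= D * (1 / 2) ^ (k + n)"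
   using d L2_diff[OF F F] by simp
  have i: "(\<integral>\<^sup>+k. ennreal (D * (1 / 2) ^ (k + n)) \<partial>count_space UNIV) <= ennreal (2 * D * (1 / 2) ^ n)"
  proof -
   have "(%k. D * (1 / 2) ^ n * (1 / 2) ^ k) sums (D * (1 / 2) ^ n * (1 / (1 - 1 / 2)))"
    by (intro sums_mult geometric_sums) simp
   then have s: "(%k. D * (1 / 2) ^ (k + n)) sums (2 * D * (1 / 2) ^ n)" by (simp add: power_add mult_ac)
   have "(\<integral>\<^sup>+k. ennreal (D * (1 / 2) ^ (k + n)) \<partial>count_space UNIV) = (\<Sum>k. ennreal (D * (1 / 2) ^ (k + n)))"
    by (simp add: nn_integral_count_space_nat)
   also have "... = ennreal (2 * D * (1 / 2) ^ n)" using s D by (intro suminf_ennreal_eq) auto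
   finally show ?thesis by simp
  qed
  have B: "2 * D * (1 / 2) ^ n >= 0" using D by simp
  note mk = Minkowski_integral[OF sf M m _ le i B]
  have ai: "AE x in M. integrable (count_space UNIV) (%k. ?G (k + n) x)" by (rule mk(1)) simp
  have sm: "AE x in M. summable (%k. ?G (k + n) x)"
   using ai by eventually_elim (auto simp: integrable_count_space_nat_iff intro: summable_norm_cancel)
  have e: "AE x in M. (\<integral>k. ?G (k + n) x \<partial>count_space UNIV) = (\<Sum>k. ?G (k + n) x)"
   using ai by eventually_elim (rule integral_count_space_nat)
  have iL: "(%x. \<integral>k. ?G (k + n) x \<partial>count_space UNIV) \<in> L2 M" by (rule mk(2)) simp
  have iN: "nrm M (%x. \<integral>k. ?G (k + n) x \<partial>count_space UNIV) <= 2 * D * (1 / 2) ^ n" by (rule mk(3)) simp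
  have "(%x. \<Sum>k. ?G (k + n) x) \<in> borel_measurable M" by measurable
  then show ?thesis using sm iL iN L2_norm_AE_cong[OF e L2D(1)[OF iL]] by simp
 qed
 show "(%x. F 0 x + (\<Sum>k. ?G k x)) \<in> L2 M" using L2_add[OF F[of 0]] key[of 0] by simp
 have "nrm M (%x. F 0 x + (\<Sum>k. ?G k x) - F n x) = nrm M (%x. \<Sum>k. ?G (k + n) x)"
 proof (rule L2_norm_AE_cong(1))
  have s0: "AE x in M. summable (%k. ?G k x)" using key[of 0] by simp
  show "AE x in M. F 0 x + (\<Sum>k. ?G k x) - F n x = (\<Sum>k. ?G (k + n) x)" using s0
  proof eventually_elim
   fix x assume s: "summable (%k. ?G k x)"
   have "(\<Sum>k<n. ?G k x) = F n x - F 0 x" by (rule sum_lessThan_telescope)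
   then show "F 0 x + (\<Sum>k. ?G k x) - F n x = (\<Sum>k. ?G (k + n) x)"
    using suminf_split_initial_segment[OF s, of n] by simp
  qed
 qed measurable
 then show "nrm M (%x. F 0 x + (\<Sum>k. ?G k x) - F n x) <= 2 * D * (1 / 2) ^ n" using key[of n] by simp
qed

context nonlinear_wave
begin

primrec picard :: "real => nat => real => 'a => real" where
 "picard R 0 = (%t x. 0)"
| "picard R (Suc n) = N R (U (picard R n))"

text \<open>The limit of the iteration, as a telescoping series. The unknown is the source rather than the solution, since
every source produces a curve with all required regularity.\<close>

definition src :: "real => real => 'a => real" where
 "src R t x = picard R 0 t x + (\<Sum>k. picard R (Suc k) t x - picard R k t x)"

lemma picard_admissible: "R > 0 ==> admissible M (picard R n)"
 by (induction n) (auto intro!: admissible_zero N_admissible V_curve_U simp del: picard.simps(1) simp: picard.simps(1))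

lemma picard_step:
 assumes R: "R > 0" and t: "t >= 0"
 shows "nrm M (%x. picard R (Suc n) t x - picard R n t x) <= (Lip R * R * exp (rate R * t)) * (1 / 2) ^ n"
 using t
proof (induction n arbitrary: t)
 case 0
 have l: "rate R >= 0" by (simp add: rate_def)
 have LR: "Lip R * R >= 0" using Lip_nonneg R by simp
 have "nrm M (picard R 1 t) <= Lip R * R"
  using N_L2[where v = "U (picard R 0)" and t = t, OF R U_V[OF picard_admissible[OF R, of 0] 0] 0] by simp
 also have "... <= Lip R * R * exp (rate R * t)" using mult_left_mono[OF _ LR, of 1 "exp (rate R * t)"] l 0 by simp
 finally show ?case by simp
next
 case (Suc n)
 let ?D = "Lip R * R * (1 / 2) ^ n"
 have D: "?D >= 0" using Lip_nonneg R by simp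
 have "nrm M (%x. N R (U (picard R (Suc n))) t x - N R (U (picard R n)) t x) <= ?D / 2 * exp (rate R * t)"
 proof (rule N_contraction[OF R picard_admissible[OF R] picard_admissible[OF R] Suc.prems D])
  fix s assume "s \<in> {0<..<t}"
  then show "nrm M (%x. picard R (Suc n) s x - picard R n s x) <= ?D * exp (rate R * s)"
   using Suc.IH[of s] by (simp add: mult_ac del: picard.simps)
 qed
 then show ?case by (simp add: mult_ac)
qed

lemma src_approx:
 assumes R: "R > 0" and t: "t >= 0"
 shows "src R t \<in> L2 M" and "nrm M (%x. src R t x - picard R n t x) <= 2 * (Lip R * R) * (1 / 2) ^ n * exp (rate R * t)"
proof -
 have D: "Lip R * R * exp (rate R * t) >= 0" using Lip_nonneg R by simp
 have p: "picard R n t \<in> L2 M" for n by (rule admissible_L2[OF picard_admissible[OF R]])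
 note T = L2_telescope[where F = "%n. picard R n t", OF M p picard_step[OF R t] D]
 show "src R t \<in> L2 M" using T(1) by (simp add: src_def[abs_def])
 show "nrm M (%x. src R t x - picard R n t x) <= 2 * (Lip R * R) * (1 / 2) ^ n * exp (rate R * t)"
  using T(2)[of n] by (simp add: src_def mult_ac)
qed

lemma src_admissible:
 assumes R: "R > 0"
 shows "admissible M (src R)"
proof -
 note [measurable] = pm[OF picard_admissible[OF R]]
 have "(%z. src R (fst z) (snd z)) \<in> jmeas M"
 proof -
  have [measurable]: "(%z. picard R n (fst z) (snd z)) \<in> jmeas M" for n
   using pm[OF picard_admissible[OF R, of n]] by (simp add: split_beta')
  show ?thesis unfolding src_def by measurable
 qed
 moreover have "src R t x = 0" if "t < 0" for t x
  using p0[OF picard_admissible[OF R] that] by (simp add: src_def del: picard.simps)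
 moreover have "L2_cont M {0..} (src R)" unfolding L2_cont_def
 proof (intro ballI conjI)
  fix t :: real assume t: "t \<in> {0..}"
  show "src R t \<in> L2 M" using src_approx(1)[OF R] t by simp
  show "((%ta. nrm M (%x. src R ta x - src R t x)) \<longlongrightarrow> 0) (at t within {0..})"
  proof (rule tendstoI)
   fix e :: real assume e: "e > 0"
   define B where "B = 2 * (Lip R * R) * exp (rate R * (t + 1))"
   have B0: "B >= 0" using Lip_nonneg R by (simp add: B_def)
   obtain n where n: "(1 / 2) ^ n < e / (3 * (B + 1))"
    using real_arch_pow_inv[of "e / (3 * (B + 1))" "1/2"] e B0 by auto
   have Bn: "B * (1 / 2) ^ n < e / 3"
   proof -
    have "B * (1 / 2) ^ n <= (B + 1) * (1 / 2) ^ n" by (intro mult_right_mono) auto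
    also have "... < e / 3" using n B0 by (simp add: field_simps)
    finally show ?thesis .
   qed
   have near: "nrm M (%x. src R ta x - picard R n ta x) < e / 3" if "ta >= 0" "ta < t + 1" for ta
   proof -
    have "rate R * ta <= rate R * (t + 1)" using that by (intro mult_left_mono) (auto simp: rate_def)
    then have "2 * (Lip R * R) * (1 / 2) ^ n * exp (rate R * ta) <= 2 * (Lip R * R) * (1 / 2) ^ n * exp (rate R * (t + 1))"
     using Lip_nonneg R by (intro mult_left_mono) auto
    then show ?thesis using src_approx(2)[OF R that(1), of n] Bn by (simp add: B_def mult_ac)
   qed
   have pL: "picard R n ta \<in> L2 M" for ta by (rule admissible_L2[OF picard_admissible[OF R]])
   have "\<forall>\<^sub>F ta in at t within {0..}. nrm M (%x. picard R n ta x - picard R n t x) < e / 3"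
    using order_tendstoD(2)[OF L2_contD(2)[OF admissible_cont[OF picard_admissible[OF R, of n]] t], of "e / 3"] e by simp
   moreover have "\<forall>\<^sub>F ta in at t within {0..}. ta < t + 1"
    using order_tendstoD(2)[OF tendsto_ident_at, of t "t + 1" "{0..}"] by simp
   moreover have "\<forall>\<^sub>F ta in at t within {0..}. ta \<in> {0..}" by (simp add: eventually_at_filter)
   ultimately show "\<forall>\<^sub>F ta in at t within {0..}. dist (nrm M (%x. src R ta x - src R t x)) 0 < e"
   proof eventually_elim
    case (elim ta)
    have sL: "src R ta \<in> L2 M" "src R t \<in> L2 M" using src_approx(1)[OF R] elim t by auto
    have "nrm M (%x. src R ta x - src R t x) <= nrm M (%x. src R ta x - picard R n ta x) +
      (nrm M (%x. picard R n ta x - picard R n t x) + nrm M (%x. picard R n t x - src R t x))"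
     using L2_norm_diff_triangle[OF sL(1) pL[of ta] sL(2)] L2_norm_diff_triangle[OF pL[of ta] pL[of t] sL(2)] by simp
    also have "nrm M (%x. picard R n t x - src R t x) = nrm M (%x. src R t x - picard R n t x)" by (rule L2_norm_minus_commute)
    finally show ?case using near[of ta] near[of t] elim t by simp
   qed
  qed
 qed
 ultimately show ?thesis by (auto simp: admissible_def split_beta')
qed

abbreviation "uR R \<equiv> U (src R)"

lemma src_fixed_point:
 assumes R: "R > 0" and t: "t >= 0"
 shows "AE x in M. src R t x = N R (U (src R)) t x"
proof -
 let ?e = "%n::nat. 2 * (Lip R * R) * (1 / 2) ^ n"
 have sL: "src R t \<in> L2 M" by (rule src_approx(1)[OF R t])
 have NL: "N R (U (src R)) t \<in> L2 M" using N_L2[where v = "uR R" and t = t, OF R U_V[OF src_admissible[OF R] t] t] by simp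
 have b: "nrm M (%x. src R t x - N R (U (src R)) t x) <= 2 * ?e n * exp (rate R * t)" for n
 proof -
  have e0: "?e n >= 0" using Lip_nonneg R by simp
  define E where "E = ?e n * exp (rate R * t)"
  have E0: "E >= 0" using e0 by (simp add: E_def)
  have "nrm M (%x. N R (U (src R)) t x - N R (U (picard R n)) t x) <= ?e n / 2 * exp (rate R * t)"
   by (rule N_contraction[OF R src_admissible[OF R] picard_admissible[OF R] t e0]) (use src_approx(2)[OF R] in auto)
  then have 1: "nrm M (%x. N R (U (picard R n)) t x - N R (U (src R)) t x) <= E / 2"
   using L2_norm_minus_commute[of M "N R (U (picard R n)) t" "N R (U (src R)) t"] by (simp add: E_def)
  have 2: "nrm M (%x. src R t x - N R (U (picard R n)) t x) <= E / 2"
   using src_approx(2)[OF R t, of "Suc n"] by (simp add: E_def)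
  have "nrm M (%x. src R t x - N R (U (src R)) t x) <= nrm M (%x. src R t x - N R (U (picard R n)) t x) +
    nrm M (%x. N R (U (picard R n)) t x - N R (U (src R)) t x)"
   using L2_norm_diff_triangle[OF sL admissible_L2[OF picard_admissible[OF R, of "Suc n"], of t] NL] by simp
  then have "nrm M (%x. src R t x - N R (U (src R)) t x) <= 2 * E" using 1 2 E0 by linarith
  then show ?thesis by (simp add: E_def)
 qed
 have "(%n. 2 * (2 * (Lip R * R) * (1 / 2) ^ n) * exp (rate R * t)) \<longlonglongrightarrow> 2 * (2 * (Lip R * R) * 0) * exp (rate R * t)"
  by (intro tendsto_intros LIMSEQ_power_zero) simp
 then have "nrm M (%x. src R t x - N R (U (src R)) t x) <= 2 * (2 * (Lip R * R) * 0) * exp (rate R * t)"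
  by (rule LIMSEQ_le_const) (intro exI allI impI b)
 then have "nrm M (%x. src R t x - N R (U (src R)) t x) <= 0" by simp
 then have "AE x in M. src R t x - N R (U (src R)) t x = 0" by (intro L2_norm_eq_0D L2_diff sL NL)
 then show ?thesis by eventually_elim simp
qed

lemma V_distance_continuous:
 assumes v: "continuous_V M m (1/2) {0..T} v" and ph: "admissible M ph"
 shows "continuous_on {0..T} (%t. nV (%x. v t x - U ph t x))"
proof -
 have "L2_cont M {0..T} (%t x. sm x * v t x + - (sm x * U ph t x))"
 proof (rule L2_cont_add)
  show "L2_cont M {0..T} (%t x. sm x * v t x)"
   using v by (simp add: continuous_V_def L2_cont_def V_iff V_norm_half right_diff_distrib)
  have "nrm M (%x. - (sm x * U ph ta x) - - (sm x * U ph t x)) = nrm M (%x. sm x * U ph ta x - sm x * U ph t x)" for ta t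
   using L2_norm_uminus[of M "%x. sm x * U ph ta x - sm x * U ph t x"] by simp
  moreover have "L2_cont M {0..T} (%t x. sm x * U ph t x)" by (rule L2_cont_subset[OF sU_cont[OF ph]]) auto
  ultimately show "L2_cont M {0..T} (%t x. - (sm x * U ph t x))"
   unfolding L2_cont_def by (auto intro: L2_uminus)
 qed
 from L2_cont_norm[OF this] show ?thesis by (simp add: V_norm_half right_diff_distrib)
qed

text \<open>Bounded multipliers commute with the vector valued integral, but \<open>\<surd>m\<close> is unbounded; its truncations
suffice.\<close>

lemma V_norm_limit:
 assumes g: "g \<in> V M m (1/2)" and B: "\<And>n. nrm M (%x. min (sm x) (real n) * g x) <= B"
 shows "nV g <= B"
proof -
 have [measurable]: "g \<in> borel_measurable M" by (rule V_m[OF g])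
 have gL: "(%x. sm x * g x) \<in> L2 M" using g by (simp add: V_iff)
 have "(%n. \<integral>x. (min (sm x) (real n) * g x)\<^sup>2 \<partial>M) \<longlonglongrightarrow> (\<integral>x. (sm x * g x)\<^sup>2 \<partial>M)"
 proof (rule integral_dominated_convergence[where w = "%x. (sm x * g x)\<^sup>2"])
  show "integrable M (%x. (sm x * g x)\<^sup>2)" by (rule L2D(2)[OF gL])
  show "AE x in M. (%n. (min (sm x) (real n) * g x)\<^sup>2) \<longlonglongrightarrow> (sm x * g x)\<^sup>2"
  proof (rule AE_I2, rule tendsto_eventually)
   fix x
   obtain k where "sm x <= real k" using real_arch_simple by blast
   then show "\<forall>\<^sub>F n in sequentially. (min (sm x) (real n) * g x)\<^sup>2 = (sm x * g x)\<^sup>2"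
    by (intro eventually_sequentiallyI[of k]) (simp add: min_def)
  qed
  show "AE x in M. norm ((min (sm x) (real n) * g x)\<^sup>2) <= (sm x * g x)\<^sup>2" for n
  proof (rule AE_I2)
   fix x
   have "\<bar>min (sm x) (real n)\<bar> <= \<bar>sm x\<bar>" using mpos[of x] by auto
   then have "\<bar>min (sm x) (real n) * g x\<bar> <= \<bar>sm x * g x\<bar>" unfolding abs_mult by (rule mult_right_mono) simp
   then show "norm ((min (sm x) (real n) * g x)\<^sup>2) <= (sm x * g x)\<^sup>2" by (simp only: abs_le_square_iff real_norm_def abs_power2)
  qed
 qed measurable
 then have "(%n. (nrm M (%x. min (sm x) (real n) * g x))\<^sup>2) \<longlonglongrightarrow> (nV g)\<^sup>2"
  by (simp add: L2_norm_sq V_norm_half)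
 moreover have "(nrm M (%x. min (sm x) (real n) * g x))\<^sup>2 <= B\<^sup>2" for n using B[of n] by (intro power_mono) auto
 ultimately have "(nV g)\<^sup>2 <= B\<^sup>2" by (intro LIMSEQ_le_const2) auto
 moreover have "B >= 0" using B[of 0] L2_norm_nonneg order_trans by blast
 ultimately show ?thesis by (rule power2_le_imp_le)
qed

text \<open>Gronwall's argument in the weighted supremum norm. A weak solution \<open>v\<close> is only a curve of equivalence classes,
so \<open>v\<close> and \<open>uR R\<close> are compared through the vector valued integral and not pointwise in \<open>x\<close>.\<close>

lemma solution_unique:
 assumes R: "R > 0" and v: "continuous_V M m (1/2) {0..T} v" and vR: "\<And>t. t \<in> {0..T} ==> nV (v t) <= R"
  and vi: "\<And>t. t \<in> {0..T} ==> L2_integrable (time_measure t) M (Duhamel_integrand m f al v t)"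
  and vp: "\<And>t. t \<in> {0..T} ==> AE x in M. Phi M m f al u0 u1 v t x = v t x"
  and t: "t \<in> {0..T}"
 shows "AE x in M. v t x = uR R t x"
proof -
 let ?ph = "src R"
 note ph = src_admissible[OF R]
 let ?d = "%t. nV (%x. v t x - uR R t x)"
 have vV: "v t \<in> V M m (1/2)" if "t \<in> {0..T}" for t using v that by (simp add: continuous_V_def)
 have dV: "(%x. v t x - uR R t x) \<in> V M m (1/2)" if "t \<in> {0..T}" for t using V_diff[OF vV[OF that] U_V[OF ph]] that by simp
 have dc: "continuous_on {0..T} ?d" by (rule V_distance_continuous[OF v ph])
 have step: "?d t <= D / 2 * exp (rate R * t)"
  if t: "t \<in> {0..T}" and D: "D >= 0" and d: "\<And>s. s \<in> {0..T} ==> ?d s <= D * exp (rate R * s)" for t D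
 proof (rule V_norm_limit[OF dV[OF t]])
  fix n :: nat
  let ?b = "%x. min (sm x) (real n)"
  let ?F = "Duhamel_integrand m f al v t"
  let ?G = "%ta x. ?ph ta x * (t - ta) powr (al - 1) * mittag_leffler al al (- m x * (t - ta) powr al)"
  have hF: "has_L2_integral (time_measure t) M ?F (L2_integral (time_measure t) M ?F)"
   using vi[OF t] someI_ex[of "has_L2_integral (time_measure t) M ?F"] by (simp add: L2_integrable_def L2_integral_def)
  have hG: "has_L2_integral (time_measure t) M ?G (%x. conv (mlk al al (m x)) (%s. ?ph s x) t)"
   using Duhamel_integral[OF ph, of t] t by simp
  have b: "?b \<in> borel_measurable M" "AE x in M. \<bar>?b x\<bar> <= real n" using mpos by (auto simp: less_imp_le)
  note h = has_L2_integral_mult_diff[OF M hF hG b(1) _ b(2)]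
  let ?e = "%ta. 2 * Lip R * (C * (t - ta) powr (al / 2 - 1) * ?d ta) * ind {0<..<t} ta"
  have sp: "space (time_measure t) = {0..t}" by (simp add: space_restrict_space)
  have em: "?e \<in> borel_measurable (time_measure t)"
  proof -
   have "?d \<in> borel_measurable (restrict_space borel {0..t})"
    by (rule borel_measurable_continuous_on_restrict[OF continuous_on_subset[OF dc]]) (use t in auto)
   moreover have "sets (restrict_space borel {0..t}) = sets (time_measure t)" by (rule sets_restrict_space_cong) simp
   ultimately have dm: "?d \<in> borel_measurable (time_measure t)" using measurable_cong_sets[OF _ refl] by blast
   have "(%ta. 2 * Lip R * (C * (t - ta) powr (al / 2 - 1)) * ind {0<..<t} ta) \<in> borel_measurable (time_measure t)"
    by (rule measurable_restrict_space1) measurable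
   from borel_measurable_times[OF this dm] show ?thesis by (simp add: mult_ac)
  qed
  have bd: "AE ta in time_measure t. nrm M (%x. ?b x * (?F ta x - ?G ta x)) <= ?e ta"
  proof -
   have "AE ta in lborel. ta \<in> {0..t} --> nrm M (%x. ?b x * (?F ta x - ?G ta x)) <= ?e ta"
    using AE_neq_lborel[of 0] AE_neq_lborel[of t]
   proof eventually_elim
    case (elim ta)
    show ?case
    proof
     assume "ta \<in> {0..t}"
     then have ta: "ta \<in> {0<..<t}" "ta \<in> {0..T}" "ta >= 0" using elim t by auto
     let ?g = "%x. N R v ta x - N R (uR R) ta x"
     have gL: "?g \<in> L2 M" using L2_diff[of "N R v ta" M "N R (uR R) ta"] N_L2[where v = v and t = ta, OF R vV[OF ta(2)] ta(3)] N_L2[where v = "uR R" and t = ta, OF R U_V[OF ph ta(3)] ta(3)] by simp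
     have gN: "nrm M ?g <= 2 * Lip R * ?d ta" by (rule N_diff[where v = v and u = "uR R" and t = ta, OF R vV[OF ta(2)] U_V[OF ph ta(3)] ta(3)])
     let ?k = "%x. ?b x * mlk al al (m x) (t - ta)"
     have kb: "\<bar>?k x\<bar> <= C * (t - ta) powr (al / 2 - 1)" for x
     proof -
      have "\<bar>?k x\<bar> <= \<bar>sm x * mlk al al (m x) (t - ta)\<bar>"
       unfolding abs_mult using mpos[of x] by (intro mult_right_mono) auto
      then show ?thesis using mlk_bounds(6)[OF al, of "m x" "t - ta"] mpos[of x] ta by simp
     qed
     have km: "?k \<in> borel_measurable M" by measurable
     have c0: "C * (t - ta) powr (al / 2 - 1) >= 0" using C0 by simp
     note r = L2_mult_bounded[OF km gL c0 AE_I2[OF kb]]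
     have eq: "AE x in M. ?b x * (?F ta x - ?G ta x) = ?k x * ?g x" using src_fixed_point[OF R ta(3)]
     proof eventually_elim
      fix x assume e: "src R ta x = N R (uR R) ta x"
      have "mlk al al (m x) (t - ta) = (t - ta) powr (al - 1) * mittag_leffler al al (- m x * (t - ta) powr al)" using ta by (simp add: mlk_def)
      moreover have "N R v ta x = f (v ta x)" using trunc_id[OF R vR[OF ta(2)]] ta by (simp add: N_def)
      ultimately show "?b x * (?F ta x - ?G ta x) = ?k x * ?g x" unfolding Duhamel_integrand_def e by (simp only: algebra_simps)
     qed
     have "nrm M (%x. ?b x * (?F ta x - ?G ta x)) = nrm M (%x. ?k x * ?g x)"
     proof (rule L2_norm_AE_cong(1)[OF eq _ L2D(1)[OF r(1)]])
      show "(%x. ?b x * (?F ta x - ?G ta x)) \<in> borel_measurable M"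
       using h sp \<open>ta \<in> {0..t}\<close> by (auto simp: has_L2_integral_def L2_iff)
     qed
     also have "... <= C * (t - ta) powr (al / 2 - 1) * (2 * Lip R * ?d ta)" using r(2) mult_left_mono[OF gN c0] by linarith
     finally show "nrm M (%x. ?b x * (?F ta x - ?G ta x)) <= ?e ta" using ta by (simp add: mult_ac)
    qed
   qed
   then show ?thesis by (subst AE_restrict_space_iff) auto
  qed
  have int: "(\<integral>\<^sup>+ta. ennreal (?e ta) \<partial>time_measure t) <= ennreal (D / 2 * exp (rate R * t))"
  proof -
   have "(\<integral>\<^sup>+ta. ennreal (?e ta) \<partial>time_measure t) = (NN ta. ennreal (?e ta) * ind {0..t} ta)"
    by (rule nn_integral_restrict_space) simp
   also have "... = (NN ta. ennreal (?e ta))" by (intro nn_integral_cong) (auto simp: indicator_def)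
   also have "... <= ennreal (D / 2 * exp (rate R * t))" by (rule weighted_contraction[OF d D]) (use t in auto)
   finally show ?thesis .
  qed
  have "nrm M (%x. ?b x * (L2_integral (time_measure t) M ?F x - conv (mlk al al (m x)) (%s. ?ph s x) t)) <= D / 2 * exp (rate R * t)"
   by (rule has_L2_integral_norm_le[OF sigma_finite_time M h em bd int]) (use D in auto)
  moreover have "nrm M (%x. ?b x * (v t x - uR R t x)) = nrm M (%x. ?b x * (L2_integral (time_measure t) M ?F x - conv (mlk al al (m x)) (%s. ?ph s x) t))"
  proof (rule L2_norm_AE_cong(1))
   show "AE x in M. ?b x * (v t x - uR R t x) = ?b x * (L2_integral (time_measure t) M ?F x - conv (mlk al al (m x)) (%s. ?ph s x) t)"
    using vp[OF t] by eventually_elim (auto simp: Phi_def U_def)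
   show "(%x. ?b x * (v t x - uR R t x)) \<in> borel_measurable M" using V_m[OF dV[OF t]] b(1) by measurable
   show "(%x. ?b x * (L2_integral (time_measure t) M ?F x - conv (mlk al al (m x)) (%s. ?ph s x) t)) \<in> borel_measurable M"
    using h by (auto simp: has_L2_integral_def L2_iff)
  qed
  ultimately show "nrm M (%x. ?b x * (v t x - uR R t x)) <= D / 2 * exp (rate R * t)" by simp
 qed
 have l: "rate R >= 0" by (simp add: rate_def)
 have "bounded (?d ` {0..T})" by (intro compact_imp_bounded compact_continuous_image dc compact_Icc)
 then obtain B where B: "\<forall>y\<in>?d ` {0..T}. norm y <= B" unfolding bounded_iff by blast
 then have dB: "?d s <= B" if "s \<in> {0..T}" for s using that by fastforce
 have B0: "B >= 0" using dB[OF t] V_norm_nonneg order_trans by blast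
 have iter: "?d s <= B * (1 / 2) ^ n * exp (rate R * s)" if "s \<in> {0..T}" for s n
  using that
 proof (induction n arbitrary: s)
  case 0
  then show ?case using dB[OF 0] mult_left_mono[OF _ B0, of 1 "exp (rate R * s)"] l by simp
 next
  case (Suc n)
  show ?case using step[OF Suc.prems _ Suc.IH] B0 by simp
 qed
 have "(%n. B * (1 / 2) ^ n * exp (rate R * t)) \<longlonglongrightarrow> B * 0 * exp (rate R * t)"
  by (intro tendsto_intros LIMSEQ_power_zero) simp
 then have "?d t <= B * 0 * exp (rate R * t)" by (rule LIMSEQ_le_const) (intro exI allI impI iter t)
 then have "?d t <= 0" by simp
 then have "AE x in M. v t x - uR R t x = 0" by (rule V_norm_eq_0D[OF dV[OF t]])
 then show ?thesis by eventually_elim simp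
qed

end

section \<open>Equality almost everywhere\<close>

lemma tendsto_within_cong:
 "(\<And>ta. ta \<in> S ==> g ta = h ta) ==> (g \<longlongrightarrow> l) (at t within S) \<longleftrightarrow> (h \<longlongrightarrow> l) (at t within S)"
 by (intro tendsto_cong) (simp add: eventually_at_filter)

lemma V_cong:
 assumes [measurable]: "m \<in> borel_measurable M" "m' \<in> borel_measurable M" and e: "AE x in M. m x = m' x"
  and gh: "AE x in M. g x = h x" and [measurable]: "g \<in> borel_measurable M" "h \<in> borel_measurable M"
 shows "g \<in> V M m ga \<longleftrightarrow> h \<in> V M m' ga" "V_norm M m ga g = V_norm M m' ga h"
proof -
 have a: "AE x in M. m x powr ga * g x = m' x powr ga * h x" using e gh by eventually_elim simp
 note c = L2_norm_AE_cong[OF a]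
 show "V_norm M m ga g = V_norm M m' ga h" unfolding V_norm_def by (rule c(1)) measurable
 have "(%x. m x powr ga * g x) \<in> L2 M \<longleftrightarrow> (%x. m' x powr ga * h x) \<in> L2 M" by (rule c(2)) measurable
 then show "g \<in> V M m ga \<longleftrightarrow> h \<in> V M m' ga" using L2_norm_AE_cong(2)[OF gh] by (simp add: V_def)
qed

text \<open>The notions of the statement are invariant under changes on null sets of \<open>x\<close>, both of the curve at each time and of \<open>m\<close>.
Note that the chosen derivatives and integrals do not change at all, because the predicates that define
them coincide.\<close>

locale equivalent_curves =
 fixes M :: "'a measure" and m m' :: "'a => real" and u v :: "real => 'a => real" and I :: "real set"
 assumes mm [measurable]: "m \<in> borel_measurable M" "m' \<in> borel_measurable M" and me: "AE x in M. m x = m' x"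
  and um: "\<And>t. t \<in> I ==> u t \<in> borel_measurable M" and vm: "\<And>t. t \<in> I ==> v t \<in> borel_measurable M"
  and uv: "\<And>t. t \<in> I ==> AE x in M. u t x = v t x"
begin

lemma deriv_cong:
 assumes S: "S \<subseteq> I" and t: "t \<in> S"
 shows "has_L2_derivative M u d t S \<longleftrightarrow> has_L2_derivative M v d t S" "L2_deriv M S u t = L2_deriv M S v t"
proof -
 have "((%ta. nrm M (%x. (u ta x - u t x) / (ta - t) - d x)) \<longlongrightarrow> 0) (at t within S) \<longleftrightarrow>
   ((%ta. nrm M (%x. (v ta x - v t x) / (ta - t) - d x)) \<longlongrightarrow> 0) (at t within S)" if d: "d \<in> L2 M" for d
 proof (rule tendsto_within_cong, rule L2_norm_AE_cong(1))
  fix ta assume "ta \<in> S"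
  then have ta: "ta \<in> I" "t \<in> I" using S t by auto
  note [measurable] = um[OF ta(1)] vm[OF ta(1)] um[OF ta(2)] vm[OF ta(2)] L2D(1)[OF d]
  show "AE x in M. (u ta x - u t x) / (ta - t) - d x = (v ta x - v t x) / (ta - t) - d x"
   using uv[OF ta(1)] uv[OF ta(2)] by eventually_elim simp
  show "(%x. (u ta x - u t x) / (ta - t) - d x) \<in> borel_measurable M" "(%x. (v ta x - v t x) / (ta - t) - d x) \<in> borel_measurable M"
   by measurable
 qed
 then have e: "has_L2_derivative M u d t S \<longleftrightarrow> has_L2_derivative M v d t S" for d by (auto simp: has_L2_derivative_def)
 then show "has_L2_derivative M u d t S \<longleftrightarrow> has_L2_derivative M v d t S" .
 show "L2_deriv M S u t = L2_deriv M S v t" by (simp add: L2_deriv_def e)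
qed

lemma energy_cong:
 assumes S: "S \<subseteq> I" and t: "t \<in> S" "{0<..<t} \<subseteq> S"
 shows "energy M m al s S u t = energy M m' al s S v t"
proof -
 have "t \<in> I" using S t by auto
 then have "V_norm M m (1/2) (u t) = V_norm M m' (1/2) (v t)" using V_cong(2)[OF mm me uv um vm] by blast
 moreover have "g_conv (2 - al) (%ta. (nrm M (L2_deriv M S u ta))\<^sup>2) t = g_conv (2 - al) (%ta. (nrm M (L2_deriv M S v ta))\<^sup>2) t"
  unfolding g_conv_def
 proof (rule nn_integral_cong)
  fix ta :: real
  show "ennreal (gk (2 - al) (t - ta) * (nrm M (L2_deriv M S u ta))\<^sup>2) * ind {0<..<t} ta =
   ennreal (gk (2 - al) (t - ta) * (nrm M (L2_deriv M S v ta))\<^sup>2) * ind {0<..<t} ta"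
   using deriv_cong(2)[OF S, of ta] t(2) by (cases "ta \<in> {0<..<t}") auto
 qed
 ultimately show ?thesis using deriv_cong(2)[OF S t(1)] by (simp add: energy_def)
qed

lemma weak_energy_solution_cong:
 assumes I: "I = {0..T}" and T: "T > 0" and al: "al > 0" and [measurable]: "u1 \<in> borel_measurable M" "f \<in> bor"
  and v: "weak_energy_solution M m' f al s u0 u1 T v"
 shows "weak_energy_solution M m f al s u0 u1 T u"
proof -
 let ?S = "{0<..T}"
 have S: "?S \<subseteq> I" by (auto simp: I)
 have X: "continuous_V M m' (1/2) {0..T} v" "C1_L2 M ?S v" "(SUP t \<in> ?S. energy M m' al s ?S v t) < \<infinity>"
  using v by (auto simp: weak_energy_solution_def X_space_def)
 have dL: "L2_deriv M ?S v t \<in> L2 M" if "t \<in> ?S" for t using X(2) that by (simp add: C1_L2_def has_L2_derivative_def)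
 have 1: "continuous_V M m (1/2) {0..T} u" unfolding continuous_V_def
 proof (intro ballI conjI)
  fix t assume t: "t \<in> {0..T}"
  show "u t \<in> V M m (1/2)" using X(1) V_cong(1)[OF mm me uv um vm, of t] t I by (auto simp: continuous_V_def)
  have "((%ta. V_norm M m (1/2) (%x. u ta x - u t x)) \<longlongrightarrow> 0) (at t within {0..T}) \<longleftrightarrow>
    ((%ta. V_norm M m' (1/2) (%x. v ta x - v t x)) \<longlongrightarrow> 0) (at t within {0..T})"
  proof (rule tendsto_within_cong, rule V_cong(2)[OF mm me])
   fix ta assume "ta \<in> {0..T}"
   then have ta: "ta \<in> I" "t \<in> I" using t I by auto
   show "AE x in M. u ta x - u t x = v ta x - v t x" using uv[OF ta(1)] uv[OF ta(2)] by eventually_elim simp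
   note [measurable] = um[OF ta(1)] vm[OF ta(1)] um[OF ta(2)] vm[OF ta(2)]
   show "(%x. u ta x - u t x) \<in> borel_measurable M" "(%x. v ta x - v t x) \<in> borel_measurable M" by measurable
  qed
  then show "((%ta. V_norm M m (1/2) (%x. u ta x - u t x)) \<longlongrightarrow> 0) (at t within {0..T})"
   using X(1) t by (simp add: continuous_V_def)
 qed
 have 2: "C1_L2 M ?S u" unfolding C1_L2_def
 proof (intro ballI conjI)
  fix t assume t: "t \<in> ?S"
  show "u t \<in> L2 M" using 1 t by (simp add: continuous_V_def V_def)
  show "has_L2_derivative M u (L2_deriv M ?S u t) t ?S"
   using X(2) t unfolding deriv_cong[OF S t] by (simp add: C1_L2_def)
  have "((%ta. nrm M (%x. L2_deriv M ?S u ta x - L2_deriv M ?S u t x)) \<longlongrightarrow> 0) (at t within ?S) \<longleftrightarrow>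
    ((%ta. nrm M (%x. L2_deriv M ?S v ta x - L2_deriv M ?S v t x)) \<longlongrightarrow> 0) (at t within ?S)"
   by (rule tendsto_within_cong) (simp add: deriv_cong(2)[OF S] deriv_cong(2)[OF S t])
  then show "((%ta. nrm M (%x. L2_deriv M ?S u ta x - L2_deriv M ?S u t x)) \<longlongrightarrow> 0) (at t within ?S)"
   using X(2) t by (simp add: C1_L2_def)
 qed
 have 3: "(SUP t \<in> ?S. energy M m al s ?S u t) < \<infinity>"
 proof -
  have "(SUP t \<in> ?S. energy M m al s ?S u t) = (SUP t \<in> ?S. energy M m' al s ?S v t)"
   by (intro SUP_cong refl energy_cong S) auto
  then show ?thesis using X(3) by simp
 qed
 have 4: "AE x in M. u 0 x = u0 x"
 proof -
  have "AE x in M. v 0 x = u0 x" using v by (simp add: weak_energy_solution_def)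
  moreover have "AE x in M. u 0 x = v 0 x" using T by (intro uv) (simp add: I)
  ultimately show ?thesis by eventually_elim simp
 qed
 obtain be where be: "be > 1 / al - 1 / 2" "((%t. V_norm M m' (- be) (%x. L2_deriv M ?S v t x - u1 x)) \<longlongrightarrow> 0) (at_right 0)"
  using v by (auto simp: weak_energy_solution_def)
 have 5: "((%t. V_norm M m (- be) (%x. L2_deriv M ?S u t x - u1 x)) \<longlongrightarrow> 0) (at_right 0)"
 proof (rule Lim_transform_eventually[OF be(2)])
  have "\<forall>\<^sub>F t in at_right 0. t \<in> {0<..<T}" using T by (rule eventually_at_rightI[rotated]) simp
  then show "\<forall>\<^sub>F t in at_right 0. V_norm M m' (- be) (%x. L2_deriv M ?S v t x - u1 x) = V_norm M m (- be) (%x. L2_deriv M ?S u t x - u1 x)"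
  proof eventually_elim
   case (elim t)
   then have t: "t \<in> ?S" by simp
   note [measurable] = L2D(1)[OF dL[OF t]]
   have "(%x. L2_deriv M ?S v t x - u1 x) \<in> borel_measurable M" by measurable
   from V_cong(2)[OF mm me AE_I2[OF refl] this this]
   show ?case by (simp add: deriv_cong(2)[OF S t])
  qed
 qed
 have 6: "L2_integrable (time_measure t) M (Duhamel_integrand m f al u t) \<and> (AE x in M. Phi M m f al u0 u1 u t x = u t x)"
  if t: "t \<in> {0..T}" for t
 proof -
  have ml: "(%x. mittag_leffler al be (g x)) \<in> borel_measurable M" if "g \<in> borel_measurable M" for be g
   by (rule measurable_compose[OF that mittag_leffler_measurable[OF al]])
  have ae: "AE x in M. Duhamel_integrand m f al u t ta x = Duhamel_integrand m' f al v t ta x"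
   and dm: "Duhamel_integrand m f al u t ta \<in> borel_measurable M" "Duhamel_integrand m' f al v t ta \<in> borel_measurable M"
   if "ta \<in> space (time_measure t)" for ta
  proof -
   have ta: "ta \<in> I" using that t I by (auto simp: space_restrict_space)
   show "AE x in M. Duhamel_integrand m f al u t ta x = Duhamel_integrand m' f al v t ta x"
    using uv[OF ta] me by eventually_elim (simp add: Duhamel_integrand_def)
   note [measurable] = um[OF ta] vm[OF ta] ml
   show "Duhamel_integrand m f al u t ta \<in> borel_measurable M" "Duhamel_integrand m' f al v t ta \<in> borel_measurable M"
    unfolding Duhamel_integrand_def[abs_def] by measurable
  qed
  have ae': "AE x in M. Duhamel_integrand m' f al v t ta x = Duhamel_integrand m f al u t ta x" if "ta \<in> space (time_measure t)" for ta
   using ae[OF that] by eventually_elim simp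
  have eq: "has_L2_integral (time_measure t) M (Duhamel_integrand m f al u t) = has_L2_integral (time_measure t) M (Duhamel_integrand m' f al v t)"
  proof (rule ext, rule iffI)
   fix y
   show "has_L2_integral (time_measure t) M (Duhamel_integrand m' f al v t) y" if "has_L2_integral (time_measure t) M (Duhamel_integrand m f al u t) y"
    by (rule has_L2_integral_cong[OF ae dm(2) that])
   show "has_L2_integral (time_measure t) M (Duhamel_integrand m f al u t) y" if "has_L2_integral (time_measure t) M (Duhamel_integrand m' f al v t) y"
    by (rule has_L2_integral_cong[OF ae' dm(1) that])
  qed
  have vp: "AE x in M. Phi M m' f al u0 u1 v t x = v t x" and vi: "L2_integrable (time_measure t) M (Duhamel_integrand m' f al v t)"
   using v t by (auto simp: weak_energy_solution_def)
  have "t \<in> I" using t I by simp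
  from vp uv[OF this] me have "AE x in M. Phi M m f al u0 u1 u t x = u t x"
   by eventually_elim (simp add: Phi_def L2_integral_def eq)
  then show ?thesis using vi by (simp add: L2_integrable_def eq)
 qed
 then show ?thesis using 1 2 3 4 5 be(1) unfolding weak_energy_solution_def X_space_def by auto
qed

end

section \<open>Continuation\<close>

text \<open>A bound that improves itself cannot be lost: consider the first time at which \<open>h\<close> reaches \<open>B\<close>.\<close>

lemma continuity_trap:
 fixes h :: "real => real"
 assumes h: "continuous_on {a..b} h" and a: "h a < B"
  and step: "\<And>t. a < t ==> t <= b ==> (\<And>s. s \<in> {a<..<t} ==> h s <= B) ==> h t < B"
  and t: "t \<in> {a..b}"
 shows "h t < B"
proof (rule ccontr)
 let ?E = "{t\<in>{a..b}. B <= h t}"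
 assume "\<not> h t < B"
 then have ne: "?E \<noteq> {}" using t by auto
 have "closed ?E" by (intro continuous_on_closed_Collect_le continuous_on_const h closed_atLeastAtMost)
 moreover have "bounded ?E" by (rule bounded_subset[of "{a..b}"]) auto
 ultimately have "compact ?E" by (simp add: compact_eq_bounded_closed)
 then obtain e where e: "e \<in> ?E" "\<forall>t\<in>?E. e <= t" using compact_attains_inf ne by blast
 have "a < e" using e(1) a by (cases "a = e") auto
 moreover have "h s <= B" if "s \<in> {a<..<e}" for s
 proof (rule ccontr)
  assume "\<not> h s <= B"
  then have "e <= s" using that e by simp
  then show False using that by simp
 qed
 ultimately have "h e < B" using e(1) by (intro step) auto
 then show False using e(1) by simp
qed

context nonlinear_wave
begin

text \<open>The truncation at level \<open>R\<close> has not become active before time \<open>T\<close>, so that \<open>uR R\<close> solves the original problem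
on \<open>{0..T}\<close>.\<close>

definition good :: "real => real => bool" where
 "good R T \<longleftrightarrow> R > 0 \<and> (\<forall>t\<in>{0..T}. V_norm M m (1/2) (uR R t) <= R)"

lemma src_eq:
 assumes R: "R > 0" and t: "t >= 0" and le: "nV (uR R t) <= R"
 shows "AE x in M. src R t x = f (uR R t x)"
 using src_fixed_point[OF R t] by eventually_elim (use trunc_id[OF R le] t in \<open>simp add: N_def\<close>)

lemma good_solution:
 assumes g: "good R T" and T: "T > 0" and s: "1 - al / 2 < s"
 shows "weak_energy_solution M m f al s u0 u1 T (uR R)"
proof (rule weak_solution_of_fixed_point[OF _ T s f_meas])
 have R: "R > 0" using g by (simp add: good_def)
 show "admissible M (src R)" by (rule src_admissible[OF R])
 show "AE x in M. src R ta x = f (uR R ta x)" if "ta \<in> {0..T}" for ta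
  by (rule src_eq[OF R]) (use g that in \<open>auto simp: good_def\<close>)
qed

lemma solution_eq_uR:
 assumes v: "weak_energy_solution M m f al s u0 u1 T v" and R: "R > 0"
  and vR: "\<And>t. t \<in> {0..T} ==> nV (v t) <= R" and t: "t \<in> {0..T}"
 shows "AE x in M. v t x = uR R t x"
proof (rule solution_unique[where v = v and T = T, OF R _ vR _ _ t])
 show "continuous_V M m (1/2) {0..T} v" using v by (simp add: weak_energy_solution_def X_space_def)
 show "L2_integrable (time_measure t) M (Duhamel_integrand m f al v t)" if "t \<in> {0..T}" for t
  using v that by (simp add: weak_energy_solution_def)
 show "AE x in M. Phi M m f al u0 u1 v t x = v t x" if "t \<in> {0..T}" for t
  using v that by (simp add: weak_energy_solution_def)
qed

text \<open>The curve of the lower level is a solution bounded by the higher level, hence agrees with the curve of the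
higher level by uniqueness.\<close>

lemma good_mono:
 assumes g: "good R T" and R': "R <= R'"
 shows "good R' T" and "t \<in> {0..T} ==> AE x in M. uR R t x = uR R' t x"
proof -
 have R: "R > 0" "R' > 0" using g R' by (auto simp: good_def)
 have eq: "AE x in M. uR R t x = uR R' t x" if t: "t \<in> {0..T}" for t
 proof (cases "t = 0")
  case True
  then show ?thesis using U_zero[of "src R"] U_zero[of "src R'"] p0[OF src_admissible[OF R(1)]] p0[OF src_admissible[OF R(2)]] by simp
 next
  case False
  then have T: "T > 0" using t by simp
  have s: "1 - al / 2 < 1" using al by simp
  have "nV (uR R t) <= R'" if "t \<in> {0..T}" for t
   by (rule order_trans[OF _ R']) (use g that in \<open>simp add: good_def\<close>)
  then show ?thesis by (rule solution_eq_uR[OF good_solution[OF g T s] R(2) _ t])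
 qed
 then show "t \<in> {0..T} ==> AE x in M. uR R t x = uR R' t x" .
 have "nV (uR R' t) = nV (uR R t)" if t: "t \<in> {0..T}" for t
  using V_cong(2)[OF mm mm _ eq[OF t] U_measurable[OF src_admissible[OF R(1)]] U_measurable[OF src_admissible[OF R(2)]]] by simp
 then show "good R' T" using g R' R by (force simp: good_def)
qed

lemma good_agree:
 assumes g: "good R T" "good R' T'" and t: "t \<in> {0..T}" "t \<in> {0..T'}"
 shows "AE x in M. uR R t x = uR R' t x"
proof -
 have "AE x in M. uR R t x = uR (max R R') t x" "AE x in M. uR R' t x = uR (max R R') t x"
  by (rule good_mono(2)[OF g(1) _ t(1)], simp) (rule good_mono(2)[OF g(2) _ t(2)], simp)
 then show ?thesis by eventually_elim simp
qed

lemma good_exists: "\<exists>T>0. \<exists>R. good R T"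
proof -
 define R where "R = nV u0 + 1"
 have R: "R > 0" unfolding R_def using V_norm_nonneg[of u0] by linarith
 let ?h = "%t. nV (uR R t)"
 have "uR R 0 = u0" using U_zero[of "src R"] p0[OF src_admissible[OF R]] by (intro ext) simp
 then have "?h 0 < R" by (simp add: R_def)
 moreover have "(?h \<longlongrightarrow> ?h 0) (at 0 within {0..})"
  using U_V_norm_cont[OF src_admissible[OF R]] unfolding continuous_on_def by simp
 ultimately have "\<forall>\<^sub>F t in at 0 within {0..}. ?h t < R" by (intro order_tendstoD(2)) auto
 then obtain d where d: "d > 0" "\<And>t. t \<in> {0..} ==> t \<noteq> 0 ==> dist t 0 < d ==> ?h t < R" unfolding eventually_at by blast
 have "good R (d / 2)" unfolding good_def
 proof (intro conjI ballI R)
  fix t assume "t \<in> {0..d / 2}"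
  then show "?h t <= R" using d(2)[of t] d(1) \<open>?h 0 < R\<close> by (cases "t = 0") auto
 qed
 then show ?thesis using d(1) by (intro exI[of _ "d / 2"]) auto
qed

text \<open>On \<open>{t1..t1 + de}\<close> the bound of \<open>memory_bound\<close> consists of a part \<open>A\<close> that depends on \<open>K\<close> and of the contribution of the source, which is
small as long as the solution stays below \<open>B\<close>. For short intervals the sum is less than \<open>B\<close>, and \<open>continuity_trap\<close> applies to the curve
of a level above both \<open>B\<close> and the old one.\<close>

lemma good_extends:
 assumes K: "K >= 0" and T: "T > 0"
 shows "\<exists>de>0. \<forall>t1 R. T / 2 <= t1 --> good R t1 --> nV (uR R t1) <= K \<longrightarrow>
  g_conv (2 - al) (%ta. (nrm M (w (src R) ta))\<^sup>2) t1 <= ennreal K --> (\<exists>R'. good R' (t1 + de))"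
proof -
 obtain Km where Km0: "Km >= 0" and Km: "\<And>ph t1 sg E P. admissible M ph ==> 0 < t1 ==> 0 < sg ==> sg <= 1 ==> 0 <= E ==> 0 <= P ==>
  g_conv (2 - al) (%ta. (nrm M (w ph ta))\<^sup>2) t1 <= ennreal E ==>
  \<forall>s\<in>{0<..<sg}. nrm M (ph (t1 + s)) <= P ==>
  nV (U ph (t1 + sg)) \<le>
   Km * (nV (U ph t1) + t1 powr (1 - al) + 1 + E + P * sg powr (al / 2))"
  using memory_bound by blast
 define A where "A = Km * (K + (T / 2) powr (1 - al) + 1 + K)"
 define B where "B = K + A + 2"
 define P where "P = Lip B * B"
 have A0: "A >= 0" using Km0 K by (simp add: A_def)
 have B: "B > 0" "K < B" using A0 K by (auto simp: B_def)
 have P0: "P >= 0" using Lip_nonneg B by (simp add: P_def)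
 \<comment> \<open>so short that the source contributes at most \<open>1\<close>\<close>
 define de where "de = min 1 ((1 / (Km * P + 1)) powr (2 / al))"
 have KP: "Km * P >= 0" using Km0 P0 by simp
 have de: "de > 0" "de <= 1" using KP by (auto simp: de_def)
 have deP: "Km * (P * sg powr (al / 2)) <= 1" if "0 < sg" "sg <= de" for sg
 proof -
  have "sg powr (al / 2) <= ((1 / (Km * P + 1)) powr (2 / al)) powr (al / 2)"
   using that a0 by (intro powr_mono2) (auto simp: de_def)
  also have "... = 1 / (Km * P + 1)" using KP a0 by (simp add: powr_powr)
  finally have "(Km * P) * sg powr (al / 2) <= (Km * P) * (1 / (Km * P + 1))" using KP by (rule mult_left_mono)
  also have "... <= 1" using KP by simp
  finally show ?thesis by (simp add: mult_ac)
 qed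
 have "\<exists>R'. good R' (t1 + de)"
  if t1: "T / 2 <= t1" and g: "good R t1" and V: "nV (uR R t1) <= K"
   and G: "g_conv (2 - al) (%ta. (nrm M (w (src R) ta))\<^sup>2) t1 <= ennreal K" for t1 R
 proof -
  have t10: "t1 > 0" using t1 T by linarith
  define R' where "R' = max R B"
  have R: "R > 0" using g by (simp add: good_def)
  have R': "R' > 0" "B <= R'" "R <= R'" using B by (auto simp: R'_def)
  note ph = src_admissible[OF R'(1)]
  note gm = good_mono[OF g R'(3)]
  let ?h = "%t. nV (uR R' t)"
  have V': "?h t1 <= K"
   using V V_cong(2)[OF mm mm _ gm(2) U_measurable[OF src_admissible[OF R]] U_measurable[OF ph], of t1 "1/2"] t10 by simp
  have G': "g_conv (2 - al) (%ta. (nrm M (w (src R') ta))\<^sup>2) t1 <= ennreal K"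
  proof -
   interpret E: equivalent_curves M m m "uR R" "uR R'" "{0..t1}"
    by unfold_locales (use gm(2) U_measurable[OF src_admissible[OF R]] U_measurable[OF ph] mm in auto)
   have S: "{0<..t1} \<subseteq> {0<..}" by auto
   have "nrm M (w (src R') ta) = nrm M (w (src R) ta)" if ta: "ta \<in> {0<..t1}" for ta
   proof -
    have S': "{0<..<ta} \<subseteq> {0<..t1}" using ta by auto
    have "L2_deriv M {0<..t1} (uR R) ta = L2_deriv M {0<..t1} (uR R') ta" using ta by (intro E.deriv_cong(2)) auto
    then show ?thesis using deriv_AE(3)[OF ph S ta S'] deriv_AE(3)[OF src_admissible[OF R] S ta S'] by simp
   qed
   then have "g_conv (2 - al) (%ta. (nrm M (w (src R') ta))\<^sup>2) t1 = g_conv (2 - al) (%ta. (nrm M (w (src R) ta))\<^sup>2) t1"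
    unfolding g_conv_def by (intro nn_integral_cong) (auto simp: indicator_def)
   then show ?thesis using G by simp
  qed
  have h: "?h t < B" if t: "t \<in> {t1..t1 + de}" for t
  proof (rule continuity_trap[OF _ _ _ t])
   show "continuous_on {t1..t1 + de} ?h" by (rule continuous_on_subset[OF U_V_norm_cont[OF ph]]) (use t10 in auto)
   show "?h t1 < B" using V' B by simp
   fix t assume tt: "t1 < t" "t <= t1 + de" and le: "\<And>s. s \<in> {t1<..<t} ==> ?h s <= B"
   have src: "nrm M (src R' (t1 + s)) <= P" if s: "s \<in> {0<..<t - t1}" for s
   proof -
    have hB: "?h (t1 + s) <= B" using le[of "t1 + s"] s by simp
    have pos: "t1 + s >= 0" using s t10 by simp
    have hR: "?h (t1 + s) <= R'" using hB R' by linarith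
    note fl = f_L2[OF U_V[OF ph pos] hB]
    have "nrm M (src R' (t1 + s)) = nrm M (%x. f (uR R' (t1 + s) x))"
     by (rule L2_norm_AE_cong(1)[OF src_eq[OF R'(1) pos hR] L2D(1)[OF admissible_L2[OF ph]] L2D(1)[OF fl(1)]])
    then show ?thesis using fl(2) by (simp add: P_def)
   qed
   have "?h (t1 + (t - t1)) <= Km * (?h t1 + t1 powr (1 - al) + 1 + K + P * (t - t1) powr (al / 2))"
    by (rule Km[OF ph t10 _ _ K P0 G']) (use tt de src in auto)
   also have "... <= Km * (K + (T / 2) powr (1 - al) + 1 + K + P * (t - t1) powr (al / 2))"
   proof -
    have "t1 powr (1 - al) <= (T / 2) powr (1 - al)" using t1 T al by (intro powr_mono2') auto
    then show ?thesis using V' Km0 by (intro mult_left_mono) auto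
   qed
   also have "... = A + Km * (P * (t - t1) powr (al / 2))" by (simp add: A_def algebra_simps)
   also have "... <= A + 1" using deP[of "t - t1"] tt by simp
   also have "... < B" using K by (simp add: B_def)
   finally show "?h t < B" by simp
  qed
  have "good R' (t1 + de)" unfolding good_def
  proof (intro conjI ballI R'(1))
   fix t assume t: "t \<in> {0..t1 + de}"
   show "?h t <= R'"
   proof (cases "t <= t1")
    case True
    then show ?thesis using gm(1) t by (simp add: good_def)
   next
    case False
    then show ?thesis using h[of t] t R' by simp
   qed
  qed
  then show ?thesis by blast
 qed
 then show ?thesis using de(1) by blast
qed

end

section \<open>The maximal solution\<close>

text \<open>Derivatives at interior times do not depend on the right end of the interval.\<close>

lemma energy_local:
 assumes t: "0 < t" "t < T1" "T1 <= T"
 shows "energy M m al s {0<..<T} u t = energy M m al s {0<..<T1} u t"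
proof -
 have "at ta within {0<..<T} = at ta within {0<..<T1}" if "ta \<in> {0<..<T1}" for ta :: real
  by (rule at_within_nhd[of ta "{0<..<T1}"]) (use that t in auto)
 then have e: "L2_deriv M {0<..<T} u ta = L2_deriv M {0<..<T1} u ta" if "ta \<in> {0<..<T1}" for ta
  using that by (simp add: L2_deriv_def has_L2_derivative_def)
 have "g_conv (2 - al) (%ta. (nrm M (L2_deriv M {0<..<T} u ta))\<^sup>2) t = g_conv (2 - al) (%ta. (nrm M (L2_deriv M {0<..<T1} u ta))\<^sup>2) t"
  unfolding g_conv_def
 proof (rule nn_integral_cong)
  fix ta :: real
  show "ennreal (gk (2 - al) (t - ta) * (nrm M (L2_deriv M {0<..<T} u ta))\<^sup>2) * ind {0<..<t} ta =
   ennreal (gk (2 - al) (t - ta) * (nrm M (L2_deriv M {0<..<T1} u ta))\<^sup>2) * ind {0<..<t} ta"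
   using e[of ta] t by (cases "ta \<in> {0<..<t}") auto
 qed
 then show ?thesis using e[of t] t by (simp add: energy_def)
qed

context nonlinear_wave
begin

text \<open>The level is chosen anew at each time; \<open>good_agree\<close> shows that the choice matters only on null sets. The value beyond
\<open>Tmax\<close> is immaterial and makes \<open>max_sol t\<close> measurable for all \<open>t\<close>.\<close>

definition max_sol :: "real => 'a => real" where
 "max_sol t = (if \<exists>R. good R t then uR (SOME R. good R t) t else (%x. 0))"

lemma good_restrict: "good R T ==> t <= T ==> good R t"
 by (auto simp: good_def)

lemma uR_measurable: "good R T ==> uR R t \<in> borel_measurable M"
 by (intro U_measurable src_admissible) (simp add: good_def)

lemma max_sol_measurable: "max_sol t \<in> borel_measurable M"
proof (cases "\<exists>R. good R t")
 case True
 then show ?thesis using uR_measurable[OF someI_ex[OF True], of t] by (simp add: max_sol_def)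
qed (simp add: max_sol_def)

lemma max_sol_eq:
 assumes g: "good R T" and t: "t \<in> {0..T}"
 shows "AE x in M. max_sol t x = uR R t x"
proof -
 have gt: "good R t" using good_restrict[OF g] t by simp
 then have ex: "\<exists>R. good R t" by blast
 have tt: "t \<in> {0..t}" using t by simp
 have "AE x in M. uR (SOME R. good R t) t x = uR R t x" by (rule good_agree[OF someI_ex[OF ex] g tt t])
 then show ?thesis using ex by (simp add: max_sol_def)
qed

lemma max_sol_equiv: "good R T ==> equivalent_curves M m m max_sol (uR R) {0..T}"
 by unfold_locales (use max_sol_eq uR_measurable max_sol_measurable mm in auto)

definition Tmax :: ereal where "Tmax = Sup (ereal ` {T. T > 0 \<and> (\<exists>R. good R T)})"

lemma Tmax_upper: "good R T ==> T > 0 ==> ereal T <= Tmax"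
 unfolding Tmax_def by (intro Sup_upper) auto

lemma Tmax_pos: "Tmax > 0"
 using good_exists Tmax_upper by (metis ereal_less(2) less_le_trans)

lemma good_below_Tmax: "ereal T < Tmax ==> \<exists>R. good R T"
proof -
 assume "ereal T < Tmax"
 then obtain T' R where "T < T'" "good R T'" unfolding Tmax_def less_Sup_iff by auto
 then show ?thesis using good_restrict[of R T' T] by auto
qed

lemma max_sol_solution:
 assumes T: "0 < T" "ereal T < Tmax" and s: "1 - al / 2 < s"
 shows "weak_energy_solution M m f al s u0 u1 T max_sol"
proof -
 obtain R where g: "good R T" using good_below_Tmax[OF T(2)] by blast
 show ?thesis
  by (rule equivalent_curves.weak_energy_solution_cong[OF max_sol_equiv[OF g] refl T(1) a0(1) u1m f_meas good_solution[OF g T(1) s]])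
qed

lemma max_sol_unique:
 assumes T: "0 < T" "ereal T < Tmax" and v: "weak_energy_solution M m f al s u0 u1 T v" and t: "t \<in> {0..T}"
 shows "AE x in M. v t x = max_sol t x"
proof -
 obtain R where g: "good R T" using good_below_Tmax[OF T(2)] by blast
 have "L2_cont M {0..T} (%t x. sm x * v t x)"
  using v by (simp add: weak_energy_solution_def X_space_def continuous_V_def L2_cont_def V_iff V_norm_half right_diff_distrib)
 from L2_cont_norm[OF this] have "bounded ((%t. nV (v t)) ` {0..T})"
  by (intro compact_imp_bounded compact_continuous_image) (simp_all add: V_norm_half)
 then obtain B where B: "\<forall>y\<in>(%t. nV (v t)) ` {0..T}. norm y <= B" unfolding bounded_iff by blast
 define R' where "R' = max R B"
 have g': "good R' T" by (rule good_mono(1)[OF g]) (simp add: R'_def)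
 have "nV (v t) <= R'" if "t \<in> {0..T}" for t
 proof -
  have "norm (nV (v t)) <= B" using B that by blast
  then show ?thesis by (simp add: R'_def)
 qed
 then have "AE x in M. v t x = uR R' t x" using g' by (intro solution_eq_uR[OF v _ _ t]) (auto simp: good_def)
 then show ?thesis using max_sol_eq[OF g' t] by eventually_elim simp
qed

lemma max_sol_blow_up:
 assumes T: "Tmax = ereal T"
 shows "((%t. energy M m al s {0<..<T} max_sol t) \<longlongrightarrow> \<infinity>) (at_left T)"
proof -
 have T0: "T > 0" using Tmax_pos T by simp
 have "\<forall>\<^sub>F t in at_left T. ennreal K < energy M m al s {0<..<T} max_sol t" if K: "K >= 0" for K
 proof -
  have K1: "K + 1 >= 0" using K by simp
  obtain de where de: "de > 0" and ext: "\<And>t1 R. T / 2 <= t1 ==> good R t1 ==> nV (uR R t1) <= K + 1 ==>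
   g_conv (2 - al) (%ta. (nrm M (w (src R) ta))\<^sup>2) t1 <= ennreal (K + 1) ==> \<exists>R'. good R' (t1 + de)"
   using good_extends[OF K1 T0] by blast
  have "\<forall>\<^sub>F t in at_left T. t \<in> {max (T / 2) (T - de)<..<T}" by (rule eventually_at_leftI[of "max (T / 2) (T - de)"]) (use T0 de in auto)
  then show ?thesis
  proof eventually_elim
   case (elim t)
   then have t: "T / 2 <= t" "t < T" "T < t + de" "0 < t" using T0 by auto
   show "ennreal K < energy M m al s {0<..<T} max_sol t"
   proof (rule ccontr)
    define T1 where "T1 = (t + T) / 2"
    have T1: "t < T1" "T1 < T" using t by (auto simp: T1_def)
    obtain R where g: "good R T1" using good_below_Tmax[of T1] T T1 by auto
    have R: "R > 0" using g by (simp add: good_def)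
    note ph = src_admissible[OF R]
    have "energy M m al s {0<..<T} max_sol t = energy M m al s {0<..<T1} max_sol t" using t T1 by (intro energy_local) auto
    also have "... = energy M m al s {0<..<T1} (uR R) t"
     using t T1 by (intro equivalent_curves.energy_cong[OF max_sol_equiv[OF g]]) auto
    also have "... = ennreal ((nV (uR R t))\<^sup>2 + t powr (2 * s) * (nrm M (w (src R) t))\<^sup>2) +
      g_conv (2 - al) (%ta. (nrm M (w (src R) ta))\<^sup>2) t"
     using t T1 by (intro energy_eq[OF ph]) auto
    finally have e: "energy M m al s {0<..<T} max_sol t = ..." .
    assume "\<not> ennreal K < energy M m al s {0<..<T} max_sol t"
    then have le: "ennreal ((nV (uR R t))\<^sup>2 + t powr (2 * s) * (nrm M (w (src R) t))\<^sup>2) +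
      g_conv (2 - al) (%ta. (nrm M (w (src R) ta))\<^sup>2) t <= ennreal K" using e by simp
    have "ennreal ((nV (uR R t))\<^sup>2 + t powr (2 * s) * (nrm M (w (src R) t))\<^sup>2) <= ennreal K"
     by (rule order_trans[OF _ le]) simp
    then have "(nV (uR R t))\<^sup>2 + t powr (2 * s) * (nrm M (w (src R) t))\<^sup>2 <= K" using K by (simp add: ennreal_le_iff del: ennreal_plus)
    moreover have "0 <= t powr (2 * s) * (nrm M (w (src R) t))\<^sup>2" by simp
    ultimately have "(nV (uR R t))\<^sup>2 <= K" by linarith
    also have "K <= (K + 1)\<^sup>2" using K by (simp add: power2_eq_square algebra_simps)
    finally have V: "nV (uR R t) <= K + 1" using K1 by (rule power2_le_imp_le)
    have "g_conv (2 - al) (%ta. (nrm M (w (src R) ta))\<^sup>2) t <= ennreal K" by (rule order_trans[OF _ le]) simp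
    also have "... <= ennreal (K + 1)" by (rule ennreal_leI) simp
    finally obtain R' where "good R' (t + de)" using ext[OF t(1) good_restrict[OF g] V] T1 by auto
    then have "ereal (t + de) <= Tmax" using t de by (intro Tmax_upper) auto
    then show False using t T by simp
   qed
  qed
 qed
 then show ?thesis by (simp add: tendsto_top_iff_ennreal)
qed

end

lemma weak_energy_solution_measurable:
 "weak_energy_solution M m f al s u0 u1 T v ==> t \<in> {0..T} ==> v t \<in> borel_measurable M"
 by (simp add: weak_energy_solution_def X_space_def continuous_V_def V_def L2_iff)

theorem theorem4p1:
  fixes M :: "'a measure" and m :: "'a \<Rightarrow> real" and m0 \<alpha> s r Cf :: real
    and f :: "real \<Rightarrow> real" and u0 u1 :: "'a \<Rightarrow> real"
  assumes "finite_measure M" and "separable_L2 M"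
    and "m \<in> borel_measurable M" and "m0 > 0" and "AE x in M. m x \<ge> m0"
    and "1 < \<alpha>" and "\<alpha> < 2" and "1 - \<alpha> / 2 < s" and "s < 1"
    and "u0 \<in> V M m (1/2)" and "u1 \<in> L2 M"
    and "f C1_differentiable_on UNIV" and "Cf > 0" and "r > 1"
    and "f 0 = 0" and "\<forall>\<sigma>. \<bar>deriv f \<sigma>\<bar> \<le> Cf * \<bar>\<sigma>\<bar> powr (r - 1)"
    and "V_embeds_Lp M m (1/2) (2 * r)"
  shows "\<exists>Tmax :: ereal. Tmax > 0 \<and> (\<exists>u :: real \<Rightarrow> 'a \<Rightarrow> real.
           (\<forall>T. 0 < T \<and> ereal T < Tmax \<longrightarrow>
              weak_energy_solution M m f \<alpha> s u0 u1 T u \<and>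
              (\<forall>v. weak_energy_solution M m f \<alpha> s u0 u1 T v \<longrightarrow>
                 (\<forall>t \<in> {0..T}. AE x in M. v t x = u t x))) \<and>
           (Tmax = \<infinity> \<or>
            (\<exists>T. Tmax = ereal T \<and>
               ((\<lambda>t. energy M m \<alpha> s {0<..<T} u t) \<longlongrightarrow> \<infinity>) (at_left T))))"
proof -
 let ?m = "%x. max (m x) m0"
 have meas: "m \<in> borel_measurable M" "?m \<in> borel_measurable M" using assms(3) by auto
 have me: "AE x in M. m x = ?m x" using assms(5) by eventually_elim simp
 then have me': "AE x in M. ?m x = m x" by eventually_elim simp
 have g1: "g \<in> V M ?m (1/2) \<longleftrightarrow> g \<in> V M m (1/2)" and g2: "g \<in> V M m (1/2) ==> V_norm M ?m (1/2) g = V_norm M m (1/2) g" for g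
 proof -
  have c: "(g \<in> V M ?m (1/2) \<longleftrightarrow> g \<in> V M m (1/2)) \<and> V_norm M ?m (1/2) g = V_norm M m (1/2) g" if "g \<in> borel_measurable M"
   using V_cong[OF meas(2,1) me' AE_I2[OF refl] that that] by blast
  show "g \<in> V M ?m (1/2) \<longleftrightarrow> g \<in> V M m (1/2)"
  proof (cases "g \<in> borel_measurable M")
   case False
   then show ?thesis by (simp add: V_def L2_iff)
  qed (use c in blast)
  show "V_norm M ?m (1/2) g = V_norm M m (1/2) g" if "g \<in> V M m (1/2)"
   using c that by (simp add: V_def L2_iff)
 qed
 have Veq: "V M ?m (1/2) = V M m (1/2)" using g1 by blast
 have emb: "V_embeds_Lp M ?m (1/2) (2 * r)" using assms(17) unfolding V_embeds_Lp_def Veq by (simp add: g2)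
 interpret nonlinear_wave M ?m m0 \<alpha> u0 u1 f r Cf
  by unfold_locales (use assms meas emb in \<open>auto simp: Veq finite_measure_def sigma_finite_measure_def finite_measure_axioms_def\<close>)
 show ?thesis
 proof (intro exI conjI allI impI ballI)
  show "Tmax > 0" by (rule Tmax_pos)
  fix T assume T: "0 < T \<and> ereal T < Tmax"
  interpret E: equivalent_curves M m ?m max_sol max_sol "{0..T}"
   by unfold_locales (use meas me max_sol_measurable in auto)
  show "weak_energy_solution M m f \<alpha> s u0 u1 T max_sol"
   by (rule E.weak_energy_solution_cong[OF refl _ a0(1) u1m f_meas max_sol_solution]) (use T assms(8) in auto)
  fix v t assume v: "weak_energy_solution M m f \<alpha> s u0 u1 T v" and t: "t \<in> {0..T}"
  interpret F: equivalent_curves M ?m m v v "{0..T}"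
   by unfold_locales (use meas me' weak_energy_solution_measurable[OF v] in auto)
  show "AE x in M. v t x = max_sol t x"
   by (rule max_sol_unique[OF _ _ F.weak_energy_solution_cong[OF refl _ a0(1) u1m f_meas v] t]) (use T in auto)
 next
  show "Tmax = \<infinity> \<or> (\<exists>T. Tmax = ereal T \<and> ((%t. energy M m \<alpha> s {0<..<T} max_sol t) \<longlongrightarrow> \<infinity>) (at_left T))"
  proof (cases Tmax)
   case (real T)
   then have T0: "T > 0" using Tmax_pos by simp
   interpret E: equivalent_curves M m ?m max_sol max_sol "{0..T}"
    by unfold_locales (use meas me max_sol_measurable in auto)
   have "\<forall>\<^sub>F t in at_left T. t \<in> {0<..<T}" by (rule eventually_at_leftI[OF _ T0]) auto
   then have "\<forall>\<^sub>F t in at_left T. energy M ?m \<alpha> s {0<..<T} max_sol t = energy M m \<alpha> s {0<..<T} max_sol t"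
    by eventually_elim (rule E.energy_cong[symmetric], auto)
   from Lim_transform_eventually[OF max_sol_blow_up[OF real] this] show ?thesis using real by blast
  qed (use Tmax_pos in auto)
 qed
qed

end
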